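(* Let $\Bbbk$ be a field. (1) For all sets $J\subseteq I$, the category ${}_{(I,J)}\mathrm{Halg}$ of $(I,J)$-Hopf algebras over $\Bbbk$ is locally presentable, so in particular complete and cocomplete. (2) For all sets $J\subseteq I$, the category ${}_{(I,J)}\mathrm{Halg}^{coc}$ of cocommutative $(I,J)$-Hopf algebras over $\Bbbk$ is locally presentable, so in particular complete and cocomplete. (3) The category $\mathrm{Hbr}^{coc}$ of cocommutative Hopf braces over $\Bbbk$ is locally presentable, so in particular complete and cocomplete. (4) The category $\mathrm{Hbr}$ of Hopf braces over $\Bbbk$ is accessible, and hence the following are equivalent: $\mathrm{Hbr}$ is locally presentable; $\mathrm{Hbr}$ is complete; $\mathrm{Hbr}$ is cocomplete.
   Context: All structures are linear over a field $\Bbbk$; algebras are unital and associative, coalgebras are counital and coassociative. Sweedler notation: $\Delta(c)=c_{(1)}\otimes c_{(2)}$. For a set $I$, an $I$-bialgebra is a coalgebra equipped with an $I$-indexed family of (unital, associative) algebra structures, all sharing the same unit, such that the unit and all the multiplications are coalgebra morphisms. For $J\subseteq I$, an $(I,J)$-Hopf algebra is an $I$-bialgebra for which each bialgebra structure indexed by an element of $J$ has an antipode (i.e. is a Hopf algebra). Morphisms are the coalgebra maps that are algebra morphisms for all the $I$-indexed algebra structures. The superscript "coc" means that the underlying coalgebra is required to be cocommutative. A Hopf brace over a coalgebra $(H,\Delta,\varepsilon)$ consists of two Hopf algebra structures $(H,\cdot,1,\Delta,\varepsilon,S)$ and $(H,\diamond,1_\diamond,\Delta,\varepsilon,T)$ such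 that for all $x,y,z\in H$: $x\diamond(y\cdot z)=(x_{(1)}\diamond y)\cdot S(x_{(2)})\cdot(x_{(3)}\diamond z)$ (this forces $1=1_\diamond$). A morphism of Hopf braces is a linear map that is a Hopf algebra morphism for both structures. A Hopf brace is cocommutative if its underlying coalgebra is. For a regular cardinal $\lambda$, an object $x$ of a category $\mathcal C$ is $\lambda$-presentable if $\mathcal C(x,-)$ preserves $\lambda$-directed colimits. $\mathcal C$ is locally $\lambda$-presentable if it is cocomplete and has a set of $\lambda$-presentable objects such that every object is a $\lambda$-directed colimit of objects from that set; locally presentable means locally $\lambda$-presentable for some regular $\lambda$. $\mathcal C$ is accessible if for some regular $\lambda$ it has $\lambda$-directed colimits and a set of $\lambda$-presentable objects such that every object is a $\lambda$-directed colimit of objects from that set. *)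

theory Defs
  imports "HOL-Algebra.Module" "HOL-Algebra.AbelCoset" "HOL-Library.FuncSet"
begin

unbundle cardinal_syntax

section \<open>Size\<close>

text \<open>
  HOL has no proper classes.  The sets of the ambient set theory are represented, up to bijection,
  by the sets of cardinality less than that of a type \<open>'u\<close> whose cardinality is
  strongly inaccessible, that is, by the members of a Grothendieck universe.  Sets and classes of
  the theory of categories become small sets and arbitrary sets.
\<close>

definition small :: "'u itself \<Rightarrow> 'a set \<Rightarrow> bool" where
  "small U A \<longleftrightarrow> |A| <o |UNIV :: 'u set|"

definition universe :: "'u itself \<Rightarrow> bool" where
  "universe U \<longleftrightarrow>
     natLeq <o |UNIV :: 'u set| \<and>
     regularCard |UNIV :: 'u set| \<and>
     (\<forall>A :: 'u set. small U A \<longrightarrow> small U (Pow A))"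

definition regular_cardinal :: "'u rel \<Rightarrow> bool" where
  "regular_cardinal \<kappa> \<longleftrightarrow> Cinfinite \<kappa> \<and> regularCard \<kappa> \<and> \<kappa> <o |UNIV :: 'u set|"

section \<open>Categories\<close>

text \<open>Homs of different pairs of objects may overlap, so composition takes the three objects.\<close>

record ('o, 'm) cat =
  Obj :: "'o set"
  Hom :: "'o \<Rightarrow> 'o \<Rightarrow> 'm set"
  Idm :: "'o \<Rightarrow> 'm"
  Comp :: "'o \<Rightarrow> 'o \<Rightarrow> 'o \<Rightarrow> 'm \<Rightarrow> 'm \<Rightarrow> 'm"
    \<comment> \<open>\<open>Comp C x y z g f\<close> is \<open>g\<close> after \<open>f\<close>, for \<open>f : x \<rightarrow> y\<close> and \<open>g : y \<rightarrow> z\<close>\<close>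

definition category :: "('o, 'm) cat \<Rightarrow> bool" where
  "category C \<longleftrightarrow>
     (\<forall>x\<in>Obj C. Idm C x \<in> Hom C x x) \<and>
     (\<forall>x\<in>Obj C. \<forall>y\<in>Obj C. \<forall>z\<in>Obj C. \<forall>f\<in>Hom C x y. \<forall>g\<in>Hom C y z.
        Comp C x y z g f \<in> Hom C x z) \<and>
     (\<forall>x\<in>Obj C. \<forall>y\<in>Obj C. \<forall>f\<in>Hom C x y.
        Comp C x x y f (Idm C x) = f \<and> Comp C x y y (Idm C y) f = f) \<and>
     (\<forall>w\<in>Obj C. \<forall>x\<in>Obj C. \<forall>y\<in>Obj C. \<forall>z\<in>Obj C.
        \<forall>f\<in>Hom C w x. \<forall>g\<in>Hom C x y. \<forall>h\<in>Hom C y z.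
        Comp C w x z (Comp C x y z h g) f = Comp C w y z h (Comp C w x y g f))"

definition locally_small :: "'u itself \<Rightarrow> ('o, 'm) cat \<Rightarrow> bool" where
  "locally_small U C \<longleftrightarrow> (\<forall>x\<in>Obj C. \<forall>y\<in>Obj C. small U (Hom C x y))"

definition small_category :: "('u, 'u) cat \<Rightarrow> bool" where
  "small_category J \<longleftrightarrow>
     category J \<and> small TYPE('u) (Obj J) \<and> locally_small TYPE('u) J"

definition full_subcategory :: "('o, 'm) cat \<Rightarrow> ('o \<Rightarrow> bool) \<Rightarrow> ('o, 'm) cat" where
  "full_subcategory C P = C\<lparr>Obj := {x \<in> Obj C. P x}\<rparr>"

record ('j, 'n, 'o, 'm) func =
  onObj :: "'j \<Rightarrow> 'o"
  onHom :: "'j \<Rightarrow> 'j \<Rightarrow> 'n \<Rightarrow> 'm"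

definition is_functor ::
  "('j, 'n) cat \<Rightarrow> ('o, 'm) cat \<Rightarrow> ('j, 'n, 'o, 'm) func \<Rightarrow> bool" where
  "is_functor J C F \<longleftrightarrow>
     (\<forall>i\<in>Obj J. onObj F i \<in> Obj C) \<and>
     (\<forall>i\<in>Obj J. \<forall>j\<in>Obj J. \<forall>f\<in>Hom J i j. onHom F i j f \<in> Hom C (onObj F i) (onObj F j)) \<and>
     (\<forall>i\<in>Obj J. onHom F i i (Idm J i) = Idm C (onObj F i)) \<and>
     (\<forall>i\<in>Obj J. \<forall>j\<in>Obj J. \<forall>k\<in>Obj J. \<forall>f\<in>Hom J i j. \<forall>g\<in>Hom J j k.
        onHom F i k (Comp J i j k g f) =
        Comp C (onObj F i) (onObj F j) (onObj F k) (onHom F j k g) (onHom F i j f))"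

definition comp_func ::
  "('o, 'm, 'p, 'q) func \<Rightarrow> ('j, 'n, 'o, 'm) func \<Rightarrow> ('j, 'n, 'p, 'q) func" where
  "comp_func G F =
     \<lparr>onObj = (\<lambda>i. onObj G (onObj F i)),
      onHom = (\<lambda>i j f. onHom G (onObj F i) (onObj F j) (onHom F i j f))\<rparr>"

subsection \<open>Limits and colimits\<close>

definition is_cocone ::
  "('j, 'n) cat \<Rightarrow> ('o, 'm) cat \<Rightarrow> ('j, 'n, 'o, 'm) func \<Rightarrow> 'o \<Rightarrow> ('j \<Rightarrow> 'm) \<Rightarrow> bool" where
  "is_cocone J C F c \<iota> \<longleftrightarrow>
     c \<in> Obj C \<and> (\<forall>i\<in>Obj J. \<iota> i \<in> Hom C (onObj F i) c) \<and>
     (\<forall>i\<in>Obj J. \<forall>j\<in>Obj J. \<forall>f\<in>Hom J i j.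
        Comp C (onObj F i) (onObj F j) c (\<iota> j) (onHom F i j f) = \<iota> i)"

definition is_colimit ::
  "('j, 'n) cat \<Rightarrow> ('o, 'm) cat \<Rightarrow> ('j, 'n, 'o, 'm) func \<Rightarrow> 'o \<Rightarrow> ('j \<Rightarrow> 'm) \<Rightarrow> bool" where
  "is_colimit J C F c \<iota> \<longleftrightarrow>
     is_cocone J C F c \<iota> \<and>
     (\<forall>d \<kappa>. is_cocone J C F d \<kappa> \<longrightarrow>
        (\<exists>!h. h \<in> Hom C c d \<and> (\<forall>i\<in>Obj J. Comp C (onObj F i) c d h (\<iota> i) = \<kappa> i)))"

definition is_cone ::
  "('j, 'n) cat \<Rightarrow> ('o, 'm) cat \<Rightarrow> ('j, 'n, 'o, 'm) func \<Rightarrow> 'o \<Rightarrow> ('j \<Rightarrow> 'm) \<Rightarrow> bool" where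
  "is_cone J C F c \<pi> \<longleftrightarrow>
     c \<in> Obj C \<and> (\<forall>i\<in>Obj J. \<pi> i \<in> Hom C c (onObj F i)) \<and>
     (\<forall>i\<in>Obj J. \<forall>j\<in>Obj J. \<forall>f\<in>Hom J i j.
        Comp C c (onObj F i) (onObj F j) (onHom F i j f) (\<pi> i) = \<pi> j)"

definition is_limit ::
  "('j, 'n) cat \<Rightarrow> ('o, 'm) cat \<Rightarrow> ('j, 'n, 'o, 'm) func \<Rightarrow> 'o \<Rightarrow> ('j \<Rightarrow> 'm) \<Rightarrow> bool" where
  "is_limit J C F c \<pi> \<longleftrightarrow>
     is_cone J C F c \<pi> \<and>
     (\<forall>d \<rho>. is_cone J C F d \<rho> \<longrightarrow>
        (\<exists>!h. h \<in> Hom C d c \<and> (\<forall>i\<in>Obj J. Comp C d c (onObj F i) (\<pi> i) h = \<rho> i)))"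

definition complete_category :: "'u itself \<Rightarrow> ('o, 'm) cat \<Rightarrow> bool" where
  "complete_category U C \<longleftrightarrow>
     (\<forall>(J :: ('u, 'u) cat) F. small_category J \<and> is_functor J C F \<longrightarrow> (\<exists>c \<pi>. is_limit J C F c \<pi>))"

definition cocomplete_category :: "'u itself \<Rightarrow> ('o, 'm) cat \<Rightarrow> bool" where
  "cocomplete_category U C \<longleftrightarrow>
     (\<forall>(J :: ('u, 'u) cat) F. small_category J \<and> is_functor J C F \<longrightarrow> (\<exists>c \<iota>. is_colimit J C F c \<iota>))"

subsection \<open>Directed colimits\<close>

definition poset_cat :: "'j set \<Rightarrow> 'j rel \<Rightarrow> ('j, unit) cat" where
  "poset_cat P r =
     \<lparr>Obj = P, Hom = (\<lambda>i j. if (i, j) \<in> r then UNIV else {}),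
      Idm = (\<lambda>_. ()), Comp = (\<lambda>_ _ _ _ _. ())\<rparr>"

definition directed_poset :: "'u rel \<Rightarrow> 'u set \<Rightarrow> 'u rel \<Rightarrow> bool" where
  "directed_poset \<kappa> P r \<longleftrightarrow>
     small TYPE('u) P \<and> partial_order_on P r \<and>
     (\<forall>A\<subseteq>P. |A| <o \<kappa> \<longrightarrow> (\<exists>b\<in>P. \<forall>a\<in>A. (a, b) \<in> r))"

definition preserves_directed_colimits ::
  "'u rel \<Rightarrow> ('o, 'm) cat \<Rightarrow> ('p, 'q) cat \<Rightarrow> ('o, 'm, 'p, 'q) func \<Rightarrow> bool" where
  "preserves_directed_colimits \<kappa> C D G \<longleftrightarrow>
     (\<forall>P r F c \<iota>.
        directed_poset \<kappa> P r \<and> is_functor (poset_cat P r) C F \<and>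
        is_colimit (poset_cat P r) C F c \<iota> \<longrightarrow>
        is_colimit (poset_cat P r) D (comp_func G F) (onObj G c)
          (\<lambda>i. onHom G (onObj F i) c (\<iota> i)))"

definition has_directed_colimits :: "'u rel \<Rightarrow> ('o, 'm) cat \<Rightarrow> bool" where
  "has_directed_colimits \<kappa> C \<longleftrightarrow>
     (\<forall>P r F. directed_poset \<kappa> P r \<and> is_functor (poset_cat P r) C F \<longrightarrow>
        (\<exists>c \<iota>. is_colimit (poset_cat P r) C F c \<iota>))"

subsection \<open>Presentability\<close>

definition set_cat :: "'u itself \<Rightarrow> ('a set, 'a \<Rightarrow> 'a) cat" where
  "set_cat U =
     \<lparr>Obj = {A. small U A}, Hom = (\<lambda>A B. A \<rightarrow>\<^sub>E B),
      Idm = (\<lambda>A. \<lambda>x\<in>A. x), Comp = (\<lambda>A _ _ g f. compose A g f)\<rparr>"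

text \<open>
  Hom sets are taken in the type \<open>'m + 'u\<close> because \<open>set_cat\<close> over an arbitrary type \<open>'m\<close> of arrows
  could be too poor: subsets of \<open>'m + 'u\<close> represent all small sets, whatever \<open>'m\<close> is.
\<close>

definition hom_functor ::
  "'u itself \<Rightarrow> ('o, 'm) cat \<Rightarrow> 'o \<Rightarrow> ('o, 'm, ('m + 'u) set, 'm + 'u \<Rightarrow> 'm + 'u) func" where
  "hom_functor U C x =
     \<lparr>onObj = (\<lambda>y. Inl ` Hom C x y),
      onHom = (\<lambda>y z g. \<lambda>f \<in> Inl ` Hom C x y. Inl (Comp C x y z g (projl f)))\<rparr>"

definition presentable :: "'u rel \<Rightarrow> ('o, 'm) cat \<Rightarrow> 'o \<Rightarrow> bool" where
  "presentable \<kappa> C x \<longleftrightarrow>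
     x \<in> Obj C \<and>
     preserves_directed_colimits \<kappa> C (set_cat TYPE('u)) (hom_functor TYPE('u) C x)"

definition has_presentable_generators :: "'u rel \<Rightarrow> ('o, 'm) cat \<Rightarrow> bool" where
  "has_presentable_generators \<kappa> C \<longleftrightarrow>
     (\<exists>S. small TYPE('u) S \<and> (\<forall>s\<in>S. presentable \<kappa> C s) \<and>
        (\<forall>x\<in>Obj C. \<exists>P r F \<iota>.
           directed_poset \<kappa> P r \<and> is_functor (poset_cat P r) C F \<and>
           (\<forall>i\<in>P. onObj F i \<in> S) \<and> is_colimit (poset_cat P r) C F x \<iota>))"

definition locally_presentable :: "'u itself \<Rightarrow> ('o, 'm) cat \<Rightarrow> bool" where
  "locally_presentable U C \<longleftrightarrow>
     category C \<and> locally_small U C \<and>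
     (\<exists>\<kappa> :: 'u rel. regular_cardinal \<kappa> \<and>
        cocomplete_category U C \<and> has_presentable_generators \<kappa> C)"

definition accessible :: "'u itself \<Rightarrow> ('o, 'm) cat \<Rightarrow> bool" where
  "accessible U C \<longleftrightarrow>
     category C \<and> locally_small U C \<and>
     (\<exists>\<kappa> :: 'u rel. regular_cardinal \<kappa> \<and>
        has_directed_colimits \<kappa> C \<and> has_presentable_generators \<kappa> C)"

section \<open>Tensor products of vector spaces\<close>

text \<open>
  Vector spaces over \<open>K\<close> are the modules \<open>V\<close> with \<open>module K V\<close>, where \<open>K\<close> is a \<open>field\<close>.  The library
  record underlying \<open>module\<close> also has fields \<open>mult\<close> and \<open>one\<close>; the locale \<open>module\<close> does not refer to
  them for \<open>V\<close>, and nothing below depends on their values.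
\<close>

definition linear_maps ::
  "('k, 'r) ring_scheme \<Rightarrow> ('k, 'a, 'c) module_scheme \<Rightarrow> ('k, 'b, 'd) module_scheme \<Rightarrow> ('a \<Rightarrow> 'b) set"
where
  "linear_maps K V W =
     {f \<in> carrier V \<rightarrow> carrier W.
        (\<forall>x\<in>carrier V. \<forall>y\<in>carrier V. f (x \<oplus>\<^bsub>V\<^esub> y) = f x \<oplus>\<^bsub>W\<^esub> f y) \<and>
        (\<forall>a\<in>carrier K. \<forall>x\<in>carrier V. f (a \<odot>\<^bsub>V\<^esub> x) = a \<odot>\<^bsub>W\<^esub> f x)}"

definition free_module :: "('k, 'r) ring_scheme \<Rightarrow> 'p set \<Rightarrow> ('k, 'p \<Rightarrow> 'k) module" where
  "free_module K A =
     \<lparr>carrier = {f. (\<forall>p. f p \<in> carrier K) \<and> (\<forall>p. p \<notin> A \<longrightarrow> f p = \<zero>\<^bsub>K\<^esub>) \<and> finite {p. f p \<noteq> \<zero>\<^bsub>K\<^esub>}},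
      mult = undefined, one = undefined,
      zero = (\<lambda>_. \<zero>\<^bsub>K\<^esub>), add = (\<lambda>f g p. f p \<oplus>\<^bsub>K\<^esub> g p),
      smult = (\<lambda>a f p. a \<otimes>\<^bsub>K\<^esub> f p)\<rparr>"

definition delta :: "('k, 'r) ring_scheme \<Rightarrow> 'p \<Rightarrow> 'p \<Rightarrow> 'k" where
  "delta K p = (\<lambda>q. if q = p then \<one>\<^bsub>K\<^esub> else \<zero>\<^bsub>K\<^esub>)"

text \<open>The new scalar action maps \<open>N +> x\<close> to \<open>N +> a \<odot> x\<close>, also for \<open>a = 0\<close>.\<close>

definition quotient_module ::
  "('k, 'a, 'c) module_scheme \<Rightarrow> 'a set \<Rightarrow> ('k, 'a set) module" where
  "quotient_module M N =
     \<lparr>carrier = a_rcosets\<^bsub>M\<^esub> N,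
      mult = undefined, one = undefined,
      zero = N, add = (\<lambda>X Y. X <+>\<^bsub>M\<^esub> Y),
      smult = (\<lambda>a X. N <+>\<^bsub>M\<^esub> ((\<lambda>x. a \<odot>\<^bsub>M\<^esub> x) ` X))\<rparr>"

definition tensor_relators ::
  "('k, 'r) ring_scheme \<Rightarrow> ('k, 'a, 'c) module_scheme \<Rightarrow> ('k, 'b, 'd) module_scheme
   \<Rightarrow> ('a \<times> 'b \<Rightarrow> 'k) set" where
  "tensor_relators K V W =
     (let F = free_module K (carrier V \<times> carrier W); e = (\<lambda>v w. delta K (v, w)) in
      {e (v \<oplus>\<^bsub>V\<^esub> v') w \<ominus>\<^bsub>F\<^esub> (e v w \<oplus>\<^bsub>F\<^esub> e v' w) | v v' w.
         v \<in> carrier V \<and> v' \<in> carrier V \<and> w \<in> carrier W} \<union>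
      {e v (w \<oplus>\<^bsub>W\<^esub> w') \<ominus>\<^bsub>F\<^esub> (e v w \<oplus>\<^bsub>F\<^esub> e v w') | v w w'.
         v \<in> carrier V \<and> w \<in> carrier W \<and> w' \<in> carrier W} \<union>
      {e (a \<odot>\<^bsub>V\<^esub> v) w \<ominus>\<^bsub>F\<^esub> (a \<odot>\<^bsub>F\<^esub> e v w) | a v w.
         a \<in> carrier K \<and> v \<in> carrier V \<and> w \<in> carrier W} \<union>
      {e v (a \<odot>\<^bsub>W\<^esub> w) \<ominus>\<^bsub>F\<^esub> (a \<odot>\<^bsub>F\<^esub> e v w) | a v w.
         a \<in> carrier K \<and> v \<in> carrier V \<and> w \<in> carrier W})"

definition tensor_kernel ::
  "('k, 'r) ring_scheme \<Rightarrow> ('k, 'a, 'c) module_scheme \<Rightarrow> ('k, 'b, 'd) module_scheme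
   \<Rightarrow> ('a \<times> 'b \<Rightarrow> 'k) set" where
  "tensor_kernel K V W =
     \<Inter>{N. submodule N K (free_module K (carrier V \<times> carrier W)) \<and> tensor_relators K V W \<subseteq> N}"

definition tensor ::
  "('k, 'r) ring_scheme \<Rightarrow> ('k, 'a, 'c) module_scheme \<Rightarrow> ('k, 'b, 'd) module_scheme
   \<Rightarrow> ('k, ('a \<times> 'b \<Rightarrow> 'k) set) module" where
  "tensor K V W =
     quotient_module (free_module K (carrier V \<times> carrier W)) (tensor_kernel K V W)"

definition pure_tensor ::
  "('k, 'r) ring_scheme \<Rightarrow> ('k, 'a, 'c) module_scheme \<Rightarrow> ('k, 'b, 'd) module_scheme
   \<Rightarrow> 'a \<Rightarrow> 'b \<Rightarrow> ('a \<times> 'b \<Rightarrow> 'k) set" where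
  "pure_tensor K V W v w =
     tensor_kernel K V W +>\<^bsub>free_module K (carrier V \<times> carrier W)\<^esub> delta K (v, w)"

text \<open>
  The map \<open>V \<otimes> W \<rightarrow> Z\<close> induced by a bilinear map \<open>\<beta>\<close>, computed on some representative; for bilinear
  \<open>\<beta>\<close> the choice does not matter.  All uses below are with bilinear \<open>\<beta>\<close>.
\<close>

definition tensor_lift ::
  "('k, 'r) ring_scheme \<Rightarrow> ('k, 'z, 'e) module_scheme
   \<Rightarrow> ('a \<Rightarrow> 'b \<Rightarrow> 'z) \<Rightarrow> ('a \<times> 'b \<Rightarrow> 'k) set \<Rightarrow> 'z" where
  "tensor_lift K Z \<beta> X =
     (let f = (SOME f. f \<in> X) in
      finsum Z (\<lambda>p. f p \<odot>\<^bsub>Z\<^esub> \<beta> (fst p) (snd p)) {p. f p \<noteq> \<zero>\<^bsub>K\<^esub>})"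

definition tensor_map ::
  "('k, 'r) ring_scheme \<Rightarrow> ('k, 'a, 'c) module_scheme \<Rightarrow> ('k, 'b, 'd) module_scheme
   \<Rightarrow> ('x \<Rightarrow> 'a) \<Rightarrow> ('y \<Rightarrow> 'b) \<Rightarrow> ('x \<times> 'y \<Rightarrow> 'k) set \<Rightarrow> ('a \<times> 'b \<Rightarrow> 'k) set" where
  "tensor_map K V W f g =
     tensor_lift K (tensor K V W) (\<lambda>x y. pure_tensor K V W (f x) (g y))"

definition tensor_swap ::
  "('k, 'r) ring_scheme \<Rightarrow> ('k, 'a, 'c) module_scheme \<Rightarrow> ('k, 'b, 'd) module_scheme
   \<Rightarrow> ('a \<times> 'b \<Rightarrow> 'k) set \<Rightarrow> ('b \<times> 'a \<Rightarrow> 'k) set" where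
  "tensor_swap K V W = tensor_lift K (tensor K W V) (\<lambda>v w. pure_tensor K W V w v)"

text \<open>The associator \<open>(V \<otimes> V) \<otimes> V \<rightarrow> V \<otimes> (V \<otimes> V)\<close>.\<close>

definition tensor_assoc ::
  "('k, 'r) ring_scheme \<Rightarrow> ('k, 'a, 'c) module_scheme
   \<Rightarrow> (('a \<times> 'a \<Rightarrow> 'k) set \<times> 'a \<Rightarrow> 'k) set \<Rightarrow> ('a \<times> ('a \<times> 'a \<Rightarrow> 'k) set \<Rightarrow> 'k) set" where
  "tensor_assoc K V =
     (let VV = tensor K V V; T = tensor K V VV in
      tensor_lift K T (\<lambda>t z. tensor_lift K T
        (\<lambda>x y. pure_tensor K V VV x (pure_tensor K V V y z)) t))"

text \<open>The interchange \<open>(V \<otimes> V) \<otimes> (W \<otimes> W) \<rightarrow> (V \<otimes> W) \<otimes> (V \<otimes> W)\<close> of the two middle factors.\<close>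

definition tensor_interchange ::
  "('k, 'r) ring_scheme \<Rightarrow> ('k, 'a, 'c) module_scheme \<Rightarrow> ('k, 'b, 'd) module_scheme
   \<Rightarrow> (('a \<times> 'a \<Rightarrow> 'k) set \<times> ('b \<times> 'b \<Rightarrow> 'k) set \<Rightarrow> 'k) set
   \<Rightarrow> (('a \<times> 'b \<Rightarrow> 'k) set \<times> ('a \<times> 'b \<Rightarrow> 'k) set \<Rightarrow> 'k) set" where
  "tensor_interchange K V W =
     (let VW = tensor K V W; T = tensor K VW VW in
      tensor_lift K T (\<lambda>s t. tensor_lift K T (\<lambda>v v'. tensor_lift K T (\<lambda>w w'.
        pure_tensor K VW VW (pure_tensor K V W v w) (pure_tensor K V W v' w')) t) s))"

definition base_module :: "('k, 'r) ring_scheme \<Rightarrow> ('k, 'k) module" where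
  "base_module K =
     \<lparr>carrier = carrier K, mult = undefined, one = undefined,
      zero = zero K, add = add K, smult = mult K\<rparr>"

section \<open>Coalgebras and bialgebras\<close>

record ('k, 'a) coalg = "('k, 'a) module" +
  comult :: "'a \<Rightarrow> ('a \<times> 'a \<Rightarrow> 'k) set"
  counit :: "'a \<Rightarrow> 'k"

text \<open>
  Sweedler notation: \<open>sweedler2 K C Z \<beta> c\<close> is \<open>\<beta>(c\<^sub>1, c\<^sub>2)\<close> and \<open>sweedler3 K C Z \<tau> c\<close> is
  \<open>\<tau>(c\<^sub>1, c\<^sub>2, c\<^sub>3)\<close>, for multilinear maps with values in \<open>Z\<close>.
\<close>

definition sweedler2 ::
  "('k, 'r) ring_scheme \<Rightarrow> ('k, 'a, 'c) coalg_scheme \<Rightarrow> ('k, 'z, 'e) module_scheme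
   \<Rightarrow> ('a \<Rightarrow> 'a \<Rightarrow> 'z) \<Rightarrow> 'a \<Rightarrow> 'z" where
  "sweedler2 K C Z \<beta> c = tensor_lift K Z \<beta> (comult C c)"

definition sweedler3 ::
  "('k, 'r) ring_scheme \<Rightarrow> ('k, 'a, 'c) coalg_scheme \<Rightarrow> ('k, 'z, 'e) module_scheme
   \<Rightarrow> ('a \<Rightarrow> 'a \<Rightarrow> 'a \<Rightarrow> 'z) \<Rightarrow> 'a \<Rightarrow> 'z" where
  "sweedler3 K C Z \<tau> c =
     tensor_lift K Z (\<lambda>x. tensor_lift K Z (\<tau> x))
       (tensor_map K C (tensor K C C) (\<lambda>x. x) (comult C) (comult C c))"

definition coalgebra :: "('k, 'r) ring_scheme \<Rightarrow> ('k, 'a, 'c) coalg_scheme \<Rightarrow> bool" where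
  "coalgebra K C \<longleftrightarrow>
     module K C \<and>
     comult C \<in> linear_maps K C (tensor K C C) \<and>
     counit C \<in> linear_maps K C (base_module K) \<and>
     (\<forall>c\<in>carrier C.
        tensor_assoc K C (tensor_map K (tensor K C C) C (comult C) (\<lambda>x. x) (comult C c)) =
        tensor_map K C (tensor K C C) (\<lambda>x. x) (comult C) (comult C c)) \<and>
     (\<forall>c\<in>carrier C. sweedler2 K C C (\<lambda>x y. counit C x \<odot>\<^bsub>C\<^esub> y) c = c) \<and>
     (\<forall>c\<in>carrier C. sweedler2 K C C (\<lambda>x y. counit C y \<odot>\<^bsub>C\<^esub> x) c = c)"

definition cocommutative :: "('k, 'r) ring_scheme \<Rightarrow> ('k, 'a, 'c) coalg_scheme \<Rightarrow> bool" where
  "cocommutative K C \<longleftrightarrow> (\<forall>c\<in>carrier C. tensor_swap K C C (comult C c) = comult C c)"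

definition coalgebra_maps ::
  "('k, 'r) ring_scheme \<Rightarrow> ('k, 'a, 'c) coalg_scheme \<Rightarrow> ('k, 'b, 'd) coalg_scheme \<Rightarrow> ('a \<Rightarrow> 'b) set"
where
  "coalgebra_maps K C D =
     {f \<in> linear_maps K C D.
        (\<forall>c\<in>carrier C. comult D (f c) = tensor_map K D D f f (comult C c)) \<and>
        (\<forall>c\<in>carrier C. counit D (f c) = counit C c)}"

definition base_coalgebra :: "('k, 'r) ring_scheme \<Rightarrow> ('k, 'k) coalg" where
  "base_coalgebra K = module.extend (base_module K)
     (coalg.fields (\<lambda>a. pure_tensor K (base_module K) (base_module K) a \<one>\<^bsub>K\<^esub>) (\<lambda>a. a))"

definition tensor_coalgebra ::
  "('k, 'r) ring_scheme \<Rightarrow> ('k, 'a, 'c) coalg_scheme \<Rightarrow> ('k, 'b, 'd) coalg_scheme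
   \<Rightarrow> ('k, ('a \<times> 'b \<Rightarrow> 'k) set) coalg" where
  "tensor_coalgebra K C D = module.extend (tensor K C D)
     (coalg.fields
       (\<lambda>t. tensor_interchange K C D
          (tensor_map K (tensor K C C) (tensor K D D) (comult C) (comult D) t))
       (tensor_lift K (base_module K) (\<lambda>c d. counit C c \<otimes>\<^bsub>K\<^esub> counit D d)))"

definition algebra_structure ::
  "('k, 'r) ring_scheme \<Rightarrow> ('k, 'a, 'c) module_scheme \<Rightarrow> ('a \<Rightarrow> 'a \<Rightarrow> 'a) \<Rightarrow> 'a \<Rightarrow> bool" where
  "algebra_structure K V m u \<longleftrightarrow>
     module K V \<and> ring (V\<lparr>mult := m, one := u\<rparr>) \<and>
     (\<forall>a\<in>carrier K. \<forall>x\<in>carrier V. \<forall>y\<in>carrier V.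
        m (a \<odot>\<^bsub>V\<^esub> x) y = a \<odot>\<^bsub>V\<^esub> m x y \<and> m x (a \<odot>\<^bsub>V\<^esub> y) = a \<odot>\<^bsub>V\<^esub> m x y)"

definition algebra_map ::
  "('k, 'a, 'c) module_scheme \<Rightarrow> ('a \<Rightarrow> 'a \<Rightarrow> 'a) \<Rightarrow> 'a \<Rightarrow> ('b \<Rightarrow> 'b \<Rightarrow> 'b) \<Rightarrow> 'b
   \<Rightarrow> ('a \<Rightarrow> 'b) \<Rightarrow> bool" where
  "algebra_map V m u m' u' f \<longleftrightarrow>
     (\<forall>x\<in>carrier V. \<forall>y\<in>carrier V. f (m x y) = m' (f x) (f y)) \<and> f u = u'"

definition bialgebra ::
  "('k, 'r) ring_scheme \<Rightarrow> ('k, 'a, 'c) coalg_scheme \<Rightarrow> ('a \<Rightarrow> 'a \<Rightarrow> 'a) \<Rightarrow> 'a \<Rightarrow> bool" where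
  "bialgebra K C m u \<longleftrightarrow>
     coalgebra K C \<and> algebra_structure K C m u \<and>
     tensor_lift K C m \<in> coalgebra_maps K (tensor_coalgebra K C C) C \<and>
     (\<lambda>a. a \<odot>\<^bsub>C\<^esub> u) \<in> coalgebra_maps K (base_coalgebra K) C"

definition antipode ::
  "('k, 'r) ring_scheme \<Rightarrow> ('k, 'a, 'c) coalg_scheme \<Rightarrow> ('a \<Rightarrow> 'a \<Rightarrow> 'a) \<Rightarrow> 'a
   \<Rightarrow> ('a \<Rightarrow> 'a) \<Rightarrow> bool" where
  "antipode K C m u S \<longleftrightarrow>
     S \<in> linear_maps K C C \<and>
     (\<forall>c\<in>carrier C.
        sweedler2 K C C (\<lambda>x y. m (S x) y) c = counit C c \<odot>\<^bsub>C\<^esub> u \<and>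
        sweedler2 K C C (\<lambda>x y. m x (S y)) c = counit C c \<odot>\<^bsub>C\<^esub> u)"

section \<open>The categories\<close>

text \<open>
  Carriers are subsets of the universe type; morphisms are extensional functions, so that they are
  determined by their values on the carrier.
\<close>

record ('k, 'i, 'a) ibialg = "('k, 'a) coalg" +
  imult :: "'i \<Rightarrow> 'a \<Rightarrow> 'a \<Rightarrow> 'a"
  iunit :: "'i \<Rightarrow> 'a"

text \<open>For \<open>I = {}\<close> the family of algebra structures is empty, and this is just a coalgebra.\<close>

definition I_bialgebra :: "('k, 'r) ring_scheme \<Rightarrow> 'i set \<Rightarrow> ('k, 'i, 'a) ibialg \<Rightarrow> bool" where
  "I_bialgebra K I H \<longleftrightarrow>
     coalgebra K H \<and>
     (\<forall>i\<in>I. bialgebra K H (imult H i) (iunit H i)) \<and>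
     (\<forall>i\<in>I. \<forall>j\<in>I. iunit H i = iunit H j)"

definition IJ_Hopf_algebra ::
  "('k, 'r) ring_scheme \<Rightarrow> 'i set \<Rightarrow> 'i set \<Rightarrow> ('k, 'i, 'a) ibialg \<Rightarrow> bool" where
  "IJ_Hopf_algebra K I J H \<longleftrightarrow>
     I_bialgebra K I H \<and> (\<forall>j\<in>J. \<exists>S. antipode K H (imult H j) (iunit H j) S)"

definition Halg ::
  "('k, 'r) ring_scheme \<Rightarrow> 'i set \<Rightarrow> 'i set \<Rightarrow> (('k, 'i, 'u) ibialg, 'u \<Rightarrow> 'u) cat" where
  "Halg K I J =
     \<lparr>Obj = {H. small TYPE('u) (carrier H) \<and> IJ_Hopf_algebra K I J H},
      Hom = (\<lambda>H L. {f \<in> extensional (carrier H). f \<in> coalgebra_maps K H L \<and>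
        (\<forall>i\<in>I. algebra_map H (imult H i) (iunit H i) (imult L i) (iunit L i) f)}),
      Idm = (\<lambda>H. \<lambda>x\<in>carrier H. x),
      Comp = (\<lambda>H _ _ g f. compose (carrier H) g f)\<rparr>"

definition Halg_coc ::
  "('k, 'r) ring_scheme \<Rightarrow> 'i set \<Rightarrow> 'i set \<Rightarrow> (('k, 'i, 'u) ibialg, 'u \<Rightarrow> 'u) cat" where
  "Halg_coc K I J = full_subcategory (Halg K I J) (cocommutative K)"

record ('k, 'a) brace = "('k, 'a) coalg" +
  dot :: "'a \<Rightarrow> 'a \<Rightarrow> 'a"
  dot_unit :: 'a
  dot_antipode :: "'a \<Rightarrow> 'a"
  diamond :: "'a \<Rightarrow> 'a \<Rightarrow> 'a"
  diamond_unit :: 'a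
  diamond_antipode :: "'a \<Rightarrow> 'a"

definition Hopf_brace :: "('k, 'r) ring_scheme \<Rightarrow> ('k, 'a) brace \<Rightarrow> bool" where
  "Hopf_brace K H \<longleftrightarrow>
     bialgebra K H (dot H) (dot_unit H) \<and>
     antipode K H (dot H) (dot_unit H) (dot_antipode H) \<and>
     bialgebra K H (diamond H) (diamond_unit H) \<and>
     antipode K H (diamond H) (diamond_unit H) (diamond_antipode H) \<and>
     (\<forall>x\<in>carrier H. \<forall>y\<in>carrier H. \<forall>z\<in>carrier H.
        diamond H x (dot H y z) =
        sweedler3 K H H
          (\<lambda>x1 x2 x3. dot H (dot H (diamond H x1 y) (dot_antipode H x2)) (diamond H x3 z)) x)"

definition Hbr :: "('k, 'r) ring_scheme \<Rightarrow> (('k, 'u) brace, 'u \<Rightarrow> 'u) cat" where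
  "Hbr K =
     \<lparr>Obj = {H. small TYPE('u) (carrier H) \<and> Hopf_brace K H},
      Hom = (\<lambda>H L. {f \<in> extensional (carrier H). f \<in> coalgebra_maps K H L \<and>
        algebra_map H (dot H) (dot_unit H) (dot L) (dot_unit L) f \<and>
        algebra_map H (diamond H) (diamond_unit H) (diamond L) (diamond_unit L) f}),
      Idm = (\<lambda>H. \<lambda>x\<in>carrier H. x),
      Comp = (\<lambda>H _ _ g f. compose (carrier H) g f)\<rparr>"

definition Hbr_coc :: "('k, 'r) ring_scheme \<Rightarrow> (('k, 'u) brace, 'u \<Rightarrow> 'u) cat" where
  "Hbr_coc K = full_subcategory (Hbr K) (cocommutative K)"

end

theory Submission
imports Defs "HOL-Algebra.Free_Abelian_Groups"
begin

text \<open>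
All four categories are handled at once: a structure is a coalgebra with bialgebra multiplications
indexed by \<open>I\<close>, antipodes for \<open>J\<close> and the brace law for the pairs in \<open>br\<close>. Regard its operations as
relations, comultiplication being recorded by all finite expansions into pure tensors. A
Skolem hull closed under linear expansions is again a structure, since a linear retraction onto it
pulls the tensors back; and directed colimits are computed on underlying sets. This gives accessibility.

Coalgebras are cocomplete by gluing, hence complete. The coalgebra limit \<open>L\<close> of a diagram of structures
inherits multiplications and antipodes from its universal property, and each law holds because
the coideal generated by its failure is killed by all projections, so that \<open>L\<close> retracts onto \<open>L\<close> modulo
this coideal. For the brace law this requires cocommutativity. Finally, an accessible category is complete
iff it is cocomplete.
\<close>

\<comment> \<open>Two obstacles shape the argument. A comultiplication takes values in a tensor
  product, so it is not an operation on the carrier; in relational form, the morphisms are exactly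
  the functions preserving all relations. An infinite cardinal \<open>Lam\<close> that bounds the
  number of relation symbols yields the accessibility index \<open>kap\<close>, its successor.
  Antipodes are no symbols: as convolution inverses they are preserved by every morphism
  (\<open>antipode_natural\<close>). The other obstacle is that limits of coalgebras are not
  computed on underlying sets. Only coalgebra maps into \<open>L\<close>, not elements of
  \<open>L\<close>, are separated by the projections, so an identity in \<open>L\<close> cannot be
  verified componentwise. What can be verified is that the comultiplication respects the pairs of
  elements that the identity ought to equate. For the brace law this means comultiplying an
  expression in \<open>x1, x2, x3\<close>: its two halves interleave the parts of \<open>x\<close>,
  and sorting them uses cocommutativity. For general braces there remains the equivalence of
  completeness and cocompleteness, which rests on weakly initial cocones and weakly terminal
  cones.\<close>
syntax "_index" :: "logic => index" ("$_" [1000] 1000)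

notation (input) smult (infixl "*.\<index>" 70) and add (infixl "+.\<index>" 65)

abbreviation (input) iff_ascii (infixr "<->" 25) where "P <-> Q == (P :: bool) = Q"
abbreviation (input) mem_carrier (infix "IN" 50) where "x IN V == x \<in> carrier V"

section \<open>Small sets\<close>

locale grothendieck =
fixes ty :: "'u itself"
assumes universe: "universe TYPE('u)"
begin
lemma Cinfinite_UNIV: "Cinfinite |UNIV :: 'u set|"
using universe unfolding universe_def cinfinite_def
by (metis Field_card_of card_of_Card_order infinite_iff_natLeq_ordLeq ordLess_imp_ordLeq)

lemma small_le: "|A| <=o |B| ==> small TYPE('u) B ==> small TYPE('u) A"
unfolding small_def by (rule ordLeq_ordLess_trans)

lemma small_subset: "small TYPE('u) B ==> A <= B ==> small TYPE('u) A"
by (rule small_le[OF card_of_mono1])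

lemma small_image: "small TYPE('u) A ==> small TYPE('u) (f ` A)"
by (rule small_le[OF card_of_image])

lemma small_inj_on_iff: "inj_on f A ==> small TYPE('u) (f ` A) <-> small TYPE('u) A"
using small_le card_of_image small_image by (metis inv_into_image_cancel subset_refl)

lemma small_finite: "finite A ==> small TYPE('u) A"
using Cinfinite_UNIV unfolding small_def cinfinite_def by (metis Field_card_of finite_ordLess_infinite2)

text \<open>The way back into \<open>'u\<close>: quotients, tensor products and index categories
  live on other types, and whenever a definition asks for members of \<open>'u\<close> they are
  copied along such an injection.\<close>

lemma small_embed: "small TYPE('u) A ==> EX e :: 'a => 'u. inj_on e A" for A :: "'a set"
unfolding small_def by (metis card_of_ordLeq ordLess_imp_ordLeq)

lemma small_Pow: "small TYPE('u) (Pow A)" if "small TYPE('u) A" for A :: "'a set"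
proof -
from small_embed[OF that] obtain e :: "'a => 'u" where e: "inj_on e A" ..
have "small TYPE('u) (Pow (e ` A))" using universe small_image[OF that, of e] unfolding universe_def by blast
moreover have "inj_on (image e) (Pow A)" by (simp add: e inj_on_image_Pow)
ultimately show ?thesis using small_inj_on_iff[of "image e" "Pow A"] image_Pow_surj[of e A "e ` A"] by simp
qed

text \<open>Regularity of the cardinal of \<open>'u\<close>. Together with its strong limit property
  in \<open>small_Pow\<close> it gives the remaining closure properties.\<close>

lemma small_UN: "small TYPE('u) (\<Union>i\<in>I. A i)" if "small TYPE('u) I" "!!i. i:I ==> small TYPE('u) (A i)"
using regularCard_UNION_bound[OF Cinfinite_UNIV, of I A] universe that unfolding universe_def small_def by blast

lemma small_Sigma: "small TYPE('u) (Sigma I A)" if "small TYPE('u) I" "!!i. i:I ==> small TYPE('u) (A i)"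
proof -
have "Sigma I A = (\<Union>i\<in>I. Pair i ` A i)" by auto
thus ?thesis by (simp add: small_UN small_image that)
qed

lemma small_Un: "small TYPE('u) A ==> small TYPE('u) B ==> small TYPE('u) (A Un B)"
using small_UN[of "UNIV :: bool set" "%b. if b then A else B"] small_finite[of "UNIV :: bool set"] by (simp add: UNIV_bool Un_commute)

text \<open>A function with prescribed default \<open>c\<close> off \<open>A\<close> is determined
  by its graph over \<open>A\<close>. The default \<open>undefined\<close> gives extensional
  function sets, and the zero of the field gives free modules.\<close>

lemma small_funs: "small TYPE('u) F" if "small TYPE('u) A" "small TYPE('u) B" and F: "!!f. f:F ==> f ` A <= B & (ALL x. x~:A --> f x = c)"
proof -
let ?g = "%f. {(x, f x) | x. x:A}"
have "inj_on ?g F"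
proof (rule inj_onI)
	fix f f' assume f: "f:F" "f':F" and eq: "?g f = ?g f'"
	show "f = f'"
	proof
		fix x show "f x = f' x"
		proof (cases "x:A")
			case True
			hence "(x, f x):?g f'" using eq by blast
			thus ?thesis by blast
		qed (use F f in metis)
	qed
qed
moreover have "?g ` F <= Pow (A \<times> B)" using F by blast
ultimately show ?thesis using small_subset[OF small_Pow[OF small_Sigma[of A "%_. B"]]] that(1,2) small_inj_on_iff[of ?g F] by blast
qed

lemma small_PiE: "small TYPE('u) (Pi\<^sub>E I A)" if "small TYPE('u) I" "!!i. i:I ==> small TYPE('u) (A i)"
by (rule small_funs[OF that(1) small_UN[OF that], where c = undefined]) (auto simp: PiE_def extensional_def)

lemma small_lists: "small TYPE('u) (lists A)" if "small TYPE('u) A"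
proof -
have *: "small TYPE('u) {xs:lists A. length xs = n}" for n
proof (induction n)
	case (Suc n)
	have "{xs:lists A. length xs = Suc n} <= (%(x, xs). x # xs) ` (A \<times> {xs:lists A. length xs = n})"
		by (auto simp: length_Suc_conv image_iff)
	thus ?case using small_subset small_image small_Sigma[OF that, of "%_. {xs:lists A. length xs = n}"] Suc by (metis (no_types, lifting))
qed (auto intro: small_finite simp: conj_commute)
\<comment> \<open>The set of possible lengths is small because a universe is uncountable by
  definition.\<close>
have "small TYPE('u) (UNIV :: nat set)" using universe ordIso_ordLess_trans[OF card_of_nat] unfolding universe_def small_def by blast
hence "small TYPE('u) (\<Union>n. {xs:lists A. length xs = n})" by (rule small_UN) (rule *)
thus ?thesis by (rule small_subset) auto
qed
end

section \<open>Limits and colimits\<close>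

context
fixes C :: "('o, 'm) cat"
assumes C: "category C"
begin
lemma id_in: "x:Obj C ==> Idm C x:Hom C x x"
and comp_in: "[|f:Hom C x y; g:Hom C y z; x:Obj C; y:Obj C; z:Obj C|] ==> Comp C x y z g f:Hom C x z"
and id_right: "[|f:Hom C x y; x:Obj C; y:Obj C|] ==> Comp C x x y f (Idm C x) = f"
and id_left: "[|f:Hom C x y; x:Obj C; y:Obj C|] ==> Comp C x y y (Idm C y) f = f" and comp_assoc: "[|f:Hom C w x; g:Hom C x y; h:Hom C y z;
		w:Obj C; x:Obj C; y:Obj C; z:Obj C|] ==> Comp C w x z (Comp C x y z h g) f = Comp C w y z h (Comp C w x y g f)"
using C unfolding category_def by blast+
end

context
fixes J :: "('j, 'n) cat" and C :: "('o, 'm) cat" and F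
assumes F: "is_functor J C F"
begin
lemma functor_obj: "i:Obj J ==> onObj F i:Obj C"
and functor_hom: "[|f:Hom J i j; i:Obj J; j:Obj J|] ==> onHom F i j f:Hom C (onObj F i) (onObj F j)"
and functor_id: "i:Obj J ==> onHom F i i (Idm J i) = Idm C (onObj F i)"
and functor_comp: "[|f:Hom J i j; g:Hom J j k; i:Obj J; j:Obj J; k:Obj J|] ==> onHom F i k (Comp J i j k g f) =
			Comp C (onObj F i) (onObj F j) (onObj F k) (onHom F j k g) (onHom F i j f)" using F unfolding is_functor_def by blast+
end

lemma limit_cone: "is_limit J C F c qj ==> is_cone J C F c qj"
and colimit_cocone: "is_colimit J C F c ii ==> is_cocone J C F c ii" unfolding is_limit_def is_colimit_def by blast+

lemma limit_factor:
assumes "is_limit J C F c qj" "is_cone J C F d rh"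
obtains h where "h:Hom C d c" "!!i. i:Obj J ==> Comp C d c (onObj F i) (qj i) h = rh i"
using assms unfolding is_limit_def by blast

lemma limit_unique:
assumes "is_limit J C F c qj" "is_cone J C F d rh" "h:Hom C d c" "h':Hom C d c"
	"!!i. i:Obj J ==> Comp C d c (onObj F i) (qj i) h = rh i" "!!i. i:Obj J ==> Comp C d c (onObj F i) (qj i) h' = rh i"
shows "h = h'"
using assms unfolding is_limit_def by blast

lemma colimit_factor:
assumes "is_colimit J C F c ii" "is_cocone J C F d kk"
obtains h where "h:Hom C c d" "!!i. i:Obj J ==> Comp C (onObj F i) c d h (ii i) = kk i"
using assms unfolding is_colimit_def by blast

lemma colimit_unique:
assumes "is_colimit J C F c ii" "is_cocone J C F d kk" "h:Hom C c d" "h':Hom C c d"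
	"!!i. i:Obj J ==> Comp C (onObj F i) c d h (ii i) = kk i" "!!i. i:Obj J ==> Comp C (onObj F i) c d h' (ii i) = kk i"
shows "h = h'"
using assms unfolding is_colimit_def by blast

text \<open>Duality: each of the constructions below is carried out on one side only. Double
  reversal is an equality of records (\<open>op_op\<close>), so the lemmas about opposites can be
  read in both directions.\<close>

definition op_cat :: "('o, 'm) cat => ('o, 'm) cat" where
"op_cat C = (|Obj = Obj C, Hom = (%x y. Hom C y x), Idm = Idm C, Comp = (%x y z g f. Comp C z y x f g)|)"

definition op_func :: "('j, 'n, 'o, 'm) func => ('j, 'n, 'o, 'm) func" where
"op_func F = (|onObj = onObj F, onHom = (%i j. onHom F j i)|)"

lemma op_op [simp]: "op_cat (op_cat C) = C" "op_func (op_func F) = F"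
by (simp_all add: op_cat_def op_func_def)

lemma category_op: "category C ==> category (op_cat C)"
unfolding category_def op_cat_def by simp

lemma functor_op: "is_functor J C F ==> is_functor (op_cat J) (op_cat C) (op_func F)"
unfolding is_functor_def op_cat_def op_func_def by simp

lemma locally_small_op: "locally_small U C ==> locally_small U (op_cat C)"
unfolding locally_small_def op_cat_def by simp

lemma small_category_op: "small_category J ==> small_category (op_cat J)"
unfolding small_category_def by (simp add: category_op locally_small_op) (simp add: op_cat_def)

lemma cocone_op: "is_cocone (op_cat J) (op_cat C) (op_func F) = is_cone J C F"
unfolding is_cocone_def is_cone_def op_cat_def op_func_def by (intro ext) auto

lemma colimit_op: "is_colimit (op_cat J) (op_cat C) (op_func F) = is_limit J C F"
unfolding is_colimit_def is_limit_def cocone_op by (simp add: op_cat_def op_func_def)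

lemma cocomplete_op:
"complete_category U (op_cat C)" if "cocomplete_category U C" unfolding complete_category_def
proof (intro allI impI, elim conjE)
fix J :: "('a, 'a) cat" and F assume J: "small_category J" and F: "is_functor J (op_cat C) F"
have "EX c ii. is_colimit (op_cat J) C (op_func F) c ii"
	using that small_category_op[OF J] functor_op[OF F] unfolding cocomplete_category_def by simp
thus "EX c qj. is_limit J (op_cat C) F c qj" using colimit_op[of J "op_cat C" F] by simp
qed

section \<open>Completeness, weakly initial families and generators\<close>

context grothendieck
begin
text \<open>\<open>complete_category\<close> speaks of shapes with objects and arrows in
  \<open>'u\<close>, but shapes such as categories of cocones have other types. They are copied into
  \<open>'u\<close>, with a separate injection for each hom set since hom sets may overlap.\<close>

lemma complete_shape:
fixes J :: "('j, 'n) cat" and C :: "('o, 'm) cat"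
assumes "complete_category TYPE('u) C" "category J" "small TYPE('u) (Obj J)"
	"locally_small TYPE('u) J" "is_functor J C F"
shows "EX c qj. is_limit J C F c qj"
proof -
from small_embed[OF assms(3)] obtain e :: "'j => 'u" where e: "inj_on e (Obj J)" ..
have "ALL i j. EX c :: 'n => 'u. i:Obj J --> j:Obj J --> inj_on c (Hom J i j)"
	using small_embed assms(4) unfolding locally_small_def by metis
then obtain m :: "'j => 'j => 'n => 'u"
	where m: "!!i j. i:Obj J ==> j:Obj J ==> inj_on (m i j) (Hom J i j)" by metis
define d where "d = inv_into (Obj J) e"
define h where "h = (%i j. inv_into (Hom J i j) (m i j))"
have d [simp]: "i:Obj J ==> d (e i) = i" for i unfolding d_def using e by simp
have h [simp]: "[|f:Hom J i j; i:Obj J; j:Obj J|] ==> h i j (m i j f) = f" for i j f unfolding h_def using m by simp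
define J' where "J' = (|Obj = e ` Obj J, Hom = (%a b. m (d a) (d b) ` Hom J (d a) (d b)), Idm = (%a. m (d a) (d a) (Idm J (d a))),
	Comp = (%x y z g f. m (d x) (d z) (Comp J (d x) (d y) (d z) (h (d y) (d z) g) (h (d x) (d y) f)))|)"
define F' where "F' = (|onObj = (%a. onObj F (d a)), onHom = (%a b f. onHom F (d a) (d b) (h (d a) (d b) f))|)"
note J = id_in[OF assms(2)] comp_in[OF assms(2)] id_left[OF assms(2)] id_right[OF assms(2)] comp_assoc[OF assms(2)]
have "category J'" unfolding category_def J'_def by (auto simp: J)
moreover have "small TYPE('u) (Obj J')" "locally_small TYPE('u) J'"
	using assms(3,4) small_image unfolding locally_small_def J'_def by (auto simp: small_image)
moreover have "is_functor J' C F'" using assms(5) unfolding is_functor_def J'_def F'_def by (auto simp: J)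
ultimately obtain c qj where L: "is_limit J' C F' c qj" using assms(1) unfolding complete_category_def small_category_def by blast
have 1: "is_cone J C F x (%i. rh (e i))" if "is_cone J' C F' x rh" for x rh using that unfolding is_cone_def J'_def F'_def by (auto simp: J)
have 2: "is_cone J' C F' x (%a. rh (d a))" if "is_cone J C F x rh" for x rh using that unfolding is_cone_def J'_def F'_def by (auto simp: J)
have "is_limit J C F c (%i. qj (e i))" unfolding is_limit_def
proof (intro conjI allI impI 1 limit_cone[OF L])
	fix x rh assume "is_cone J C F x rh"
	from 2[OF this] have "EX! h. h:Hom C x c & (ALL a:Obj J'. Comp C x c (onObj F' a) (qj a) h = rh (d a))"
		using L unfolding is_limit_def by blast
	thus "EX! h. h:Hom C x c & (ALL i:Obj J. Comp C x c (onObj F i) (qj (e i)) h = rh i)" unfolding J'_def F'_def by simp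
qed
thus ?thesis by blast
qed

lemma cocomplete_shape:
assumes "cocomplete_category TYPE('u) C" "category J" "small TYPE('u) (Obj J)"
	"locally_small TYPE('u) J" "is_functor J C F"
shows "EX c ii. is_colimit J C F c ii"
proof -
have "small TYPE('u) (Obj (op_cat J))" using assms(3) by (simp add: op_cat_def)
from complete_shape[OF cocomplete_op[OF assms(1)] category_op[OF assms(2)] this locally_small_op[OF assms(4)] functor_op[OF assms(5)]]
show ?thesis using colimit_op[of "op_cat J" "op_cat C" "op_func F"] by simp
qed

lemma complete_equalizer:
fixes C :: "('o, 'm) cat"
assumes "complete_category TYPE('u) C" "category C" "x:Obj C" "y:Obj C"
	"f:Hom C x y" "g:Hom C x y"
shows "EX e k. e:Obj C & k:Hom C e x & Comp C e x y f k = Comp C e x y g k &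
	(ALL d:Obj C. ALL h:Hom C d x. Comp C d x y f h = Comp C d x y g h --> (EX! h'. h':Hom C d e & Comp C d e x k h' = h))"
proof -
\<comment> \<open>The parallel pair: \<open>False\<close> is the source, \<open>True\<close> the
  target, and the two truth values are the two arrows between them, sent to \<open>g\<close> and
  \<open>f\<close>.\<close>
define J :: "(bool, bool) cat" where "J = (|Obj = UNIV, Hom = (%i j. if i = j then {True} else if j then UNIV else {}), Idm = (%_. True),
	Comp = (%i j k g f. if i = j then g else f)|)"
define F :: "(bool, bool, 'o, 'm) func" where "F = (|onObj = (%i. if i then y else x),
	onHom = (%i j m. if i = j then Idm C (if i then y else x) else if m then f else g)|)"
note rules = id_in[OF assms(2)] comp_in[OF assms(2)] id_left[OF assms(2)] id_right[OF assms(2)]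
have "category J" unfolding category_def J_def by (simp add: UNIV_bool)
moreover have "is_functor J C F" unfolding is_functor_def J_def F_def using assms by (simp add: rules UNIV_bool)
moreover have "small TYPE('u) (Obj J)" "locally_small TYPE('u) J" unfolding locally_small_def J_def by (auto simp: small_finite)
ultimately obtain e qj where L: "is_limit J C F e qj" using complete_shape[OF assms(1)] by blast
note cone = limit_cone[OF L, unfolded is_cone_def]
have c: "e:Obj C" "qj False:Hom C e x" using cone by (auto simp: J_def F_def dest: spec[of _ False])
have c': "Comp C e x y (if m then f else g) (qj False) = qj True" for m
proof -
	have "Comp C e (onObj F False) (onObj F True) (onHom F False True m) (qj False) = qj True" using cone by (simp add: J_def)
	thus ?thesis by (simp add: F_def)
qed
note t = c'[of True, simplified] and eq = c'[of False, simplified, folded c'[of True, simplified]]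
have F: "onObj F True = y" "onObj F False = x" by (simp_all add: F_def)
have "EX! h'. h':Hom C d e & Comp C d e x (qj False) h' = h" if h: "d:Obj C" "h:Hom C d x" "Comp C d x y f h = Comp C d x y g h" for d h
proof -
	have "is_cone J C F d (%i. if i then Comp C d x y f h else h)"
		unfolding is_cone_def J_def F_def using h assms by (simp add: rules UNIV_bool)
	hence "EX! h'. h':Hom C d e & (ALL i:Obj J. Comp C d e (onObj F i) (qj i) h' = (if i then Comp C d x y f h else h))"
		using L unfolding is_limit_def by blast
	moreover have "(ALL i:Obj J. Comp C d e (onObj F i) (qj i) h' = (if i then Comp C d x y f h else h))
			<-> Comp C d e x (qj False) h' = h" if "h':Hom C d e" for h'
		using that h c assms by (auto simp: J_def UNIV_bool F t[symmetric] comp_assoc[OF assms(2)])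
	ultimately show ?thesis by (simp cong: conj_cong)
qed
thus ?thesis by (intro exI[of _ e] exI[of _ "qj False"] conjI ballI impI c eq[symmetric])
qed

text \<open>
Freyd's adjoint functor theorem in disguise: a weakly initial family of cocones, viewed as a full
subcategory of the category of cocones, has as its limit the colimit of the diagram.
\<close>

lemma colimit_if_weakly_initial:
fixes C :: "('o, 'm) cat" and J :: "('j, 'n) cat"
assumes com: "complete_category TYPE('u) C" and cat: "category C"
	and ls: "locally_small TYPE('u) C" and D: "is_functor J C D" and catJ: "category J"
	and smW: "small TYPE('u) W" and W: "!!w. w:W ==> is_cocone J C D (fst w) (snd w)" and weak: "!!x kk. is_cocone J C D x kk ==>
		EX w:W. EX h:Hom C (fst w) x. ALL i:Obj J. Comp C (onObj D i) (fst w) x h (snd w i) = kk i"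
shows "EX c ii. is_colimit J C D c ii"
proof -
note Cin = comp_in[OF cat] and ass = comp_assoc[OF cat]
note Dobj = functor_obj[OF D] and Dhom = functor_hom[OF D]
define H where "H = (%w v. {h:Hom C (fst w) (fst v).
	ALL i:Obj J. Comp C (onObj D i) (fst w) (fst v) h (snd w i) = snd v i})"
define S where "S = (|Obj = W, Hom = H, Idm = (%w. Idm C (fst w)), Comp = (%x y z. Comp C (fst x) (fst y) (fst z))|)"
define G :: "('o * ('j => 'm), 'm, 'o, 'm) func" where "G = (|onObj = fst, onHom = (%_ _ h. h)|)"
have Wobj: "fst w:Obj C" if "w:W" for w using W[OF that] unfolding is_cocone_def by blast
have Whom: "snd w i:Hom C (onObj D i) (fst w)" if "w:W" "i:Obj J" for w i using W[OF that(1)] that(2) unfolding is_cocone_def by blast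
have "category S" unfolding category_def S_def H_def by (auto simp: Wobj Whom Cin id_in[OF cat] id_left[OF cat] id_right[OF cat] ass Dobj)
moreover have "is_functor S C G" unfolding is_functor_def S_def H_def G_def by (auto simp: Wobj)
moreover have "locally_small TYPE('u) S"
proof -
	have "small TYPE('u) (H w v)" if "w:W" "v:W" for w v by (rule small_subset[of "Hom C (fst w) (fst v)"])
			(use ls Wobj that in "auto simp: locally_small_def H_def")
	thus ?thesis unfolding locally_small_def S_def by simp
qed
moreover have "small TYPE('u) (Obj S)" using smW by (simp add: S_def)
ultimately obtain l p where L: "is_limit S C G l p" using complete_shape[OF com] by blast
have l: "l:Obj C" and p: "!!w. w:W ==> p w:Hom C l (fst w)"
	and pH: "!!w v h. [|w:W; v:W; h:H w v|] ==> Comp C l (fst w) (fst v) h (p w) = p v"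
	using limit_cone[OF L] unfolding is_cone_def by (auto simp: S_def G_def)
\<comment> \<open>For fixed \<open>i\<close>, the legs at \<open>i\<close> of all cocones in
  \<open>W\<close> form a cone over \<open>G\<close>. The induced maps \<open>k i\<close> turn the
  limit \<open>l\<close> into a cocone on \<open>D\<close>.\<close>
have wit: "is_cone S C G (onObj D i) (%w. snd w i)" if "i:Obj J" for i
	unfolding is_cone_def S_def G_def H_def using that by (auto simp: Dobj Whom)
have "EX k. k:Hom C (onObj D i) l & (ALL w:W. Comp C (onObj D i) l (fst w) (p w) k = snd w i)" if "i:Obj J" for i
proof -
	from limit_factor[OF L wit[OF that]] obtain h where "h:Hom C (onObj D i) l"
		"!!w. w:Obj S ==> Comp C (onObj D i) l (onObj G w) (p w) h = snd w i" by blast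
	thus ?thesis by (auto simp: G_def S_def)
qed
then obtain k where k: "!!i. i:Obj J ==> k i:Hom C (onObj D i) l"
	"!!i w. [|i:Obj J; w:W|] ==> Comp C (onObj D i) l (fst w) (p w) (k i) = snd w i" by metis
have kc: "is_cocone J C D l k" unfolding is_cocone_def
proof (intro conjI ballI l k(1))
	fix i j f assume ij: "i:Obj J" "j:Obj J" "f:Hom J i j"
	show "Comp C (onObj D i) (onObj D j) l (k j) (onHom D i j f) = k i"
	proof (rule limit_unique[OF L wit[OF ij(1)]])
		fix w assume "w:Obj S"
		hence w: "w:W" by (simp add: S_def)
		have "Comp C (onObj D i) (onObj D j) (fst w) (snd w j) (onHom D i j f) = snd w i" using W[OF w] ij unfolding is_cocone_def by blast
		thus "Comp C (onObj D i) l (onObj G w) (p w) (Comp C (onObj D i) (onObj D j) l (k j) (onHom D i j f)) = snd w i"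
			using w ij by (simp add: G_def ass[symmetric] Dobj Dhom Wobj p k l)
		show "Comp C (onObj D i) l (onObj G w) (p w) (k i) = snd w i" using w ij by (simp add: G_def k)
	qed (use ij in "simp_all add: Cin Dobj Dhom l k")
qed
have "is_colimit J C D l k" unfolding is_colimit_def
proof (intro conjI allI impI kc)
	fix x kk assume x: "is_cocone J C D x kk"
	have xo: "x:Obj C" using x unfolding is_cocone_def by blast
	from weak[OF x] obtain w h where w: "w:W" and h: "h:Hom C (fst w) x"
		"!!i. i:Obj J ==> Comp C (onObj D i) (fst w) x h (snd w i) = kk i" by blast
	have hp: "Comp C l (fst w) x h (p w):Hom C l x" "!!i. i:Obj J ==> Comp C (onObj D i) l x (Comp C l (fst w) x h (p w)) (k i) = kk i"
		using w h xo by (simp_all add: Cin ass Wobj l p k Dobj)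
	show "EX! h. h:Hom C l x & (ALL i:Obj J. Comp C (onObj D i) l x h (k i) = kk i)"
	proof (rule ex1I[of _ "Comp C l (fst w) x h (p w)"])
		show "Comp C l (fst w) x h (p w):Hom C l x & (ALL i:Obj J. Comp C (onObj D i) l x (Comp C l (fst w) x h (p w)) (k i) = kk i)"
			using hp by blast
	next
		fix f assume "f:Hom C l x & (ALL i:Obj J. Comp C (onObj D i) l x f (k i) = kk i)"
		hence f: "f:Hom C l x" "!!i. i:Obj J ==> Comp C (onObj D i) l x f (k i) = kk i" by auto
		\<comment> \<open>Uniqueness: \<open>f\<close> and \<open>?g\<close> agree after each
		  \<open>k i\<close>, so the cocone \<open>k\<close> factors through their equalizer
		  \<open>q\<close>. Some member of \<open>W\<close> maps to that equalizer, which produces a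
		  section of \<open>q\<close> and forces \<open>f = ?g\<close>.\<close>
		let ?g = "Comp C l (fst w) x h (p w)"
		from complete_equalizer[OF com cat l xo f(1) hp(1)]
		obtain e q where e: "e:Obj C" "q:Hom C e l" "Comp C e l x f q = Comp C e l x ?g q"
			and eq: "ALL d:Obj C. ALL h:Hom C d l. Comp C d l x f h = Comp C d l x ?g h --> (EX! h'. h':Hom C d e & Comp C d e l q h' = h)"
			by (elim exE conjE)
		have mono: "h = h'" if "d:Obj C" "h:Hom C d e" "h':Hom C d e" "Comp C d e l q h = Comp C d e l q h'" for d h h'
		proof -
			have "Comp C d l x f (Comp C d e l q h) = Comp C d l x ?g (Comp C d e l q h)" using that e by (simp add: ass[symmetric] l xo f(1) hp(1))
			hence "EX! h'. h':Hom C d e & Comp C d e l q h' = Comp C d e l q h" using eq that e Cin l by simp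
			thus ?thesis using that by metis
		qed
		have "EX k':Hom C (onObj D i) e. Comp C (onObj D i) e l q k' = k i" if "i:Obj J" for i 
		proof -
			have "EX! h'. h':Hom C (onObj D i) e & Comp C (onObj D i) e l q h' = k i" using eq that k(1) f(2) hp(2) Dobj by simp
			thus ?thesis by blast
		qed
		then obtain k' where k': "!!i. i:Obj J ==> k' i:Hom C (onObj D i) e" "!!i. i:Obj J ==> Comp C (onObj D i) e l q (k' i) = k i" by metis
		let ?E = "%v. {r:Hom C (fst v) l. ALL i:Obj J. Comp C (onObj D i) (fst v) l r (snd v i) = k i}"
		\<comment> \<open>\<open>p u\<close> after \<open>r\<close> is a morphism of cocones from
		  \<open>v\<close> to \<open>u\<close>, so it carries \<open>p v\<close> to \<open>p u\<close>.
		  Hence the limit cone does not distinguish the composite from the identity.\<close>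
		have split: "Comp C l (fst v) l r (p v) = Idm C l" if v: "v:W" and r: "r:?E v" for v r
		proof (rule limit_unique[OF L limit_cone[OF L]])
			fix u assume "u:Obj S"
			hence u: "u:W" by (simp add: S_def)
			have "Comp C (fst v) l (fst u) (p u) r:H v u" unfolding H_def using u v r by (auto simp: Cin ass Wobj p l k Whom Dobj)
			from pH[OF v u this]
			show "Comp C l l (onObj G u) (p u) (Comp C l (fst v) l r (p v)) = p u" using u v r by (simp add: G_def ass[symmetric] Wobj p l)
			show "Comp C l l (onObj G u) (p u) (Idm C l) = p u" using u by (simp add: G_def id_right[OF cat] p l Wobj)
		qed (use v r in "simp_all add: Cin Wobj p l id_in[OF cat]")
		have "is_cocone J C D e k'" unfolding is_cocone_def
		proof (intro conjI ballI e(1) k'(1))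
			fix i j m assume ij: "i:Obj J" "j:Obj J" "m:Hom J i j"
			show "Comp C (onObj D i) (onObj D j) e (k' j) (onHom D i j m) = k' i"
			proof (rule mono)
				have "Comp C (onObj D i) (onObj D j) l (k j) (onHom D i j m) = k i" using kc ij unfolding is_cocone_def by blast
				thus "Comp C (onObj D i) e l q (Comp C (onObj D i) (onObj D j) e (k' j) (onHom D i j m)) = Comp C (onObj D i) e l q (k' i)"
					using ij by (simp add: ass[symmetric] Dobj Dhom k' e(1,2) l)
			qed (use ij in "simp_all add: Cin Dobj Dhom k' e(1)")
		qed
		from weak[OF this] obtain v r where v: "v:W" and r: "r:Hom C (fst v) e"
			"!!i. i:Obj J ==> Comp C (onObj D i) (fst v) e r (snd v i) = k' i" by blast
		have "Comp C (fst v) e l q r:?E v" using v r by (auto simp: Cin Wobj e(1,2) l ass Dobj Whom k')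
		from split[OF v this] have id: "Comp C l e l q (Comp C l (fst v) e r (p v)) = Idm C l" using v r by (simp add: ass Wobj p l e(1,2))
		have rp: "Comp C l (fst v) e r (p v):Hom C l e" using v r by (simp add: Cin Wobj p l e(1))
		show "f = ?g" using arg_cong[OF e(3), of "%z. Comp C l e x z (Comp C l (fst v) e r (p v))"] id rp
			by (simp add: ass e(1,2) l xo f(1) hp(1) id_right[OF cat])
	qed
qed
thus ?thesis by blast
qed

text \<open>The preceding result in the opposite category, for the family whose only member is
  \<open>(t, tw)\<close>.\<close>

lemma limit_if_weakly_terminal:
fixes C :: "('o, 'm) cat" and J :: "('j, 'n) cat"
assumes "cocomplete_category TYPE('u) C" "category C" "locally_small TYPE('u) C"
	"is_functor J C D" "category J" "is_cone J C D t tw" and "!!x rh. is_cone J C D x rh ==>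
		EX h:Hom C x t. ALL i:Obj J. Comp C x t (onObj D i) (tw i) h = rh i"
shows "EX c qj. is_limit J C D c qj"
proof -
have 1: "is_cocone (op_cat J) (op_cat C) (op_func D) = is_cone J C D" by (rule cocone_op)
have "EX c ii. is_colimit (op_cat J) (op_cat C) (op_func D) c ii"
	by (rule colimit_if_weakly_initial[OF cocomplete_op[OF assms(1)] category_op[OF assms(2)]
				locally_small_op[OF assms(3)] functor_op[OF assms(4)] category_op[OF assms(5)], of "{(t, tw)}"], unfold 1)
		(use assms(6,7) in "auto simp: small_finite op_cat_def op_func_def")
thus ?thesis by (simp add: colimit_op)
qed

text \<open>The consequence of accessibility that drives the passage from cocompleteness to
  completeness: cones with vertex in \<open>S\<close> form a small set and determine, through
  colimits, the cones with arbitrary vertex.\<close>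

definition gen_by :: "('o, 'm) cat => 'o set => bool" where
"gen_by C S <-> small TYPE('u) S & S <= Obj C & (ALL x:Obj C. EX (P :: 'u set) r F ii. is_functor (poset_cat P r) C F &
			(ALL i:P. onObj F i:S) & is_colimit (poset_cat P r) C F x ii)"

text \<open>
The colimit of all cones with vertex among the generators is weakly terminal among the cones.
\<close>

lemma complete_if_cocomplete:
fixes C :: "('o, 'm) cat"
assumes coc: "cocomplete_category TYPE('u) C" and cat: "category C"
	and ls: "locally_small TYPE('u) C" and gen: "gen_by C S"
shows "complete_category TYPE('u) C"
unfolding complete_category_def
proof (intro allI impI, elim conjE)
fix J :: "('u, 'u) cat" and D assume J: "small_category J" and D: "is_functor J C D"
have catJ: "category J" and smJ: "small TYPE('u) (Obj J)" using J unfolding small_category_def by auto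
note Cin = comp_in[OF cat] and ass = comp_assoc[OF cat]
note Dobj = functor_obj[OF D] and Dhom = functor_hom[OF D]
have smS: "small TYPE('u) S" and S: "s:S ==> s:Obj C" for s using gen unfolding gen_by_def by auto
define W where "W = {(s, qj). s:S & qj:(\<Pi>\<^sub>E i\<in>Obj J. Hom C s (onObj D i)) & is_cone J C D s qj}"
have "small TYPE('u) W"
proof (rule small_subset)
	show "small TYPE('u) (SIGMA s:S. \<Pi>\<^sub>E i\<in>Obj J. Hom C s (onObj D i))"
		using ls smJ S by (intro small_Sigma smS small_PiE) (auto simp: locally_small_def Dobj)
qed (auto simp: W_def)
define H where "H = (%w v. {h:Hom C (fst w) (fst v).
	ALL i:Obj J. Comp C (fst w) (fst v) (onObj D i) (snd v i) h = snd w i})"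
define E where "E = (|Obj = W, Hom = H, Idm = (%w. Idm C (fst w)), Comp = (%x y z. Comp C (fst x) (fst y) (fst z))|)"
define G :: "('o * ('u => 'm), 'm, 'o, 'm) func" where "G = (|onObj = fst, onHom = (%_ _ h. h)|)"
have Wobj: "fst w:Obj C" if "w:W" for w using that S by (auto simp: W_def)
have Whom: "snd w i:Hom C (fst w) (onObj D i)" if "w:W" "i:Obj J" for w i using that by (auto simp: W_def)
have "category E" unfolding category_def E_def H_def
	by (auto simp: Wobj Whom Cin id_in[OF cat] id_left[OF cat] id_right[OF cat] ass[symmetric] Dobj)
moreover have "is_functor E C G" unfolding is_functor_def E_def H_def G_def by (auto simp: Wobj)
moreover have "locally_small TYPE('u) E"
proof -
	have "small TYPE('u) (H w v)" if "w:W" "v:W" for w v by (rule small_subset[of "Hom C (fst w) (fst v)"])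
			(use ls Wobj that in "auto simp: locally_small_def H_def")
	thus ?thesis unfolding locally_small_def E_def by simp
qed
moreover have "small TYPE('u) (Obj E)" using \<open>small TYPE('u) W\<close> by (simp add: E_def)
ultimately obtain t p where L: "is_colimit E C G t p" using cocomplete_shape[OF coc] by blast
have t: "t:Obj C" and p: "!!w. w:W ==> p w:Hom C (fst w) t"
	and pH: "!!w v h. [|w:W; v:W; h:H w v|] ==> Comp C (fst w) (fst v) t (p v) h = p w"
	using colimit_cocone[OF L] unfolding is_cocone_def by (auto simp: E_def G_def)
have wit: "is_cocone E C G (onObj D i) (%w. snd w i)" if "i:Obj J" for i
	unfolding is_cocone_def E_def G_def H_def using that by (auto simp: Dobj Whom)
have "EX q. q:Hom C t (onObj D i) & (ALL w:W. Comp C (fst w) t (onObj D i) q (p w) = snd w i)" if "i:Obj J" for i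
proof -
	from colimit_factor[OF L wit[OF that]] obtain h where "h:Hom C t (onObj D i)"
		"!!w. w:Obj E ==> Comp C (onObj G w) t (onObj D i) h (p w) = snd w i" by blast
	thus ?thesis by (auto simp: G_def E_def)
qed
then obtain q where q: "!!i. i:Obj J ==> q i:Hom C t (onObj D i)"
	"!!i w. [|i:Obj J; w:W|] ==> Comp C (fst w) t (onObj D i) (q i) (p w) = snd w i" by metis
have Wcone: "Comp C (fst w) (onObj D i) (onObj D j) (onHom D i j f) (snd w i) = snd w j"
	if "w:W" "i:Obj J" "j:Obj J" "f:Hom J i j" for w i j f using that unfolding W_def is_cone_def by auto
have qc: "is_cone J C D t q" unfolding is_cone_def
proof (intro conjI ballI t q(1))
	fix i j f assume ij: "i:Obj J" "j:Obj J" "f:Hom J i j"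
	show "Comp C t (onObj D i) (onObj D j) (onHom D i j f) (q i) = q j"
	proof (rule colimit_unique[OF L wit[OF ij(2)]])
		fix w assume "w:Obj E"
		hence w: "w:W" by (simp add: E_def)
		thus "Comp C (onObj G w) t (onObj D j) (Comp C t (onObj D i) (onObj D j) (onHom D i j f) (q i)) (p w) = snd w j"
			using ij Wcone[OF w ij] by (simp add: G_def ass Dobj Dhom Wobj p q t)
		show "Comp C (onObj G w) t (onObj D j) (q j) (p w) = snd w j" using w ij by (simp add: G_def q)
	qed (use ij in "simp_all add: Cin Dobj Dhom t q")
qed
show "EX c qj. is_limit J C D c qj"
proof (rule limit_if_weakly_terminal[OF coc cat ls D catJ qc])
	fix x rh assume x: "is_cone J C D x rh"
	hence xo: "x:Obj C" and rho: "!!i. i:Obj J ==> rh i:Hom C x (onObj D i)" and rhoc: "!!i j f. [|i:Obj J; j:Obj J; f:Hom J i j|]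
			==> Comp C x (onObj D i) (onObj D j) (onHom D i j f) (rh i) = rh j" unfolding is_cone_def by auto
	from gen xo obtain P :: "'u set" and r F ii where F: "is_functor (poset_cat P r) C F" "!!a. a:P ==> onObj F a:S"
		and X: "is_colimit (poset_cat P r) C F x ii" unfolding gen_by_def by blast
	let ?P = "poset_cat P r"
	have Pobj: "Obj ?P = P" by (simp add: poset_cat_def)
	have Fobj: "!!a. a:P ==> onObj F a:Obj C" using F(2) S by blast
	have io: "!!a. a:P ==> ii a:Hom C (onObj F a) x" and ioc: "!!a b f. [|a:P; b:P; f:Hom ?P a b|]
			==> Comp C (onObj F a) (onObj F b) x (ii b) (onHom F a b f) = ii a"
		using colimit_cocone[OF X] unfolding is_cocone_def by (auto simp: Pobj)
	\<comment> \<open>Restricting the cone \<open>rh\<close> along the coprojection \<open>ii a\<close>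
	  gives a cone whose vertex is a generator, that is, an element of \<open>W\<close>. The maps
	  \<open>p (e a)\<close> are compatible and glue to a map from \<open>x\<close> to
	  \<open>t\<close>.\<close>
	define e where "e = (%a. (onObj F a, \<lambda>i\<in>Obj J. Comp C (onObj F a) x (onObj D i) (rh i) (ii a)))"
	have e: "e a:W" if "a:P" for a unfolding W_def e_def is_cone_def using that F(2) Fobj
		by (auto simp: Cin rho io xo Dobj Dhom ass[symmetric] rhoc)
	have fe: "fst (e a) = onObj F a" for a by (simp add: e_def)
	have "is_cocone ?P C F t (%a. p (e a))" unfolding is_cocone_def Pobj
	proof (intro conjI ballI t)
		show "p (e a):Hom C (onObj F a) t" if "a:P" for a using p[OF e[OF that]] by (simp add: fe)
		fix a b f assume ab: "a:P" "b:P" "f:Hom ?P a b"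
		have fh: "onHom F a b f:Hom C (onObj F a) (onObj F b)" using functor_hom[OF F(1)] ab by (simp add: Pobj)
		have "onHom F a b f:H (e a) (e b)" unfolding H_def using ab fh by (auto simp: e_def ass io ioc Fobj rho xo Dobj)
		from pH[OF e e this] ab show "Comp C (onObj F a) (onObj F b) t (p (e b)) (onHom F a b f) = p (e a)" by (simp add: fe)
	qed
	from colimit_factor[OF X this] obtain h where h: "h:Hom C x t"
		"!!a. a:P ==> Comp C (onObj F a) x t h (ii a) = p (e a)" by (auto simp: Pobj)
	have "Comp C x t (onObj D i) (q i) h = rh i" if i: "i:Obj J" for i
	proof (rule colimit_unique[OF X])
		let ?k = "%a. Comp C (onObj F a) x (onObj D i) (rh i) (ii a)"
		show "is_cocone ?P C F (onObj D i) ?k" unfolding is_cocone_def Pobj using i F(1)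
			by (auto simp: Cin Dobj Fobj rho io xo ass ioc functor_hom Pobj)
		fix a assume "a:Obj ?P"
		hence a: "a:P" by (simp add: Pobj)
		show "Comp C (onObj F a) x (onObj D i) (Comp C x t (onObj D i) (q i) h) (ii a) = ?k a" using a i q(2)[OF i e[OF a]]
			by (simp add: ass Fobj io xo h q t Dobj fe) (simp add: e_def)
	qed (use i in "simp_all add: Cin h q xo t Dobj rho")
	with h(1) show "EX h:Hom C x t. ALL i:Obj J. Comp C x t (onObj D i) (q i) h = rh i" by blast
qed
qed
end

section \<open>Categories of relational structures\<close>

text \<open>The concrete criterion for a directed colimit of sets: every element comes from a stage,
  and elements of one stage that become equal are already identified at a later stage. It is applied
  to carriers of structures and to hom sets.\<close>

lemma set_directed_colimit:
assumes la: "!!i. i:P ==> l i:A i \<rightarrow>\<^sub>E L" and ka: "!!i. i:P ==> k i:A i \<rightarrow>\<^sub>E D"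
	and t: "!!i j a. [|i:P; j:P; (i, j):r; a:A i|] ==> t i j a:A j" and lt: "!!i j a. [|i:P; j:P; (i, j):r; a:A i|] ==> l j (t i j a) = l i a"
	and kt: "!!i j a. [|i:P; j:P; (i, j):r; a:A i|] ==> k j (t i j a) = k i a" and dir: "!!i j. [|i:P; j:P|] ==> EX m:P. (i, m):r & (j, m):r"
	and surj: "!!x. x:L ==> EX i:P. EX a:A i. x = l i a" and inj: "!!i a b. [|i:P; a:A i; b:A i; l i a = l i b|]
		==> EX j:P. (i, j):r & t i j a = t i j b"
shows "EX! h. h:L \<rightarrow>\<^sub>E D & (ALL i:P. compose (A i) h (l i) = k i)"
proof -
have wd: "k i a = k j b" if w: "i:P" "j:P" "a:A i" "b:A j" "l i a = l j b" for i j a b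
proof -
	obtain m where m: "m:P" "(i, m):r" "(j, m):r" using dir w(1,2) by blast
	have "l m (t i m a) = l m (t j m b)" using w m lt by simp
	then obtain n where n: "n:P" "(m, n):r" "t m n (t i m a) = t m n (t j m b)"
		using inj[OF m(1) t[OF w(1) m(1,2) w(3)] t[OF w(2) m(1,3) w(4)]] by blast
	have "k i a = k n (t m n (t i m a))" using w m n(1,2) kt t by simp
	also have "... = k j b" unfolding n(3) using w m n(1,2) kt t by simp
	finally show ?thesis .
qed
have "ALL x:L. EX y. EX i:P. EX a:A i. x = l i a & y = k i a" using surj by blast
then obtain h0 where h0: "!!x. x:L ==> EX i:P. EX a:A i. x = l i a & h0 x = k i a" by (metis (no_types))
have hk: "h0 (l i a) = k i a" if "i:P" "a:A i" for i a using h0[of "l i a"] wd that la[OF that(1)] by (metis PiE_mem)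
show ?thesis
proof (rule ex1I[of _ "restrict h0 L"])
	have "h0 x:D" if "x:L" for x using h0[OF that] ka by (metis PiE_mem)
	moreover have "compose (A i) (restrict h0 L) (l i) = k i" if "i:P" for i
	proof
		fix a show "compose (A i) (restrict h0 L) (l i) a = k i a"
			using hk[OF that] la[OF that] ka[OF that] by (cases "a:A i") (auto simp: compose_def PiE_iff extensional_def)
	qed
	ultimately show "restrict h0 L:L \<rightarrow>\<^sub>E D & (ALL i:P. compose (A i) (restrict h0 L) (l i) = k i)" by auto
next
	fix h assume h: "h:L \<rightarrow>\<^sub>E D & (ALL i:P. compose (A i) h (l i) = k i)"
	show "h = restrict h0 L"
	proof
		fix x show "h x = restrict h0 L x"
		proof (cases "x:L")
			case True
			then obtain i a where ia: "i:P" "a:A i" "x = l i a" using surj by blast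
			hence "compose (A i) h (l i) a = k i a" using h by simp
			thus ?thesis using ia True hk by (simp add: compose_def)
		qed (use h in "auto simp: PiE_iff extensional_def")
	qed
qed
qed

text \<open>The properties from which accessibility is derived. \<open>transport\<close> allows
  carriers to be renamed, so that few representatives suffice. \<open>skolem_hull\<close> is a
  downward Loewenheim-Skolem property; it is stated for every \<open>N\<close> at least as large as
  \<open>Lam\<close>, since the construction of colimits uses hulls as large as the given
  diagram.\<close>

locale relational = grothendieck ty for ty :: "'u itself" +
fixes C :: "('o, 'u => 'u) cat" and El :: "'o => 'u set"
	and Rel :: "'o => 'r => 'u list set" and R :: "'r set" and Lam :: "'u set"
assumes inf_Lam: "infinite Lam" and small_Lam: "small TYPE('u) Lam" and R_Lam: "|R| <=o |Lam|"
	and small_El: "x:Obj C ==> small TYPE('u) (El x)" and Rel_sub: "[|x:Obj C; rh:R; xs:Rel x rh|] ==> set xs <= El x"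
	and Hom_eq: "[|x:Obj C; y:Obj C|] ==> Hom C x y = {f:El x \<rightarrow>\<^sub>E El y. ALL rh:R. ALL xs:Rel x rh. map f xs:Rel y rh}"
	and Idm_eq: "Idm C x = (\<lambda>a\<in>El x. a)" and Comp_eq: "Comp C x y z g f = compose (El x) g f"
	and transport: "[|x:Obj C; inj_on b (El x)|] ==> EX y:Obj C. El y = b ` El x & (ALL rh:R. Rel y rh = map b ` Rel x rh)"
	and skolem_hull: "[|x:Obj C; A <= El x; |A| <=o |N :: 'u set|; |Lam| <=o |N||] ==> EX y:Obj C. A <= El y & El y <= El x & |El y| <=o |N| &
			(ALL rh:R. Rel y rh = Rel x rh Int lists (El y))"
begin
text \<open>A colimit computed on underlying sets in which each instance of a relation stems from a
  stage. As soon as one such colimit exists, all colimits of the diagram have this form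
  (\<open>colimit_str_colimit\<close>); this is how presentability, which quantifies over arbitrary
  colimits, is handled.\<close>

definition str_colimit :: "'u set => 'u rel => ('u, unit, 'o, 'u => 'u) func => 'o => ('u => 'u => 'u) => bool"
where "str_colimit P r F c ii <-> is_cocone (poset_cat P r) C F c ii & (ALL x:El c. EX i:P. EX a:El (onObj F i). x = ii i a) &
	(ALL i:P. ALL a:El (onObj F i). ALL b:El (onObj F i). ii i a = ii i b --> (EX j:P. (i, j):r & onHom F i j () a = onHom F i j () b)) &
	(ALL rh:R. ALL xs:Rel c rh. EX i:P. EX ys:Rel (onObj F i) rh. xs = map (ii i) ys)"

lemma category_C: "category C"
unfolding category_def
proof (intro conjI ballI)
fix x y z f g assume xyz: "x:Obj C" "y:Obj C" "z:Obj C" and f: "f:Hom C x y" and g: "g:Hom C y z"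
have "map (compose (El x) g f) xs = map g (map f xs)" if "rh:R" "xs:Rel x rh" for rh xs
	using Rel_sub[OF xyz(1) that] by (auto simp: compose_def)
hence "map (compose (El x) g f) xs:Rel z rh" if "rh:R" "xs:Rel x rh" for rh xs using f g xyz that by (simp add: Hom_eq del: map_map)
thus "Comp C x y z g f:Hom C x z" using f g xyz by (auto simp: Hom_eq Comp_eq compose_def PiE_iff)
next
fix w x y z f g h assume "w:Obj C" "x:Obj C" "y:Obj C" "z:Obj C" "f:Hom C w x" "g:Hom C x y" "h:Hom C y z"
thus "Comp C w x z (Comp C x y z h g) f = Comp C w y z h (Comp C w x y g f)" by (auto simp: Comp_eq Hom_eq compose_def PiE_iff fun_eq_iff)
next
fix x assume x: "x:Obj C"
have "map (\<lambda>a\<in>El x. a) xs = xs" if "rh:R" "xs:Rel x rh" for rh xs using Rel_sub[OF x that] by (intro map_idI) auto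
thus "Idm C x:Hom C x x" using x by (auto simp: Hom_eq Idm_eq)
next
fix x y f assume "x:Obj C" "y:Obj C" "f:Hom C x y"
thus "Comp C x x y f (Idm C x) = f" "Comp C x y y (Idm C y) f = f"
	by (auto simp: Comp_eq Idm_eq Hom_eq compose_def PiE_iff fun_eq_iff extensional_def)
qed

lemma locally_small_C: "locally_small TYPE('u) C"
unfolding locally_small_def
proof (intro ballI)
fix x y assume xy: "x:Obj C" "y:Obj C"
hence "Hom C x y <= (\<Pi>\<^sub>E a\<in>El x. El y)" by (auto simp: Hom_eq)
moreover have "small TYPE('u) (\<Pi>\<^sub>E a\<in>El x. El y)" by (rule small_PiE) (use xy small_El in auto)
ultimately show "small TYPE('u) (Hom C x y)" using small_subset by blast
qed

lemmas C_id = id_in[OF category_C] and C_comp = comp_in[OF category_C]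
and C_idl = id_left[OF category_C] and C_idr = id_right[OF category_C] and C_assoc = comp_assoc[OF category_C]

lemma hom_PiE: "[|f:Hom C x y; x:Obj C; y:Obj C|] ==> f:El x \<rightarrow>\<^sub>E El y"
and hom_mem: "[|f:Hom C x y; x:Obj C; y:Obj C; a:El x|] ==> f a:El y"
and hom_rel: "[|f:Hom C x y; x:Obj C; y:Obj C; rh:R; xs:Rel x rh|] ==> map f xs:Rel y rh" by (auto simp: Hom_eq)

text \<open>\<open>cardSuc |Lam|\<close> is a relation on sets of elements of \<open>'u\<close>,
  while the index has to be a cardinal on \<open>'u\<close>; hence the choice of a subset of
  \<open>'u\<close> of that size. Being a successor makes \<open>kap\<close> regular and turns
  "fewer than \<open>kap\<close>" into "at most \<open>|Lam|\<close>".\<close>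

definition kap :: "'u rel" where
"kap = card_of (SOME M :: 'u set. |M| =o cardSuc |Lam| )"

lemma kap: "kap =o cardSuc |Lam|" "regular_cardinal kap" "|A| <o kap <-> |A| <=o |Lam|" for A :: "'a set"
proof -
have cL: "Cinfinite |Lam|" using inf_Lam by (simp add: cinfinite_def card_of_Card_order)
\<comment> \<open>The successor lies below the power set, which is small by the strong limit
  property of the universe.\<close>
have "cardSuc |Lam| <=o |Pow Lam|" by (rule cardSuc_least) (auto simp: card_of_Card_order card_of_Pow)
hence lt: "cardSuc |Lam| <o |UNIV :: 'u set|" using small_Pow[OF small_Lam] unfolding small_def by (rule ordLeq_ordLess_trans)
then obtain M :: "'u set" where "|M| =o cardSuc |Lam|"
	by (metis Cinfinite_cardSuc cL card_of_Field_ordIso internalize_card_of_ordLeq2 ordIso_ordLeq_trans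
			ordIso_symmetric ordIso_transitive ordLess_imp_ordLeq)
thus 1: "kap =o cardSuc |Lam|" unfolding kap_def by (rule someI)
have ci: "Cinfinite kap" using 1 Cinfinite_cardSuc[OF cL] by (metis Cinfinite_cong ordIso_symmetric)
moreover have "regularCard kap" using regularCard_ordIso[OF ordIso_symmetric[OF 1] Cinfinite_cardSuc[OF cL] regularCard_cardSuc[OF cL]] .
moreover have "kap <o |UNIV :: 'u set|" using 1 lt by (rule ordIso_ordLess_trans)
ultimately show "regular_cardinal kap" unfolding regular_cardinal_def by blast
show "|A| <o kap <-> |A| <=o |Lam|" for A :: "'a set" using 1 cardSuc_ordLeq_ordLess[of "|Lam|" "|A|"]
	by (metis card_of_Card_order ordIso_symmetric ordLess_ordIso_trans)
qed

context
fixes P :: "'u set" and r :: "'u rel" and F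
assumes F: "is_functor (poset_cat P r) C F" and P: "directed_poset kap P r"
begin
abbreviation "At i == El (onObj F i)"
abbreviation "tr i j == onHom F i j ()"

lemma bound: "[|A <= P; |A| <=o |Lam||] ==> EX b:P. ALL a:A. (a, b):r"
using P unfolding directed_poset_def kap(3) by blast

lemma bound2: "[|i:P; j:P|] ==> EX m:P. (i, m):r & (j, m):r"
using bound[of "{i, j}"] inf_Lam by (auto simp: ordLess_imp_ordLeq)

lemma r_refl: "i:P ==> (i, i):r"
and r_trans: "[|(i, j):r; (j, k):r|] ==> (i, k):r" using P unfolding directed_poset_def partial_order_on_def preorder_on_def
by (auto dest: refl_onD transD)

lemma F_obj: "i:P ==> onObj F i:Obj C"
using functor_obj[OF F] by (simp add: poset_cat_def)

lemma F_hom: "[|i:P; j:P; (i, j):r|] ==> tr i j:Hom C (onObj F i) (onObj F j)"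
using functor_hom[OF F, of "()" i j] by (simp add: poset_cat_def)

lemma tr_mem: "[|i:P; j:P; (i, j):r; a:At i|] ==> tr i j a:At j"
using hom_mem[OF F_hom F_obj F_obj] by blast

lemma tr_rel: "[|i:P; j:P; (i, j):r; rh:R; xs:Rel (onObj F i) rh|]
==> map (tr i j) xs:Rel (onObj F j) rh" using hom_rel[OF F_hom F_obj F_obj] by blast

lemma tr_comp: "[|i:P; j:P; k:P; (i, j):r; (j, k):r; a:At i|]
==> tr j k (tr i j a) = tr i k a" using functor_comp[OF F, of "()" i j "()" k] r_trans[of i j k]
by (simp add: poset_cat_def Comp_eq compose_def)

context
fixes c ii assumes c: "is_cocone (poset_cat P r) C F c ii"
begin
lemma cc_obj: "c:Obj C" using c unfolding is_cocone_def by blast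

lemma cc_hom: "i:P ==> ii i:Hom C (onObj F i) c"
using c unfolding is_cocone_def by (simp add: poset_cat_def)

lemma cc_rel: "[|i:P; rh:R; xs:Rel (onObj F i) rh|] ==> map (ii i) xs:Rel c rh"
using hom_rel[OF cc_hom F_obj cc_obj] by blast

lemma cc_tr:
assumes "i:P" "j:P" "(i, j):r" "a:At i" shows "ii j (tr i j a) = ii i a"
proof -
have "ALL i:P. ALL j:P. (i, j):r --> compose (At i) (ii j) (tr i j) = ii i"
	using c unfolding is_cocone_def by (simp add: poset_cat_def Comp_eq)
hence "compose (At i) (ii j) (tr i j) a = ii i a" using assms by simp
thus ?thesis using assms(4) by (simp add: compose_def)
qed
end

text \<open>The mediating map exists on sets, and it preserves relations because every instance in
  \<open>c\<close> is the image of an instance at some stage.\<close>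

lemma str_colimit_colimit:
assumes s: "str_colimit P r F c ii" shows "is_colimit (poset_cat P r) C F c ii"
unfolding is_colimit_def
proof (intro conjI allI impI)
show cc: "is_cocone (poset_cat P r) C F c ii" using s unfolding str_colimit_def by blast
fix d kk assume d: "is_cocone (poset_cat P r) C F d kk"
have ex: "EX! h. h:El c \<rightarrow>\<^sub>E El d & (ALL i:P. compose (At i) h (ii i) = kk i)"
	by (rule set_directed_colimit[where t = tr and r = r])
		(use s hom_PiE[OF cc_hom[OF cc] F_obj cc_obj[OF cc]] hom_PiE[OF cc_hom[OF d] F_obj cc_obj[OF d]]
			cc_tr[OF cc] cc_tr[OF d] tr_mem bound2 in "auto simp: str_colimit_def")
moreover have "h:Hom C c d" if h: "h:El c \<rightarrow>\<^sub>E El d" "ALL i:P. compose (At i) h (ii i) = kk i" for h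
proof -
	have "map h xs:Rel d rh" if r: "rh:R" "xs:Rel c rh" for rh xs
	proof -
		obtain i ys where i: "i:P" "ys:Rel (onObj F i) rh" "xs = map (ii i) ys" using s r unfolding str_colimit_def by blast
		have "map h xs = map (compose (At i) h (ii i)) ys" using Rel_sub[OF F_obj[OF i(1)] r(1) i(2)] i(3) by (auto simp: compose_def)
		thus ?thesis using cc_rel[OF d i(1) r(1) i(2)] h(2) i(1) by simp
	qed
	thus ?thesis using h cc_obj[OF cc] cc_obj[OF d] by (simp add: Hom_eq)
qed
moreover have "h:El c \<rightarrow>\<^sub>E El d" if "h:Hom C c d" for h using that cc_obj[OF cc] cc_obj[OF d] by (rule hom_PiE)
ultimately show "EX! h. h:Hom C c d & (ALL i:Obj (poset_cat P r). Comp C (onObj F i) c d h (ii i) = kk i)"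
	unfolding Comp_eq by (simp add: poset_cat_def) metis
qed

text \<open>Two colimits of the same diagram are isomorphic, and the mutually inverse morphisms
  \<open>h\<close> and \<open>k\<close> transfer elements, identifications and relation
  instances.\<close>

lemma colimit_str_colimit:
assumes d: "is_colimit (poset_cat P r) C F d kk" and s: "str_colimit P r F c ii"
shows "str_colimit P r F d kk"
proof -
let ?P = "poset_cat P r"
have Pobj: "Obj ?P = P" by (simp add: poset_cat_def)
note c = str_colimit_colimit[OF s]
note cc = colimit_cocone[OF c] and cd = colimit_cocone[OF d]
note ob = cc_obj[OF cc] cc_obj[OF cd]
obtain h where h: "h:Hom C c d" "!!i. i:P ==> Comp C (onObj F i) c d h (ii i) = kk i" by (rule colimit_factor[OF c cd]) (auto simp: Pobj)
obtain k where k: "k:Hom C d c" "!!i. i:P ==> Comp C (onObj F i) d c k (kk i) = ii i" by (rule colimit_factor[OF d cc]) (auto simp: Pobj)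
have hk: "Comp C d c d h k = Idm C d" by (rule colimit_unique[OF d cd])
		(use h k ob in "auto simp: Pobj C_comp C_id C_assoc F_obj cc_hom[OF cd] C_idl")
have kh: "Comp C c d c k h = Idm C c" by (rule colimit_unique[OF c cc])
		(use h k ob in "auto simp: Pobj C_comp C_id C_assoc F_obj cc_hom[OF cc] C_idl")
have hk': "h (k a) = a" if "a:El d" for a using fun_cong[OF hk, of a] that by (simp add: Comp_eq Idm_eq compose_def)
have kh': "k (h a) = a" if "a:El c" for a using fun_cong[OF kh, of a] that by (simp add: Comp_eq Idm_eq compose_def)
have hi: "h (ii i a) = kk i a" if "i:P" "a:At i" for i a
	using fun_cong[OF h(2)[OF that(1)], of a] that(2) by (simp add: Comp_eq compose_def)
have ki: "k (kk i a) = ii i a" if "i:P" "a:At i" for i a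
	using fun_cong[OF k(2)[OF that(1)], of a] that(2) by (simp add: Comp_eq compose_def)
show ?thesis unfolding str_colimit_def
proof (intro conjI ballI impI cd)
	fix x assume x: "x:El d"
	obtain i a where "i:P" "a:At i" "k x = ii i a" using s hom_mem[OF k(1) ob(2,1) x] unfolding str_colimit_def by blast
	thus "EX i:P. EX a:At i. x = kk i a" using hi hk'[OF x] by metis
next
	fix i a b assume "i:P" "a:At i" "b:At i" "kk i a = kk i b"
	thus "EX j:P. (i, j):r & tr i j a = tr i j b" using s ki unfolding str_colimit_def by metis
next
	fix rh xs assume r: "rh:R" "xs:Rel d rh"
	obtain i ys where i: "i:P" "ys:Rel (onObj F i) rh" "map k xs = map (ii i) ys"
		using s hom_rel[OF k(1) ob(2,1) r] r(1) unfolding str_colimit_def by blast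
	have "xs = map h (map k xs)" using Rel_sub[OF ob(2) r] by (auto simp: hk' intro!: map_idI[symmetric])
	also have "... = map (kk i) ys" using Rel_sub[OF F_obj[OF i(1)] r(1) i(2)] i(1,3) hi by auto
	finally show "EX i:P. EX ys:Rel (onObj F i) rh. xs = map (kk i) ys" using i by blast
qed
qed

context
fixes c ii x assumes s: "str_colimit P r F c ii" and x: "x:Obj C" and card_x: "|El x| <=o |Lam|"
begin
lemma cc: "is_cocone (poset_cat P r) C F c ii" using s unfolding str_colimit_def by blast

lemma card_rel: "|Sigma R (Rel x)| <=o |Lam|"
proof (rule card_of_Sigma_ordLeq_infinite[OF inf_Lam R_Lam], intro ballI)
fix rh assume "rh:R"
hence "Rel x rh <= lists (El x)" using Rel_sub[OF x] by blast
hence "|Rel x rh| <=o |lists (El x)|" by (rule card_of_mono1)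
also have "|lists (El x)| <=o |lists Lam|" using card_x by (rule card_of_lists_mono)
also have "|lists Lam| =o |Lam|" using inf_Lam by (rule card_of_lists_infinite)
finally show "|Rel x rh| <=o |Lam|" .
qed

lemma bound_family:
assumes "|A| <=o |Lam|" "k:P" "!!a. a:A ==> f a:P"
shows "EX l:P. (k, l):r & (ALL a:A. (f a, l):r)"
proof -
obtain l where l: "l:P" "ALL a:A. (f a, l):r" using bound[of "f ` A"] assms(1,3) ordLeq_transitive[OF card_of_image assms(1)] by blast
obtain m where "m:P" "(k, m):r" "(l, m):r" using bound2[OF assms(2) l(1)] by blast
thus ?thesis using l r_trans by blast
qed

lemma eventually_equal:
assumes A: "|A| <=o |Lam|" and i: "i:P" and gh: "!!a. a:A ==> g a:At i" "!!a. a:A ==> h a:At i"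
	and eq: "!!a. a:A ==> ii i (g a) = ii i (h a)"
shows "EX j:P. (i, j):r & (ALL a:A. tr i j (g a) = tr i j (h a))"
proof -
have "ALL a:A. EX j:P. (i, j):r & tr i j (g a) = tr i j (h a)" using s i gh eq unfolding str_colimit_def by blast
then obtain f where f: "!!a. a:A ==> f a:P" "!!a. a:A ==> (i, f a):r" "!!a. a:A ==> tr i (f a) (g a) = tr i (f a) (h a)" by metis
obtain l where l: "l:P" "(i, l):r" "ALL a:A. (f a, l):r" using bound_family[OF A i, of f] f(1) by blast
have "tr i l (g a) = tr i l (h a)" if "a:A" for a using f[OF that] l that gh[OF that] i tr_comp[of i "f a" l] by metis
thus ?thesis using l by blast
qed

text \<open>\<open>x\<close> has at most \<open>|Lam|\<close> elements and at most
  \<open>|Lam|\<close> relation instances. By directedness one stage contains preimages of all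
  values of \<open>f\<close>, and at a later stage all the relation instances hold.\<close>

lemma hom_lift:
assumes f: "f:Hom C x c"
shows "EX i:P. EX g:Hom C x (onObj F i). Comp C x (onObj F i) c (ii i) g = f"
proof -
have fin: "|set xs| <=o |Lam|" for xs :: "'u list" using inf_Lam by (simp add: ordLess_imp_ordLeq)
have "ALL a:El x. EX i:P. EX b:At i. f a = ii i b" using s hom_mem[OF f x cc_obj[OF cc]] unfolding str_colimit_def by blast
then obtain ia ba where ia: "!!a. a:El x ==> ia a:P"
	and ba: "!!a. a:El x ==> ba a:At (ia a)" "!!a. a:El x ==> f a = ii (ia a) (ba a)" by metis
have "P ~= {}" using bound[of "{}"] by auto
then obtain k0 where "k0:P" by blast
from bound_family[OF card_x this, of ia] ia obtain k where k: "k:P" "!!a. a:El x ==> (ia a, k):r" by blast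
\<comment> \<open>So far this is a lift of functions; it may fail to preserve relations at stage
  \<open>k\<close>.\<close>
define g0 where "g0 a = tr (ia a) k (ba a)" for a
have g0: "g0 a:At k" "ii k (g0 a) = f a" if "a:El x" for a unfolding g0_def using that ia ba k cc_tr[OF cc] tr_mem by auto
have "EX l:P. (k, l):r & map (%a. tr k l (g0 a)) xs:Rel (onObj F l) rh" if r: "rh:R" "xs:Rel x rh" for rh xs
proof -
	note sub = Rel_sub[OF x r]
	obtain i ys where i: "i:P" "ys:Rel (onObj F i) rh" "map f xs = map (ii i) ys"
		using s hom_rel[OF f x cc_obj[OF cc] r] r(1) unfolding str_colimit_def by blast
	note suby = Rel_sub[OF F_obj[OF i(1)] r(1) i(2)]
	have len: "length ys = length xs" using i(3) map_eq_imp_length_eq by metis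
	obtain m where m: "m:P" "(k, m):r" "(i, m):r" using bound2[OF k(1) i(1)] by blast
	\<comment> \<open>The list of chosen preimages and the list that satisfies the relation at stage
	  \<open>i\<close> have the same image in \<open>c\<close>. Their finitely many entries are
	  identified at a later stage.\<close>
	have "EX l:P. (m, l):r & (ALL n:{..<length xs}. tr m l (tr k m (g0 (xs ! n))) = tr m l (tr i m (ys ! n)))"
	proof (rule eventually_equal[OF _ m(1)])
		show "|{..<length xs}| <=o |Lam|" using inf_Lam by (simp add: ordLess_imp_ordLeq)
		fix n assume "n:{..<length xs}"
		hence n: "xs ! n:El x" "ys ! n:At i" "n < length xs" using sub suby len by (auto dest: nth_mem)
		thus "tr k m (g0 (xs ! n)):At m" "tr i m (ys ! n):At m" using g0 k m i tr_mem by auto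
		have "f (xs ! n) = ii i (ys ! n)" using i(3) n(3) len by (metis nth_map)
		thus "ii m (tr k m (g0 (xs ! n))) = ii m (tr i m (ys ! n))" using n g0 k m i cc_tr[OF cc] by simp
	qed
	then obtain l where l: "l:P" "(m, l):r" "!!n. n < length xs ==> tr m l (tr k m (g0 (xs ! n))) = tr m l (tr i m (ys ! n))" by auto
	have "map (%a. tr k l (g0 a)) xs = map (tr i l) ys"
	proof (rule nth_equalityI)
		fix n assume "n < length (map (%a. tr k l (g0 a)) xs)"
		hence n: "n < length xs" "xs ! n:El x" "ys ! n:At i" using sub suby len by (auto dest: nth_mem)
		have "tr k l (g0 (xs ! n)) = tr m l (tr k m (g0 (xs ! n)))" using tr_comp[of k m l] n g0 k m l by simp
		also have "... = tr i l (ys ! n)" using l(3)[OF n(1)] tr_comp[of i m l] n i m l by simp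
		finally show "map (%a. tr k l (g0 a)) xs ! n = map (tr i l) ys ! n" using n len by simp
	qed (simp add: len)
	moreover have "(k, l):r" "(i, l):r" using m l r_trans by blast+
	ultimately show ?thesis using tr_rel[OF i(1) l(1) _ r(1) i(2)] l(1) by auto
qed
\<comment> \<open>By \<open>card_rel\<close> the stages obtained for the individual relation
  instances have a common upper bound.\<close>
hence "ALL q:Sigma R (Rel x). EX l:P. (k, l):r & map (%a. tr k l (g0 a)) (snd q):Rel (onObj F l) (fst q)" by auto
then obtain st where st: "!!q. q:Sigma R (Rel x) ==> st q:P" "!!q. q:Sigma R (Rel x) ==> (k, st q):r"
	"!!q. q:Sigma R (Rel x) ==> map (%a. tr k (st q) (g0 a)) (snd q):Rel (onObj F (st q)) (fst q)" by metis
obtain l where l: "l:P" "(k, l):r" "!!q. q:Sigma R (Rel x) ==> (st q, l):r" using bound_family[OF card_rel k(1), of st] st(1) by blast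
define g where "g = (\<lambda>a\<in>El x. tr k l (g0 a))"
have "map g xs:Rel (onObj F l) rh" if r: "rh:R" "xs:Rel x rh" for rh xs
proof -
	have q: "(rh, xs):Sigma R (Rel x)" using r by simp
	have "map g xs = map (tr (st (rh, xs)) l) (map (%a. tr k (st (rh, xs)) (g0 a)) xs)"
		using Rel_sub[OF x r] st(1,2)[OF q] l(1) l(3)[OF q] k(1) g0 tr_comp by (auto simp: g_def)
	thus ?thesis using tr_rel[OF st(1)[OF q] l(1) l(3)[OF q] r(1)] st(3)[OF q] by (simp del: map_map map_eq_conv)
qed
hence g: "g:Hom C x (onObj F l)" unfolding Hom_eq[OF x F_obj[OF l(1)]] using l k g0 tr_mem by (auto simp: g_def)
have "Comp C x (onObj F l) c (ii l) g = f"
proof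
	fix a show "Comp C x (onObj F l) c (ii l) g a = f a" using hom_PiE[OF f x cc_obj[OF cc]] l k g0 cc_tr[OF cc]
		by (cases "a:El x") (auto simp: Comp_eq compose_def g_def PiE_iff extensional_def)
qed
thus ?thesis using l(1) g by blast
qed

lemma hom_eventually_equal:
assumes i: "i:P" and gh: "g:Hom C x (onObj F i)" "h:Hom C x (onObj F i)"
	and eq: "Comp C x (onObj F i) c (ii i) g = Comp C x (onObj F i) c (ii i) h"
shows "EX j:P. (i, j):r &
	Comp C x (onObj F i) (onObj F j) (tr i j) g = Comp C x (onObj F i) (onObj F j) (tr i j) h"
proof -
have "ii i (g a) = ii i (h a)" if "a:El x" for a using fun_cong[OF eq, of a] that by (simp add: Comp_eq compose_def)
then obtain j where "j:P" "(i, j):r" "ALL a:El x. tr i j (g a) = tr i j (h a)"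
	using eventually_equal[OF card_x i, of g h] hom_mem gh x F_obj[OF i] by blast
thus ?thesis by (auto simp: Comp_eq compose_def fun_eq_iff intro!: bexI[of _ j])
qed
end

end
end

section \<open>Presentable generators and the equivalence of completeness and cocompleteness\<close>

locale relational_accessible = relational ty C El Rel R Lam
for ty :: "'u itself" and C :: "('o, 'u => 'u) cat" and El Rel and R :: "'r set" and Lam +
assumes directed: "[|directed_poset kap P r; is_functor (poset_cat P r) C F|]
	==> EX c ii. str_colimit P r F c ii"
begin
text \<open>For the diagram of hom sets, \<open>hom_lift\<close> is the surjectivity and
  \<open>hom_eventually_equal\<close> the injectivity condition of
  \<open>set_directed_colimit\<close>.\<close>

lemma presentable_if_small:
assumes x: "x:Obj C" and card_x: "|El x| <=o |Lam|"
shows "presentable kap C x"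
unfolding presentable_def preserves_directed_colimits_def
proof (intro conjI x allI impI, elim conjE)
fix P r F c ii
assume P: "directed_poset kap P r" and F: "is_functor (poset_cat P r) C F" and cl: "is_colimit (poset_cat P r) C F c ii"
obtain c' ii' where "str_colimit P r F c' ii'" using directed[OF P F] by blast
from colimit_str_colimit[OF F P cl this] have s: "str_colimit P r F c ii" .
have cc: "is_cocone (poset_cat P r) C F c ii" using s unfolding str_colimit_def by blast
note cc_obj = cc_obj[OF F P] and F_obj = F_obj[OF F P] and cc_hom = cc_hom[OF F P] and F_hom = F_hom[OF F P]
note ob = cc_obj[OF cc] F_obj
note lift = hom_lift[OF F P s x card_x] and eq = hom_eventually_equal[OF F P s x card_x]
let ?G = "hom_functor TYPE('u) C x"
let ?A = "%i. Inl ` Hom C x (onObj F i) :: (('u => 'u) + 'u) set"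
let ?t = "%i j. onHom ?G (onObj F i) (onObj F j) (onHom F i j ())"
let ?l = "%i. onHom ?G (onObj F i) c (ii i)"
have coconeI: "Comp C (onObj F i) (onObj F j) c (ii j) (onHom F i j ()) = ii i" if "i:P" "j:P" "(i, j):r" for i j
	using cc that unfolding is_cocone_def by (simp add: poset_cat_def)
have smH: "small TYPE('u) (Hom C x y)" if "y:Obj C" for y using locally_small_C x that unfolding locally_small_def by blast
have la: "?l i:?A i \<rightarrow>\<^sub>E Inl ` Hom C x c" if "i:P" for i
	using C_comp[OF _ cc_hom[OF cc that] x] that ob by (auto simp: hom_functor_def)
have ta: "?t i j a:?A j" if "i:P" "j:P" "(i, j):r" "a:?A i" for i j a
	using C_comp[OF _ F_hom[OF that(1-3)] x] that ob by (auto simp: hom_functor_def)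
have lt: "?l j (?t i j a) = ?l i a" if "i:P" "j:P" "(i, j):r" "a:?A i" for i j a using ta[OF that] that ob coconeI[OF that(1-3)]
		C_assoc[OF _ F_hom[OF that(1-3)] cc_hom[OF cc that(2)] x, symmetric] by (auto simp: hom_functor_def)
have onG: "onObj (comp_func ?G F) i = ?A i" "onHom (comp_func ?G F) i j f = ?t i j" for i j f
	by (simp_all add: comp_func_def hom_functor_def)
have onGc: "onObj ?G c = Inl ` Hom C x c" by (simp add: hom_functor_def)
have sc: "Obj (set_cat TYPE('u)) = {A. small TYPE('u) A}" "Hom (set_cat TYPE('u)) = (%A B. A \<rightarrow>\<^sub>E B)"
	"Comp (set_cat TYPE('u)) = (%A _ _ g f. compose A g f)" by (simp_all add: set_cat_def)
have pc: "Obj (poset_cat P r) = P" "Hom (poset_cat P r) i j = (if (i, j):r then UNIV else {})" for i j by (simp_all add: poset_cat_def)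
show "is_colimit (poset_cat P r) (set_cat TYPE('u)) (comp_func ?G F) (onObj ?G c) ?l" unfolding is_colimit_def
proof (intro conjI allI impI)
	show "is_cocone (poset_cat P r) (set_cat TYPE('u)) (comp_func ?G F) (onObj ?G c) ?l" unfolding is_cocone_def onG onGc sc pc
	proof (intro conjI ballI la)
		show "Inl ` Hom C x c:{A. small TYPE('u) A}" using smH ob small_image by blast
		fix i j f assume ij: "i:P" "j:P" "f:(if (i, j):r then UNIV else {})"
		hence r: "(i, j):r" by (auto split: if_splits)
		show "compose (?A i) (?l j) (?t i j) = ?l i"
		proof
			fix a show "compose (?A i) (?l j) (?t i j) a = ?l i a" using lt[OF ij(1,2) r, of a] la[OF ij(1)]
				by (cases "a:?A i") (auto simp: compose_def PiE_iff extensional_def)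
		qed
	qed
	fix D kk assume D: "is_cocone (poset_cat P r) (set_cat TYPE('u)) (comp_func ?G F) D kk"
	have ka: "kk i:?A i \<rightarrow>\<^sub>E D" if "i:P" for i using D that unfolding is_cocone_def onG sc pc by blast
	have kt: "kk j (?t i j a) = kk i a" if "i:P" "j:P" "(i, j):r" "a:?A i" for i j a
	proof -
		have "compose (?A i) (kk j) (?t i j) = kk i" using D that(1-3) unfolding is_cocone_def onG sc pc by simp
		hence "compose (?A i) (kk j) (?t i j) a = kk i a" by simp
		thus ?thesis using that(4) by (simp add: compose_def)
	qed
	have "EX! h. h:Inl ` Hom C x c \<rightarrow>\<^sub>E D & (ALL i:P. compose (?A i) h (?l i) = kk i)"
	proof (rule set_directed_colimit[where t = ?t and r = r, OF la ka ta lt kt bound2[OF F P]])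
		fix f assume "f:(Inl ` Hom C x c :: (('u => 'u) + 'u) set)"
		then obtain f' where f': "f = Inl f'" "f':Hom C x c" by blast
		from lift[OF f'(2)] obtain i g where "i:P" "g:Hom C x (onObj F i)" "Comp C x (onObj F i) c (ii i) g = f'" by blast
		thus "EX i:P. EX a:?A i. f = ?l i a" by (auto simp: hom_functor_def f')
	next
		fix i a b assume i: "i:P" and ab: "a:?A i" "b:?A i" "?l i a = ?l i b"
		from ab(1,2) obtain g h where gh: "a = Inl g" "g:Hom C x (onObj F i)" "b = Inl h" "h:Hom C x (onObj F i)" by blast
		have "Comp C x (onObj F i) c (ii i) g = Comp C x (onObj F i) c (ii i) h" using ab(3) gh by (simp add: hom_functor_def)
		from eq[OF i gh(2,4) this] show "EX j:P. (i, j):r & ?t i j a = ?t i j b" using gh by (auto simp: hom_functor_def)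
	qed
	thus "EX! h. h:Hom (set_cat TYPE('u)) (onObj ?G c) D &
			(ALL i:Obj (poset_cat P r). Comp (set_cat TYPE('u)) (onObj (comp_func ?G F) i) (onObj ?G c) D h (?l i) = kk i)"
		unfolding onG onGc sc pc .
qed
qed

text \<open>One object for each carrier inside \<open>N\<close> and each system of relations on it.
  Distinct objects may share these data, for instance when operations differ off the carrier, so a
  small set is obtained only after choosing representatives.\<close>

definition rep :: "'u set => 'o set" where
"rep N = (%k. SOME x. x:Obj C & El x <= N & (El x, {(rh, xs). rh:R & xs:Rel x rh}) = k) `
	(%x. (El x, {(rh, xs). rh:R & xs:Rel x rh})) ` {x:Obj C. El x <= N}"

lemma rep:
assumes "x:Obj C" "El x <= N"
obtains s where "s:rep N" "El s = El x" "!!rh. rh:R ==> Rel s rh = Rel x rh"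
proof -
let ?k = "%x. (El x, {(rh, xs). rh:R & xs:Rel x rh})"
let ?s = "SOME y. y:Obj C & El y <= N & ?k y = ?k x"
have "?s:Obj C & El ?s <= N & ?k ?s = ?k x" by (rule someI[of _ x]) (use assms in simp)
moreover have "?s:rep N" unfolding rep_def using assms by blast
ultimately show thesis by (intro that[of ?s]) auto
qed

lemma rep_obj: assumes "s:rep N" shows "s:Obj C & El s <= N"
proof -
let ?k = "%x. (El x, {(rh, xs). rh:R & xs:Rel x rh})"
from assms obtain x where "x:Obj C" "El x <= N" "s = (SOME y. y:Obj C & El y <= N & ?k y = ?k x)"
	unfolding rep_def image_image by (elim imageE CollectE conjE) (rule that, assumption+)
thus ?thesis using someI[of "%y. y:Obj C & El y <= N & ?k y = ?k x" x] by simp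
qed

lemma small_rep: assumes N: "small TYPE('u) N" shows "small TYPE('u) (rep N)"
unfolding rep_def
proof (rule small_image, rule small_subset)
have "small TYPE('u) R" using small_le[OF R_Lam small_Lam] .
thus "small TYPE('u) (Pow N \<times> Pow (R \<times> lists N))" by (intro small_Sigma small_Pow small_lists N)
show "(%x. (El x, {(rh, xs). rh:R & xs:Rel x rh})) ` {x:Obj C. El x <= N} <= Pow N \<times> Pow (R \<times> lists N)" using Rel_sub by blast
qed

text \<open>Reflection of relations makes \<open>s\<close> an induced substructure of
  \<open>x\<close>; therefore morphisms into \<open>x\<close> whose image lies in that of
  \<open>e\<close> factor through \<open>s\<close> (\<open>embedding_factor\<close>).\<close>

definition embedding :: "'o => 'o => ('u => 'u) => bool" where
"embedding s x e <-> e:Hom C s x & inj_on e (El s) & (ALL rh:R. ALL xs:lists (El s). map e xs:Rel x rh --> xs:Rel s rh)"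

text \<open>A hull of \<open>A\<close> is no larger than \<open>N\<close>; it is renamed to a subset
  of \<open>N\<close> and then replaced by its representative.\<close>

lemma embedding_rep:
assumes x: "x:Obj C" and A: "A <= El x" "|A| <=o |N :: 'u set|" "|Lam| <=o |N|"
obtains s e where "s:rep N" "embedding s x e" "A <= e ` El s"
proof -
obtain y where y: "y:Obj C" "A <= El y" "El y <= El x" "|El y| <=o |N|" "!!rh. rh:R ==> Rel y rh = Rel x rh Int lists (El y)"
	using skolem_hull[OF x A] by blast
obtain b where b: "inj_on b (El y)" "b ` El y <= N" using y(4) card_of_ordLeq[of "El y" N] by blast
from transport[OF y(1) b(1)] obtain z where z: "z:Obj C" "El z = b ` El y"
	and zr: "ALL rh:R. Rel z rh = map b ` Rel y rh" by (elim bexE conjE)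
obtain s where s: "s:rep N" "El s = El z" "!!rh. rh:R ==> Rel s rh = Rel z rh" using rep[OF z(1)] b(2) z(2) by metis
define e where "e = restrict (inv_into (El y) b) (El s)"
have sy: "El s = b ` El y" using s z by simp
have eb: "e (b a) = a" if "a:El y" for a unfolding e_def sy using that b(1) by simp
have emap: "map e (map b xs) = xs" if "set xs <= El y" for xs using eb that unfolding map_map by (intro map_idI) auto
have im: "e ` El s = El y" using eb unfolding sy by (auto simp: image_iff)
have rel: "Rel s rh = map b ` Rel y rh" if "rh:R" for rh using s(3) zr that by simp
have "e:Hom C s x" unfolding Hom_eq[OF conjunct1[OF rep_obj[OF s(1)]] x]
proof (intro CollectI conjI ballI)
	show "e:El s \<rightarrow>\<^sub>E El x" using im y(3) by (auto simp: e_def)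
	fix rh xs assume r: "rh:R" "xs:Rel s rh"
	then obtain ys where ys: "ys:Rel y rh" "xs = map b ys" using rel by blast
	have "set ys <= El y" using Rel_sub[OF y(1) r(1) ys(1)] .
	thus "map e xs:Rel x rh" using emap ys y(5)[OF r(1)] by (simp del: map_map)
qed
moreover have "inj_on e (El s)" unfolding sy by (rule inj_onI) (auto simp: eb)
moreover have "xs:Rel s rh" if "rh:R" "xs:lists (El s)" "map e xs:Rel x rh" for rh xs
proof -
	have "map e xs:map e ` lists (El s)" using that(2) by (rule imageI)
	hence "map e xs:lists (El y)" using im lists_image[of e "El s"] by simp
	hence "map e xs:Rel y rh" using that y(5) by blast
	moreover have "map b (map e xs) = xs" using that(2) eb unfolding sy by (auto intro!: map_idI)
	ultimately show ?thesis using rel[OF that(1)] by (metis image_eqI)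
qed
ultimately have "embedding s x e" unfolding embedding_def by blast
with s(1) show thesis using that im y(2) by blast
qed

lemma embedding_factor:
assumes e: "embedding s x e" and ob: "s:Obj C" "x:Obj C" "y:Obj C"
	and f: "f:Hom C y x" "f ` El y <= e ` El s" defines "g == \<lambda>a\<in>El y. inv_into (El s) e (f a)"
shows "g:Hom C y s" "Comp C y s x e g = f"
proof -
have g: "g a:El s" "e (g a) = f a" if "a:El y" for a
proof -
	have "f a:e ` El s" using f(2) that by blast
	thus "g a:El s" "e (g a) = f a" unfolding g_def using that by (simp_all add: inv_into_into f_inv_into_f)
qed
show "g:Hom C y s" unfolding Hom_eq[OF ob(3,1)]
proof (intro CollectI conjI ballI)
	show "g:El y \<rightarrow>\<^sub>E El s" using g by (auto simp: g_def)
	fix rh xs assume r: "rh:R" "xs:Rel y rh"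
	have sub: "set xs <= El y" using Rel_sub[OF ob(3) r] .
	have "map e (map g xs) = map f xs" using sub g by auto
	hence "map e (map g xs):Rel x rh" using hom_rel[OF f(1) ob(3,2) r] by (simp only:)
	moreover have "map g xs:lists (El s)" using sub g(1) by (auto simp: subset_iff)
	ultimately show "map g xs:Rel s rh" using e r(1) unfolding embedding_def by blast
qed
show "Comp C y s x e g = f"
proof
	fix a show "Comp C y s x e g a = f a" using g hom_PiE[OF f(1) ob(3,2)]
		by (cases "a:El y") (auto simp: Comp_eq compose_def PiE_iff extensional_def)
qed
qed

lemma embedding_mono:
assumes e: "embedding s x e" and ob: "s:Obj C" "x:Obj C" "y:Obj C"
	and f: "f:Hom C y s" "g:Hom C y s" "Comp C y s x e f = Comp C y s x e g"
shows "f = g"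
proof
fix a show "f a = g a"
proof (cases "a:El y")
	case True
	hence "e (f a) = e (g a)" using fun_cong[OF f(3), of a] by (simp add: Comp_eq compose_def)
	thus ?thesis using e hom_mem[OF f(1) ob(3,1) True] hom_mem[OF f(2) ob(3,1) True] unfolding embedding_def by (metis inj_onD)
qed (use hom_PiE[OF f(1) ob(3,1)] hom_PiE[OF f(2) ob(3,1)] in "auto simp: PiE_iff extensional_def")
qed

text \<open>\<open>x\<close> is the directed union of the images of all embeddings of structures
  from \<open>rep Lam\<close>. The union is directed because \<open>|Lam|\<close> many sets of size
  at most \<open>|Lam|\<close> lie in one hull of that size.\<close>

lemma generation:
assumes x: "x:Obj C"
shows "EX P r F ii. directed_poset kap P r & is_functor (poset_cat P r) C F &
	(ALL i:P. onObj F i:rep Lam) & is_colimit (poset_cat P r) C F x ii"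
proof -
\<comment> \<open>Stages are images rather than embeddings, so that inclusion is antisymmetric. The
  injection \<open>enc\<close> codes them in \<open>'u\<close>, where \<open>directed_poset\<close>
  expects its elements.\<close>
define Q where "Q = {B. EX s:rep Lam. EX e. embedding s x e & B = e ` El s}"
have Qsub: "B <= El x" if "B:Q" for B using that rep_obj x hom_mem unfolding Q_def embedding_def by blast
have "small TYPE('u) Q" by (rule small_subset[OF small_Pow[OF small_El[OF x]]]) (use Qsub in auto)
from small_embed[OF this] obtain enc :: "'u set => 'u" where enc: "inj_on enc Q" ..
define d where "d = inv_into Q enc"
have d [simp]: "d (enc B) = B" if "B:Q" for B unfolding d_def using enc that by simp
have "ALL B:Q. EX s e. s:rep Lam & embedding s x e & B = e ` El s" unfolding Q_def by blast
then obtain sB eB where se: "!!B. B:Q ==> sB B:rep Lam" "!!B. B:Q ==> embedding (sB B) x (eB B)"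
	"!!B. B:Q ==> eB B ` El (sB B) = B" by metis
define P where "P = enc ` Q"
define r where "r = {(enc B, enc B') | B B'. B:Q & B':Q & B <= B'}"
define s where "s i = sB (d i)" for i
define e where "e i = eB (d i)" for i
have dQ: "d i:Q" if "i:P" for i using that unfolding P_def by auto
have so: "s i:Obj C" "s i:rep Lam" and em: "embedding (s i) x (e i)" and im: "e i ` El (s i) = d i" if "i:P" for i
	using se dQ[OF that] rep_obj[of "sB (d i)" Lam] unfolding s_def e_def by auto
have eh: "e i:Hom C (s i) x" if "i:P" for i using em[OF that] unfolding embedding_def by blast
have rP: "i:P" "j:P" "d i <= d j" if "(i, j):r" for i j using that unfolding r_def P_def by auto
have rI: "(i, j):r" if "i:P" "j:P" "d i <= d j" for i j using that unfolding r_def P_def by auto blast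
define F where "F = (|onObj = s, onHom = (%i j (_ :: unit). \<lambda>a\<in>El (s i). inv_into (El (s j)) (e j) (e i a))|)"
have tr: "onHom F i j u:Hom C (s i) (s j)" "Comp C (s i) (s j) x (e j) (onHom F i j u) = e i" if "(i, j):r" for i j u
	using embedding_factor[OF em[OF rP(2)] so(1)[OF rP(2)] x so(1)[OF rP(1)] eh[OF rP(1)], OF that that that that]
		im[OF rP(1)[OF that]] im[OF rP(2)[OF that]] rP(3)[OF that] by (simp_all add: F_def)
have pc: "Obj (poset_cat P r) = P" "Hom (poset_cat P r) i j = (if (i, j):r then UNIV else {})" for i j by (simp_all add: poset_cat_def)
have rr: "(i, i):r" if "i:P" for i using rI that by blast
have rt: "(i, k):r" if "(i, j):r" "(j, k):r" for i j k using rI[OF rP(1)[OF that(1)] rP(2)[OF that(2)]] rP(3) that by blast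
have F: "is_functor (poset_cat P r) C F" unfolding is_functor_def pc
proof (intro conjI ballI)
	show "onObj F i:Obj C" if "i:P" for i using so(1) that by (simp add: F_def)
	show "onHom F i j f:Hom C (onObj F i) (onObj F j)" if "i:P" "j:P" "f:(if (i, j):r then UNIV else {})" for i j f
		using that tr(1)[of i j] by (auto simp: F_def split: if_splits)
	show "onHom F i i (Idm (poset_cat P r) i) = Idm C (onObj F i)" if i: "i:P" for i
	proof -
		have "onHom F i i () = Idm C (s i)" by (rule embedding_mono[OF em[OF i] so(1)[OF i] x so(1)[OF i]])
				(use tr[OF rr[OF i]] so(1)[OF i] x eh[OF i] in "auto simp: C_id C_idr")
		thus ?thesis by (simp add: F_def)
	qed
	fix i j k and f g :: unit assume i: "i:P" "j:P" "k:P" "f:(if (i, j):r then UNIV else {})" "g:(if (j, k):r then UNIV else {})"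
	hence r: "(i, j):r" "(j, k):r" by (auto split: if_splits)
	have "onHom F i k () = Comp C (s i) (s j) (s k) (onHom F j k ()) (onHom F i j ())"
		by (rule embedding_mono[OF em[OF i(3)] so(1)[OF i(3)] x so(1)[OF i(1)]])
			(use tr r rt[OF r] so(1) i x eh in "simp_all add: C_comp C_assoc[symmetric]")
	thus "onHom F i k (Comp (poset_cat P r) i j k g f) = Comp C (onObj F i) (onObj F j) (onObj F k) (onHom F j k g) (onHom F i j f)"
		by (simp add: F_def)
qed
have hull: "EX i:P. A <= d i" if "A <= El x" "|A| <=o |Lam|" for A
proof -
	have "|Lam| <=o |Lam|" by simp
	from embedding_rep[OF x that this] obtain s e where "s:rep Lam" "embedding s x e" "A <= e ` El s" .
	hence "e ` El s:Q" "A <= e ` El s" unfolding Q_def by blast+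
	thus ?thesis unfolding P_def by (metis d imageI)
qed
have P: "directed_poset kap P r" unfolding directed_poset_def kap(3)
proof (intro conjI allI impI)
	show "small TYPE('u) P" unfolding P_def using \<open>small TYPE('u) Q\<close> by (rule small_image)
	have "inj_on d P" unfolding P_def by (rule inj_onI) auto
	hence "i = j" if "(i, j):r" "(j, i):r" for i j using rP[OF that(1)] rP[OF that(2)] by (metis inj_onD subset_antisym)
	moreover have "r <= P \<times> P" using rP by auto
	moreover have "trans r" using rt by (rule transI)
	ultimately show "partial_order_on P r" using rr unfolding partial_order_on_def preorder_on_def refl_on_def antisym_def by blast
	fix A assume A: "A <= P" "|A| <=o |Lam|"
	have "|d i| <=o |Lam|" if "i:A" for i
	proof -
		have i: "i:P" using that A by blast
		have "|d i| <=o |El (s i)|" using card_of_image[of "e i" "El (s i)"] im[OF i] by simp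
		also have "|El (s i)| <=o |Lam|" using rep_obj[OF so(2)[OF i]] by (simp add: card_of_mono1)
		finally show ?thesis .
	qed
	hence "|\<Union>i\<in>A. d i| <=o |Lam|" by (intro card_of_UNION_ordLeq_infinite inf_Lam A(2)) blast
	moreover have "(\<Union>i\<in>A. d i) <= El x" using dQ Qsub A(1) by blast
	ultimately obtain j where "j:P" "(\<Union>i\<in>A. d i) <= d j" using hull by blast
	thus "EX b:P. ALL a:A. (a, b):r" using A(1) by (intro bexI[of _ j]) (auto intro!: rI)
qed
have fin: "EX i:P. set xs <= d i" if "set xs <= El x" for xs using hull[OF that] inf_Lam by (simp add: ordLess_imp_ordLeq)
have "str_colimit P r F x e" unfolding str_colimit_def
proof (intro conjI ballI impI)
	show "is_cocone (poset_cat P r) C F x e" unfolding is_cocone_def pc using x eh tr(2) by (auto simp: F_def split: if_splits)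
	show "EX i:P. EX a:El (onObj F i). y = e i a" if "y:El x" for y using fin[of "[y]"] that im by (fastforce simp: F_def)
	\<comment> \<open>Embeddings are injective, so identifications are already visible at stage
	  \<open>i\<close> itself.\<close>
	show "EX j:P. (i, j):r & onHom F i j () a = onHom F i j () b" if "i:P" "a:El (onObj F i)" "b:El (onObj F i)" "e i a = e i b" for i a b
		using that em[OF that(1)] rr[OF that(1)] by (intro bexI[of _ i]) (auto simp: F_def embedding_def dest: inj_onD)
	fix rh xs assume r: "rh:R" "xs:Rel x rh"
	obtain i where i: "i:P" "set xs <= d i" using fin Rel_sub[OF x r] by blast
	hence "xs:map (e i) ` lists (El (s i))" using im[OF i(1)] lists_image[of "e i" "El (s i)"] by auto
	then obtain ys where ys: "set ys <= El (s i)" "xs = map (e i) ys" by auto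
	hence "ys:Rel (s i) rh" using em[OF i(1)] r unfolding embedding_def by auto
	thus "EX i:P. EX ys:Rel (onObj F i) rh. xs = map (e i) ys" using i(1) ys(2) by (auto simp: F_def)
qed
from str_colimit_colimit[OF F P this] show ?thesis
	using P F so(2) by (intro exI[of _ P] exI[of _ r] exI[of _ F] exI[of _ e]) (simp add: F_def)
qed

lemma presentable_generators: "has_presentable_generators kap C"
unfolding has_presentable_generators_def
proof (rule exI[of _ "rep Lam"], intro conjI ballI)
show "small TYPE('u) (rep Lam)" by (rule small_rep[OF small_Lam])
show "presentable kap C s" if "s:rep Lam" for s using rep_obj[OF that] by (intro presentable_if_small) (auto simp: card_of_mono1)
qed (rule generation)

lemma has_directed_colimits: "has_directed_colimits kap C"
unfolding has_directed_colimits_def using directed str_colimit_colimit by blast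

lemma accessible: "accessible TYPE('u) C"
unfolding accessible_def using category_C locally_small_C kap(2) has_directed_colimits presentable_generators by blast

text \<open>Local smallness and presentable generators are available for every category in this
  locale, so cocompleteness is all that is left of local presentability.\<close>

lemma locally_presentable_iff: "locally_presentable TYPE('u) C <-> cocomplete_category TYPE('u) C"
unfolding locally_presentable_def using category_C locally_small_C kap(2) presentable_generators by blast

lemma complete_if_C: "cocomplete_category TYPE('u) C ==> complete_category TYPE('u) C"
proof (rule complete_if_cocomplete[OF _ category_C locally_small_C])
show "gen_by C (rep Lam)" unfolding gen_by_def using small_rep[OF small_Lam] rep_obj generation by blast
qed

text \<open>A solution set argument: every cocone on \<open>D\<close> factors through a hull of the
  union of the images of its legs. The size of this hull is bounded in terms of \<open>D\<close>
  alone, so the cocones with vertex in \<open>rep N\<close> are weakly initial.\<close>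

lemma cocomplete_if_C:
assumes "complete_category TYPE('u) C" shows "cocomplete_category TYPE('u) C"
unfolding cocomplete_category_def
proof (intro allI impI, elim conjE)
fix J :: "('u, 'u) cat" and D assume J: "small_category J" and D: "is_functor J C D"
note Dobj = functor_obj[OF D] and Dhom = functor_hom[OF D]
have smJ: "small TYPE('u) (Obj J)" and catJ: "category J" using J unfolding small_category_def by auto
\<comment> \<open>The union of the images of the legs is a quotient of the disjoint union of the
  carriers. Adding \<open>Lam\<close> makes \<open>N\<close> large enough for
  \<open>skolem_hull\<close>.\<close>
define Z where "Z = (SIGMA i:Obj J. El (onObj D i))"
have smZ: "small TYPE('u) (Z <+> Lam)" unfolding Z_def Plus_def by (intro small_Un small_image small_Sigma smJ small_Lam small_El Dobj)
from small_embed[OF smZ] obtain n :: "('u * 'u) + 'u => 'u" where n: "inj_on n (Z <+> Lam)" ..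
define N where "N = n ` (Z <+> Lam)"
have NZ: "|Z <+> Lam| <=o |N|" unfolding N_def using n card_of_ordLeq by blast
have smN: "small TYPE('u) N" unfolding N_def by (rule small_image[OF smZ])
have LN: "|Lam| <=o |N|" using card_of_Plus2 NZ by (rule ordLeq_transitive)
have ZN: "|Z| <=o |N|" using card_of_Plus1 NZ by (rule ordLeq_transitive)
define W where "W = {w:(SIGMA s:rep N. \<Pi>\<^sub>E i\<in>Obj J. Hom C (onObj D i) s). is_cocone J C D (fst w) (snd w)}"
show "EX c ii. is_colimit J C D c ii"
proof (rule colimit_if_weakly_initial[OF assms category_C locally_small_C D catJ])
	show "small TYPE('u) W"
	proof (rule small_subset)
		show "small TYPE('u) (SIGMA s:rep N. \<Pi>\<^sub>E i\<in>Obj J. Hom C (onObj D i) s)"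
			using locally_small_C rep_obj Dobj unfolding locally_small_def by (intro small_Sigma small_rep smN small_PiE smJ) blast
	qed (auto simp: W_def)
	show "is_cocone J C D (fst w) (snd w)" if "w:W" for w using that unfolding W_def by blast
	fix x kk assume x: "is_cocone J C D x kk"
	hence xo: "x:Obj C" and k: "!!i. i:Obj J ==> kk i:Hom C (onObj D i) x" and kc: "!!i j f. [|i:Obj J; j:Obj J; f:Hom J i j|] ==>
			Comp C (onObj D i) (onObj D j) x (kk j) (onHom D i j f) = kk i" unfolding is_cocone_def by blast+
	define A where "A = (%(i, a). kk i a) ` Z"
	have "A <= El x" unfolding A_def Z_def using hom_mem[OF k Dobj xo] by auto
	moreover have "|A| <=o |N|" unfolding A_def using card_of_image ZN by (rule ordLeq_transitive)
	ultimately obtain s e where s: "s:rep N" and e: "embedding s x e" and Ae: "A <= e ` El s" using embedding_rep[OF xo _ _ LN] by metis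
	have so: "s:Obj C" using rep_obj[OF s] by blast
	have eh: "e:Hom C s x" using e unfolding embedding_def by blast
	define g where "g = (\<lambda>i\<in>Obj J. \<lambda>a\<in>El (onObj D i). inv_into (El s) e (kk i a))"
	have g: "g i:Hom C (onObj D i) s" "Comp C (onObj D i) s x e (g i) = kk i" if "i:Obj J" for i
	proof -
		have "kk i ` El (onObj D i) <= e ` El s" using Ae that unfolding A_def Z_def by auto
		from embedding_factor[OF e so xo Dobj[OF that] k[OF that] this]
		show "g i:Hom C (onObj D i) s" "Comp C (onObj D i) s x e (g i) = kk i" using that by (simp_all add: g_def)
	qed
	have "is_cocone J C D s g" unfolding is_cocone_def
	proof (intro conjI ballI so g(1))
		fix i j f assume ij: "i:Obj J" "j:Obj J" "f:Hom J i j"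
		show "Comp C (onObj D i) (onObj D j) s (g j) (onHom D i j f) = g i" by (rule embedding_mono[OF e so xo Dobj[OF ij(1)]])
				(use ij g kc Dobj Dhom so xo eh in "simp_all add: C_comp C_assoc[symmetric]")
	qed
	hence "(s, g):W" unfolding W_def using s g(1) by (auto simp: g_def)
	thus "EX w:W. EX h:Hom C (fst w) x. ALL i:Obj J. Comp C (onObj D i) (fst w) x h (snd w i) = kk i"
		using eh g(2) by (intro bexI[of _ "(s, g)"] bexI[of _ e]) auto
qed
qed
end

section \<open>Linear algebra\<close>

definition bilinear_maps ::
"('k, 'r) ring_scheme => ('k, 'a, 'c) module_scheme => ('k, 'b, 'd) module_scheme => ('k, 'z, 'e) module_scheme => ('a => 'b => 'z) set"
where "bilinear_maps K V W Z = {be. (ALL v:carrier V. be v:linear_maps K W Z) & (ALL w:carrier W. (%v. be v w):linear_maps K V Z)}"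

text \<open>Sums over lists rather than over finite sets: expansions of tensors may repeat a pure
  tensor, and such sums are handled by induction on the list.\<close>

definition lsum :: "('a, 'm) ring_scheme => ('p => 'a) => 'p list => 'a" where
"lsum Z f xs = foldr (%x s. f x +.$Z s) xs \<zero>$Z"

lemma lsum_simps [simp]: "lsum Z f [] = \<zero>$Z" "lsum Z f (x # xs) = f x +.$Z lsum Z f xs"
by (simp_all add: lsum_def)

lemma lsum_cong: "[|xs = ys; !!x. x:set ys ==> f x = g x|] ==> lsum Z f xs = lsum Z g ys"
unfolding lsum_def by (auto intro: foldr_cong)

lemma lsum_map: "lsum Z f (map g xs) = lsum Z (%x. f (g x)) xs"
by (induction xs) auto

locale linear_algebra =
fixes K :: "'k ring"
assumes K: "field K"
begin
abbreviation "Vec V == module K V"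
abbreviation "Lin == linear_maps K"
abbreviation "BaseC == base_coalgebra K"
abbreviation "Cmaps == coalgebra_maps K"
abbreviation "Free == free_module K"
abbreviation "Tlift == tensor_lift K"
abbreviation "Tmap == tensor_map K"
abbreviation "Base == base_module K"
abbreviation "Cocom == cocommutative K"
abbreviation "Bialg == bialgebra K"
abbreviation "Antip == antipode K"
abbreviation "Coalg == coalgebra K"
abbreviation "Bilin == bilinear_maps K"

lemma cring_K: "cring K"
using K by (simp add: field_def domain_def)

lemma
assumes "Vec V"
shows add_closed: "[|x IN V; y IN V|] ==> x +.$V y IN V"
	and zero_closed: "\<zero>$V IN V" and minus_closed: "x IN V ==> \<ominus>$V x IN V"
	and smult_closed: "[|a IN K; x IN V|] ==> a *.$V x IN V" and add_assoc: "[|x IN V; y IN V; z IN V|]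
		==> (x +.$V y) +.$V z = x +.$V (y +.$V z)" and add_comm: "[|x IN V; y IN V|] ==> x +.$V y = y +.$V x"
	and add_lcomm: "[|x IN V; y IN V; z IN V|] ==> x +.$V (y +.$V z) = y +.$V (x +.$V z)" and zero_left: "x IN V ==> \<zero>$V +.$V x = x"
	and zero_right: "x IN V ==> x +.$V \<zero>$V = x" and smult_add_left: "[|a IN K; b IN K; x IN V|]
		==> (a +.$K b) *.$V x = a *.$V x +.$V b *.$V x" and smult_add_right: "[|a IN K; x IN V; y IN V|]
		==> a *.$V (x +.$V y) = a *.$V x +.$V a *.$V y" and smult_smult: "[|a IN K; b IN K; x IN V|]
		==> (a \<otimes>$K b) *.$V x = a *.$V (b *.$V x)" and smult_one: "x IN V ==> \<one>$K *.$V x = x"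
	and smult_zero_left: "x IN V ==> \<zero>$K *.$V x = \<zero>$V" and smult_zero_right: "a IN K ==> a *.$V \<zero>$V = \<zero>$V"
	and diff_zero_iff: "[|x IN V; y IN V|] ==> x \<ominus>$V y = \<zero>$V <-> x = y"
	and diff_eq: "[|x IN V; y IN V|] ==> x \<ominus>$V y = x +.$V (\<ominus>$K \<one>$K) *.$V y"
	and add_cancel: "[|x +.$V y = x +.$V z; x IN V; y IN V; z IN V|] ==> y = z"
proof -
interpret module K V by fact
show "[|x IN V; y IN V|] ==> x +.$V y IN V" "\<zero>$V IN V" "x IN V ==> \<ominus>$V x IN V" "[|a IN K; x IN V|] ==> a *.$V x IN V"
	"[|x IN V; y IN V; z IN V|] ==> (x +.$V y) +.$V z = x +.$V (y +.$V z)" "[|x IN V; y IN V|] ==> x +.$V y = y +.$V x"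
	"[|x IN V; y IN V; z IN V|] ==> x +.$V (y +.$V z) = y +.$V (x +.$V z)" by (simp_all add: M.a_ac)
show "x IN V ==> \<zero>$V +.$V x = x" "x IN V ==> x +.$V \<zero>$V = x" "[|a IN K; b IN K; x IN V|]
		==> (a +.$K b) *.$V x = a *.$V x +.$V b *.$V x" "[|a IN K; x IN V; y IN V|] ==> a *.$V (x +.$V y) = a *.$V x +.$V a *.$V y"
	"[|a IN K; b IN K; x IN V|] ==> (a \<otimes>$K b) *.$V x = a *.$V (b *.$V x)" "x IN V ==> \<one>$K *.$V x = x"
	"x IN V ==> \<zero>$K *.$V x = \<zero>$V" "a IN K ==> a *.$V \<zero>$V = \<zero>$V"
	by (simp_all add: smult_l_distr smult_r_distr smult_assoc1)
show "[|x IN V; y IN V|] ==> x \<ominus>$V y = \<zero>$V <-> x = y"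
	by (metis M.minus_equality M.r_neg M.minus_minus M.a_inv_closed a_minus_def)
show "[|x IN V; y IN V|] ==> x \<ominus>$V y = x +.$V (\<ominus>$K \<one>$K) *.$V y" by (simp add: a_minus_def smult_l_minus)
show "[|x +.$V y = x +.$V z; x IN V; y IN V; z IN V|] ==> y = z" by simp
qed

lemma K_closed: "\<zero>$K IN K" "\<one>$K IN K" "\<ominus>$K \<one>$K IN K"
	"[|a IN K; b IN K|] ==> a +.$K b IN K" "[|a IN K; b IN K|] ==> a \<otimes>$K b IN K" "a IN K ==> \<ominus>$K a IN K"
proof -
interpret cring K by (rule cring_K)
show "\<zero>$K IN K" "\<one>$K IN K" "\<ominus>$K \<one>$K IN K" "[|a IN K; b IN K|] ==> a +.$K b IN K"
	"[|a IN K; b IN K|] ==> a \<otimes>$K b IN K" "a IN K ==> \<ominus>$K a IN K" by simp_all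
qed

lemmas vclosed = add_closed zero_closed smult_closed K_closed

lemma base_module [simp]:
"carrier Base = carrier K" "\<zero>$Base = \<zero>$K" "x +.$Base y = x +.$K y" "x *.$Base y = x \<otimes>$K y"
by (simp_all add: base_module_def)

lemma base_Vec: "Vec Base"
proof -
interpret cring K by (rule cring_K)
show ?thesis by (rule moduleI[OF cring_K abelian_groupI]) (auto simp: a_ac m_assoc l_distr r_distr intro!: bexI[of _ "\<ominus>$K _"] l_neg)
qed

subsection \<open>Linear maps\<close>

lemma LinI:
assumes "!!x. x IN V ==> f x IN W"
	"!!x y. [|x IN V; y IN V|] ==> f (x +.$V y) = f x +.$W f y" "!!a x. [|a IN K; x IN V|] ==> f (a *.$V x) = a *.$W f x"
shows "f:Lin V W"
using assms unfolding linear_maps_def by auto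

lemma Lin_in: "[|f:Lin V W; x IN V|] ==> f x IN W"
and Lin_add: "[|f:Lin V W; x IN V; y IN V|] ==> f (x +.$V y) = f x +.$W f y"
and Lin_smult: "[|f:Lin V W; a IN K; x IN V|] ==> f (a *.$V x) = a *.$W f x" unfolding linear_maps_def by auto

lemma Lin_zero: "[|f:Lin V W; Vec V; Vec W|] ==> f \<zero>$V = \<zero>$W"
by (metis Lin_in Lin_smult smult_zero_left zero_closed K_closed(1))

lemma Lin_diff: "[|f:Lin V W; Vec V; Vec W; x IN V; y IN V|]
==> f (x \<ominus>$V y) = f x \<ominus>$W f y" by (simp add: diff_eq Lin_add Lin_smult Lin_in vclosed)

lemma Lin_comp: "[|f:Lin V W; g:Lin W Z|] ==> (%x. g (f x)):Lin V Z"
by (rule LinI) (simp_all add: Lin_in Lin_add Lin_smult)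

lemma Lin_id: "(%x. x):Lin V V"
by (rule LinI) auto

lemma Lin_cong: "[|f:Lin V W; !!x. x IN V ==> f x = g x; Vec V|] ==> g:Lin V W"
by (rule LinI) (metis Lin_in, metis Lin_add add_closed, metis Lin_smult smult_closed)

lemma lsum_closed: "[|Vec Z; !!x. x:set xs ==> f x IN Z|] ==> lsum Z f xs IN Z"
by (induction xs) (auto simp: vclosed)

lemma Lin_lsum: "[|g:Lin Z Z'; Vec Z; Vec Z'; !!x. x:set xs ==> f x IN Z|]
==> g (lsum Z f xs) = lsum Z' (%x. g (f x)) xs" by (induction xs) (auto simp: Lin_zero Lin_add lsum_closed)

lemma lsum_add: "[|Vec Z; !!x. x:set xs ==> f x IN Z; !!x. x:set xs ==> g x IN Z|]
==> lsum Z (%x. f x +.$Z g x) xs = lsum Z f xs +.$Z lsum Z g xs"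
by (induction xs) (auto simp: zero_left zero_closed add_assoc add_lcomm lsum_closed add_closed)

lemma smult_Lin: "[|a IN K; Vec Z|] ==> (%x. a *.$Z x):Lin Z Z"
proof -
interpret cring K by (rule cring_K)
assume "a IN K" "Vec Z"
thus ?thesis by (intro LinI) (auto simp: smult_closed smult_add_right smult_smult[symmetric] m_comm)
qed

lemma lsum_smult: "[|Vec Z; a IN K; !!x. x:set xs ==> f x IN Z|]
==> lsum Z (%x. a *.$Z f x) xs = a *.$Z lsum Z f xs" using Lin_lsum[OF smult_Lin] by metis

lemma lsum_zero: "Vec Z ==> lsum Z (%x. \<zero>$Z) xs = \<zero>$Z"
by (induction xs) (auto simp: zero_left zero_closed)

lemma lsum_swap: "[|Vec Z; !!x y. [|x:set xs; y:set ys|] ==> f x y IN Z|]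
==> lsum Z (%x. lsum Z (f x) ys) xs = lsum Z (%y. lsum Z (%x. f x y) xs) ys" by (induction xs) (auto simp: lsum_zero lsum_add lsum_closed)

lemma BilinI:
assumes "!!v w. [|v IN V; w IN W|] ==> be v w IN Z"
	"!!v v' w. [|v IN V; v' IN V; w IN W|] ==> be (v +.$V v') w = be v w +.$Z be v' w"
	"!!v w w'. [|v IN V; w IN W; w' IN W|] ==> be v (w +.$W w') = be v w +.$Z be v w'"
	"!!a v w. [|a IN K; v IN V; w IN W|] ==> be (a *.$V v) w = a *.$Z be v w"
	"!!a v w. [|a IN K; v IN V; w IN W|] ==> be v (a *.$W w) = a *.$Z be v w"
shows "be:Bilin V W Z"
using assms unfolding bilinear_maps_def by (auto intro!: LinI)

lemma Bilin_right: "[|be:Bilin V W Z; v IN V|] ==> be v:Lin W Z"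
and Bilin_left: "[|be:Bilin V W Z; w IN W|] ==> (%v. be v w):Lin V Z" and Bilin_in: "[|be:Bilin V W Z; v IN V; w IN W|] ==> be v w IN Z"
unfolding bilinear_maps_def by (auto dest: Lin_in)

subsection \<open>Modules given by generators and relations\<close>

lemma free_Vec: "Vec (Free A)"
proof -
interpret cring K by (rule cring_K)
have fin: "finite {p. f p +.$K g p ~= \<zero>$K}" if "finite {p. f p ~= \<zero>$K}" "finite {p. g p ~= \<zero>$K}" for f g :: "'a => 'k"
	by (rule finite_subset[OF _ finite_UnI[OF that]]) (use l_zero zero_closed in auto)
have fin': "finite {p. a \<otimes>$K f p ~= \<zero>$K}" if "finite {p. f p ~= \<zero>$K}" "a IN K" for a and f :: "'a => 'k"
	by (rule finite_subset[OF _ that(1)]) (use that(2) in auto)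
show ?thesis
proof (rule moduleI[OF cring_K abelian_groupI])
	fix f assume f: "f IN Free A"
	show "EX g:carrier (Free A). g +.$(Free A) f = \<zero>$(Free A)"
	proof (rule bexI)
		show "(%p. (\<ominus>$K \<one>$K) \<otimes>$K f p) +.$(Free A) f = \<zero>$(Free A)" using f by (auto simp: free_module_def l_minus l_neg)
		show "(%p. (\<ominus>$K \<one>$K) \<otimes>$K f p) IN Free A" using f fin'[of f "\<ominus>$K \<one>$K"] by (auto simp: free_module_def)
	qed
qed (auto simp: free_module_def a_ac m_assoc l_distr r_distr fin fin' intro!: ext)
qed

context
fixes A :: "'p set"
begin
abbreviation "Fr == Free A"

text \<open>The linear extension of \<open>ff\<close> to the free module on
  \<open>A\<close>.\<close>

definition ev :: "('k, 'z, 'e) module_scheme => ('p => 'z) => ('p => 'k) => 'z" where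
"ev Z ff f = finsum Z (%p. f p *.$Z ff p) {p. f p ~= \<zero>$K}"

lemma delta_in: "p:A ==> delta K p IN Fr"
using K_closed by (auto simp: free_module_def delta_def)

lemma Fr_val: "f IN Fr ==> f p IN K" "[|f IN Fr; f p ~= \<zero>$K|] ==> p:A"
"f IN Fr ==> finite {p. f p ~= \<zero>$K}" by (auto simp: free_module_def)

context
fixes Z :: "('k, 'z, 'e) module_scheme" and ff
assumes Z: "Vec Z" and phi: "!!p. p:A ==> ff p IN Z"
begin
lemma ev_superset:
assumes "f IN Fr" "finite B" "{p. f p ~= \<zero>$K} <= B" "B <= A"
shows "ev Z ff f = finsum Z (%p. f p *.$Z ff p) B"
proof -
interpret module K Z by (rule Z)
show ?thesis unfolding ev_def by (rule M.add.finprod_mono_neutral_cong_left)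
		(use assms phi in "auto simp: Fr_val smult_closed Z intro!: smult_zero_left[OF Z]")
qed

lemma ev_Lin: "ev Z ff:Lin Fr Z"
proof -
interpret module K Z by (rule Z)
show ?thesis
proof (rule LinI)
	fix f assume f: "f IN Fr"
	hence fv: "!!p. f p ~= \<zero>$K ==> f p *.$Z ff p IN Z" using Fr_val phi by (auto intro: smult_closed)
	thus "ev Z ff f IN Z" unfolding ev_def by (auto intro: M.finsum_closed)
	fix a assume a: "a IN K"
	note fK = Fr_val(1)[OF f] and fA = Fr_val(2)[OF f] and fin = Fr_val(3)[OF f]
	let ?B = "{p. f p ~= \<zero>$K}"
	have af: "a *.$Fr f IN Fr" using a f by (simp add: vclosed free_Vec)
	have "ev Z ff (a *.$Fr f) = finsum Z (%p. (a *.$Fr f) p *.$Z ff p) ?B"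
		by (rule ev_superset[OF af]) (use a fK fA fin in "auto simp: free_module_def")
	also have "... = finsum Z (%p. a *.$Z (f p *.$Z ff p)) ?B"
		by (rule M.finsum_cong') (use a fK fA phi in "auto simp: free_module_def smult_assoc1")
	also have "... = a *.$Z ev Z ff f" unfolding ev_def by (rule finsum_smult_ldistr[symmetric]) (use a fin fv in auto)
	finally show "ev Z ff (a *.$Fr f) = a *.$Z ev Z ff f" .
next
	fix f g assume fg: "f IN Fr" "g IN Fr"
	let ?B = "{p. f p ~= \<zero>$K} Un {p. g p ~= \<zero>$K}"
	note fK = Fr_val(1)[OF fg(1)] Fr_val(1)[OF fg(2)]
	have B: "finite ?B" "?B <= A" using Fr_val(3)[OF fg(1)] Fr_val(3)[OF fg(2)] Fr_val(2)[OF fg(1)] Fr_val(2)[OF fg(2)] by auto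
	have c: "f p *.$Z ff p IN Z" "g p *.$Z ff p IN Z" if "p:?B" for p
		using that B(2) phi Fr_val(1)[OF fg(1)] Fr_val(1)[OF fg(2)] by (auto intro!: smult_closed)
	have s: "f +.$Fr g IN Fr" using fg by (simp add: vclosed free_Vec)
	have "ev Z ff (f +.$Fr g) = finsum Z (%p. (f +.$Fr g) p *.$Z ff p) ?B" by (rule ev_superset[OF s B(1) _ B(2)]) (auto simp: free_module_def)
	also have "... = finsum Z (%p. f p *.$Z ff p +.$Z g p *.$Z ff p) ?B"
		by (rule M.finsum_cong') (use c fK B phi in "auto simp: free_module_def smult_l_distr")
	also have "... = finsum Z (%p. f p *.$Z ff p) ?B +.$Z finsum Z (%p. g p *.$Z ff p) ?B" by (rule M.finsum_addf) (use c in auto)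
	also have "... = ev Z ff f +.$Z ev Z ff g" using ev_superset[OF fg(1) B(1) _ B(2)] ev_superset[OF fg(2) B(1) _ B(2)] by auto
	finally show "ev Z ff (f +.$Fr g) = ev Z ff f +.$Z ev Z ff g" .
qed
qed

lemma ev_delta: assumes "p:A" shows "ev Z ff (delta K p) = ff p"
proof -
interpret module K Z by (rule Z)
have "\<zero>$K ~= \<one>$K" using K by (auto simp: field_def domain_def domain_axioms_def)
have "ev Z ff (delta K p) = finsum Z (%q. delta K p q *.$Z ff q) {p}"
	by (rule ev_superset) (use assms delta_in[OF assms] in "auto simp: delta_def split: if_splits")
thus ?thesis using assms phi by (simp add: delta_def)
qed
end

lemma free_induct:
assumes f: "f IN Fr" and z: "P \<zero>$Fr"
	and s: "!!a p g. [|a IN K; p:A; g IN Fr; P g|] ==> P (a *.$Fr delta K p +.$Fr g)"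
shows "P f"
proof -
interpret cring K by (rule cring_K)
have "ALL f:carrier Fr. {p. f p ~= \<zero>$K} <= B --> P f" if "finite B" for B using that
proof (induction B)
	case empty
	have "f = \<zero>$Fr" if "{p. f p ~= \<zero>$K} <= {}" for f using that by (auto simp: free_module_def)
	thus ?case using z by blast
next
	case (insert q B)
	show ?case
	proof (intro ballI impI)
		fix f assume f: "f IN Fr" "{p. f p ~= \<zero>$K} <= insert q B"
		define g where "g = f(q := \<zero>$K)"
		have "{p. g p ~= \<zero>$K} <= {p. f p ~= \<zero>$K}" by (auto simp: g_def)
		hence g: "g IN Fr" using f(1) finite_subset[of "{p. g p ~= \<zero>$K}"] by (auto simp: free_module_def g_def)
		have gB: "{p. g p ~= \<zero>$K} <= B" using f(2) by (auto simp: g_def)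
		show "P f"
		proof (cases "f q = \<zero>$K")
			case True
			hence "f = g" by (auto simp: g_def)
			thus ?thesis using insert.IH g gB by blast
		next
			case False
			hence "f = f q *.$Fr delta K q +.$Fr g" using Fr_val(1)[OF f(1)] by (auto simp: free_module_def g_def delta_def)
			thus ?thesis using s[OF Fr_val(1)[OF f(1)] Fr_val(2)[OF f(1) False] g] insert.IH g gB by metis
		qed
	qed
qed
from this[OF Fr_val(3)[OF f]] show ?thesis using f by blast
qed
end

definition cls :: "('k, 'a, 'c) module_scheme => 'a set => 'a => 'a set" where
"cls M N x = N +>$M x"

context
fixes M :: "('k, 'a, 'c) module_scheme" and N
assumes M: "Vec M" and N: "submodule N K M"
begin
lemma abelian_sub: "abelian_subgroup N M"
proof -
interpret module K M by (rule M)
show ?thesis by (rule abelian_subgroupI3) (use N M.abelian_group_axioms in "auto simp: submodule_def additive_subgroup_def")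
qed

lemma N_closed: "x:N ==> x IN M" "\<zero>$M:N" "[|x:N; y:N|] ==> x +.$M y:N"
"[|a IN K; x:N|] ==> a *.$M x:N"
proof -
interpret abelian_subgroup N M by (rule abelian_sub)
show "x:N ==> x IN M" "\<zero>$M:N" "[|x:N; y:N|] ==> x +.$M y:N" "[|a IN K; x:N|] ==> a *.$M x:N"
	using submodule.smult_closed[OF N] by auto
qed

lemma cls_smult:
assumes a: "a IN K" and x: "x IN M"
shows "N <+>$M ((%x. a *.$M x) ` cls M N x) = cls M N (a *.$M x)"
proof -
have "EX m:N. n +.$M a *.$M (n' +.$M x) = m +.$M a *.$M x" if "n:N" "n':N" for n n' using that a x N_closed
	by (intro bexI[of _ "n +.$M a *.$M n'"]) (auto simp: smult_add_right[OF M] add_assoc[OF M] smult_closed[OF M])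
moreover have "n +.$M a *.$M x = n +.$M a *.$M (\<zero>$M +.$M x)" for n using x by (simp add: zero_left[OF M])
ultimately show ?thesis unfolding cls_def a_r_coset_def' set_add_def' using N_closed(2) by blast
qed

lemma quotient_carrier: "carrier (quotient_module M N) = cls M N ` carrier M"
by (auto simp: quotient_module_def A_RCOSETS_def' cls_def)

lemma cls_eq_iff: "[|x IN M; y IN M|] ==> cls M N x = cls M N y <-> x \<ominus>$M y:N"
proof -
interpret abelian_subgroup N M by (rule abelian_sub)
assume xy: "x IN M" "y IN M"
show ?thesis unfolding cls_def a_minus_def using a_rcos_module[OF xy(2,1)] xy by (metis a_repr_independence' a_rcos_self)
qed

lemma quotient_Vec: "Vec (quotient_module M N)" and cls_Lin: "cls M N:Lin M (quotient_module M N)"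
proof -
interpret abelian_subgroup N M by (rule abelian_sub)
let ?Q = "quotient_module M N"
have zero: "\<zero>$?Q = cls M N \<zero>$M" using a_coset_add_zero[OF a_subset] by (simp add: quotient_module_def cls_def)
have ops: "cls M N x +.$?Q cls M N y = cls M N (x +.$M y)" "a IN K ==> a *.$?Q cls M N x = cls M N (a *.$M x)"
	if "x IN M" "y IN M" for x y a using a_rcos_sum[OF that] cls_smult that by (simp_all add: quotient_module_def cls_def)
show "cls M N:Lin M ?Q" by (rule LinI) (simp_all add: quotient_carrier ops)
show "Vec ?Q"
proof (rule moduleI[OF cring_K abelian_groupI], unfold quotient_carrier)
	fix X assume "X:cls M N ` carrier M"
	then obtain x where "X = cls M N x" "x IN M" by blast
	thus "EX Y:cls M N ` carrier M. Y +.$?Q X = \<zero>$?Q" by (intro bexI[of _ "cls M N (\<ominus>$M x)"]) (auto simp: ops zero l_neg)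
qed (auto simp: ops zero add_comm[OF M] add_lcomm[OF M] K_closed vclosed(1-3)[OF M] add_assoc[OF M] zero_left[OF M] smult_add_left[OF M]
		smult_add_right[OF M] smult_smult[OF M] smult_one[OF M])
qed
end

text \<open>Modules by generators and relations, with bodies that match those of the tensor product.
  Tensor products and gluings are both instances and share the facts proved here.\<close>

definition relations :: "'p set => ('p => 'k) set => ('p => 'k) set" where
"relations A R = \<Inter>{N. submodule N K (Free A) & R <= N}"

definition pres :: "'p set => ('p => 'k) set => ('k, ('p => 'k) set) module" where
"pres A R = quotient_module (Free A) (relations A R)"

definition gen :: "'p set => ('p => 'k) set => 'p => ('p => 'k) set" where
"gen A R p = relations A R +>$(Free A) delta K p"

context
fixes A :: "'p set" and R
assumes R: "R <= carrier (free_module K A)"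
begin
lemma relations_sub: "submodule (relations A R) K (Free A)"
proof -
interpret F: module K "Free A" by (rule free_Vec)
have "R <= carrier (Free A) & submodule (carrier (Free A)) K (Free A)" using R F.carrier_is_submodule by blast
thus ?thesis unfolding relations_def by (intro F.submoduleI) (auto dest: F.submoduleE simp: N_closed[OF free_Vec])
qed

lemma relations_least:
"[|submodule N K (Free A); R <= N|] ==> relations A R <= N" "R <= relations A R" unfolding relations_def by auto

lemma pres_Vec: "Vec (pres A R)"
unfolding pres_def by (rule quotient_Vec[OF free_Vec relations_sub])

abbreviation "qcls == cls (Free A) (relations A R)"

lemma qcls_Lin: "qcls:Lin (Free A) (pres A R)"
unfolding pres_def by (rule cls_Lin[OF free_Vec relations_sub])

lemma gen_cls: "gen A R p = qcls (delta K p)"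
by (simp add: gen_def cls_def)

lemma gen_in: "p:A ==> gen A R p IN pres A R"
unfolding gen_cls by (rule Lin_in[OF qcls_Lin delta_in])

lemma pres_carrier: "carrier (pres A R) = qcls ` carrier (Free A)"
unfolding pres_def by (rule quotient_carrier[OF free_Vec relations_sub])

lemma pres_induct:
assumes x: "x IN pres A R" and z: "P \<zero>$(pres A R)"
	and s: "!!a p t. [|a IN K; p:A; t IN pres A R; P t|] ==> P (a *.$(pres A R) gen A R p +.$(pres A R) t)"
shows "P x"
proof -
obtain f where f: "f IN Free A" "x = qcls f" using x unfolding pres_carrier by blast
note q = qcls_Lin
have "P (qcls f)" using f(1)
proof (rule free_induct)
	show "P (qcls \<zero>$(Free A))" using z Lin_zero[OF q free_Vec pres_Vec] by simp
	fix a p g assume "a IN K" "p:A" "g IN Free A" "P (qcls g)"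
	thus "P (qcls (a *.$(Free A) delta K p +.$(Free A) g))" using s[of a p "qcls g"] Lin_in[OF q]
		by (simp add: Lin_add[OF q] Lin_smult[OF q] delta_in smult_closed[OF free_Vec] gen_cls)
qed
thus ?thesis using f by simp
qed
end

context
fixes A :: "('a * 'b) set" and R and Z :: "('k, 'z, 'e) module_scheme" and be
assumes R: "R <= carrier (free_module K A)" and Z: "Vec Z"
	and beta: "!!p. p:A ==> case_prod be p IN Z" and ker: "!!rh. rh:R ==> ev Z (case_prod be) rh = \<zero>$Z"
begin
text \<open>\<open>tensor_lift\<close> evaluates at a chosen representative. The kernel of the
  linear extension is a submodule that contains the relations, so the choice is immaterial. The
  relations are left arbitrary because \<open>tensor_lift\<close> also describes maps out of
  gluings, where the first component of a generator is an index.\<close>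

lemma tensor_lift_cls:
assumes f: "f IN Free A"
shows "Tlift Z be (cls (Free A) (relations A R) f) = ev Z (case_prod be) f"
proof -
interpret F: module K "Free A" by (rule free_Vec)
let ?e = "ev Z (case_prod be)"
note e = ev_Lin[of Z A "case_prod be", OF Z beta]
have "submodule {n:carrier (Free A). ?e n = \<zero>$Z} K (Free A)"
proof (rule F.submoduleI)
	fix n assume "n:{n:carrier (Free A). ?e n = \<zero>$Z}"
	hence n: "n IN Free A" "?e n = \<zero>$Z" by auto
	have "\<ominus>$(Free A) n = (\<ominus>$K \<one>$K) *.$(Free A) n" using n by (simp add: F.smult_l_minus)
	thus "\<ominus>$(Free A) n:{n:carrier (Free A). ?e n = \<zero>$Z}" using n by (simp add: Lin_smult[OF e] smult_zero_right[OF Z] K_closed)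
qed (auto simp: Lin_zero[OF e free_Vec Z] Lin_add[OF e] Lin_smult[OF e] zero_left[OF Z] zero_closed[OF Z]
			smult_zero_right[OF Z])
hence "relations A R <= {n:carrier (Free A). ?e n = \<zero>$Z}" using relations_least(1)[OF R] R ker by blast
moreover have "(SOME g. g:cls (Free A) (relations A R) f):cls (Free A) (relations A R) f"
proof (rule someI[where x = "\<zero>$(Free A) +.$(Free A) f"])
	have "\<zero>$(Free A):relations A R" by (rule N_closed(2)[OF free_Vec relations_sub[OF R]])
	thus "\<zero>$(Free A) +.$(Free A) f:cls (Free A) (relations A R) f" unfolding cls_def a_r_coset_def' by blast
qed
ultimately obtain n where n: "n IN Free A" "?e n = \<zero>$Z" "(SOME g. g:cls (Free A) (relations A R) f) = n +.$(Free A) f"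
	unfolding cls_def a_r_coset_def' by blast
have "Tlift Z be X = ?e (SOME g. g:X)" for X unfolding tensor_lift_def ev_def by (simp add: Let_def case_prod_unfold)
thus ?thesis using n f by (simp add: Lin_add[OF e] Lin_in[OF e] zero_left[OF Z])
qed

lemma tensor_lift_Lin: "Tlift Z be:Lin (pres A R) Z"
proof -
let ?q = "cls (Free A) (relations A R)"
note e = ev_Lin[of Z A "case_prod be", OF Z beta] and q = qcls_Lin[OF R]
note F = add_closed[OF free_Vec] smult_closed[OF free_Vec]
show ?thesis by (rule LinI, unfold pres_carrier[OF R]) (auto simp: tensor_lift_cls Lin_in[OF e] Lin_add[OF e] Lin_smult[OF e] F
			Lin_add[OF q, symmetric] Lin_smult[OF q, symmetric])
qed

lemma tensor_lift_gen: "(a, b):A ==> Tlift Z be (gen A R (a, b)) = be a b"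
using ev_delta[of Z A "case_prod be" "(a, b)", OF Z beta] by (simp add: gen_cls[OF R] tensor_lift_cls delta_in)
end

subsection \<open>Tensor products\<close>

abbreviation "ten == tensor K"
abbreviation "pur == pure_tensor K"

lemma free_diff: "[|x IN Free A; y IN Free A|]
==> x \<ominus>$(Free A) y IN Free A" by (simp add: diff_eq[OF free_Vec] add_closed[OF free_Vec] smult_closed[OF free_Vec] K_closed)

lemma ev_diff:
assumes "Vec Z" "!!p. p:A ==> ff p IN Z"
	and "x IN Free A" "y IN Free A" "ev Z ff x = ev Z ff y"
shows "ev Z ff (x \<ominus>$(Free A) y) = \<zero>$Z"
using Lin_diff[OF ev_Lin[of Z A ff, OF assms(1,2)] free_Vec assms(1) assms(3,4)] assms
	Lin_in[OF ev_Lin[of Z A ff, OF assms(1,2)]] by (simp add: diff_zero_iff)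

lemma qcls_diff:
assumes R: "R <= carrier (Free A)" and "x \<ominus>$(Free A) y:R"
	and "x IN Free A" "y IN Free A"
shows "cls (Free A) (relations A R) x = cls (Free A) (relations A R) y"
using relations_least(2)[of R A] assms cls_eq_iff[OF free_Vec relations_sub[OF R]] by blast

context
fixes V :: "('k, 'a, 'c) module_scheme" and W :: "('k, 'b, 'd) module_scheme"
assumes V: "Vec V" and W: "Vec W"
begin
abbreviation "VW == carrier V \<times> carrier W"

lemma relators_sub: "tensor_relators K V W <= carrier (Free VW)"
unfolding tensor_relators_def Let_def by (auto intro!: free_diff add_closed[OF free_Vec] smult_closed[OF free_Vec] delta_in
		vclosed(1,3)[OF V] vclosed(1,3)[OF W])

lemma ten_pres: "ten V W = pres VW (tensor_relators K V W)"
and pure_gen: "pur V W v w = gen VW (tensor_relators K V W) (v, w)"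
by (simp_all add: tensor_def pres_def tensor_kernel_def relations_def pure_tensor_def gen_def)

lemma ten_Vec: "Vec (ten V W)"
unfolding ten_pres by (rule pres_Vec[OF relators_sub])

lemma pur_in: "[|v IN V; w IN W|] ==> pur V W v w IN ten V W"
unfolding ten_pres pure_gen by (rule gen_in[OF relators_sub]) simp

lemma pur_Bilin: "pur V W:Bilin V W (ten V W)"
proof -
let ?F = "Free VW" and ?R = "tensor_relators K V W"
let ?q = "cls ?F (relations VW ?R)"
note q = qcls_Lin[OF relators_sub]
note F = add_closed[OF free_Vec] smult_closed[OF free_Vec] delta_in
note cl = vclosed(1,3)[OF V] vclosed(1,3)[OF W]
note d = qcls_diff[OF relators_sub]
note mem = tensor_relators_def Let_def
have p: "pur V W v w = ?q (delta K (v, w))" for v w unfolding pure_gen by (rule gen_cls[OF relators_sub])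
show ?thesis
proof (rule BilinI)
	show "pur V W v w IN ten V W" if "v IN V" "w IN W" for v w using pur_in that by blast
	fix v v' w assume v: "v IN V" "v' IN V" "w IN W"
	have "?q (delta K (v +.$V v', w)) = ?q (delta K (v, w) +.$?F delta K (v', w))"
		by (rule d, unfold mem, rule UnI1, rule UnI1, rule UnI1, use v in blast) (use v in "auto simp: cl intro!: F")
	thus "pur V W (v +.$V v') w = pur V W v w +.$(ten V W) pur V W v' w"
		unfolding p ten_pres using v by (simp add: Lin_add[OF q] delta_in)
next
	fix v w w' assume v: "v IN V" "w IN W" "w' IN W"
	have "?q (delta K (v, w +.$W w')) = ?q (delta K (v, w) +.$?F delta K (v, w'))"
		by (rule d, unfold mem, rule UnI1, rule UnI1, rule UnI2, use v in blast) (use v in "auto simp: cl intro!: F")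
	thus "pur V W v (w +.$W w') = pur V W v w +.$(ten V W) pur V W v w'"
		unfolding p ten_pres using v by (simp add: Lin_add[OF q] delta_in)
next
	fix a v w assume v: "a IN K" "v IN V" "w IN W"
	have "?q (delta K (a *.$V v, w)) = ?q (a *.$?F delta K (v, w))" by (rule d, unfold mem, rule UnI1, rule UnI2, use v in blast)
			(use v in "auto simp: cl intro!: F")
	thus "pur V W (a *.$V v) w = a *.$(ten V W) pur V W v w" unfolding p ten_pres using v by (simp add: Lin_smult[OF q] delta_in)
	have "?q (delta K (v, a *.$W w)) = ?q (a *.$?F delta K (v, w))" by (rule d, unfold mem, rule UnI2, use v in blast)
			(use v in "auto simp: cl intro!: F")
	thus "pur V W v (a *.$W w) = a *.$(ten V W) pur V W v w" unfolding p ten_pres using v by (simp add: Lin_smult[OF q] delta_in)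
qed
qed

text \<open>Scalar coefficients are absorbed into the left factor, which leaves a plain sum of pure
  tensors.\<close>

lemma tensor_rep:
assumes t: "t IN ten V W"
obtains ps where "set ps <= VW" "t = lsum (ten V W) (%p. pur V W (fst p) (snd p)) ps"
proof -
have "EX ps. set ps <= VW & t = lsum (ten V W) (%p. pur V W (fst p) (snd p)) ps" using t unfolding ten_pres
proof (rule pres_induct[OF relators_sub])
	show "EX ps. set ps <= VW & \<zero>$(pres VW (tensor_relators K V W)) =
			lsum (pres VW (tensor_relators K V W)) (%p. pur V W (fst p) (snd p)) ps" by (rule exI[of _ "[]"]) simp
	fix a p t assume a: "a IN K" and p: "p:VW"
		and "EX ps. set ps <= VW & t = lsum (pres VW (tensor_relators K V W)) (%p. pur V W (fst p) (snd p)) ps"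
	then obtain ps where ps: "set ps <= VW" "t = lsum (pres VW (tensor_relators K V W)) (%p. pur V W (fst p) (snd p)) ps" by blast
	obtain v w where vw: "p = (v, w)" "v IN V" "w IN W" using p by auto
	have "a *.$(ten V W) pur V W v w = pur V W (a *.$V v) w" using Lin_smult[OF Bilin_left[OF pur_Bilin vw(3)] a vw(2)] by simp
	thus "EX ps. set ps <= VW & a *.$(pres VW (tensor_relators K V W)) gen VW (tensor_relators K V W) p
			+.$(pres VW (tensor_relators K V W)) t = lsum (pres VW (tensor_relators K V W)) (%p. pur V W (fst p) (snd p)) ps"
		using ps vw a smult_closed[OF V] by (intro exI[of _ "(a *.$V v, w) # ps"]) (simp add: pure_gen[symmetric] ten_pres)
qed
thus thesis using that by blast
qed

lemma tensor_ext:
assumes "f:Lin (ten V W) Z" "g:Lin (ten V W) Z" "Vec Z"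
	and "!!v w. [|v IN V; w IN W|] ==> f (pur V W v w) = g (pur V W v w)" and t: "t IN ten V W"
shows "f t = g t"
proof -
obtain ps where ps: "set ps <= VW" "t = lsum (ten V W) (%p. pur V W (fst p) (snd p)) ps" using tensor_rep[OF t] .
show ?thesis unfolding ps(2) using ps(1) by (subst Lin_lsum[OF assms(1) ten_Vec assms(3)], force intro!: pur_in,
			subst Lin_lsum[OF assms(2) ten_Vec assms(3)], force intro!: pur_in) (force intro!: lsum_cong assms(4))
qed

context
fixes Z :: "('k, 'z, 'e) module_scheme" and be
assumes Z: "Vec Z" and b: "be:Bilin V W Z"
begin
lemma relators_ev: assumes "rh:tensor_relators K V W" shows "ev Z (case_prod be) rh = \<zero>$Z"
proof -
have bc: "case_prod be p IN Z" if "p:VW" for p using that Bilin_in[OF b] by auto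
note e = ev_Lin[of Z VW "case_prod be", OF Z bc]
note F = add_closed[OF free_Vec] smult_closed[OF free_Vec] delta_in
note cl = vclosed(1,3)[OF V] vclosed(1,3)[OF W]
note E = Lin_add[OF e] Lin_smult[OF e] delta_in ev_delta[of Z VW "case_prod be", OF Z bc]
note B = Lin_add[OF Bilin_left[OF b]] Lin_add[OF Bilin_right[OF b]] Lin_smult[OF Bilin_left[OF b]] Lin_smult[OF Bilin_right[OF b]]
show ?thesis using assms unfolding tensor_relators_def Let_def by (auto intro!: ev_diff[of Z VW, OF Z bc] F cl simp: E cl B)
qed

lemma lift_Lin: "Tlift Z be:Lin (ten V W) Z"
unfolding ten_pres by (rule tensor_lift_Lin[OF relators_sub Z _ relators_ev]) (use Bilin_in[OF b] in auto)

lemma lift_pure: "[|v IN V; w IN W|] ==> Tlift Z be (pur V W v w) = be v w"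
unfolding pure_gen by (rule tensor_lift_gen[OF relators_sub Z _ relators_ev]) (use Bilin_in[OF b] in auto)

lemma lift_lsum: "set ps <= VW ==>
Tlift Z be (lsum (ten V W) (%p. pur V W (fst p) (snd p)) ps) = lsum Z (%p. be (fst p) (snd p)) ps"
by (subst Lin_lsum[OF lift_Lin ten_Vec Z], force intro!: pur_in) (force intro!: lsum_cong lift_pure)
end

end

lemma comp_Bilin:
assumes "f:Lin V V'" "g:Lin W W'" "Vec V'" "Vec W'"
shows "(%x y. pur V' W' (f x) (g y)):Bilin V W (ten V' W')"
proof -
note p = pur_Bilin[OF assms(3,4)]
note B = Lin_add[OF Bilin_left[OF p]] Lin_add[OF Bilin_right[OF p]] Lin_smult[OF Bilin_left[OF p]] Lin_smult[OF Bilin_right[OF p]]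
show ?thesis by (rule BilinI) (use assms(1,2) pur_in[OF assms(3,4)] in "simp_all add: Lin_in Lin_add Lin_smult B")
qed

lemma tmap_Lin:
assumes "f:Lin V V'" "g:Lin W W'" "Vec V" "Vec W" "Vec V'" "Vec W'"
shows "Tmap V' W' f g:Lin (ten V W) (ten V' W')"
unfolding tensor_map_def using assms by (intro lift_Lin ten_Vec comp_Bilin)

lemma tmap_pure:
assumes "f:Lin V V'" "g:Lin W W'" "Vec V" "Vec W" "Vec V'" "Vec W'" "v IN V" "w IN W"
shows "Tmap V' W' f g (pur V W v w) = pur V' W' (f v) (g w)"
unfolding tensor_map_def using assms by (intro lift_pure ten_Vec comp_Bilin)

lemma tmap_comp:
assumes "f:Lin V V'" "g:Lin W W'" "f':Lin V' V''" "g':Lin W' W''"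
	"Vec V" "Vec W" "Vec V'" "Vec W'" "Vec V''" "Vec W''" "t IN ten V W"
shows "Tmap V'' W'' f' g' (Tmap V' W' f g t) = Tmap V'' W'' (%x. f' (f x)) (%x. g' (g x)) t"
proof (rule tensor_ext[OF assms(5,6) _ _ ten_Vec _ assms(11)])
show "(%t. Tmap V'' W'' f' g' (Tmap V' W' f g t)):Lin (ten V W) (ten V'' W'')" by (rule Lin_comp[OF tmap_Lin tmap_Lin]) (use assms in auto)
show "Tmap V'' W'' (%x. f' (f x)) (%x. g' (g x)):Lin (ten V W) (ten V'' W'')" by (rule tmap_Lin) (use assms in "auto intro: Lin_comp")
fix v w assume vw: "v IN V" "w IN W"
note c = Lin_comp[OF assms(1,3)] Lin_comp[OF assms(2,4)]
show "Tmap V'' W'' f' g' (Tmap V' W' f g (pur V W v w)) = Tmap V'' W'' (%x. f' (f x)) (%x. g' (g x)) (pur V W v w)"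
	using assms vw by (simp add: tmap_pure tmap_pure[OF c] Lin_in)
qed (use assms in auto)

lemma tmap_cong:
assumes "!!x. x IN V ==> f x = f' x" "!!x. x IN W ==> g x = g' x"
	"f:Lin V V'" "g:Lin W W'" "Vec V" "Vec W" "Vec V'" "Vec W'" "t IN ten V W"
shows "Tmap V' W' f g t = Tmap V' W' f' g' t"
proof (rule tensor_ext[OF assms(5,6) _ _ ten_Vec _ assms(9)])
have l: "f':Lin V V'" "g':Lin W W'" using Lin_cong assms by metis+
show "Tmap V' W' f g:Lin (ten V W) (ten V' W')" "Tmap V' W' f' g':Lin (ten V W) (ten V' W')" using assms l by (auto intro: tmap_Lin)
show "Tmap V' W' f g (pur V W v w) = Tmap V' W' f' g' (pur V W v w)" if "v IN V" "w IN W" for v w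
	using assms that by (simp add: tmap_pure tmap_pure[OF l])
qed (use assms in auto)

lemma tmap_id:
assumes "Vec V" "Vec W" "t IN ten V W"
shows "Tmap V W (%x. x) (%x. x) t = t"
by (rule tensor_ext[OF assms(1,2) _ Lin_id ten_Vec _ assms(3)])
	(use assms in "auto intro: tmap_Lin Lin_id simp: tmap_pure[OF Lin_id Lin_id]")
end

context linear_algebra
begin
lemma LinL: "[|be:Bilin A B Z; F:Lin V A; b IN B|] ==> (%x. be (F x) b):Lin V Z"
using Lin_comp[of F V A "%v. be v b" Z] Bilin_left[of be A B Z b] by simp

lemma LinR: "[|be:Bilin A B Z; F:Lin V B; a IN A|] ==> (%x. be a (F x)):Lin V Z"
using Lin_comp[of F V B "be a" Z] Bilin_right[of be A B Z a] by simp

lemmas LinLR = LinL LinR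

lemma BilinI': "[|!!a. a IN A ==> (%b. be a b):Lin B Z; !!b. b IN B ==> (%a. be a b):Lin A Z|]
==> be:Bilin A B Z" unfolding bilinear_maps_def by auto

lemma smult_Bilin: assumes "Vec Z" shows "(%a x. a *.$Z x):Bilin Base Z Z"
by (rule BilinI') (use assms in "auto intro!: smult_Lin LinI simp: smult_closed smult_add_left smult_smult")

lemma Bilin_simps:
assumes "be:Bilin V W Z"
shows "[|v IN V; v' IN V; w IN W|] ==> be (v +.$V v') w = be v w +.$Z be v' w"
	"[|v IN V; w IN W; w' IN W|] ==> be v (w +.$W w') = be v w +.$Z be v w'" "[|a IN K; v IN V; w IN W|] ==> be (a *.$V v) w = a *.$Z be v w"
	"[|a IN K; v IN V; w IN W|] ==> be v (a *.$W w) = a *.$Z be v w" "[|v IN V; w IN W|] ==> be v w IN Z"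
using Lin_add[OF Bilin_left[OF assms]] Lin_add[OF Bilin_right[OF assms]]
	Lin_smult[OF Bilin_left[OF assms]] Lin_smult[OF Bilin_right[OF assms]] Bilin_in[OF assms] by auto

definition trilin where
"trilin A B D Z tw <-> (ALL a:carrier A. tw a:Bilin B D Z) & (ALL b:carrier B. ALL d:carrier D. (%a. tw a b d):Lin A Z)"

lemma trilinI:
assumes "!!a b. [|a IN A; b IN B|] ==> (%d. tw a b d):Lin D Z"
	"!!a d. [|a IN A; d IN D|] ==> (%b. tw a b d):Lin B Z" "!!b d. [|b IN B; d IN D|] ==> (%a. tw a b d):Lin A Z"
shows "trilin A B D Z tw"
using assms unfolding trilin_def by (auto intro!: BilinI')

text \<open>Linearity in a parameter of the bilinear map, for a fixed tensor \<open>t\<close>.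
  Combined with \<open>lift_Lin\<close> it shows that iterated lifts are again bilinear. An
  expansion of \<open>t\<close> reduces it to a finite sum of linear functions.\<close>

lemma lift_LinP:
assumes "Vec V" "Vec W" "Vec Z" "t IN ten V W"
	and b: "!!x. x IN X ==> be x:Bilin V W Z" and l: "!!v w. [|v IN V; w IN W|] ==> (%x. be x v w):Lin X Z" and X: "Vec X"
shows "(%x. Tlift Z (be x) t):Lin X Z"
proof -
obtain ps where ps: "set ps <= carrier V \<times> carrier W" "t = lsum (ten V W) (%p. pur V W (fst p) (snd p)) ps"
	using tensor_rep[OF assms(1,2,4)] .
have "(%x. lsum Z (%p. be x (fst p) (snd p)) ps):Lin X Z"
proof (rule LinI)
	have c: "be x (fst p) (snd p) IN Z" if "x IN X" "p:set ps" for x p using Bilin_in[OF b[OF that(1)]] ps(1) that(2) by force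
	show "lsum Z (%p. be x (fst p) (snd p)) ps IN Z" if "x IN X" for x using c[OF that] assms(3) by (rule lsum_closed[rotated])
	fix x y a assume x: "x IN X"
	have "lsum Z (%p. be (a *.$X x) (fst p) (snd p)) ps = lsum Z (%p. a *.$Z be x (fst p) (snd p)) ps" if a: "a IN K"
		using ps(1) Lin_smult[OF l a x] by (intro lsum_cong) auto
	thus "lsum Z (%p. be (a *.$X x) (fst p) (snd p)) ps = a *.$Z lsum Z (%p. be x (fst p) (snd p)) ps"
		if a: "a IN K" using a lsum_smult[OF assms(3) a c[OF x]] by simp
	assume y: "y IN X"
	have "lsum Z (%p. be (x +.$X y) (fst p) (snd p)) ps = lsum Z (%p. be x (fst p) (snd p) +.$Z be y (fst p) (snd p)) ps"
		using ps(1) Lin_add[OF l x y] by (intro lsum_cong) auto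
	thus "lsum Z (%p. be (x +.$X y) (fst p) (snd p)) ps = lsum Z (%p. be x (fst p) (snd p)) ps +.$Z lsum Z (%p. be y (fst p) (snd p)) ps"
		using lsum_add[OF assms(3) c[OF x] c[OF y]] by simp
qed
moreover have "lsum Z (%p. be x (fst p) (snd p)) ps = Tlift Z (be x) t" if "x IN X" for x
	unfolding ps(2) using lift_lsum[OF assms(1-3) b[OF that] ps(1)] by simp
ultimately show ?thesis using X by (rule Lin_cong)
qed

section \<open>Sweedler calculus\<close>

text \<open>Enough structure to expand comultiplications, before coassociativity and the counit laws
  are known. Sweedler sums can thus be used to establish these very laws.\<close>

definition precoalg where
"precoalg C <-> Vec C & comult C:Lin C (ten C C) & counit C:Lin C Base"

text \<open>A fixed Sweedler expansion of \<open>c\<close>. By \<open>sw_lift\<close> the choice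
  disappears from values on bilinear maps.\<close>

definition dec :: "('k, 'a, 'c) coalg_scheme => 'a => ('a * 'a) list" where
"dec C c = (SOME ps. set ps <= carrier C \<times> carrier C & comult C c = lsum (ten C C) (%p. pur C C (fst p) (snd p)) ps)"

text \<open>\<open>be(c1, c2)\<close> as an explicit finite sum. In contrast to
  \<open>tensor_lift\<close> it commutes with linear maps and admits rewriting under the sum without
  bilinearity of \<open>be\<close>, which is what nested Sweedler computations require.\<close>

definition sw :: "('k, 'a, 'c) coalg_scheme => ('k, 'z, 'e) module_scheme => ('a => 'a => 'z) => 'a => 'z"
where "sw C Z be c = lsum Z (%p. be (fst p) (snd p)) (dec C c)"

lemma coalg_pre: "Coalg C ==> precoalg C"
unfolding coalgebra_def precoalg_def by blast

context
fixes C :: "('k, 'a, 'c) coalg_scheme"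
assumes C: "precoalg C"
begin
lemma pre_Vec: "Vec C" and comult_Lin: "comult C:Lin C (ten C C)"
and counit_Lin: "counit C:Lin C Base" using C unfolding precoalg_def by auto

lemma pre_ten: "Vec (ten C C)"
using pre_Vec by (intro ten_Vec)

lemma counit_in: "c IN C ==> counit C c IN K"
using Lin_in[OF counit_Lin] by simp

lemma dec: assumes "c IN C"
shows "set (dec C c) <= carrier C \<times> carrier C"
	"comult C c = lsum (ten C C) (%p. pur C C (fst p) (snd p)) (dec C c)"
proof -
obtain ps where "set ps <= carrier C \<times> carrier C" "comult C c = lsum (ten C C) (%p. pur C C (fst p) (snd p)) ps"
	by (rule tensor_rep[OF pre_Vec pre_Vec Lin_in[OF comult_Lin assms]])
hence "set ps <= carrier C \<times> carrier C & comult C c = lsum (ten C C) (%p. pur C C (fst p) (snd p)) ps" ..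
hence "set (dec C c) <= carrier C \<times> carrier C & comult C c = lsum (ten C C) (%p. pur C C (fst p) (snd p)) (dec C c)"
	unfolding dec_def by (rule someI)
thus "set (dec C c) <= carrier C \<times> carrier C" "comult C c = lsum (ten C C) (%p. pur C C (fst p) (snd p)) (dec C c)" by auto
qed

lemma sw_closed:
"[|Vec Z; c IN C; !!x y. [|x IN C; y IN C|] ==> be x y IN Z|] ==> sw C Z be c IN Z"
unfolding sw_def using dec(1) by (intro lsum_closed) force+

lemma sw_cong:
"[|c IN C; !!x y. [|x IN C; y IN C|] ==> be x y = be' x y|] ==> sw C Z be c = sw C Z be' c"
unfolding sw_def using dec(1) by (intro lsum_cong) force+

lemma comult_sw: "c IN C ==> comult C c = sw C (ten C C) (pur C C) c"
unfolding sw_def using dec(2) .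

lemma Lin_sw:
"[|g:Lin Z Z'; Vec Z; Vec Z'; c IN C; !!x y. [|x IN C; y IN C|] ==> be x y IN Z|] ==> g (sw C Z be c) = sw C Z' (%x y. g (be x y)) c"
unfolding sw_def using dec(1)[of c] by (intro Lin_lsum) force+

lemma sw_lift: "[|Vec Z; be:Bilin C C Z; c IN C|] ==> Tlift Z be (comult C c) = sw C Z be c"
unfolding sw_def dec(2)[of c] by (rule lift_lsum[OF pre_Vec pre_Vec _ _ dec(1)])

lemma sweedler2_sw: "[|Vec Z; be:Bilin C C Z; c IN C|] ==> sweedler2 K C Z be c = sw C Z be c"
unfolding sweedler2_def by (rule sw_lift)

lemma sw_Lin: assumes "Vec Z" "be:Bilin C C Z" shows "sw C Z be:Lin C Z"
by (rule Lin_cong[OF Lin_comp[OF comult_Lin lift_Lin[OF pre_Vec pre_Vec assms]] sw_lift[OF assms] pre_Vec])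

lemma sw_LinP:
assumes Z: "Vec Z" and X: "Vec X" and c: "c IN C"
	and l: "!!a b. [|a IN C; b IN C|] ==> (%x. ga x a b):Lin X Z"
shows "(%x. sw C Z (ga x) c):Lin X Z"
proof -
have "(%x. lsum Z (%p. ga x (fst p) (snd p)) ps):Lin X Z" if "set ps <= carrier C \<times> carrier C" for ps using that
proof (induction ps)
	case (Cons p ps)
	have p: "fst p IN C" "snd p IN C" and ps: "set ps <= carrier C \<times> carrier C" using Cons.prems by auto
	note L = l[OF p] Cons.IH[OF ps]
	show ?case by (rule LinI) (simp_all add: L[THEN Lin_in] L[THEN Lin_add] L[THEN Lin_smult] vclosed(1-3)[OF Z]
				add_assoc[OF Z] add_lcomm[OF Z] smult_add_right[OF Z])
qed (auto intro!: LinI simp: zero_left[OF Z] smult_zero_right[OF Z] vclosed(2)[OF Z])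
thus ?thesis unfolding sw_def using dec(1)[OF c] .
qed

text \<open>With \<open>coassoc_right\<close> this translates coassociativity, which is stated with
  associators and maps of tensor products, into an equation between nested Sweedler sums.\<close>

lemma coassoc_left:
assumes c: "c IN C"
defines "T == ten C (ten C C)"
shows "tensor_assoc K C (Tmap (ten C C) C (comult C) (%x. x) (comult C c)) =
	sw C T (%x y. sw C T (%x' x''. pur C (ten C C) x' (pur C C x'' y)) x) c"
proof -
note V = pre_Vec and VV = pre_ten
have T: "Vec T" unfolding T_def using V VV by (rule ten_Vec)
note p = pur_Bilin[OF V V] and p' = pur_Bilin[OF V VV, folded T_def]
let ?a = "%t z. Tlift T (%x y. pur C (ten C C) x (pur C C y z)) t"
have b: "(%x y. pur C (ten C C) x (pur C C y z)):Bilin C C T" if "z IN C" for z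
	by (intro BilinI' LinR[OF p'] LinL[OF p'] LinL[OF p] Lin_id that) (auto intro: Bilin_in[OF p] that)
have a: "?a:Bilin (ten C C) C T" by (intro BilinI' lift_Lin[OF V V T] lift_LinP[OF V V T] b V LinR[OF p'] LinR[OF p] Lin_id)
have "tensor_assoc K C (Tmap (ten C C) C (comult C) (%x. x) (comult C c)) = Tlift T ?a (Tmap (ten C C) C (comult C) (%x. x) (comult C c))"
	by (simp add: tensor_assoc_def Let_def T_def)
also have "... = sw C T (%x y. Tlift T ?a (Tmap (ten C C) C (comult C) (%x. x) (pur C C x y))) c" unfolding comult_sw[OF c]
	by (rule Lin_sw[OF Lin_comp[OF tmap_Lin lift_Lin]]) (use comult_Lin Lin_id V VV T a c pur_in[OF V V] in auto)
also have "... = sw C T (%x y. sw C T (%x' x''. pur C (ten C C) x' (pur C C x'' y)) x) c"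
proof (rule sw_cong[OF c])
	fix x y assume xy: "x IN C" "y IN C"
	have "Tmap (ten C C) C (comult C) (%x. x) (pur C C x y) = pur (ten C C) C (comult C x) y"
		by (rule tmap_pure[OF comult_Lin Lin_id]) (use V VV xy in auto)
	moreover have "Tlift T ?a (pur (ten C C) C (comult C x) y) = ?a (comult C x) y"
		by (rule lift_pure[OF VV V T a]) (use xy Lin_in[OF comult_Lin] in auto)
	ultimately show "Tlift T ?a (Tmap (ten C C) C (comult C) (%x. x) (pur C C x y)) = sw C T (%x' x''. pur C (ten C C) x' (pur C C x'' y)) x"
		using sw_lift[OF T b] xy by simp
qed
finally show ?thesis .
qed

lemma coassoc_right:
assumes c: "c IN C"
defines "T == ten C (ten C C)"
shows "Tmap C (ten C C) (%x. x) (comult C) (comult C c) =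
	sw C T (%x y. sw C T (%y' y''. pur C (ten C C) x (pur C C y' y'')) y) c"
proof -
note V = pre_Vec and VV = pre_ten
have T: "Vec T" unfolding T_def using V VV by (rule ten_Vec)
note p' = pur_Bilin[OF V VV, folded T_def]
have "Tmap C (ten C C) (%x. x) (comult C) (comult C c) = sw C T (%x y. Tmap C (ten C C) (%x. x) (comult C) (pur C C x y)) c"
	unfolding comult_sw[OF c] T_def by (rule Lin_sw[OF tmap_Lin]) (use comult_Lin Lin_id V VV T c pur_in[OF V V] in "auto simp: T_def")
also have "... = sw C T (%x y. sw C T (%y' y''. pur C (ten C C) x (pur C C y' y'')) y) c"
proof (rule sw_cong[OF c])
	fix x y assume xy: "x IN C" "y IN C"
	have "Tmap C (ten C C) (%x. x) (comult C) (pur C C x y) = pur C (ten C C) x (comult C y)"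
		by (rule tmap_pure[OF Lin_id comult_Lin]) (use V VV xy in auto)
	also have "... = sw C T (%y' y''. pur C (ten C C) x (pur C C y' y'')) y" unfolding comult_sw[OF xy(2)]
		by (rule Lin_sw[OF Bilin_right[OF p'] VV T]) (use xy pur_in[OF V V] in auto)
	finally show "Tmap C (ten C C) (%x. x) (comult C) (pur C C x y) = sw C T (%y' y''. pur C (ten C C) x (pur C C y' y'')) y" .
qed
finally show ?thesis .
qed

lemma coalgebraI:
assumes "!!c. c IN C ==>
		sw C (ten C (ten C C)) (%x y. sw C (ten C (ten C C)) (%x' x''. pur C (ten C C) x' (pur C C x'' y)) x) c =
		sw C (ten C (ten C C)) (%x y. sw C (ten C (ten C C)) (%y' y''. pur C (ten C C) x (pur C C y' y'')) y) c"
	and "!!c. c IN C ==> sw C C (%x y. counit C x *.$C y) c = c" and "!!c. c IN C ==> sw C C (%x y. counit C y *.$C x) c = c"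
shows "Coalg C"
proof -
note s = smult_Bilin[OF pre_Vec]
have "(%x y. counit C x *.$C y):Bilin C C C" "(%x y. counit C y *.$C x):Bilin C C C"
	by (auto intro!: BilinI' LinLR[OF s] Lin_id counit_Lin simp: counit_in)
thus ?thesis unfolding coalgebra_def using assms pre_Vec comult_Lin counit_Lin by (simp add: coassoc_left coassoc_right sweedler2_sw)
qed
end

context
fixes C :: "('k, 'a, 'c) coalg_scheme"
assumes C: "coalgebra K C"
begin
text \<open>The trilinear map \<open>tw\<close> induces a linear map on the triple tensor product;
  it is applied to both sides of coassociativity. This is the form in which coassociativity enters
  all later computations.\<close>

lemma sw_assoc:
assumes Z: "Vec Z" and t: "trilin C C C Z tw" and c: "c IN C"
shows "sw C Z (%x y. sw C Z (%x' x''. tw x' x'' y) x) c = sw C Z (%x y. sw C Z (%y' y''. tw x y' y'') y) c"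
proof -
note pre = coalg_pre[OF C]
note V = pre_Vec[OF pre] and VV = pre_ten[OF pre]
let ?T = "ten C (ten C C)"
have T: "Vec ?T" using V VV by (rule ten_Vec)
note p = pur_in[OF V V] and p' = pur_in[OF V VV]
have tb: "tw x:Bilin C C Z" if "x IN C" for x using t that unfolding trilin_def by blast
have tl: "(%x. tw x y z):Lin C Z" if "y IN C" "z IN C" for y z using t that unfolding trilin_def by blast
have b: "(%x. Tlift Z (tw x)):Bilin C (ten C C) Z" by (intro BilinI' lift_LinP[OF V V Z] lift_Lin[OF V V Z] tb V tl)
let ?L = "Tlift Z (%x. Tlift Z (tw x))"
note L = lift_Lin[OF V VV Z b]
have Lp: "?L (pur C (ten C C) x (pur C C y z)) = tw x y z" if "x IN C" "y IN C" "z IN C" for x y z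
	using lift_pure[OF V VV Z b that(1) p[OF that(2,3)]] lift_pure[OF V V Z tb[OF that(1)] that(2,3)] by simp
have "?L (sw C ?T (%x y. sw C ?T (%x' x''. pur C (ten C C) x' (pur C C x'' y)) x) c) =
		sw C Z (%x y. ?L (sw C ?T (%x' x''. pur C (ten C C) x' (pur C C x'' y)) x)) c"
	by (rule Lin_sw[OF pre L T Z c]) (auto intro!: sw_closed[OF pre T] p p')
also have "... = sw C Z (%x y. sw C Z (%x' x''. ?L (pur C (ten C C) x' (pur C C x'' y))) x) c"
	by (intro sw_cong[OF pre c] Lin_sw[OF pre L T Z] p p')
also have "... = sw C Z (%x y. sw C Z (%x' x''. tw x' x'' y) x) c" by (intro sw_cong[OF pre] c Lp)
finally have 1: "?L (sw C ?T (%x y. sw C ?T (%x' x''. pur C (ten C C) x' (pur C C x'' y)) x) c) =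
	sw C Z (%x y. sw C Z (%x' x''. tw x' x'' y) x) c" .
have "?L (sw C ?T (%x y. sw C ?T (%y' y''. pur C (ten C C) x (pur C C y' y'')) y) c) =
		sw C Z (%x y. ?L (sw C ?T (%y' y''. pur C (ten C C) x (pur C C y' y'')) y)) c"
	by (rule Lin_sw[OF pre L T Z c]) (auto intro!: sw_closed[OF pre T] p p')
also have "... = sw C Z (%x y. sw C Z (%y' y''. ?L (pur C (ten C C) x (pur C C y' y''))) y) c"
	by (intro sw_cong[OF pre c] Lin_sw[OF pre L T Z] p p')
also have "... = sw C Z (%x y. sw C Z (%y' y''. tw x y' y'') y) c" by (intro sw_cong[OF pre] c Lp)
finally show ?thesis using 1 C c coassoc_left[OF pre c] coassoc_right[OF pre c] unfolding coalgebra_def by simp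
qed

lemma sw_counit:
assumes f: "f:Lin C Z" and Z: "Vec Z" and c: "c IN C"
shows "sw C Z (%x y. counit C x *.$Z f y) c = f c" "sw C Z (%x y. counit C y *.$Z f x) c = f c"
proof -
note pre = coalg_pre[OF C]
note V = pre_Vec[OF pre] and s = smult_Bilin[OF pre_Vec[OF pre]]
note e = counit_in[OF pre]
have "(%x y. counit C x *.$C y):Bilin C C C" "(%x y. counit C y *.$C x):Bilin C C C"
	by (auto intro!: BilinI' LinLR[OF s] Lin_id counit_Lin[OF pre] simp: e)
hence 1: "sw C C (%x y. counit C x *.$C y) c = c" "sw C C (%x y. counit C y *.$C x) c = c"
	using C c sweedler2_sw[OF pre V] unfolding coalgebra_def by simp_all
have "f (sw C C (%x y. counit C x *.$C y) c) = sw C Z (%x y. f (counit C x *.$C y)) c"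
	by (rule Lin_sw[OF pre f V Z c]) (auto intro: smult_closed[OF V] e)
also have "... = sw C Z (%x y. counit C x *.$Z f y) c" by (intro sw_cong[OF pre c] Lin_smult[OF f] e)
finally show "sw C Z (%x y. counit C x *.$Z f y) c = f c" using 1 by simp
have "f (sw C C (%x y. counit C y *.$C x) c) = sw C Z (%x y. f (counit C y *.$C x)) c"
	by (rule Lin_sw[OF pre f V Z c]) (auto intro: smult_closed[OF V] e)
also have "... = sw C Z (%x y. counit C y *.$Z f x) c" by (intro sw_cong[OF pre c] Lin_smult[OF f] e)
finally show "sw C Z (%x y. counit C y *.$Z f x) c = f c" using 1 by simp
qed
end

subsection \<open>Coalgebra maps\<close>

text \<open>Interchange of two finite sums; the terms only have to lie in \<open>Z\<close>.\<close>

lemma sw_swap: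
assumes C: "precoalg C" and D: "precoalg D" and Z: "Vec Z" and c: "c IN C" and d: "d IN D"
	and g: "!!x y u v. [|x IN C; y IN C; u IN D; v IN D|] ==> ga x y u v IN Z"
shows "sw C Z (%x y. sw D Z (ga x y) d) c = sw D Z (%u v. sw C Z (%x y. ga x y u v) c) d"
unfolding sw_def
proof (rule lsum_swap[OF Z])
fix p q assume "p:set (dec C c)" "q:set (dec D d)"
hence "p:carrier C \<times> carrier C" "q:carrier D \<times> carrier D" using dec(1)[OF C c] dec(1)[OF D d] by auto
thus "ga (fst p) (snd p) (fst q) (snd q) IN Z" using g by auto
qed

lemma tmap_sw:
assumes "precoalg C" "f:Lin C V" "g:Lin C W" "Vec V" "Vec W" "c IN C"
shows "Tmap V W f g (comult C c) = sw C (ten V W) (%x y. pur V W (f x) (g y)) c"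
unfolding tensor_map_def by (rule sw_lift[OF assms(1) ten_Vec[OF assms(4,5)] comp_Bilin[OF assms(2-5)] assms(6)])

context
fixes C :: "('k, 'a, 'c) coalg_scheme" and D :: "('k, 'b, 'd) coalg_scheme"
assumes C: "precoalg C" and D: "precoalg D"
begin
lemma cm_I:
assumes "f:Lin C D"
	"!!c. c IN C ==> comult D (f c) = sw C (ten D D) (%x y. pur D D (f x) (f y)) c" "!!c. c IN C ==> counit D (f c) = counit C c"
shows "f:Cmaps C D"
using assms tmap_sw[OF C assms(1,1) pre_Vec[OF D] pre_Vec[OF D]] unfolding coalgebra_maps_def by simp

text \<open>The rule for moving a Sweedler sum along a coalgebra map, used from here on instead of
  the equation between comultiplications.\<close>

lemma cm_sw:
assumes f: "f:Cmaps C D" and Z: "Vec Z" and b: "be:Bilin D D Z" and c: "c IN C"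
shows "sw D Z be (f c) = sw C Z (%x y. be (f x) (f y)) c"
proof -
have l: "f:Lin C D" using f unfolding coalgebra_maps_def by blast
note fc = Lin_in[OF l]
note V = pre_Vec[OF D] and VV = pre_ten[OF D]
have "sw D Z be (f c) = Tlift Z be (comult D (f c))" using sw_lift[OF D Z b fc[OF c]] by simp
also have "comult D (f c) = sw C (ten D D) (%x y. pur D D (f x) (f y)) c"
	using f c tmap_sw[OF C l l V V] unfolding coalgebra_maps_def by simp
also have "Tlift Z be ... = sw C Z (%x y. Tlift Z be (pur D D (f x) (f y))) c"
	by (rule Lin_sw[OF C lift_Lin[OF V V Z b] VV Z c]) (intro pur_in[OF V V] fc)
also have "... = sw C Z (%x y. be (f x) (f y)) c" by (intro sw_cong[OF C c] lift_pure[OF V V Z b] fc)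
finally show ?thesis .
qed
end

lemma cm_Lin: "f:Cmaps C D ==> f:Lin C D"
and cm_counit: "[|f:Cmaps C D; c IN C|] ==> counit D (f c) = counit C c" unfolding coalgebra_maps_def by auto

lemma cm_comp:
assumes "precoalg C" "precoalg D" "precoalg E"
	and f: "f:Cmaps C D" and g: "g:Cmaps D E"
shows "(%x. g (f x)):Cmaps C E"
proof (rule cm_I[OF assms(1,3)])
note fl = cm_Lin[OF f] and gl = cm_Lin[OF g]
show "(%x. g (f x)):Lin C E" using fl gl by (rule Lin_comp)
fix c assume c: "c IN C"
note V = pre_Vec[OF assms(3)]
have "comult E (g (f c)) = sw D (ten E E) (%x y. pur E E (g x) (g y)) (f c)"
	using g Lin_in[OF fl c] tmap_sw[OF assms(2) gl gl V V] unfolding coalgebra_maps_def by simp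
also have "... = sw C (ten E E) (%x y. pur E E (g (f x)) (g (f y))) c"
	by (rule cm_sw[OF assms(1,2) f ten_Vec[OF V V] comp_Bilin[OF gl gl V V] c])
finally show "comult E (g (f c)) = sw C (ten E E) (%x y. pur E E (g (f x)) (g (f y))) c" .
show "counit E (g (f c)) = counit C c" using cm_counit[OF g Lin_in[OF fl c]] cm_counit[OF f c] by simp
qed
end

text \<open>Records that differ in their extension or in the fields \<open>mult\<close> and
  \<open>one\<close> carry the same vector space. Linear maps and tensor products depend only on the
  four fields compared here, which allows results to be moved between such records.\<close>

definition same_sp :: "('k, 'a, 'c) module_scheme => ('k, 'a, 'd) module_scheme => bool" where
"same_sp V W <-> carrier V = carrier W & \<zero>$V = \<zero>$W & add V = add W & smult V = smult W"

context linear_algebra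
begin
lemma Vec_same: "[|same_sp V W; Vec V|] ==> Vec W"
proof -
assume s: "same_sp V W" and V: "Vec V"
interpret module K V by (rule V)
have inv: "EX y:carrier V. y +.$V x = \<zero>$V" if "x IN V" for x using that by (intro bexI[of _ "\<ominus>$V x"]) (auto simp: M.l_neg)
have eqs: "carrier W = carrier V" "\<zero>$W = \<zero>$V" "add W = add V" "smult W = smult V" using s by (simp_all add: same_sp_def)
show ?thesis by (rule moduleI[OF cring_K abelian_groupI]) (use inv in "auto simp: eqs M.a_ac smult_l_distr smult_r_distr smult_assoc1")
qed

lemma Lin_same: "[|same_sp V V'; same_sp W W'|] ==> Lin V W = Lin V' W'"
unfolding same_sp_def linear_maps_def by simp

lemma ten_same: "[|same_sp V V'; same_sp W W'|] ==> ten V W = ten V' W'"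
and pur_same: "[|same_sp V V'; same_sp W W'|] ==> pur V W = pur V' W'"
unfolding same_sp_def tensor_def pure_tensor_def tensor_kernel_def tensor_relators_def fun_eq_iff by simp_all

lemma Bilin_same: "[|same_sp V V'; same_sp W W'; same_sp Z Z'|] ==> Bilin V W Z = Bilin V' W' Z'"
unfolding same_sp_def linear_maps_def bilinear_maps_def by simp

lemma sw_Lin_comp: "[|precoalg C; Vec Z; be:Bilin C C Z; G:Lin X C|] ==> (%x. sw C Z be (G x)):Lin X Z"
by (rule Lin_comp[OF _ sw_Lin])

lemma sw_lsum_same: "[|\<zero>$Z = \<zero>$Z'; add Z = add Z'|] ==> sw C Z = sw C Z'"
by (simp add: fun_eq_iff sw_def lsum_def)

context
fixes A :: "('k, 'a, 'x) module_scheme" and B :: "('k, 'b, 'y) module_scheme"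
	and D :: "('k, 'd, 'v) module_scheme" and Z :: "('k, 'z, 'w) module_scheme" and tw
assumes t: "trilin A B D Z tw"
begin
lemma Tri1: "[|F:Lin V A; b IN B; d IN D|] ==> (%x. tw (F x) b d):Lin V Z"
using t Lin_comp[of F V A "%a. tw a b d" Z] unfolding trilin_def by simp

lemma Tri2: "[|F:Lin V B; a IN A; d IN D|] ==> (%x. tw a (F x) d):Lin V Z"
using t LinL[of "tw a" B D Z F V d] unfolding trilin_def by simp

lemma Tri3: "[|F:Lin V D; a IN A; b IN B|] ==> (%x. tw a b (F x)):Lin V Z"
using t LinR[of "tw a" B D Z F V b] unfolding trilin_def by simp

lemma Tri_closed: "[|a IN A; b IN B; d IN D|] ==> tw a b d IN Z"
using t Bilin_in[of "tw a" B D Z b d] unfolding trilin_def by blast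
end

lemma sw_Tri_left:
assumes C: "precoalg C" and Z: "Vec Z" and t: "trilin C C D Z tw" and D: "Vec D"
shows "(%x y. sw C Z (%x' x''. tw x' x'' y) x):Bilin C D Z"
using pre_Vec[OF C] by (intro BilinI' sw_LinP[OF C Z D] sw_Lin_comp[OF C Z] Tri1[OF t] Tri2[OF t] Tri3[OF t] Lin_id)

lemma sw_Tri_right:
assumes C: "precoalg C" and Z: "Vec Z" and t: "trilin D C C Z tw" and D: "Vec D"
shows "(%x y. sw C Z (%y' y''. tw x y' y'') y):Bilin D C Z"
using pre_Vec[OF C] by (intro BilinI' sw_LinP[OF C Z D] sw_Lin_comp[OF C Z] Tri1[OF t] Tri2[OF t] Tri3[OF t] Lin_id)

subsection \<open>Bialgebras\<close>

lemma algebra_iff: "algebra_structure K V m u <-> Vec V & m:Bilin V V V & u IN V &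
(ALL x:carrier V. ALL y:carrier V. ALL z:carrier V. m (m x y) z = m x (m y z)) & (ALL x:carrier V. m u x = x & m x u = x)" (is "?L <-> ?R")
proof
assume L: ?L
let ?V = "V(|mult := m, one := u|)"
interpret r: ring ?V using L unfolding algebra_structure_def by blast
have V: "Vec V" using L unfolding algebra_structure_def by blast
have s: "m (a *.$V x) y = a *.$V m x y" "m x (a *.$V y) = a *.$V m x y" if "a IN K" "x IN V" "y IN V" for a x y
	using L that unfolding algebra_structure_def by blast+
have "m:Bilin V V V" by (rule BilinI) (use s r.m_closed r.l_distr r.r_distr in simp_all)
thus ?R using V r.m_assoc r.l_one r.r_one r.one_closed by simp
next
assume R: ?R
hence V: "Vec V" and m: "m:Bilin V V V" and u: "u IN V" by auto
let ?V = "V(|mult := m, one := u|)"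
interpret module K V by (rule V)
note b = Bilin_simps[OF m]
have inv: "EX y:carrier V. y +.$V x = \<zero>$V" if "x IN V" for x using that by (intro bexI[of _ "\<ominus>$V x"]) (auto simp: M.l_neg)
have "ring ?V"
proof (rule ringI)
	show "abelian_group ?V" by (rule abelian_groupI) (use inv in "auto simp: M.a_ac")
	show "monoid ?V" by (rule monoidI) (use R u b(5) in auto)
qed (auto simp: b(1,2))
thus ?L unfolding algebra_structure_def using V b(3,4) by auto
qed

abbreviation "TC == tensor_coalgebra K"

lemma TC_same: "same_sp (ten C D) (TC C D)"
by (simp add: same_sp_def tensor_coalgebra_def module.extend_def coalg.fields_def)

lemma TC_carrier [simp]: "carrier (TC C D) = carrier (ten C D)"
using TC_same[of C D] unfolding same_sp_def by simp

lemma srefl: "same_sp V V"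
by (simp add: same_sp_def)

context
fixes C :: "('k, 'a, 'c) coalg_scheme" and D :: "('k, 'b, 'd) coalg_scheme"
assumes C: "precoalg C" and D: "precoalg D"
begin
lemmas CV = pre_Vec[OF C] and DV = pre_Vec[OF D]

lemma TC_Vec: "Vec (TC C D)"
by (rule Vec_same[OF TC_same ten_Vec[OF CV DV]])

abbreviation "T2 == ten (ten C D) (ten C D)"
abbreviation "p2 x y == pur (ten C D) (ten C D) x y"

lemma TT_Vec: "Vec T2"
by (intro ten_Vec CV DV)

lemma interchange:
shows interchange_Lin: "tensor_interchange K C D:Lin (ten (ten C C) (ten D D)) T2"
	and interchange_pure: "[|s IN ten C C; t IN ten D D|] ==> tensor_interchange K C D (pur (ten C C) (ten D D) s t) =
		Tlift T2 (%v v'. Tlift T2 (%w w'. p2 (pur C D v w) (pur C D v' w')) t) s"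
proof -
note VV = ten_Vec[OF CV CV] ten_Vec[OF DV DV] ten_Vec[OF CV DV]
note p = pur_Bilin[OF CV DV] and q = pur_Bilin[OF VV(3) VV(3)]
note pc = pur_in[OF CV DV]
have 1: "(%w w'. p2 (pur C D v w) (pur C D v' w')):Bilin D D T2" if "v IN C" "v' IN C" for v v'
	using that by (intro BilinI' LinLR[OF q] LinR[OF p] Lin_id pc)
have 2: "(%v v'. Tlift T2 (%w w'. p2 (pur C D v w) (pur C D v' w')) t):Bilin C C T2" if "t IN ten D D" for t using that
	by (intro BilinI' lift_LinP[OF DV DV TT_Vec] 1 CV LinLR[OF q] LinL[OF p] Lin_id pc)
have 3: "(%s t. Tlift T2 (%v v'. Tlift T2 (%w w'. p2 (pur C D v w) (pur C D v' w')) t) s) :Bilin (ten C C) (ten D D) T2"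
	by (intro BilinI' lift_Lin[OF CV CV TT_Vec] 2 lift_LinP[OF CV CV TT_Vec] lift_Lin[OF DV DV TT_Vec] 1 VV)
show "tensor_interchange K C D:Lin (ten (ten C C) (ten D D)) T2"
	unfolding tensor_interchange_def Let_def by (rule lift_Lin[OF VV(1,2) TT_Vec 3])
show "[|s IN ten C C; t IN ten D D|] ==> tensor_interchange K C D (pur (ten C C) (ten D D) s t) =
		Tlift T2 (%v v'. Tlift T2 (%w w'. p2 (pur C D v w) (pur C D v' w')) t) s"
	unfolding tensor_interchange_def Let_def by (rule lift_pure[OF VV(1,2) TT_Vec 3])
qed

lemma TC_comult_pure:
assumes xy: "x IN C" "y IN D"
shows "comult (TC C D) (pur C D x y) =
	sw C T2 (%x1 x2. sw D T2 (%y1 y2. p2 (pur C D x1 y1) (pur C D x2 y2)) y) x"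
proof -
note VV = ten_Vec[OF CV CV] ten_Vec[OF DV DV] ten_Vec[OF CV DV]
note p = pur_Bilin[OF CV DV] and q = pur_Bilin[OF VV(3) VV(3)]
note pc = pur_in[OF CV DV]
have 1: "(%w w'. p2 (pur C D v w) (pur C D v' w')):Bilin D D T2" if "v IN C" "v' IN C" for v v'
	using that by (intro BilinI' LinLR[OF q] LinR[OF p] Lin_id pc)
have 2: "(%v v'. Tlift T2 (%w w'. p2 (pur C D v w) (pur C D v' w')) t):Bilin C C T2" if "t IN ten D D" for t using that
	by (intro BilinI' lift_LinP[OF DV DV TT_Vec] 1 CV LinLR[OF q] LinL[OF p] Lin_id pc)
have c: "comult C x IN ten C C" "comult D y IN ten D D" using Lin_in[OF comult_Lin[OF C]] Lin_in[OF comult_Lin[OF D]] xy by auto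
have "comult (TC C D) (pur C D x y) = tensor_interchange K C D (Tmap (ten C C) (ten D D) (comult C) (comult D) (pur C D x y))"
	by (simp add: tensor_coalgebra_def module.extend_def coalg.fields_def)
also have "... = Tlift T2 (%v v'. Tlift T2 (%w w'. p2 (pur C D v w) (pur C D v' w')) (comult D y)) (comult C x)"
	using tmap_pure[OF comult_Lin[OF C] comult_Lin[OF D] CV DV VV(1,2) xy] interchange_pure[OF c] by simp
also have "... = sw C T2 (%v v'. Tlift T2 (%w w'. p2 (pur C D v w) (pur C D v' w')) (comult D y)) x"
	by (rule sw_lift[OF C TT_Vec 2[OF c(2)] xy(1)])
also have "... = sw C T2 (%x1 x2. sw D T2 (%y1 y2. p2 (pur C D x1 y1) (pur C D x2 y2)) y) x"
	by (intro sw_cong[OF C xy(1)] sw_lift[OF D TT_Vec 1 xy(2)])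
finally show ?thesis .
qed

lemma counit_Bilin: "(%c d. counit C c \<otimes>$K counit D d):Bilin C D Base"
using LinL[OF smult_Bilin[OF base_Vec] counit_Lin[OF C]] LinR[OF smult_Bilin[OF base_Vec] counit_Lin[OF D]]
by (intro BilinI') (simp_all add: counit_in[OF C] counit_in[OF D])

lemma TC_counit_pure:
"[|x IN C; y IN D|] ==> counit (TC C D) (pur C D x y) = counit C x \<otimes>$K counit D y" using lift_pure[OF CV DV base_Vec counit_Bilin]
by (simp add: tensor_coalgebra_def module.extend_def coalg.fields_def)

lemma TC_pre: "precoalg (TC C D)"
unfolding precoalg_def
proof (intro conjI TC_Vec)
note VV = ten_Vec[OF CV CV] ten_Vec[OF DV DV] ten_Vec[OF CV DV]
have "(%t. tensor_interchange K C D (Tmap (ten C C) (ten D D) (comult C) (comult D) t)):Lin (ten C D) T2"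
	by (rule Lin_comp[OF tmap_Lin[OF comult_Lin[OF C] comult_Lin[OF D] CV DV VV(1,2)] interchange_Lin])
thus "comult (TC C D):Lin (TC C D) (ten (TC C D) (TC C D))"
	unfolding ten_same[OF TC_same TC_same, symmetric] Lin_same[OF TC_same srefl, symmetric]
	by (simp add: tensor_coalgebra_def module.extend_def coalg.fields_def)
show "counit (TC C D):Lin (TC C D) Base" using lift_Lin[OF CV DV base_Vec counit_Bilin] unfolding Lin_same[OF TC_same srefl, symmetric]
	by (simp add: tensor_coalgebra_def module.extend_def coalg.fields_def)
qed

lemma TC_ext:
assumes "f:Lin (TC C D) Z" "g:Lin (TC C D) Z" "Vec Z"
	and "!!v w. [|v IN C; w IN D|] ==> f (pur C D v w) = g (pur C D v w)" and "t IN ten C D"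
shows "f t = g t"
by (rule tensor_ext[OF CV DV, of f Z g]) (use assms Lin_same[OF TC_same[of C D] srefl[of Z]] in auto)

lemma sw_TC:
assumes Z: "Vec Z" and b: "be:Bilin (TC C D) (TC C D) Z" and xy: "x IN C" "y IN D"
shows "sw (TC C D) Z be (pur C D x y) =
	sw C Z (%x1 x2. sw D Z (%y1 y2. be (pur C D x1 y1) (pur C D x2 y2)) y) x"
proof -
note VV = ten_Vec[OF CV DV]
note pc = pur_in[OF CV DV] and qc = pur_in[OF VV VV]
have b': "be:Bilin (ten C D) (ten C D) Z" using b Bilin_same[OF TC_same[of C D] TC_same[of C D] srefl[of Z]] by simp
note L = lift_Lin[OF VV VV Z b']
have "sw (TC C D) Z be (pur C D x y) = Tlift Z be (comult (TC C D) (pur C D x y))" using sw_lift[OF TC_pre Z b] pc[OF xy] by simp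
also have "... = sw C Z (%x1 x2. Tlift Z be (sw D T2 (%y1 y2. p2 (pur C D x1 y1) (pur C D x2 y2)) y)) x" unfolding TC_comult_pure[OF xy]
	by (rule Lin_sw[OF C L TT_Vec Z xy(1)]) (intro sw_closed[OF D TT_Vec xy(2)] pc qc)
also have "... = sw C Z (%x1 x2. sw D Z (%y1 y2. Tlift Z be (p2 (pur C D x1 y1) (pur C D x2 y2))) y) x"
	by (intro sw_cong[OF C xy(1)] Lin_sw[OF D L TT_Vec Z xy(2)] pc qc)
also have "... = sw C Z (%x1 x2. sw D Z (%y1 y2. be (pur C D x1 y1) (pur C D x2 y2)) y) x"
	by (intro sw_cong[OF C xy(1)] sw_cong[OF D xy(2)] lift_pure[OF VV VV Z b'] pc)
finally show ?thesis .
qed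
end

lemma pur_Bilin_TC: "[|precoalg C; precoalg D|] ==> pur C D:Bilin C D (TC C D)"
using pur_Bilin[OF pre_Vec pre_Vec] Bilin_same[OF srefl srefl TC_same] by blast

text \<open>On a pure tensor the sums over \<open>C\<close> and over \<open>D\<close> are
  interleaved. \<open>sw_swap\<close> separates them, coassociativity is applied in each factor, and
  the sums are interleaved again; the counit laws are handled factor by factor.\<close>

lemma TC_coalgebra:
fixes C :: "('k, 'a, 'c) coalg_scheme" and D :: "('k, 'b, 'd) coalg_scheme"
assumes C: "Coalg C" and D: "Coalg D"
shows "Coalg (TC C D)"
proof (rule coalgebraI)
note pC = coalg_pre[OF C] and pD = coalg_pre[OF D]
note CV = pre_Vec[OF pC] and DV = pre_Vec[OF pD]
let ?T = "TC C D"
show T: "precoalg ?T" by (rule TC_pre[OF pC pD])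
note TV = pre_Vec[OF T]
note p = pur_Bilin_TC[OF pC pD]
note pc = pur_in[OF CV DV]
let ?Z = "ten ?T (ten ?T ?T)"
have Z: "Vec ?Z" by (intro ten_Vec TV)
let ?t = "%x y z. pur ?T (ten ?T ?T) x (pur ?T ?T y z)"
note q = pur_Bilin[OF TV TV] and q' = pur_Bilin[OF TV ten_Vec[OF TV TV]]
have t: "trilin ?T ?T ?T ?Z ?t" by (intro trilinI LinLR[OF q'] LinLR[OF q] Lin_id Bilin_in[OF q])
note tc = Tri_closed[OF t, unfolded TC_carrier]
note bl = sw_Tri_left[OF T Z t TV] and br = sw_Tri_right[OF T Z t TV]
show "sw ?T ?Z (%x y. sw ?T ?Z (%x' x''. ?t x' x'' y) x) c = sw ?T ?Z (%x y. sw ?T ?Z (%y' y''. ?t x y' y'') y) c" if "c IN ?T" for c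
proof (rule TC_ext[OF pC pD sw_Lin[OF T Z bl] sw_Lin[OF T Z br] Z])
	fix x y assume xy: "x IN C" "y IN D"
	let ?p = "pur C D"
	have bt1: "(%s s'. ?t s s' s''):Bilin ?T ?T ?Z" if "s'' IN ?T" for s'' using that by (intro BilinI' Tri1[OF t] Tri2[OF t] Lin_id)
	have bt2: "(%s' s''. ?t s s' s''):Bilin ?T ?T ?Z" if "s IN ?T" for s using that by (intro BilinI' Tri2[OF t] Tri3[OF t] Lin_id)
	have tri1: "trilin D D D ?Z (%c d e. ?t (?p a c) (?p b d) (?p x e))" if "a IN C" "b IN C" "x IN C" for a b x
		using that by (intro trilinI Tri1[OF t] Tri2[OF t] Tri3[OF t] LinR[OF p] Lin_id) (auto intro: pc)
	have tri2: "trilin C C C ?Z (%a b x. sw D ?Z (%y1 y2. sw D ?Z (%c d. ?t (?p a y1) (?p b c) (?p x d)) y2) y)"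
		by (intro trilinI sw_LinP[OF pD Z CV xy(2)] sw_LinP[OF pD Z CV] Tri1[OF t] Tri2[OF t] Tri3[OF t] LinL[OF p] Lin_id) (auto intro: pc)
	have "sw ?T ?Z (%x y. sw ?T ?Z (%x' x''. ?t x' x'' y) x) (?p x y) =
		sw C ?Z (%x1 x2. sw D ?Z (%y1 y2. sw ?T ?Z (%x' x''. ?t x' x'' (?p x2 y2)) (?p x1 y1)) y) x" by (rule sw_TC[OF pC pD Z bl xy])
	also have "... = sw C ?Z (%x1 x2. sw D ?Z (%y1 y2. sw C ?Z (%a b. sw D ?Z (%c d.
			?t (?p a c) (?p b d) (?p x2 y2)) y1) x1) y) x" by (intro sw_cong[OF pC] sw_cong[OF pD] xy sw_TC[OF pC pD Z] bt1) (auto intro: pc)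
	also have "... = sw C ?Z (%x1 x2. sw C ?Z (%a b. sw D ?Z (%y1 y2. sw D ?Z (%c d.
			?t (?p a c) (?p b d) (?p x2 y2)) y1) y) x1) x" by (intro sw_cong[OF pC xy(1)] sw_swap[OF pD pC Z xy(2)] sw_closed[OF pD Z] tc pc)
	also have "... = sw C ?Z (%x1 x2. sw C ?Z (%a b. sw D ?Z (%y1 y2. sw D ?Z (%c d.
			?t (?p a y1) (?p b c) (?p x2 d)) y2) y) x1) x" by (intro sw_cong[OF pC] xy sw_assoc[OF D Z tri1])
	also have "... = sw C ?Z (%x1 x2. sw C ?Z (%a b. sw D ?Z (%y1 y2. sw D ?Z (%c d.
			?t (?p x1 y1) (?p a c) (?p b d)) y2) y) x2) x" by (rule sw_assoc[OF C Z tri2 xy(1)])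
	also have "... = sw C ?Z (%x1 x2. sw D ?Z (%y1 y2. sw C ?Z (%a b. sw D ?Z (%c d.
			?t (?p x1 y1) (?p a c) (?p b d)) y2) x2) y) x" by (intro sw_cong[OF pC xy(1)] sw_swap[OF pC pD Z _ xy(2)] sw_closed[OF pD Z] tc pc)
	also have "... = sw C ?Z (%x1 x2. sw D ?Z (%y1 y2. sw ?T ?Z (%y' y''. ?t (?p x1 y1) y' y'') (?p x2 y2)) y) x"
		by (intro sw_cong[OF pC] sw_cong[OF pD] xy sw_TC[OF pC pD Z, symmetric] bt2) (auto intro: pc)
	also have "... = sw ?T ?Z (%x y. sw ?T ?Z (%y' y''. ?t x y' y'') y) (?p x y)" by (rule sw_TC[OF pC pD Z br xy, symmetric])
	finally show "sw ?T ?Z (%x y. sw ?T ?Z (%x' x''. ?t x' x'' y) x) (?p x y) = sw ?T ?Z (%x y. sw ?T ?Z (%y' y''. ?t x y' y'') y) (?p x y)" .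
qed (use that in simp)
note s = smult_Bilin[OF TV] and e = counit_Lin[OF T]
have e1: "(%x y. counit ?T x *.$?T y):Bilin ?T ?T ?T" and e2: "(%x y. counit ?T y *.$?T x):Bilin ?T ?T ?T"
	using counit_in[OF T] by (auto intro!: BilinI' LinLR[OF s] Lin_id e)
have split: "counit ?T (pur C D a b) *.$?T pur C D x y = counit C a *.$?T (pur C D x (counit D b *.$D y))"
	if "a IN C" "b IN D" "x IN C" "y IN D" for a b x y
	using that Lin_smult[OF Bilin_right[OF p]] smult_smult[OF TV] counit_in[OF pC] counit_in[OF pD] pc by (simp add: TC_counit_pure[OF pC pD])
have inner: "sw D ?T (%y1 y2. counit C a *.$?T (pur C D x (be y1 y2))) y = counit C a *.$?T pur C D x y"
	if "sw D D be y = y" "!!y1 y2. [|y1 IN D; y2 IN D|] ==> be y1 y2 IN D" "a IN C" "x IN C" "y IN D" for a x y be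
	using Lin_sw[OF pD LinR[OF s LinR[OF p Lin_id that(4)], of "counit C a"] DV TV that(5), of be] that counit_in[OF pC] by simp
note ce = counit_in[OF pC] counit_in[OF pD] smult_closed[OF DV] smult_closed[OF CV]
show "sw ?T ?T (%x y. counit ?T x *.$?T y) c = c" if "c IN ?T" for c
proof (rule TC_ext[OF pC pD sw_Lin[OF T TV e1] Lin_id TV])
	fix x y assume xy: "x IN C" "y IN D"
	have "sw ?T ?T (%x y. counit ?T x *.$?T y) (pur C D x y) =
			sw C ?T (%x1 x2. sw D ?T (%y1 y2. counit C x1 *.$?T (pur C D x2 (counit D y1 *.$D y2))) y) x"
		unfolding sw_TC[OF pC pD TV e1 xy] by (intro sw_cong[OF pC] sw_cong[OF pD] xy split)
	also have "... = sw C ?T (%x1 x2. counit C x1 *.$?T pur C D x2 y) x" using xy by (intro sw_cong[OF pC] inner sw_counit[OF D Lin_id DV] ce)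
	also have "... = pur C D x y" by (rule sw_counit(1)[OF C LinL[OF p Lin_id xy(2)] TV xy(1)])
	finally show "sw ?T ?T (%x y. counit ?T x *.$?T y) (pur C D x y) = pur C D x y" .
qed (use that in simp)
show "sw ?T ?T (%x y. counit ?T y *.$?T x) c = c" if "c IN ?T" for c
proof (rule TC_ext[OF pC pD sw_Lin[OF T TV e2] Lin_id TV])
	fix x y assume xy: "x IN C" "y IN D"
	have "sw ?T ?T (%x y. counit ?T y *.$?T x) (pur C D x y) =
			sw C ?T (%x1 x2. sw D ?T (%y1 y2. counit C x2 *.$?T (pur C D x1 (counit D y2 *.$D y1))) y) x"
		unfolding sw_TC[OF pC pD TV e2 xy] by (intro sw_cong[OF pC] sw_cong[OF pD] xy split)
	also have "... = sw C ?T (%x1 x2. counit C x2 *.$?T pur C D x1 y) x" using xy by (intro sw_cong[OF pC] inner sw_counit[OF D Lin_id DV] ce)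
	also have "... = pur C D x y" by (rule sw_counit(2)[OF C LinL[OF p Lin_id xy(2)] TV xy(1)])
	finally show "sw ?T ?T (%x y. counit ?T y *.$?T x) (pur C D x y) = pur C D x y" .
qed (use that in simp)
qed
end

context linear_algebra
begin
lemma base_same: "same_sp Base BaseC"
by (simp add: same_sp_def base_coalgebra_def module.extend_def coalg.fields_def)

lemma base_simps: "carrier BaseC = carrier K"
"comult BaseC a = pur Base Base a \<one>$K" "counit BaseC a = a"
by (simp_all add: base_coalgebra_def module.extend_def coalg.fields_def base_module_def)

lemma unit_map_Lin: "[|Vec V; u IN V|] ==> (%a. a *.$V u):Lin Base V"
by (rule LinL[OF smult_Bilin Lin_id])

text \<open>Linear maps on the tensor square are compared on pure tensors, and maps on the base
  field at \<open>\<one>$K\<close>. The requirements that multiplication and unit be coalgebra maps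
  thereby become Sweedler identities for elements.\<close>

lemma bialgebra_iff:
fixes C :: "('k, 'a, 'c) coalg_scheme"
defines "T == ten C C"
shows "Bialg C m u <-> Coalg C & algebra_structure K C m u &
	(ALL x:carrier C. ALL y:carrier C. comult C (m x y) = sw C T (%x1 x2. sw C T (%y1 y2. pur C C (m x1 y1) (m x2 y2)) y) x) &
	(ALL x:carrier C. ALL y:carrier C. counit C (m x y) = counit C x \<otimes>$K counit C y) &
	comult C u = pur C C u u & counit C u = \<one>$K"
proof (cases "Coalg C & algebra_structure K C m u")
case True
hence pC: "precoalg C" and CV: "Vec C" and m: "m:Bilin C C C" and u: "u IN C" and one: "m u u = u"
	using coalg_pre[of C] by (simp_all add: algebra_iff)
have TV: "Vec T" unfolding T_def using CV by (intro ten_Vec)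
note p = pur_Bilin[OF CV CV, folded T_def] and pc = pur_in[OF CV CV, folded T_def]
let ?M = "Tlift C m"
have M: "?M:Lin (ten C C) C" by (rule lift_Lin[OF CV CV CV m])
hence M': "?M:Lin (TC C C) C" using Lin_same[OF TC_same srefl] by blast
have Mp: "?M (pur C C x y) = m x y" if "x IN C" "y IN C" for x y using lift_pure[OF CV CV CV m that] .
note TCp = TC_pre[OF pC pC]
have b: "(%s t. pur C C (?M s) (?M t)):Bilin (TC C C) (TC C C) T" using comp_Bilin[OF M' M' CV CV] by (simp add: T_def)
have map_sw: "Tmap C C ?M ?M (comult (TC C C) t) = sw (TC C C) T (%s t. pur C C (?M s) (?M t)) t" if "t IN TC C C" for t
	unfolding T_def by (rule tmap_sw[OF TCp M' M' CV CV that])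
have pure: "sw (TC C C) T (%s t. pur C C (?M s) (?M t)) (pur C C x y) = sw C T (%x1 x2. sw C T (%y1 y2. pur C C (m x1 y1) (m x2 y2)) y) x"
	if "x IN C" "y IN C" for x y unfolding sw_TC[OF pC pC TV b that] using that by (intro sw_cong[OF pC]) (auto simp: Mp)
have 1: "(ALL t:carrier (TC C C). comult C (?M t) = Tmap C C ?M ?M (comult (TC C C) t)) <->
	(ALL x:carrier C. ALL y:carrier C. comult C (m x y) = sw C T (%x1 x2. sw C T (%y1 y2. pur C C (m x1 y1) (m x2 y2)) y) x)" (is "?A <-> ?B")
proof
	assume A: ?A
	show ?B
	proof (intro ballI)
		fix x y assume xy: "x IN C" "y IN C"
		hence t: "pur C C x y IN TC C C" using pc by (simp add: T_def)
		hence "comult C (?M (pur C C x y)) = Tmap C C ?M ?M (comult (TC C C) (pur C C x y))" using A by blast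
		thus "comult C (m x y) = sw C T (%x1 x2. sw C T (%y1 y2. pur C C (m x1 y1) (m x2 y2)) y) x" using map_sw[OF t] pure xy by (simp add: Mp)
	qed
next
	assume B: ?B
	show ?A
	proof
		fix t assume t: "t IN TC C C"
		have "comult C (?M t) = sw (TC C C) T (%s t. pur C C (?M s) (?M t)) t"
			by (rule TC_ext[OF pC pC Lin_comp[OF M' comult_Lin[OF pC, folded T_def]] sw_Lin[OF TCp TV b] TV]) (use t B in "auto simp: Mp pure")
		thus "comult C (?M t) = Tmap C C ?M ?M (comult (TC C C) t)" using map_sw[OF t] by simp
	qed
qed
have 2: "(ALL t:carrier (TC C C). counit C (?M t) = counit (TC C C) t) <->
	(ALL x:carrier C. ALL y:carrier C. counit C (m x y) = counit C x \<otimes>$K counit C y)" (is "?A <-> ?B")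
proof
	assume A: ?A
	show ?B
	proof (intro ballI)
		fix x y assume xy: "x IN C" "y IN C"
		hence t: "pur C C x y IN TC C C" using pc by (simp add: T_def)
		hence "counit C (?M (pur C C x y)) = counit (TC C C) (pur C C x y)" using A by blast
		thus "counit C (m x y) = counit C x \<otimes>$K counit C y" using TC_counit_pure[OF pC pC xy] Mp[OF xy] by simp
	qed
next
	assume B: ?B
	show ?A
	proof
		fix t assume t: "t IN TC C C"
		show "counit C (?M t) = counit (TC C C) t"
		proof (rule TC_ext[OF pC pC Lin_comp[OF M' counit_Lin[OF pC]] counit_Lin[OF TCp] base_Vec])
			fix x y assume xy: "x IN C" "y IN C"
			thus "counit C (?M (pur C C x y)) = counit (TC C C) (pur C C x y)" using B TC_counit_pure[OF pC pC xy] Mp[OF xy] by simp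
		qed (use t in simp)
	qed
qed
let ?U = "%a. a *.$C u"
note U = unit_map_Lin[OF CV u]
have U': "?U:Lin BaseC C" using U Lin_same[OF base_same srefl] by blast
have one_u: "\<one>$K *.$C u = u" by (rule smult_one[OF CV u])
have Um: "Tmap C C ?U ?U (comult BaseC a) = a *.$T pur C C u u" if "a IN K" for a unfolding base_simps
	using tmap_pure[OF U U base_Vec base_Vec CV CV, of a "\<one>$K"] that K_closed(2) one_u Lin_smult[OF Bilin_left[OF p u] that u] by simp
have 3: "(ALL a:carrier K. comult C (?U a) = Tmap C C ?U ?U (comult BaseC a)) <-> comult C u = pur C C u u" (is "?A <-> ?B")
proof
	assume ?A
	hence "comult C (?U \<one>$K) = Tmap C C ?U ?U (comult BaseC \<one>$K)" using K_closed(2) by blast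
	thus ?B using Um[OF K_closed(2)] one_u smult_one[OF TV pc[OF u u]] by simp
next
	assume ?B
	thus ?A using Um Lin_smult[OF comult_Lin[OF pC, folded T_def] _ u] by simp
qed
interpret cring K by (rule cring_K)
have 4: "(ALL a:carrier K. counit C (?U a) = counit BaseC a) <-> counit C u = \<one>$K"
	using Lin_smult[OF counit_Lin[OF pC] _ u] K_closed(2) counit_in[OF pC u] by (auto simp: base_simps dest: bspec[of _ _ "\<one>$K"])
have "Bialg C m u <-> (ALL t:carrier (TC C C). comult C (?M t) = Tmap C C ?M ?M (comult (TC C C) t)) &
	(ALL t:carrier (TC C C). counit C (?M t) = counit (TC C C) t) & (ALL a:carrier K. comult C (?U a) = Tmap C C ?U ?U (comult BaseC a)) &
	(ALL a:carrier K. counit C (?U a) = counit BaseC a)" unfolding bialgebra_def coalgebra_maps_def using True M' U'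
	by (auto simp: base_simps(1))
thus ?thesis unfolding 1 2 3 4 using True by simp
qed (auto simp: bialgebra_def)

context
fixes H :: "('k, 'a, 'c) coalg_scheme" and m u
assumes B: "bialgebra K H m u"
begin
lemma bi_coalgebra: "Coalg H" and bi_Bil: "m:Bilin H H H" and bi_unit: "u IN H"
and bi_assoc: "[|x IN H; y IN H; z IN H|] ==> m (m x y) z = m x (m y z)" and bi_one: "x IN H ==> m u x = x" "x IN H ==> m x u = x"
and bi_counit: "[|x IN H; y IN H|] ==> counit H (m x y) = counit H x \<otimes>$K counit H y"
and bi_comult_unit: "comult H u = pur H H u u" and bi_counit_unit: "counit H u = \<one>$K"
and bi_comult: "[|x IN H; y IN H|] ==> comult H (m x y) = sw H (ten H H) (%x1 x2. sw H (ten H H) (%y1 y2. pur H H (m x1 y1) (m x2 y2)) y) x"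
using B unfolding bialgebra_iff algebra_iff by blast+

lemma bi_closed: "[|x IN H; y IN H|] ==> m x y IN H"
using Bilin_in[OF bi_Bil] .

lemmas bi_pre = coalg_pre[OF bi_coalgebra]
lemmas bi_Vec = pre_Vec[OF bi_pre]

lemma sw_mult:
assumes Z: "Vec Z" and b: "be:Bilin H H Z" and xy: "x IN H" "y IN H"
shows "sw H Z be (m x y) = sw H Z (%x1 x2. sw H Z (%y1 y2. be (m x1 y1) (m x2 y2)) y) x"
proof -
note V = bi_Vec and VV = ten_Vec[OF bi_Vec bi_Vec] and pc = pur_in[OF bi_Vec bi_Vec]
note L = lift_Lin[OF V V Z b]
have "sw H Z be (m x y) = Tlift Z be (comult H (m x y))" using sw_lift[OF bi_pre Z b] bi_closed xy by simp
also have "... = sw H Z (%x1 x2. Tlift Z be (sw H (ten H H) (%y1 y2. pur H H (m x1 y1) (m x2 y2)) y)) x" unfolding bi_comult[OF xy]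
	by (intro Lin_sw[OF bi_pre L VV Z] sw_closed[OF bi_pre VV] xy pc bi_closed)
also have "... = sw H Z (%x1 x2. sw H Z (%y1 y2. Tlift Z be (pur H H (m x1 y1) (m x2 y2))) y) x"
	by (intro sw_cong[OF bi_pre] Lin_sw[OF bi_pre L VV Z] xy pc bi_closed)
also have "... = sw H Z (%x1 x2. sw H Z (%y1 y2. be (m x1 y1) (m x2 y2)) y) x"
	by (intro sw_cong[OF bi_pre] lift_pure[OF V V Z b] xy bi_closed)
finally show ?thesis .
qed

lemma sw_unit: "[|Vec Z; be:Bilin H H Z|] ==> sw H Z be u = be u u"
using sw_lift[OF bi_pre _ _ bi_unit, of Z be] lift_pure[OF bi_Vec bi_Vec _ _ bi_unit bi_unit, of Z be] by (simp add: bi_comult_unit)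

lemma anti_iff: "Antip H m u S <-> S:Lin H H & (ALL c:carrier H.
	sw H H (%x y. m (S x) y) c = counit H c *.$H u & sw H H (%x y. m x (S y)) c = counit H c *.$H u)"
proof (cases "S:Lin H H")
case True
have "(%x y. m (S x) y):Bilin H H H" "(%x y. m x (S y)):Bilin H H H"
	by (intro BilinI' LinLR[OF bi_Bil] True Lin_id Lin_in[OF True]; assumption)+
thus ?thesis unfolding antipode_def using True sweedler2_sw[OF bi_pre bi_Vec] by simp
qed (simp add: antipode_def)
end

subsection \<open>Antipodes\<close>

text \<open>In the convolution algebra of linear maps from \<open>C\<close> to \<open>A\<close>, a
  left inverse \<open>f\<close> and a right inverse \<open>h\<close> of \<open>g\<close> coincide:
  \<open>f = f (g h) = (f g) h = h\<close>. The counit laws insert and remove the convolution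
  unit.\<close>

lemma conv_inv_unique:
assumes C: "Coalg C" and A: "Vec A" and m: "mm:Bilin A A A" and e: "e IN A"
	and assoc: "!!x y z. [|x IN A; y IN A; z IN A|] ==> mm (mm x y) z = mm x (mm y z)"
	and one: "!!x. x IN A ==> mm e x = x" "!!x. x IN A ==> mm x e = x" and f: "f:Lin C A" and g: "g:Lin C A" and h: "h:Lin C A"
	and fg: "!!c. c IN C ==> sw C A (%x y. mm (f x) (g y)) c = counit C c *.$A e"
	and gh: "!!c. c IN C ==> sw C A (%x y. mm (g x) (h y)) c = counit C c *.$A e" and c: "c IN C"
shows "f c = h c"
proof -
note pC = coalg_pre[OF C]
note fc = Lin_in[OF f] Lin_in[OF g] Lin_in[OF h] Bilin_in[OF m]
have t: "trilin C C C A (%x y z. mm (f x) (mm (g y) (h z)))" by (intro trilinI LinLR[OF m] f g h fc)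
have "f c = sw C A (%x y. counit C y *.$A f x) c" by (rule sw_counit(2)[OF C f A c, symmetric])
also have "... = sw C A (%x y. mm (f x) (sw C A (%y1 y2. mm (g y1) (h y2)) y)) c" by (intro sw_cong[OF pC c])
		(simp add: gh Lin_smult[OF Bilin_right[OF m]] e fc one counit_in[OF pC])
also have "... = sw C A (%x y. sw C A (%y1 y2. mm (f x) (mm (g y1) (h y2))) y) c"
	by (intro sw_cong[OF pC c] Lin_sw[OF pC Bilin_right[OF m] A A] fc)
also have "... = sw C A (%x y. sw C A (%x1 x2. mm (f x1) (mm (g x2) (h y))) x) c" by (rule sw_assoc[OF C A t c, symmetric])
also have "... = sw C A (%x y. sw C A (%x1 x2. mm (mm (f x1) (g x2)) (h y)) x) c" by (intro sw_cong[OF pC] c assoc[symmetric] fc)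
also have "... = sw C A (%x y. mm (sw C A (%x1 x2. mm (f x1) (g x2)) x) (h y)) c"
	by (intro sw_cong[OF pC c] Lin_sw[OF pC Bilin_left[OF m] A A, symmetric] fc)
also have "... = sw C A (%x y. counit C x *.$A h y) c" by (intro sw_cong[OF pC c])
		(simp add: fg Lin_smult[OF Bilin_left[OF m]] e fc one counit_in[OF pC])
also have "... = h c" by (rule sw_counit(1)[OF C h A c])
finally show ?thesis .
qed

text \<open>\<open>f\<close> after \<open>S\<close> is a left and \<open>T\<close> after
  \<open>f\<close> a right convolution inverse of \<open>f\<close>. Hence antipodes are preserved by
  bialgebra maps and descend to directed colimits.\<close>

lemma antipode_natural:
assumes H: "Bialg H m u" and L: "Bialg L n v"
	and S: "Antip H m u S" and T: "Antip L n v T" and f: "f:Cmaps H L" and fm: "algebra_map H m u n v f" and c: "c IN H"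
shows "f (S c) = T (f c)"
proof -
note pH = bi_pre[OF H] and HV = bi_Vec[OF H] and LV = bi_Vec[OF L] and pL = bi_pre[OF L]
have Sl: "S:Lin H H" and S1: "!!c. c IN H ==> sw H H (%x y. m (S x) y) c = counit H c *.$H u" using S anti_iff[OF H] by auto
have Tl: "T:Lin L L" and T2: "!!c. c IN L ==> sw L L (%x y. n x (T y)) c = counit L c *.$L v" using T anti_iff[OF L] by auto
have fl: "f:Lin H L" by (rule cm_Lin[OF f])
have fm': "f (m x y) = n (f x) (f y)" if "x IN H" "y IN H" for x y using fm that unfolding algebra_map_def by blast
have fu: "f u = v" using fm unfolding algebra_map_def by blast
note cl = Lin_in[OF Sl] Lin_in[OF Tl] Lin_in[OF fl] bi_closed[OF H] bi_closed[OF L]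
have b: "(%x y. n x (T y)):Bilin L L L" by (intro BilinI' LinLR[OF bi_Bil[OF L]] Tl Lin_id cl)
show ?thesis
proof (rule conv_inv_unique[OF bi_coalgebra[OF H] LV bi_Bil[OF L] bi_unit[OF L] bi_assoc[OF L]
			bi_one[OF L] Lin_comp[OF Sl fl] fl Lin_comp[OF fl Tl] _ _ c])
	fix c assume c: "c IN H"
	have "sw H L (%x y. n (f (S x)) (f y)) c = sw H L (%x y. f (m (S x) y)) c" by (intro sw_cong[OF pH c]) (simp add: fm' cl)
	also have "... = f (sw H H (%x y. m (S x) y) c)" by (intro Lin_sw[OF pH fl HV LV c, symmetric] cl)
	finally show "sw H L (%x y. n (f (S x)) (f y)) c = counit H c *.$L v"
		using S1[OF c] Lin_smult[OF fl counit_in[OF pH c] bi_unit[OF H]] fu by simp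
	have "sw H L (%x y. n (f x) (T (f y))) c = sw L L (%x y. n x (T y)) (f c)" by (rule cm_sw[OF pH pL f LV b c, symmetric])
	thus "sw H L (%x y. n (f x) (T (f y))) c = counit H c *.$L v" using T2[OF cl(3)[OF c]] cm_counit[OF f c] by simp
qed auto
qed

text \<open>Anti-comultiplicativity of the antipode. In the convolution algebra of maps from
  \<open>H\<close> to its tensor square, the comultiplication has the left side as a left inverse
  and the right side as a right inverse.\<close>

lemma antipode_comult:
assumes H: "Bialg H m u" and S: "Antip H m u S" and c: "c IN H"
shows "comult H (S c) = sw H (ten H H) (%x y. pur H H (S y) (S x)) c"
proof -
note pH = bi_pre[OF H] and V = bi_Vec[OF H] and cH = bi_coalgebra[OF H]
let ?T = "ten H H" and ?p = "pur H H"
have T: "Vec ?T" using V by (intro ten_Vec)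
note p = pur_Bilin[OF V V] and pc = pur_in[OF V V] and mb = bi_Bil[OF H] and mc = bi_closed[OF H]
note u = bi_unit[OF H]
have Sl: "S:Lin H H" and S1: "!!c. c IN H ==> sw H H (%x y. m (S x) y) c = counit H c *.$H u"
	and S2: "!!c. c IN H ==> sw H H (%x y. m x (S y)) c = counit H c *.$H u" using S anti_iff[OF H] by auto
note sc = Lin_in[OF Sl] and ec = counit_in[OF pH]
\<comment> \<open>The componentwise multiplication of the tensor square, written as a nested lift;
  its associativity and unit laws are verified on pure tensors.\<close>
let ?mu = "%s t. Tlift ?T (%a b. Tlift ?T (%d e. ?p (m a d) (m b e)) t) s"
have b1: "(%d e. ?p (m a d) (m b e)):Bilin H H ?T" if "a IN H" "b IN H" for a b
	using that by (intro BilinI' LinLR[OF p] LinR[OF mb] Lin_id mc)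
have b2: "(%a b. Tlift ?T (%d e. ?p (m a d) (m b e)) t):Bilin H H ?T" if "t IN ?T" for t
	using that by (intro BilinI' lift_LinP[OF V V T] b1 V LinLR[OF p] LinL[OF mb] Lin_id mc)
have mu: "?mu:Bilin ?T ?T ?T" by (intro BilinI' lift_Lin[OF V V T] b2 lift_LinP[OF V V T] b1 T)
have mu_pure: "?mu (?p a b) (?p d e) = ?p (m a d) (m b e)" if "a IN H" "b IN H" "d IN H" "e IN H" for a b d e
	using that by (simp add: lift_pure[OF V V T b2] lift_pure[OF V V T b1] pc)
note muc = Bilin_in[OF mu]
have mu_ext: "F t = G t" if "F:Lin ?T ?T" "G:Lin ?T ?T" "!!a b. [|a IN H; b IN H|] ==> F (?p a b) = G (?p a b)" "t IN ?T" for F G t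
	by (rule tensor_ext[OF V V that(1,2) T that(3,4)])
have assoc: "?mu (?mu r s) t = ?mu r (?mu s t)" if r: "r IN ?T" and s: "s IN ?T" and t: "t IN ?T" for r s t
proof (rule mu_ext[of "%r. ?mu (?mu r s) t" "%r. ?mu r (?mu s t)", OF _ _ _ r])
	fix a b assume ab: "a IN H" "b IN H"
	show "?mu (?mu (?p a b) s) t = ?mu (?p a b) (?mu s t)"
	proof (rule mu_ext[of "%s. ?mu (?mu (?p a b) s) t" "%s. ?mu (?p a b) (?mu s t)", OF _ _ _ s])
		fix a' b' assume ab': "a' IN H" "b' IN H"
		show "?mu (?mu (?p a b) (?p a' b')) t = ?mu (?p a b) (?mu (?p a' b') t)"
			by (rule mu_ext[of "%t. ?mu (?mu (?p a b) (?p a' b')) t" "%t. ?mu (?p a b) (?mu (?p a' b') t)", OF _ _ _ t])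
				(use ab ab' in "auto intro!: LinR[OF mu] Lin_id muc pc simp: mu_pure mc bi_assoc[OF H]")
	qed (use ab t in "auto intro!: LinR[OF mu] LinL[OF mu] Lin_id pc")
qed (use s t in "auto intro!: LinL[OF mu] Lin_id muc")
have one: "?mu (?p u u) t = t" if t: "t IN ?T" for t by (rule mu_ext[of "%t. ?mu (?p u u) t" "%t. t", OF _ _ _ t])
		(use u in "auto intro!: LinR[OF mu] Lin_id pc simp: mu_pure bi_one[OF H]")
have one': "?mu t (?p u u) = t" if t: "t IN ?T" for t by (rule mu_ext[of "%t. ?mu t (?p u u)" "%t. t", OF _ _ _ t])
		(use u in "auto intro!: LinL[OF mu] Lin_id pc simp: mu_pure bi_one[OF H]")
note dl = comult_Lin[OF pH]
have mult: "comult H (m x y) = ?mu (comult H x) (comult H y)" if "x IN H" "y IN H" for x y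
proof -
	have "?mu (comult H x) (comult H y) = sw H ?T (%a b. Tlift ?T (%d e. ?p (m a d) (m b e)) (comult H y)) x"
		by (rule sw_lift[OF pH T b2[OF Lin_in[OF dl that(2)]] that(1)])
	also have "... = sw H ?T (%a b. sw H ?T (%d e. ?p (m a d) (m b e)) y) x" by (intro sw_cong[OF pH] that sw_lift[OF pH T b1])
	finally show ?thesis using bi_comult[OF H that] by simp
qed
let ?h = "sw H ?T (%x y. ?p (S y) (S x))"
have hb: "(%x y. ?p (S y) (S x)):Bilin H H ?T" by (intro BilinI' LinLR[OF p] Sl sc)
have h: "?h:Lin H ?T" by (rule sw_Lin[OF pH T hb])
show ?thesis
proof (rule conv_inv_unique[OF cH T mu pc[OF u u] assoc one one' Lin_comp[OF Sl dl] dl h _ _ c])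
	fix c assume c: "c IN H"
	have "sw H ?T (%x y. ?mu (comult H (S x)) (comult H y)) c = sw H ?T (%x y. comult H (m (S x) y)) c"
		by (intro sw_cong[OF pH c] mult[symmetric] sc)
	also have "... = comult H (sw H H (%x y. m (S x) y) c)" by (intro Lin_sw[OF pH dl V T c, symmetric] mc sc)
	finally show "sw H ?T (%x y. ?mu (comult H (S x)) (comult H y)) c = counit H c *.$?T ?p u u"
		using S1[OF c] Lin_smult[OF dl ec[OF c] u] bi_comult_unit[OF H] by simp
	have muh: "?mu (comult H x) (?h y) = sw H ?T (%x1 x2. sw H ?T (%y1 y2. ?p (m x1 (S y2)) (m x2 (S y1))) y) x" if "x IN H" "y IN H" for x y
	proof -
		have "?mu (comult H x) (?h y) = sw H ?T (%x1 x2. Tlift ?T (%d e. ?p (m x1 d) (m x2 e)) (?h y)) x"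
			by (rule sw_lift[OF pH T b2[OF Lin_in[OF h that(2)]] that(1)])
		also have "... = sw H ?T (%x1 x2. sw H ?T (%y1 y2. Tlift ?T (%d e. ?p (m x1 d) (m x2 e)) (?p (S y2) (S y1))) y) x"
			by (intro sw_cong[OF pH] that Lin_sw[OF pH lift_Lin[OF V V T b1] T T] pc sc)
		also have "... = sw H ?T (%x1 x2. sw H ?T (%y1 y2. ?p (m x1 (S y2)) (m x2 (S y1))) y) x"
			by (intro sw_cong[OF pH] that lift_pure[OF V V T b1] sc)
		finally show ?thesis .
	qed
	have t1: "trilin H H H ?T (%x1 x2 y. sw H ?T (%y1 y2. ?p (m x1 (S y2)) (m x2 (S y1))) y)"
	proof -
		have "(%y1 y2. ?p (m x1 (S y2)) (m x2 (S y1))):Bilin H H ?T" if "x1 IN H" "x2 IN H" for x1 x2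
			using that by (intro BilinI' LinLR[OF p] LinR[OF mb] LinL[OF mb] Sl mc sc)
		thus ?thesis by (intro trilinI sw_LinP[OF pH T V] sw_Lin_comp[OF pH T] LinLR[OF p] LinL[OF mb] Lin_id mc sc)
	qed
	have t2: "trilin H H H ?T (%p' p'' q. ?p (m x (S q)) (m p' (S p'')))" if "x IN H" for x
		using that by (intro trilinI LinLR[OF p] LinLR[OF mb] Sl Lin_id mc sc)
	\<comment> \<open>In \<open>x1 S(y2) \<otimes> x2 S(y1)\<close> coassociativity makes
	  \<open>x2 S(y1)\<close> an antipode product of one element. It collapses to a counit, after which
	  \<open>x1 S(y2)\<close> collapses likewise.\<close>
	have "sw H ?T (%x y. ?mu (comult H x) (?h y)) c = sw H ?T (%x y. sw H ?T (%x1 x2. sw H ?T (%y1 y2. ?p (m x1 (S y2)) (m x2 (S y1))) y) x) c"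
		by (intro sw_cong[OF pH c] muh)
	also have "... = sw H ?T (%x y. sw H ?T (%a b. sw H ?T (%y1 y2. ?p (m x (S y2)) (m a (S y1))) b) y) c" by (rule sw_assoc[OF cH T t1 c])
	also have "... = sw H ?T (%x y. sw H ?T (%q y2. sw H ?T (%a b. ?p (m x (S y2)) (m a (S b))) q) y) c"
		by (intro sw_cong[OF pH c] sw_assoc[OF cH T t2, symmetric])
	also have "... = sw H ?T (%x y. sw H ?T (%q y2. counit H q *.$?T ?p (m x (S y2)) u) y) c"
	proof (intro sw_cong[OF pH] c)
		fix x y q y2 assume k: "x IN H" "q IN H" "y2 IN H"
		have "sw H ?T (%a b. ?p (m x (S y2)) (m a (S b))) q = ?p (m x (S y2)) (sw H H (%a b. m a (S b)) q)"
			using k by (intro Lin_sw[OF pH Bilin_right[OF p] V T, symmetric] mc sc)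
		thus "sw H ?T (%a b. ?p (m x (S y2)) (m a (S b))) q = counit H q *.$?T ?p (m x (S y2)) u"
			using k S2[OF k(2)] Lin_smult[OF Bilin_right[OF p] ec[OF k(2)] u] mc sc by simp
	qed
	also have "... = sw H ?T (%x y. ?p (m x (S y)) u) c" by (intro sw_cong[OF pH c] sw_counit(1)[OF cH _ T] LinL[OF p] LinR[OF mb] Sl u)
	also have "... = ?p (sw H H (%x y. m x (S y)) c) u" by (intro Lin_sw[OF pH Bilin_left[OF p u] V T c, symmetric] mc sc)
	also have "... = counit H c *.$?T ?p u u" using S2[OF c] Lin_smult[OF Bilin_left[OF p u] ec[OF c] u] by simp
	finally show "sw H ?T (%x y. ?mu (comult H x) (?h y)) c = counit H c *.$?T ?p u u" .
qed
qed
end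

context linear_algebra
begin
subsection \<open>Linear retractions\<close>

definition subspace :: "('k, 'a, 'c) module_scheme => 'a set => bool" where
"subspace V N <-> N <= carrier V & \<zero>$V:N & (ALL x:N. ALL y:N. x +.$V y:N) & (ALL a:carrier K. ALL x:N. a *.$V x:N)"

text \<open>A maximal subspace meeting \<open>L\<close> trivially, by Zorn. Division in the field
  enters in the proof that it spans the space together with \<open>L\<close>.\<close>

lemma complement:
assumes V: "Vec V" and L: "subspace V L"
obtains N where "subspace V N" "N Int L = {\<zero>$V}"
	"ALL x:carrier V. EX n:N. EX l:L. x = n +.$V l"
proof -
interpret K: field K by (rule K)
interpret module K V by (rule V)
let ?A = "{N. subspace V N & N Int L = {\<zero>$V}}"
have "EX M:?A. ALL X:?A. M <= X --> X = M"
proof (rule subset_Zorn_nonempty)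
	have "{\<zero>$V}:?A" using L by (auto simp: subspace_def)
	thus "?A ~= {}" by blast
	fix c assume c: "c ~= {}" "subset.chain ?A c"
	hence sub: "!!N. N:c ==> subspace V N & N Int L = {\<zero>$V}" and tot: "!!N N'. [|N:c; N':c|] ==> N <= N' | N' <= N"
		unfolding subset_chain_def by auto
	have "x +.$V y:\<Union>c" if xy: "x:\<Union>c" "y:\<Union>c" for x y
	proof -
		obtain N N' where N: "N:c" "x:N" "N':c" "y:N'" using xy by blast
		then obtain M where "M:c" "x:M" "y:M" using tot[of N N'] by blast
		thus ?thesis using sub unfolding subspace_def by blast
	qed
	moreover have "\<Union>c Int L = {\<zero>$V}" using sub c(1) by blast
	moreover have "\<Union>c <= carrier V" using sub unfolding subspace_def by blast
	moreover have "a *.$V x:\<Union>c" if "a IN K" "x:\<Union>c" for a x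
	proof -
		from that(2) obtain N where N: "N:c" "x:N" by (rule UnionE)
		hence "a *.$V x:N" using sub[OF N(1)] that(1) unfolding subspace_def by auto
		thus ?thesis using N(1) by blast
	qed
	moreover have "\<zero>$V:\<Union>c" using sub c(1) by blast
	ultimately show "\<Union>c \<in> ?A" unfolding subspace_def by auto
qed
then obtain N where NA: "N:?A" and NX: "ALL X:?A. N <= X --> X = N" by (elim bexE)
from NA have N: "subspace V N" "N Int L = {\<zero>$V}" by simp_all
from NX have max: "!!X. [|subspace V X; X Int L = {\<zero>$V}; N <= X|] ==> X = N" by simp
have NV: "n IN V" if "n:N" for n using that N(1) unfolding subspace_def by blast
have LV: "n IN V" if "n:L" for n using that L unfolding subspace_def by blast
have "EX n:N. EX l:L. x = n +.$V l" if x: "x IN V" for x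
proof (rule ccontr)
	assume no: "~(EX n:N. EX l:L. x = n +.$V l)"
	\<comment> \<open>Adjoining \<open>x\<close> keeps the intersection with \<open>L\<close> trivial:
	  if \<open>n + a x\<close> were in \<open>L\<close> with \<open>a\<close> nonzero, dividing by
	  \<open>a\<close> would write \<open>x\<close> as an element of \<open>N\<close> plus an element
	  of \<open>L\<close>.\<close>
	define X where "X = {n +.$V a *.$V x | n a. n:N & a IN K}"
	have XI: "n +.$V a *.$V x:X" if "n:N" "a IN K" for n a using that unfolding X_def by blast
	have z: "\<zero>$V:N" using N(1) unfolding subspace_def by blast
	have "subspace V X" unfolding subspace_def
	proof (intro conjI ballI)
		show "X <= carrier V" using NV x unfolding X_def by auto
		show "\<zero>$V:X" using XI[OF z K.zero_closed] x by simp
		fix y assume "y:X"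
		then obtain n a where y: "y = n +.$V a *.$V x" "n:N" "a IN K" unfolding X_def by blast { fix b assume b: "b IN K"
			have "b *.$V y = b *.$V n +.$V (b \<otimes>$K a) *.$V x" using y b x NV by (simp add: smult_r_distr smult_assoc1)
			moreover have "b *.$V n:N" using N(1) b y unfolding subspace_def by blast
			ultimately show "b *.$V y:X" using XI b y by simp }
		fix y' assume "y':X"
		then obtain n' a' where y': "y' = n' +.$V a' *.$V x" "n':N" "a' IN K" unfolding X_def by blast
		have "y +.$V y' = (n +.$V n') +.$V (a +.$K a') *.$V x" using y y' x NV by (simp add: smult_l_distr M.a_ac)
		moreover have "n +.$V n':N" using N(1) y y' unfolding subspace_def by blast
		ultimately show "y +.$V y':X" using XI y y' by simp
	qed
	moreover have "X Int L = {\<zero>$V}"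
	proof -
		have "l = \<zero>$V" if l: "l:X" "l:L" for l
		proof -
			obtain n a where n: "l = n +.$V a *.$V x" "n:N" "a IN K" using l(1) unfolding X_def by blast
			show ?thesis
			proof (cases "a = \<zero>$K")
				case True
				hence "l = n" using n NV x by simp
				thus ?thesis using n l N(2) by blast
			next
				case False
				define b where "b = inv\<^bsub>K\<^esub> a"
				have b: "b IN K" "b \<otimes>$K a = \<one>$K" using K.field_Units False n(3) unfolding b_def by auto
				have "\<ominus>$K b *.$V n +.$V b *.$V l = \<ominus>$K b *.$V n +.$V (b *.$V n +.$V x)"
					using n b x NV by (simp add: smult_r_distr smult_assoc1[symmetric])
				also have "... = (\<ominus>$K b +.$K b) *.$V n +.$V x" using b n x NV by (simp add: smult_l_distr M.a_assoc)
				also have "... = x" using b n x NV by (simp add: K.l_neg)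
				finally have "x = \<ominus>$K b *.$V n +.$V b *.$V l" by simp
				moreover have "\<ominus>$K b *.$V n:N" "b *.$V l:L" using N(1) L n l b unfolding subspace_def by auto
				ultimately show ?thesis using no by blast
			qed
		qed
		moreover have "\<zero>$V:X" using XI[OF z K.zero_closed] x by simp
		ultimately show ?thesis using L unfolding subspace_def by blast
	qed
	moreover have "N <= X" using XI[OF _ K.zero_closed] NV x by force
	ultimately have "X = N" by (rule max)
	moreover have "x:X" using XI[OF z K.one_closed] x by simp
	ultimately have "x:N" "\<zero>$V:L" "x = x +.$V \<zero>$V" using L x unfolding subspace_def by auto
	thus False using no by blast
qed
thus thesis using that N by blast
qed

text \<open>The projection onto \<open>L\<close> along a complement. Its effect on tensor squares is
  what lets an expansion that involves only elements of \<open>L\<close> be read inside the tensor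
  square of \<open>L\<close>.\<close>

lemma retraction:
assumes V: "Vec V" and L: "subspace V L"
obtains rh where "rh:Lin V V" "!!x. x IN V ==> rh x:L" "!!x. x:L ==> rh x = x"
proof -
interpret module K V by (rule V)
obtain N where N: "subspace V N" "N Int L = {\<zero>$V}" and ex: "ALL x:carrier V. EX n:N. EX l:L. x = n +.$V l" using complement[OF V L] .
have NV: "n IN V" if "n:N" for n using that N(1) unfolding subspace_def by blast
have LV: "n IN V" if "n:L" for n using that L unfolding subspace_def by blast
have uni: "l = l'" if e: "n +.$V l = n' +.$V l'" "n:N" "n':N" "l:L" "l':L" for n n' l l'
proof -
	note c = NV[OF e(2)] NV[OF e(3)] LV[OF e(4)] LV[OF e(5)]
	let ?m = "\<ominus>$K \<one>$K"
	have "l \<ominus>$V l' = n' \<ominus>$V n"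
	proof -
		have "l = n' +.$V l' \<ominus>$V n" using c e(1) by (metis M.add.inv_solve_right' M.a_comm a_minus_def M.a_closed)
		hence "l = (n' \<ominus>$V n) +.$V l'" using c by (simp add: a_minus_def M.a_ac)
		thus ?thesis using c by (simp add: a_minus_def M.a_assoc M.r_neg)
	qed
	moreover have "n' \<ominus>$V n:N" "l \<ominus>$V l':L" using N(1) L e c K_closed(3) unfolding subspace_def by (auto simp: diff_eq[OF V])
	ultimately have "l \<ominus>$V l' = \<zero>$V" using N(2) by auto
	thus ?thesis using diff_zero_iff[OF V c(3,4)] by simp
qed
define rh where "rh x = (SOME l. l:L & (EX n:N. x = n +.$V l))" for x
have rho: "rh x:L & (EX n:N. x = n +.$V rh x)" if "x IN V" for x unfolding rh_def by (rule someI_ex) (use ex that in blast)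
have rhoI: "rh (n +.$V l) = l" if "n:N" "l:L" for n l using rho[of "n +.$V l"] that uni NV LV by (metis M.a_closed)
show thesis
proof (rule that)
	show "rh x:L" if "x IN V" for x using rho[OF that] by blast
	have z: "\<zero>$V:N" using N(1) unfolding subspace_def by blast
	show "rh x = x" if "x:L" for x using rhoI[OF z that] LV[OF that] by simp
	show "rh:Lin V V"
	proof (rule LinI)
		fix x assume x: "x IN V"
		thus "rh x IN V" using rho LV by blast
		obtain n where n: "n:N" "x = n +.$V rh x" "rh x:L" using rho[OF x] by blast { fix a assume a: "a IN K"
			have "a *.$V n:N" "a *.$V rh x:L" using N(1) L n a unfolding subspace_def by auto
			moreover have "a *.$V x = a *.$V n +.$V a *.$V rh x" using n a NV LV by (metis smult_r_distr)
			ultimately show "rh (a *.$V x) = a *.$V rh x" using rhoI by simp }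
		fix y assume y: "y IN V"
		obtain n' where n': "n':N" "y = n' +.$V rh y" "rh y:L" using rho[OF y] by blast
		have "n +.$V n':N" "rh x +.$V rh y:L" using N(1) L n n' unfolding subspace_def by auto
		moreover have "x +.$V y = (n +.$V n') +.$V (rh x +.$V rh y)"
		proof -
			have "x +.$V y = (n +.$V rh x) +.$V (n' +.$V rh y)" using arg_cong2[OF n(2) n'(2), of "add V"] .
			also have "... = (n +.$V n') +.$V (rh x +.$V rh y)" using NV[OF n(1)] NV[OF n'(1)] LV[OF n(3)] LV[OF n'(3)] by (simp add: M.a_ac)
			finally show ?thesis .
		qed
		ultimately show "rh (x +.$V y) = rh x +.$V rh y" using rhoI by simp
	qed
qed
qed

section \<open>The class of structures\<close>

lemma sweedler3_sw:
assumes C: "precoalg C" and Z: "Vec Z" and t: "trilin C C C Z tw" and c: "c IN C"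
shows "sweedler3 K C Z tw c = sw C Z (%x y. sw C Z (tw x) y) c"
proof -
note V = pre_Vec[OF C] and VV = pre_ten[OF C]
have tb: "tw x:Bilin C C Z" if "x IN C" for x using t that unfolding trilin_def by blast
have b: "(%x. Tlift Z (tw x)):Bilin C (ten C C) Z" by (intro BilinI' lift_LinP[OF V V Z] lift_Lin[OF V V Z] tb V Tri1[OF t] Lin_id)
have "sweedler3 K C Z tw c = Tlift Z (%x. Tlift Z (tw x)) (sw C (ten C (ten C C)) (%x y. pur C (ten C C) x (comult C y)) c)"
	unfolding sweedler3_def using tmap_sw[OF C Lin_id comult_Lin[OF C] V VV c] by simp
also have "... = sw C Z (%x y. Tlift Z (%x. Tlift Z (tw x)) (pur C (ten C C) x (comult C y))) c"
	by (intro Lin_sw[OF C lift_Lin[OF V VV Z b] ten_Vec[OF V VV] Z c] pur_in[OF V VV] Lin_in[OF comult_Lin[OF C]])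
also have "... = sw C Z (%x y. sw C Z (tw x) y) c"
	by (intro sw_cong[OF C c]) (simp add: lift_pure[OF V VV Z b] Lin_in[OF comult_Lin[OF C]] sw_lift[OF C Z tb])
finally show ?thesis .
qed

text \<open>The brace identity with \<open>sweedler3\<close> spelled out as two nested Sweedler
  sums; \<open>d\<close> is the dot, \<open>e\<close> the diamond, and the agreement with the
  original form is \<open>brace_law_sweedler3\<close>.\<close>

definition brace_law where
"brace_law H d S e <-> (ALL x:carrier H. ALL y:carrier H. ALL z:carrier H.
	e x (d y z) = sw H H (%x1 w. sw H H (%x2 x3. d (d (e x1 y) (S x2)) (e x3 z)) w) x)"

lemma brace_trilin:
assumes "d:Bilin H H H" "e:Bilin H H H" "S:Lin H H" "y IN H" "z IN H"
shows "trilin H H H H (%x1 x2 x3. d (d (e x1 y) (S x2)) (e x3 z))"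
using assms(4,5) by (intro trilinI LinLR[OF assms(1)] LinL[OF assms(2)] assms(3) Lin_id
		Bilin_in[OF assms(1)] Bilin_in[OF assms(2)] Lin_in[OF assms(3)])

text \<open>The common class behind the four categories: \<open>br\<close> is empty for
  \<open>Halg\<close>, and \<open>{(False, True)}\<close> for braces with \<open>False\<close> for
  the dot and \<open>True\<close> for the diamond. The antipodes are an argument so that the brace
  law can refer to them, without being part of the structure that morphisms see.\<close>

definition hstruct :: "'i set => 'i set => bool => ('i * 'i) set => ('k, 'i, 'a) ibialg => ('i => 'a => 'a) => bool" where
"hstruct I J coc br H S <-> Coalg H & (ALL i:I. Bialg H (imult H i) (iunit H i)) &
	(ALL i:I. ALL j:I. iunit H i = iunit H j) & (coc --> Cocom H) & (ALL j:J. Antip H (imult H j) (iunit H j) (S j)) &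
	(ALL (i, j):br. brace_law H (imult H i) (S i) (imult H j))"

definition hmaps :: "'i set => ('k, 'i, 'a) ibialg => ('k, 'i, 'b) ibialg => ('a => 'b) set" where
"hmaps I H L = {f:Cmaps H L.
	ALL i:I. algebra_map H (imult H i) (iunit H i) (imult L i) (iunit L i) f}"
end

text \<open>\<open>Smult\<close> and \<open>Counit\<close> carry a scalar, so that the relations only involve elements of the structure.\<close>

datatype ('k, 'i) sym = Add | Smult 'k | Counit 'k | Comult | Mult 'i | Unit 'i

text \<open>The comultiplication of \<open>pullback\<close> mentions the tensor square of the space
  under definition, so this space is made available beforehand. The map \<open>j\<close> includes
  \<open>B\<close> into the carrier of \<open>H\<close>, and \<open>r\<close> is its left
  inverse.\<close>

definition pullback_space :: "('k, 'i, 'a) ibialg => 'b set => ('b => 'a) => ('a => 'b) => ('k, 'b) module" where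
"pullback_space H B j r = (|carrier = B, mult = undefined, one = undefined, ring.zero = r \<zero>$H,
	add = (%x y. r (j x +.$H j y)), smult = (%a x. r (a *.$H j x))|)"

definition pullback ::
"'k ring => ('k, 'i, 'a) ibialg => 'b set => ('b => 'a) => ('a => 'b) => ('k, 'i, 'b) ibialg" where
"pullback K H B j r = (|carrier = B, mult = undefined, one = undefined, ring.zero = r \<zero>$H,
	add = (%x y. r (j x +.$H j y)), smult = (%a x. r (a *.$H j x)),
	comult = (%b. tensor_map K (pullback_space H B j r) (pullback_space H B j r) r r (comult H (j b))), counit = (%b. counit H (j b)),
	imult = (%i x y. r (imult H i (j x) (j y))), iunit = (%i. r (iunit H i))|)"

context linear_algebra
begin
definition tsum :: "('k, 'a, 'c) module_scheme => ('a * 'a) list => ('a * 'a => 'k) set" where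
"tsum C ps = lsum (ten C C) (%p. pur C C (fst p) (snd p)) ps"

text \<open>For \<open>Comult\<close> all expansions are recorded, not just the chosen one, since a
  morphism need not map \<open>dec\<close> to \<open>dec\<close>. The two lists of factors have
  equal length, which makes the splitting of the concatenation unique.\<close>

primrec rel :: "('k, 'i, 'a) ibialg => ('k, 'i) sym => 'a list set" where
"rel H Add = {[x, y, x +.$H y] | x y. x IN H & y IN H}"
| "rel H (Smult a) = {[x, a *.$H x] | x. x IN H}"
| "rel H (Counit a) = {[x] | x. x IN H & counit H x = a}"
| "rel H Comult = {c # xs @ ys | c xs ys. c IN H & length xs = length ys &
	set xs <= carrier H & set ys <= carrier H & comult H c = tsum H (zip xs ys)}"
| "rel H (Mult i) = {[x, y, imult H i x y] | x y. x IN H & y IN H}"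
| "rel H (Unit i) = {[iunit H i]}"

definition syms :: "'i set => ('k, 'i) sym set" where
"syms I = {Add, Comult} Un Smult ` carrier K Un Counit ` carrier K Un Mult ` I Un Unit ` I"

lemma tsum_map:
assumes "f:Lin C D" "Vec C" "Vec D" "set ps <= carrier C \<times> carrier C"
shows "Tmap D D f f (tsum C ps) = tsum D (map (%(x, y). (f x, f y)) ps)"
proof -
have m: "fst p IN C" "snd p IN C" if "p:set ps" for p using assms(4) that by auto
have "Tmap D D f f (tsum C ps) = lsum (ten D D) (%p. Tmap D D f f (pur C C (fst p) (snd p))) ps" unfolding tsum_def
	by (rule Lin_lsum[OF tmap_Lin[OF assms(1,1,2,2,3,3)] ten_Vec[OF assms(2,2)] ten_Vec[OF assms(3,3)]]) (use m pur_in[OF assms(2,2)] in auto)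
also have "... = lsum (ten D D) (%p. pur D D (f (fst p)) (f (snd p))) ps" using m by (intro lsum_cong refl tmap_pure[OF assms(1,1,2,2,3,3)])
also have "... = tsum D (map (%(x, y). (f x, f y)) ps)" by (simp add: tsum_def lsum_map case_prod_unfold)
finally show ?thesis .
qed

lemma zip_map_pair: "zip (map f xs) (map f ys) = map (%(x, y). (f x, f y)) (zip xs ys)"
by (simp add: zip_map_map case_prod_unfold)

lemma tsum_zip_map:
assumes "f:Lin C D" "Vec C" "Vec D" "set xs <= carrier C" "set ys <= carrier C"
shows "Tmap D D f f (tsum C (zip xs ys)) = tsum D (zip (map f xs) (map f ys))"
unfolding zip_map_pair by (rule tsum_map[OF assms(1-3)]) (use assms(4,5) in "auto dest: set_zip_leftD set_zip_rightD")

lemma comult_tsum: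
assumes "precoalg C" "c IN C"
obtains xs ys where "length xs = length ys" "set xs <= carrier C" "set ys <= carrier C" "comult C c = tsum C (zip xs ys)"
proof -
note d = dec[OF assms]
have "comult C c = tsum C (zip (map fst (dec C c)) (map snd (dec C c)))" using d(2) by (simp add: tsum_def zip_map_fst_snd)
thus thesis using that[of "map fst (dec C c)" "map snd (dec C c)"] d(1) by force
qed

definition is_ibialg :: "'i set => ('k, 'i, 'a) ibialg => bool" where
"is_ibialg I H <-> Coalg H & (ALL i:I. Bialg H (imult H i) (iunit H i))"

lemma hstruct_ibialg: "hstruct I J coc br H S ==> is_ibialg I H"
unfolding hstruct_def is_ibialg_def by blast

lemma ibi:
assumes "is_ibialg I H"
shows "precoalg H" "Vec H" "[|i:I; x IN H; y IN H|] ==> imult H i x y IN H"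
	"i:I ==> iunit H i IN H" using assms unfolding is_ibialg_def by (auto intro: coalg_pre pre_Vec bi_closed bi_unit)

lemma rel_sub:
assumes H: "is_ibialg I H" and r: "rh:syms I" "xs:rel H rh"
shows "set xs <= carrier H"
proof (cases rh)
case Comult
then obtain c ys zs where "xs = c # ys @ zs" "c IN H" "set ys <= carrier H" "set zs <= carrier H" using r(2) by auto
thus ?thesis by simp
qed (use r ibi(3,4)[OF H] vclosed(1,3)[OF ibi(2)[OF H]] in "auto simp: syms_def")

context
fixes H :: "('k, 'i, 'a) ibialg" and L :: "('k, 'i, 'b) ibialg" and I
assumes H: "is_ibialg I H" and L: "is_ibialg I L"
begin
lemmas ibHL = ibi(1)[OF H] ibi(1)[OF L] ibi(2)[OF H] ibi(2)[OF L] ibi(3)[OF H] ibi(4)[OF H]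

lemma hmaps_rel:
assumes f: "f:hmaps I H L" and r: "rh:syms I" "xs:rel H rh"
shows "map f xs:rel L rh"
proof -
have fc: "f:Cmaps H L" using f unfolding hmaps_def by blast
have fl: "f:Lin H L" by (rule cm_Lin[OF fc])
have fm: "f (imult H i x y) = imult L i (f x) (f y)" "f (iunit H i) = iunit L i" if "i:I" "x IN H" "y IN H" for i x y
	using f that unfolding hmaps_def algebra_map_def by blast+
show ?thesis
proof (cases rh)
	case Comult
	then obtain c ys zs where c: "xs = c # ys @ zs" "c IN H" "length ys = length zs"
		"set ys <= carrier H" "set zs <= carrier H" "comult H c = tsum H (zip ys zs)" using r(2) by auto
	have "comult L (f c) = Tmap L L f f (comult H c)" using fc c(2) unfolding coalgebra_maps_def by blast
	hence "comult L (f c) = tsum L (zip (map f ys) (map f zs))" unfolding c(6) using tsum_zip_map[OF fl ibHL(3,4) c(4,5)] by simp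
	moreover have "map f xs = f c # map f ys @ map f zs" using c(1) by simp
	moreover have "set (map f ys) <= carrier L" "set (map f zs) <= carrier L" "f c IN L" using c Lin_in[OF fl] by auto
	ultimately show ?thesis unfolding Comult rel.simps using c(3) by (metis (mono_tags, lifting) CollectI length_map)
next
	case (Unit i)
	thus ?thesis using r fm(2)[of i "\<zero>$H" "\<zero>$H"] vclosed(2)[OF ibHL(3)] by (auto simp: syms_def)
qed (use r fm fl in "auto simp: syms_def Lin_in Lin_add Lin_smult cm_counit[OF fc]")
qed

text \<open>For the comultiplication a single expansion of \<open>c\<close> suffices: its image is
  an expansion of \<open>f c\<close>, and comparison of lengths shows that it splits at the expected
  place.\<close>

lemma rel_hmaps:
assumes f: "f:carrier H \<rightarrow> carrier L" and r: "!!rh xs. [|rh:syms I; xs:rel H rh|] ==> map f xs:rel L rh"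
shows "f:hmaps I H L"
proof -
have fc: "f x IN L" if "x IN H" for x using f that by blast
have fl: "f:Lin H L"
proof (rule LinI)
	fix x y assume "x IN H" "y IN H"
	thus "f (x +.$H y) = f x +.$L f y" using r[of Add "[x, y, x +.$H y]"] by (auto simp: syms_def)
next
	fix a x assume "a IN K" "x IN H"
	thus "f (a *.$H x) = a *.$L f x" using r[of "Smult a" "[x, a *.$H x]"] by (auto simp: syms_def)
qed (rule fc)
have "comult L (f c) = Tmap L L f f (comult H c)" if c: "c IN H" for c
proof -
	obtain xs ys where d: "length xs = length ys" "set xs <= carrier H" "set ys <= carrier H"
		"comult H c = tsum H (zip xs ys)" by (rule comult_tsum[OF ibHL(1) c])
	hence "c # xs @ ys:rel H Comult" using c by auto
	hence "map f (c # xs @ ys):rel L Comult" using r[of Comult "c # xs @ ys"] by (simp add: syms_def del: rel.simps)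
	then obtain c' xs' ys' where e: "f c # map f xs @ map f ys = c' # xs' @ ys'" "length xs' = length ys'"
		"comult L c' = tsum L (zip xs' ys')" by auto
	have "length (map f xs) = length xs'"
	proof -
		have "length (map f xs @ map f ys) = length (xs' @ ys')" using e(1) by simp
		thus ?thesis using d(1) e(2) by simp
	qed
	hence "c' = f c" "xs' = map f xs" "ys' = map f ys" using e(1) by simp_all
	thus ?thesis using e(3) d(4) tsum_zip_map[OF fl ibHL(3,4) d(2,3)] by simp
qed
moreover have "counit L (f c) = counit H c" if "c IN H" for c
proof -
	have "map f [c]:rel L (Counit (counit H c))" by (rule r) (use that counit_in[OF ibHL(1)] in "auto simp: syms_def")
	thus ?thesis by simp
qed
ultimately have "f:Cmaps H L" using fl unfolding coalgebra_maps_def by blast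
moreover have "f (imult H i x y) = imult L i (f x) (f y)" if "i:I" "x IN H" "y IN H" for i x y
proof -
	have "map f [x, y, imult H i x y]:rel L (Mult i)" by (rule r) (use that in "auto simp: syms_def")
	thus ?thesis by auto
qed
moreover have "f (iunit H i) = iunit L i" if "i:I" for i
proof -
	have "map f [iunit H i]:rel L (Unit i)" by (rule r) (use that in "auto simp: syms_def")
	thus ?thesis by auto
qed
ultimately show ?thesis unfolding hmaps_def algebra_map_def by blast
qed

text \<open>A linear left inverse \<open>g\<close> also splits the induced map of tensor squares, so
  an expansion that holds in \<open>L\<close> between images of elements of \<open>H\<close> already
  holds in \<open>H\<close>.\<close>

lemma hmaps_reflect:
assumes f: "f:hmaps I H L" and g: "g:Lin L H" "!!x. x IN H ==> g (f x) = x"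
	and r: "rh:syms I" "set xs <= carrier H" "map f xs:rel L rh"
shows "xs:rel H rh"
proof -
have fc: "f:Cmaps H L" using f unfolding hmaps_def by blast
have fl: "f:Lin H L" by (rule cm_Lin[OF fc])
have fm: "f (imult H i x y) = imult L i (f x) (f y)" "f (iunit H i) = iunit L i" if "i:I" "x IN H" "y IN H" for i x y
	using f that unfolding hmaps_def algebra_map_def by blast+
have inj: "x = y" if "f x = f y" "x IN H" "y IN H" for x y using g(2) that by metis
have gf: "map g (map f zs) = zs" if "set zs <= carrier H" for zs using that g(2) unfolding map_map by (intro map_idI) auto
show ?thesis
proof (cases rh)
	case Comult
	then obtain c' ys' zs' where e: "map f xs = c' # ys' @ zs'" "length ys' = length zs'"
		"comult L c' = tsum L (zip ys' zs')" using r(3) by auto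
	then obtain c ws where c: "xs = c # ws" "f c = c'" "map f ws = ys' @ zs'" by (cases xs) auto
	then obtain ys zs where w: "ws = ys @ zs" "map f ys = ys'" "map f zs = zs'" by (auto simp: map_eq_append_conv)
	have sub: "c IN H" "set ys <= carrier H" "set zs <= carrier H" using r(2) c(1) w(1) by auto
	have "comult H c IN ten H H" using Lin_in[OF comult_Lin[OF ibHL(1)] sub(1)] .
	hence "comult H c = Tmap H H g g (Tmap L L f f (comult H c))"
		using tmap_comp[OF fl fl g(1,1) ibHL(3,3,4,4,3,3)] tmap_cong[OF g(2)[symmetric] g(2)[symmetric] Lin_id Lin_id ibHL(3,3,3,3)]
			tmap_id[OF ibHL(3,3)] by simp
	also have "Tmap L L f f (comult H c) = comult L c'" using fc sub(1) c(2) unfolding coalgebra_maps_def by auto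
	also have "Tmap H H g g ... = tsum H (zip ys zs)" unfolding e(3) w(2,3)[symmetric] using sub Lin_in[OF fl]
		by (subst tsum_zip_map[OF g(1) ibHL(4,3)]) (auto simp: gf simp del: map_map)
	finally have "comult H c = tsum H (zip ys zs)" .
	moreover have "xs = c # ys @ zs" "length ys = length zs" using e(2) c(1) w by auto
	ultimately show ?thesis unfolding Comult rel.simps using sub by blast
next
	case (Counit a)
	thus ?thesis using r(2,3) cm_counit[OF fc] by (cases xs) auto
next
	case Add
	obtain x y z where xyz: "xs = [x, y, z]" "f z = f x +.$L f y" using r(3) Add by (auto simp: map_eq_Cons_conv)
	thus ?thesis using r(2) inj[of z "x +.$H y"] Lin_add[OF fl] vclosed(1)[OF ibHL(3)] by (auto simp: Add)
next
	case (Smult a)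
	obtain x y where xy: "xs = [x, y]" "f y = a *.$L f x" using r(3) Smult by (auto simp: map_eq_Cons_conv)
	thus ?thesis using r(1,2) inj[of y "a *.$H x"] Lin_smult[OF fl] vclosed(3)[OF ibHL(3)] by (auto simp: Smult syms_def)
next
	case (Mult i)
	obtain x y z where xyz: "xs = [x, y, z]" "f z = imult L i (f x) (f y)" using r(3) Mult by (auto simp: map_eq_Cons_conv)
	thus ?thesis using r(1,2) inj[of z "imult H i x y"] fm ibHL(5) by (auto simp: Mult syms_def)
next
	case (Unit i)
	obtain x where "xs = [x]" "f x = iunit L i" using r(3) Unit by (auto simp: map_eq_Cons_conv)
	thus ?thesis using r(1,2) inj[of x "iunit H i"] fm(2)[of i x x] ibHL(6) by (auto simp: Unit syms_def)
qed
qed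
end

lemma swap_sw:
assumes C: "precoalg C" and c: "c IN C"
shows "tensor_swap K C C (comult C c) = sw C (ten C C) (%x y. pur C C y x) c"
unfolding tensor_swap_def using pur_Bilin[OF pre_Vec[OF C] pre_Vec[OF C]]
by (intro sw_lift[OF C pre_ten[OF C] _ c]) (auto simp: bilinear_maps_def)

lemma cocommutative_iff:
assumes C: "precoalg C"
shows "Cocom C <->
	(ALL c:carrier C. sw C (ten C C) (%x y. pur C C y x) c = sw C (ten C C) (pur C C) c)"
unfolding cocommutative_def by (auto simp: swap_sw[OF C] comult_sw[OF C, symmetric])

lemma sw_cocom:
assumes C: "precoalg C" and coc: "Cocom C" and Z: "Vec Z" and b: "be:Bilin C C Z" and c: "c IN C"
shows "sw C Z (%x y. be y x) c = sw C Z be c"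
proof -
note V = pre_Vec[OF C] and T = pre_ten[OF C] and L = lift_Lin[OF pre_Vec[OF C] pre_Vec[OF C] Z b]
note pc = pur_in[OF V V]
have "sw C Z (%x y. be y x) c = sw C Z (%x y. Tlift Z be (pur C C y x)) c" by (intro sw_cong[OF C c]) (simp add: lift_pure[OF V V Z b])
also have "... = Tlift Z be (sw C (ten C C) (%x y. pur C C y x) c)" by (intro Lin_sw[OF C L T Z c, symmetric] pc)
also have "sw C (ten C C) (%x y. pur C C y x) c = comult C c" using coc c unfolding cocommutative_iff[OF C] comult_sw[OF C c] by blast
also have "Tlift Z be ... = sw C Z be c" by (rule sw_lift[OF C Z b c])
finally show ?thesis .
qed

section \<open>Pulling structures back along injections\<close>

text \<open>Two situations are covered: renaming of a carrier along a bijection, and restriction to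
  a subset with a linear retraction. The assumptions say that the image of \<open>j\<close> is
  closed under the operations and contains the factors of some expansion of each of its
  comultiplications.\<close>

context
fixes H :: "('k, 'i, 'a) ibialg" and I J :: "'i set" and coc br S and B :: "'b set"
	and j :: "'b => 'a" and r :: "'a => 'b"
assumes H: "hstruct I J coc br H S" and JI: "J <= I" and br: "br <= J \<times> I"
	and jB: "!!b. b:B ==> j b IN H" and rB: "!!x. x IN H ==> r x:B" and rj: "!!b. b:B ==> r (j b) = b" and jr: "(%x. j (r x)):Lin H H"
	and cm: "!!b. b:B ==> EX ps. set ps <= B \<times> B & comult H (j b) = tsum H (map (%(x, y). (j x, j y)) ps)"
	and mul: "!!i a b. [|i:I; a:B; b:B|] ==> j (r (imult H i (j a) (j b))) = imult H i (j a) (j b)"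
	and un: "!!i. i:I ==> j (r (iunit H i)) = iunit H i" and ant: "!!i b. [|i:J; b:B|] ==> j (r (S i (j b))) = S i (j b)"
begin
abbreviation "pspace == pullback_space H B j r"
abbreviation "pull == pullback K H B j r"
abbreviation "S' i x == r (S i (j x))"

lemma pull_simps [simp]: "carrier pull = B" "\<zero>$pull = r \<zero>$H" "x +.$pull y = r (j x +.$H j y)"
"a *.$pull x = r (a *.$H j x)" "counit pull x = counit H (j x)" "imult pull i x y = r (imult H i (j x) (j y))"
"iunit pull i = r (iunit H i)" by (simp_all add: pullback_def)

lemma H_facts: "Coalg H" "precoalg H" "Vec H" "i:I ==> Bialg H (imult H i) (iunit H i)"
using H coalg_pre[of H] pre_Vec[of H] unfolding hstruct_def by blast+

lemma j_ops: "[|x:B; y:B|] ==> j (r (j x +.$H j y)) = j x +.$H j y"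
"[|a IN K; x:B|] ==> j (r (a *.$H j x)) = a *.$H j x" "j (r \<zero>$H) = \<zero>$H"
using Lin_add[OF jr] Lin_smult[OF jr] Lin_zero[OF jr H_facts(3,3)] by (simp_all add: jB rj)

lemma j_inj: "[|j x = j y; x:B; y:B|] ==> x = y"
using rj by metis

lemma pull_Vec: "Vec pull"
proof -
interpret module K H by (rule H_facts(3))
note o = j_ops jB rB
have neg: "(\<ominus>$K \<one>$K) *.$H y +.$H y = \<zero>$H" if "y IN H" for y using that by (simp add: smult_l_minus M.l_neg)
show ?thesis
proof (rule moduleI[OF cring_K abelian_groupI])
	fix x assume x: "x IN pull"
	thus "EX y:carrier pull. y +.$pull x = \<zero>$pull"
		by (intro bexI[of _ "r ((\<ominus>$K \<one>$K) *.$H j x)"]) (simp_all add: o neg K_closed)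
qed (auto intro!: j_inj simp: o M.a_ac smult_l_distr smult_r_distr smult_assoc1 rj)
qed

lemma pspace_same: "same_sp pspace pull"
by (simp add: same_sp_def pullback_space_def pullback_def)

lemma comult_pull: "comult pull b = Tmap pull pull r r (comult H (j b))"
proof -
have "Tmap pspace pspace r r = Tmap pull pull r r"
	unfolding tensor_map_def using ten_same[OF pspace_same pspace_same] pur_same[OF pspace_same pspace_same] by simp
thus ?thesis by (simp add: pullback_def)
qed

lemma j_Lin: "j:Lin pull H"
by (rule LinI) (auto simp: j_ops jB)

lemma r_Lin: "r:Lin H pull"
proof (rule LinI)
fix x y assume xy: "x IN H" "y IN H"
have "j (r (x +.$H y)) = j (r x) +.$H j (r y)" using Lin_add[OF jr xy] .
also have "... = j (r (j (r x) +.$H j (r y)))" using j_ops(1)[OF rB rB] xy by simp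
finally show "r (x +.$H y) = r x +.$pull r y" unfolding pull_simps by (rule j_inj) (use xy H_facts(3) in "auto simp: rB jB vclosed")
next
fix a x assume ax: "a IN K" "x IN H"
have "j (r (a *.$H x)) = a *.$H j (r x)" using Lin_smult[OF jr ax] .
also have "... = j (r (a *.$H j (r x)))" using j_ops(2)[OF ax(1) rB] ax by simp
finally show "r (a *.$H x) = a *.$pull r x" unfolding pull_simps by (rule j_inj) (use ax H_facts(3) in "auto simp: rB jB vclosed")
qed (simp add: rB)

lemma pull_pre: "precoalg pull"
unfolding precoalg_def
proof (intro conjI pull_Vec)
note V = H_facts(3) pull_Vec
have "(%b. Tmap pull pull r r (comult H (j b))):Lin pull (ten pull pull)"
	by (rule Lin_comp[OF j_Lin Lin_comp[OF comult_Lin[OF H_facts(2)] tmap_Lin[OF r_Lin r_Lin V(1,1,2,2)]]])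
thus "comult pull:Lin pull (ten pull pull)" unfolding comult_pull[symmetric] .
have "(%b. counit H (j b)):Lin pull Base" by (rule Lin_comp[OF j_Lin counit_Lin[OF H_facts(2)]])
thus "counit pull:Lin pull Base" by (simp add: pullback_def)
qed

lemma j_coalgebra_map: "j:Cmaps pull H"
unfolding coalgebra_maps_def
proof (intro CollectI conjI ballI j_Lin)
fix b assume "b IN pull"
hence b: "b:B" by simp
note V = H_facts(3) pull_Vec
obtain ps where ps: "set ps <= B \<times> B" "comult H (j b) = tsum H (map (%(x, y). (j x, j y)) ps)" using cm[OF b] by blast
have 1: "map (%(x, y). (r x, r y)) (map (%(x, y). (j x, j y)) ps) = ps" using ps(1) unfolding map_map by (intro map_idI) (auto simp: rj)
have "comult pull b = tsum pull ps" unfolding comult_pull ps(2) by (subst tsum_map[OF r_Lin V]) (use ps(1) jB 1 in "auto simp del: map_map")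
thus "comult H (j b) = Tmap H H j j (comult pull b)" using tsum_map[OF j_Lin V(2,1), of ps] ps by simp
qed simp

lemma sw_pull: "[|Vec Z; be:Bilin H H Z; b:B|] ==> sw pull Z (%x y. be (j x) (j y)) b = sw H Z be (j b)"
using cm_sw[OF pull_pre H_facts(2) j_coalgebra_map, of Z be b] by simp

text \<open>Each element is written as \<open>r (j x)\<close>; \<open>sw_pull\<close> then moves the
  Sweedler sums to \<open>H\<close>, where the law holds, and back again. The other laws are treated
  in the same manner.\<close>

lemma pull_coalgebra: "Coalg pull"
proof (rule coalgebraI[OF pull_pre])
note V = pull_Vec and pH = H_facts(2) and HV = H_facts(3)
let ?Z = "ten pull (ten pull pull)"
let ?t = "%x y z. pur pull (ten pull pull) (r x) (pur pull pull (r y) (r z))"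
have VV: "Vec (ten pull pull)" and Z: "Vec ?Z" by (intro ten_Vec V)+
note q = pur_Bilin[OF V V] and q' = pur_Bilin[OF V VV] and rc = Lin_in[OF r_Lin]
have t: "trilin H H H ?Z ?t" by (intro trilinI LinLR[OF q'] LinLR[OF q] r_Lin rc Bilin_in[OF q])
have b1: "(%x' x''. ?t x' x'' y):Bilin H H ?Z" if "y IN H" for y using that by (intro BilinI' Tri1[OF t] Tri2[OF t] Lin_id)
have b2: "(%y' y''. ?t x y' y''):Bilin H H ?Z" if "x IN H" for x using that by (intro BilinI' Tri2[OF t] Tri3[OF t] Lin_id)
fix c assume "c IN pull"
hence c: "c:B" by simp
have "sw pull ?Z (%x y. sw pull ?Z (%x' x''. pur pull (ten pull pull) x' (pur pull pull x'' y)) x) c =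
		sw pull ?Z (%x y. sw pull ?Z (%x' x''. ?t (j x') (j x'') (j y)) x) c" by (intro sw_cong[OF pull_pre]) (use c in "auto simp: rj")
also have "... = sw pull ?Z (%x y. sw H ?Z (%x' x''. ?t x' x'' (j y)) (j x)) c"
	by (intro sw_cong[OF pull_pre] sw_pull[OF Z b1]) (use c in "auto simp: jB")
also have "... = sw H ?Z (%x y. sw H ?Z (%x' x''. ?t x' x'' y) x) (j c)" by (rule sw_pull[OF Z sw_Tri_left[OF pH Z t HV] c])
also have "... = sw H ?Z (%x y. sw H ?Z (%y' y''. ?t x y' y'') y) (j c)" by (rule sw_assoc[OF H_facts(1) Z t jB[OF c]])
also have "... = sw pull ?Z (%x y. sw H ?Z (%y' y''. ?t (j x) y' y'') (j y)) c"
	by (rule sw_pull[OF Z sw_Tri_right[OF pH Z t HV] c, symmetric])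
also have "... = sw pull ?Z (%x y. sw pull ?Z (%y' y''. ?t (j x) (j y') (j y'')) y) c"
	by (intro sw_cong[OF pull_pre] sw_pull[OF Z b2, symmetric]) (use c in "auto simp: jB")
also have "... = sw pull ?Z (%x y. sw pull ?Z (%y' y''. pur pull (ten pull pull) x (pur pull pull y' y'')) y) c"
	by (intro sw_cong[OF pull_pre]) (use c in "auto simp: rj")
finally show "sw pull ?Z (%x y. sw pull ?Z (%x' x''. pur pull (ten pull pull) x' (pur pull pull x'' y)) x) c =
	sw pull ?Z (%x y. sw pull ?Z (%y' y''. pur pull (ten pull pull) x (pur pull pull y' y'')) y) c" .
note s = smult_Bilin[OF V] and e = counit_Lin[OF pH] and ec = counit_in[OF pH]
have e1: "(%x y. counit H x *.$pull r y):Bilin H H pull" "(%x y. counit H y *.$pull r x):Bilin H H pull"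
	by (auto intro!: BilinI' LinLR[OF s] r_Lin e rc simp: ec simp del: pull_simps)
have "sw pull pull (%x y. counit pull x *.$pull y) c = sw pull pull (%x y. counit H (j x) *.$pull r (j y)) c"
	by (intro sw_cong[OF pull_pre]) (use c in "auto simp: rj")
also have "... = r (j c)" using sw_pull[OF V e1(1) c] sw_counit(1)[OF H_facts(1) r_Lin V jB[OF c]] by simp
finally show "sw pull pull (%x y. counit pull x *.$pull y) c = c" using rj[OF c] by simp
have "sw pull pull (%x y. counit pull y *.$pull x) c = sw pull pull (%x y. counit H (j y) *.$pull r (j x)) c"
	by (intro sw_cong[OF pull_pre]) (use c in "auto simp: rj")
also have "... = r (j c)" using sw_pull[OF V e1(2) c] sw_counit(2)[OF H_facts(1) r_Lin V jB[OF c]] by simp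
finally show "sw pull pull (%x y. counit pull y *.$pull x) c = c" using rj[OF c] by simp
qed

lemma pull_imult: "imult pull i = (%x y. r (imult H i (j x) (j y)))"
by (simp add: pullback_def)

lemma pull_bialgebra: assumes i: "i:I" shows "Bialg pull (imult pull i) (iunit pull i)"
proof -
note B = H_facts(4)[OF i]
note mb = bi_Bil[OF B] and mc = bi_closed[OF B] and uc = bi_unit[OF B] and pH = H_facts(2) and HV = H_facts(3)
note jmul = mul[OF i] and jun = un[OF i]
let ?m = "imult H i" and ?u = "iunit H i"
have alg: "algebra_structure K pull (imult pull i) (iunit pull i)" unfolding algebra_iff
proof (intro conjI pull_Vec ballI)
	show "imult pull i:Bilin pull pull pull" unfolding pull_imult
		by (intro BilinI' Lin_comp[OF LinR[OF mb j_Lin] r_Lin] Lin_comp[OF LinL[OF mb j_Lin] r_Lin]) (simp_all add: jB)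
	show "iunit pull i IN pull" using uc rB by simp
	show "imult pull i (imult pull i x y) z = imult pull i x (imult pull i y z)" if "x IN pull" "y IN pull" "z IN pull" for x y z
		using that by (simp add: jmul bi_assoc[OF B] jB)
	show "imult pull i (iunit pull i) x = x" "imult pull i x (iunit pull i) = x" if "x IN pull" for x
		using that by (simp_all add: jun bi_one[OF B] jB rj)
qed
let ?T = "ten pull pull"
have T: "Vec ?T" by (intro ten_Vec pull_Vec)
let ?b = "%s t. pur pull pull (r s) (r t)"
have b: "?b:Bilin H H ?T" by (rule comp_Bilin[OF r_Lin r_Lin pull_Vec pull_Vec])
have "comult pull (imult pull i x y) =
		sw pull ?T (%x1 x2. sw pull ?T (%y1 y2. pur pull pull (imult pull i x1 y1) (imult pull i x2 y2)) y) x" if "x:B" "y:B" for x y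
proof -
	note xy = jB[OF that(1)] jB[OF that(2)]
	have b1: "(%y1 y2. ?b (?m x1 y1) (?m x2 y2)):Bilin H H ?T" if "x1 IN H" "x2 IN H" for x1 x2
		using that by (intro BilinI' LinLR[OF b] LinR[OF mb] Lin_id mc)
	have b2: "(%x1 x2. sw H ?T (%y1 y2. ?b (?m x1 y1) (?m x2 y2)) (j y)):Bilin H H ?T"
		by (intro BilinI' sw_LinP[OF pH T HV xy(2)] LinLR[OF b] LinL[OF mb] Lin_id mc)
	have "comult pull (imult pull i x y) = Tmap pull pull r r (comult H (?m (j x) (j y)))" using jmul[OF that] by (simp add: comult_pull)
	also have "... = sw H ?T ?b (?m (j x) (j y))" by (rule tmap_sw[OF pH r_Lin r_Lin pull_Vec pull_Vec mc[OF xy]])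
	also have "... = sw H ?T (%x1 x2. sw H ?T (%y1 y2. ?b (?m x1 y1) (?m x2 y2)) (j y)) (j x)" by (rule sw_mult[OF B T b xy])
	also have "... = sw pull ?T (%x1 x2. sw H ?T (%y1 y2. ?b (?m (j x1) y1) (?m (j x2) y2)) (j y)) x"
		by (rule sw_pull[OF T b2 that(1), symmetric])
	also have "... = sw pull ?T (%x1 x2. sw pull ?T (%y1 y2. ?b (?m (j x1) (j y1)) (?m (j x2) (j y2))) y) x"
		by (intro sw_cong[OF pull_pre] sw_pull[OF T b1, symmetric]) (use that in "auto simp: jB")
	finally show ?thesis by (simp add: pull_imult)
qed
moreover have "counit pull (imult pull i x y) = counit pull x \<otimes>$K counit pull y" if "x:B" "y:B" for x y
	using that by (simp add: jmul bi_counit[OF B] jB)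
moreover have "comult pull (iunit pull i) = pur pull pull (iunit pull i) (iunit pull i)"
	using tmap_pure[OF r_Lin r_Lin HV HV pull_Vec pull_Vec uc uc] by (simp add: comult_pull jun bi_comult_unit[OF B])
moreover have "counit pull (iunit pull i) = \<one>$K" by (simp add: jun bi_counit_unit[OF B])
ultimately show ?thesis unfolding bialgebra_iff using pull_coalgebra alg by simp
qed

lemma pull_hstruct: "hstruct I J coc br pull S'"
unfolding hstruct_def
proof (intro conjI ballI impI pull_coalgebra pull_bialgebra)
note pH = H_facts(2) and HV = H_facts(3)
show "iunit pull i = iunit pull k" if "i:I" "k:I" for i k using H that unfolding hstruct_def pull_simps by metis
have anti: "S' i:Lin pull pull" "!!x. x IN H ==> S i x IN H"
	"Antip pull (imult pull i) (iunit pull i) (S' i)" "S i:Lin H H" if i: "i:J" for i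
proof -
	have iI: "i:I" using i JI by blast
	note B = H_facts(4)[OF iI]
	note mb = bi_Bil[OF B] and mc = bi_closed[OF B] and uc = bi_unit[OF B]
	have A: "Antip H (imult H i) (iunit H i) (S i)" using H i unfolding hstruct_def by blast
	hence Sl: "S i:Lin H H" and S1: "!!c. c IN H ==> sw H H (%x y. imult H i (S i x) y) c = counit H c *.$H iunit H i &
			sw H H (%x y. imult H i x (S i y)) c = counit H c *.$H iunit H i" using anti_iff[OF B] by auto
	note sc = Lin_in[OF Sl]
	show "S i:Lin H H" by fact
	show S'l: "S' i:Lin pull pull" by (rule Lin_comp[OF j_Lin Lin_comp[OF Sl r_Lin]])
	show "S i x IN H" if "x IN H" for x using sc that .
	have b1: "(%x y. imult H i (S i x) y):Bilin H H H" "(%x y. imult H i x (S i y)):Bilin H H H"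
		by (intro BilinI' LinLR[OF mb] Sl Lin_id sc; assumption)+
	have b2: "(%x y. r (imult H i (S i x) y)):Bilin H H pull" "(%x y. r (imult H i x (S i y))):Bilin H H pull"
		by (intro BilinI' Lin_comp[OF _ r_Lin] LinLR[OF mb] Sl Lin_id sc; assumption)+
	have "sw pull pull (%x y. imult pull i (S' i x) y) c = counit pull c *.$pull iunit pull i &
			sw pull pull (%x y. imult pull i x (S' i y)) c = counit pull c *.$pull iunit pull i" if c: "c:B" for c
	proof -
		have "sw pull pull (%x y. imult pull i (S' i x) y) c = sw pull pull (%x y. r (imult H i (S i (j x)) (j y))) c"
			using c i by (intro sw_cong[OF pull_pre]) (simp_all add: ant)
		also have "... = r (sw H H (%x y. imult H i (S i x) y) (j c))"
			using sw_pull[OF pull_Vec b2(1) c] Lin_sw[OF pH r_Lin HV pull_Vec jB[OF c]] mc sc by simp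
		also have "... = counit pull c *.$pull iunit pull i"
			using S1[OF jB[OF c]] counit_in[OF pH jB[OF c]] uc Lin_smult[OF r_Lin, of "counit H (j c)" "iunit H i"] by (simp add: un[OF iI])
		moreover have "sw pull pull (%x y. imult pull i x (S' i y)) c = sw pull pull (%x y. r (imult H i (j x) (S i (j y)))) c"
			using c i by (intro sw_cong[OF pull_pre]) (simp_all add: ant)
		moreover have "... = r (sw H H (%x y. imult H i x (S i y)) (j c))"
			using sw_pull[OF pull_Vec b2(2) c] Lin_sw[OF pH r_Lin HV pull_Vec jB[OF c]] mc sc by simp
		moreover have "... = counit pull c *.$pull iunit pull i"
			using S1[OF jB[OF c]] counit_in[OF pH jB[OF c]] uc Lin_smult[OF r_Lin, of "counit H (j c)" "iunit H i"] by (simp add: un[OF iI])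
		ultimately show ?thesis by simp
	qed
	thus "Antip pull (imult pull i) (iunit pull i) (S' i)" using anti_iff[OF pull_bialgebra[OF iI]] S'l by simp
qed
show "Antip pull (imult pull i) (iunit pull i) (S' i)" if "i:J" for i using anti(3)[OF that] .
show "Cocom pull" if coc
proof -
	note T = ten_Vec[OF pull_Vec pull_Vec]
	have b: "(%x y. pur pull pull (r x) (r y)):Bilin H H (ten pull pull)" by (rule comp_Bilin[OF r_Lin r_Lin pull_Vec pull_Vec])
	have b': "(%x y. pur pull pull (r y) (r x)):Bilin H H (ten pull pull)" using b unfolding bilinear_maps_def by blast
	have coc: "Cocom H" using H that unfolding hstruct_def by blast
	have "sw pull (ten pull pull) (%x y. pur pull pull y x) c = sw pull (ten pull pull) (pur pull pull) c" if c: "c:B" for c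
	proof -
		have "sw pull (ten pull pull) (%x y. pur pull pull y x) c = sw pull (ten pull pull) (%x y. pur pull pull (r (j y)) (r (j x))) c"
			by (intro sw_cong[OF pull_pre]) (use c in "auto simp: rj")
		also have "... = sw H (ten pull pull) (%x y. pur pull pull (r y) (r x)) (j c)" by (rule sw_pull[OF T b' c])
		also have "... = sw H (ten pull pull) (%x y. pur pull pull (r x) (r y)) (j c)" by (rule sw_cocom[OF pH coc T b jB[OF c]])
		also have "... = sw pull (ten pull pull) (%x y. pur pull pull (r (j x)) (r (j y))) c" by (rule sw_pull[OF T b c, symmetric])
		also have "... = sw pull (ten pull pull) (pur pull pull) c" by (intro sw_cong[OF pull_pre]) (use c in "auto simp: rj")
		finally show ?thesis .
	qed
	thus ?thesis unfolding cocommutative_iff[OF pull_pre] by simp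
qed
fix q assume q: "q:br"
obtain i k where ik: "q = (i, k)" by (cases q)
have iJ: "i:J" and iI: "i:I" and kI: "k:I" using q ik br JI by auto
note Bi = H_facts(4)[OF iI] and Bk = H_facts(4)[OF kI]
let ?d = "imult H i" and ?e = "imult H k"
note Sl = anti(4)[OF iJ]
note d = bi_Bil[OF Bi] and e = bi_Bil[OF Bk] and cl = bi_closed[OF Bi] bi_closed[OF Bk] Lin_in[OF Sl]
have law: "brace_law H ?d (S i) ?e" using H q ik unfolding hstruct_def by auto
have "imult pull k x (imult pull i y z) = sw pull pull (%x1 w. sw pull pull (%x2 x3.
		imult pull i (imult pull i (imult pull k x1 y) (S' i x2)) (imult pull k x3 z)) w) x" if B: "x:B" "y:B" "z:B" for x y z
proof -
	note jx = jB[OF B(1)] jB[OF B(2)] jB[OF B(3)]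
	let ?t = "%x1 x2 x3. ?d (?d (?e x1 (j y)) (S i x2)) (?e x3 (j z))"
	note t = brace_trilin[OF d e Sl jx(2,3)]
	have tr: "trilin H H H pull (%x1 x2 x3. r (?t x1 x2 x3))"
		by (intro trilinI Lin_comp[OF _ r_Lin] Tri1[OF t] Tri2[OF t] Tri3[OF t] Lin_id)
	have b: "(%x2 x3. r (?t x1 x2 x3)):Bilin H H pull" if "x1 IN H" for x1 using tr that unfolding trilin_def by blast
	have dd: "j (r (?d (?e (j a) (j y)) (S i (j b)))) = ?d (?e (j a) (j y)) (S i (j b))" if "a:B" "b:B" for a b
		using mul[OF iI, of "r (?e (j a) (j y))" "r (S i (j b))"] that B by (simp add: mul[OF kI] ant[OF iJ] rB cl jB)
	have "imult pull k x (imult pull i y z) = r (?e (j x) (?d (j y) (j z)))" using B iI by (simp add: mul)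
	also have "... = r (sw H H (%x1 w. sw H H (?t x1) w) (j x))" using law jx unfolding brace_law_def by simp
	also have "... = sw H pull (%x1 w. r (sw H H (?t x1) w)) (j x)"
		by (intro Lin_sw[OF pH r_Lin HV pull_Vec jx(1)] sw_closed[OF pH HV] Tri_closed[OF t])
	also have "... = sw H pull (%x1 w. sw H pull (%x2 x3. r (?t x1 x2 x3)) w) (j x)"
		by (intro sw_cong[OF pH jx(1)] Lin_sw[OF pH r_Lin HV pull_Vec] Tri_closed[OF t])
	also have "... = sw pull pull (%x1 w. sw H pull (%x2 x3. r (?t (j x1) x2 x3)) (j w)) x"
		by (rule sw_pull[OF pull_Vec sw_Tri_right[OF pH pull_Vec tr HV] B(1), symmetric])
	also have "... = sw pull pull (%x1 w. sw pull pull (%x2 x3. r (?t (j x1) (j x2) (j x3))) w) x"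
		by (intro sw_cong[OF pull_pre] sw_pull[OF pull_Vec b, symmetric]) (use B in "auto simp: jB")
	also have "... = sw pull pull (%x1 w. sw pull pull (%x2 x3.
		imult pull i (imult pull i (imult pull k x1 y) (S' i x2)) (imult pull k x3 z)) w) x"
		by (intro sw_cong[OF pull_pre]) (use B iI kI iJ in "auto simp: mul ant dd")
	finally show ?thesis .
qed
thus "case q of (i, k) => brace_law pull (imult pull i) (S' i) (imult pull k)" unfolding ik brace_law_def by (auto simp del: pull_simps(2-))
qed

lemma pull_hmaps: "j:hmaps I pull H"
unfolding hmaps_def algebra_map_def using j_coalgebra_map by (simp add: mul un)
end

end

text \<open>Closure under a set-valued operation on finite lists, by countable iteration. As
  \<open>cl xs\<close> is a set, a single \<open>cl\<close> can account for arbitrarily many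
  finitary Skolem functions.\<close>

lemma closure_exists:
fixes cl :: "'a list => 'a set" and N :: "'b set"
assumes N: "infinite N" and A: "A <= X" "|A| <=o |N|"
	and cl: "!!xs. set xs <= X ==> cl xs <= X" "!!xs. set xs <= X ==> |cl xs| <=o |N|"
obtains B where "A <= B" "B <= X" "|B| <=o |N|" "!!xs. set xs <= B ==> cl xs <= B"
proof -
define step where "step Y = Y Un (\<Union>xs\<in>lists Y. cl xs)" for Y
define F where "F n = (step ^^ n) A" for n
have F_Suc: "F (Suc n) = step (F n)" for n by (simp add: F_def)
have F: "F n <= X & |F n| <=o |N|" for n
proof (induction n)
	case 0
	thus ?case using A by (simp add: F_def)
next
	case (Suc n)
	have "|lists (F n)| <=o |lists N|" using Suc by (intro card_of_lists_mono) blast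
	hence "|lists (F n)| <=o |N|" using card_of_lists_infinite[OF N] by (rule ordLeq_ordIso_trans)
	hence "|\<Union>xs\<in>lists (F n). cl xs| <=o |N|" using cl(2) Suc by (intro card_of_UNION_ordLeq_infinite[OF N]) blast+
	hence "|step (F n)| <=o |N|" unfolding step_def
		using Suc card_of_Un_ordLeq_infinite_Field[of "|N|" "F n"] N by (simp add: card_of_Card_order)
	moreover have "step (F n) <= X" unfolding step_def using Suc cl(1) by blast
	ultimately show ?case by (simp add: F_Suc)
qed
have mono: "F n <= F m" if "n <= m" for n m using that by (induction m rule: dec_induct) (auto simp: F_Suc step_def)
show thesis
proof (rule that[of "\<Union>n. F n"])
	have "F 0 = A" by (simp add: F_def)
	thus "A <= (\<Union>n. F n)" by blast
	show "(\<Union>n. F n) <= X" using F by blast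
	have "|UNIV :: nat set| <=o |N|" using N infinite_iff_card_of_nat by blast
	thus "|\<Union>n. F n| <=o |N|" using F by (intro card_of_UNION_ordLeq_infinite[OF N]) blast+
	fix xs assume "set xs <= (\<Union>n. F n)"
	hence "EX n. set xs <= F n"
	proof (induction xs)
		case (Cons x xs)
		then obtain n m where "set xs <= F n" "x:F m" by auto
		hence "set (x # xs) <= F (max n m)" using mono[of n "max n m"] mono[of m "max n m"] by auto
		thus ?case by blast
	qed simp
	then obtain n where "set xs <= F n" ..
	hence "cl xs <= F (Suc n)" unfolding F_Suc step_def by auto
	thus "cl xs <= (\<Union>n. F n)" by blast
qed
qed

section \<open>Renamed structures and Skolem hulls\<close>

context linear_algebra
begin
lemma hmaps_inverse:
assumes H: "is_ibialg I H" and L: "is_ibialg I L" and f: "f:hmaps I H L"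
	and g: "g:Lin L H" "!!x. x IN H ==> g (f x) = x" "!!y. y IN L ==> f (g y) = y"
shows "g:hmaps I L H" "!!rh. rh:syms I ==> rel L rh = map f ` rel H rh"
proof -
have gc: "g y IN H" if "y IN L" for y using Lin_in[OF g(1) that] .
have fg: "map f (map g xs) = xs" if "set xs <= carrier L" for xs using that g(3) unfolding map_map by (intro map_idI) auto
have 1: "map g xs:rel H rh" if r: "rh:syms I" "xs:rel L rh" for xs rh
proof (rule hmaps_reflect[OF H L f g(1,2) r(1)])
	have s: "set xs <= carrier L" by (rule rel_sub[OF L r])
	thus "set (map g xs) <= carrier H" using gc by auto
	show "map f (map g xs):rel L rh" using fg[OF s] r(2) by simp
qed
show "g:hmaps I L H" by (rule rel_hmaps[OF L H]) (use gc 1 in auto)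
show "rel L rh = map f ` rel H rh" if r: "rh:syms I" for rh
proof (intro equalityI subsetI)
	fix xs assume xs: "xs:rel L rh"
	thus "xs:map f ` rel H rh" using 1[OF r xs] fg[OF rel_sub[OF L r xs]] by (metis image_eqI)
qed (use hmaps_rel[OF H L f r] in auto)
qed

text \<open>The pullback along the inverse of \<open>b\<close> is a copy of \<open>H\<close> on the
  image of \<open>b\<close>. All relations correspond since both maps are morphisms.\<close>

lemma pull_Lin_back:
assumes "hstruct I J coc br H S" "J <= I" "br <= J \<times> I" "inj_on b (carrier H)"
defines "j == inv_into (carrier H) b" and "B == b ` carrier H"
shows "hstruct I J coc br (pullback K H B j b) (%i x. b (S i (j x)))" "b:hmaps I H (pullback K H B j b)"
	"j:hmaps I (pullback K H B j b) H" "carrier (pullback K H B j b) = B" "!!rh. rh:syms I ==> rel (pullback K H B j b) rh = map b ` rel H rh"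
proof -
have c: "Coalg H" and bi: "!!i. i:I ==> Bialg H (imult H i) (iunit H i)" and an: "!!i. i:J ==> S i:Lin H H"
	using assms(1) anti_iff assms(2) unfolding hstruct_def antipode_def by blast+
note pH = coalg_pre[OF c] note V = pre_Vec[OF pH]
have jb: "j (b x) = x" if "x IN H" for x unfolding j_def using assms(4) that by simp
have jB: "j y IN H" "b (j y) = y" if "y:B" for y using that unfolding j_def B_def by (simp_all add: inv_into_into f_inv_into_f)
have bB: "b x:B" if "x IN H" for x using that by (simp add: B_def)
have jbl: "(%x. j (b x)):Lin H H" by (rule Lin_cong[OF Lin_id _ V]) (simp add: jb)
have cm: "EX ps. set ps <= B \<times> B & comult H (j y) = tsum H (map (%(x, y). (j x, j y)) ps)" if y: "y:B" for y
proof -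
	note d = dec[OF pH jB(1)[OF y]]
	have "map (%(x, y). (j x, j y)) (map (%(x, y). (b x, b y)) (dec H (j y))) = dec H (j y)"
		unfolding map_map using d(1) by (intro map_idI) (auto simp: jb)
	hence "comult H (j y) = tsum H (map (%(x, y). (j x, j y)) (map (%(x, y). (b x, b y)) (dec H (j y))))" using d(2) by (simp add: tsum_def)
	moreover have "set (map (%(x, y). (b x, b y)) (dec H (j y))) <= B \<times> B" using d(1) bB by auto
	ultimately show ?thesis by blast
qed
note P = assms(1-3) jB(1) bB jB(2) jbl cm
have m: "j (b (imult H i (j x) (j y))) = imult H i (j x) (j y)" if "i:I" "x:B" "y:B" for i x y using that jb bi_closed[OF bi] jB by simp
have u: "j (b (iunit H i)) = iunit H i" if "i:I" for i using that jb bi_unit[OF bi] by simp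
have s: "j (b (S i (j x))) = S i (j x)" if "i:J" "x:B" for i x using that jb Lin_in[OF an] jB by simp
show 1: "hstruct I J coc br (pullback K H B j b) (%i x. b (S i (j x)))" by (rule pull_hstruct[OF P m u s])
show c: "carrier (pullback K H B j b) = B" by (rule pull_simps[OF P m u s])
have j: "j:hmaps I (pullback K H B j b) H" by (rule pull_hmaps[OF P m u s])
thus "j:hmaps I (pullback K H B j b) H" .
have bl: "b:Lin H (pullback K H B j b)" by (rule r_Lin[OF P m u s])
note inv = hmaps_inverse[OF hstruct_ibialg[OF 1] hstruct_ibialg[OF assms(1)] j bl, unfolded c, OF jB(2) jb]
show b: "b:hmaps I H (pullback K H B j b)" using inv(1) .
have jl: "j:Lin (pullback K H B j b) H" using j cm_Lin unfolding hmaps_def by blast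
have bj: "b (j y) = y" if "y IN pullback K H B j b" for y using that jB(2) unfolding c by blast
show "rel (pullback K H B j b) rh = map b ` rel H rh" if "rh:syms I" for rh
	by (rule hmaps_inverse(2)[OF hstruct_ibialg[OF assms(1)] hstruct_ibialg[OF 1] b jl jb bj that])
qed

text \<open>The closed set is a subspace that contains the factors of a Sweedler expansion of each
  of its elements. With the linear retraction onto it, pulling back yields a structure, and
  \<open>hmaps_reflect\<close> shows that its relations are the induced ones.\<close>

lemma hull:
fixes H :: "('k, 'i, 'a) ibialg" and N :: "'b set"
assumes H: "hstruct I J coc br H S" and JI: "J <= I" and br: "br <= J \<times> I"
	and N: "infinite N" "|carrier K| <=o |N|" "|I| <=o |N|" and A: "A <= carrier H" "|A| <=o |N|"
obtains L T where "hstruct I J coc br L T" "A <= carrier L" "carrier L <= carrier H" "|carrier L| <=o |N|"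
	"!!rh. rh:syms I ==> rel L rh = rel H rh Int lists (carrier L)"
proof -
have c: "Coalg H" and bi: "!!i. i:I ==> Bialg H (imult H i) (iunit H i)" and an: "!!i. i:J ==> S i:Lin H H"
	using H anti_iff JI unfolding hstruct_def antipode_def by blast+
note pH = coalg_pre[OF c] note V = pre_Vec[OF pH]
\<comment> \<open>The empty list yields the constants; one element yields its multiples, the factors
  of its chosen expansion and its antipodes; two elements yield their sum and products.\<close>
define cl where "cl xs = (case xs of [] => {\<zero>$H} Un iunit H ` I
	| [x] => (%a. a *.$H x) ` carrier K Un (fst ` set (dec H x) Un snd ` set (dec H x)) Un (%i. S i x) ` J
	| [x, y] => {x +.$H y} Un (%i. imult H i x y) ` I | _ => {})" for xs
have Un: "|A Un B| <=o |N|" if "|A| <=o |N|" "|B| <=o |N|" for A B :: "'a set"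
	using that card_of_Un_ordLeq_infinite_Field[of "|N|" A] N(1) by (simp add: card_of_Card_order)
have fin: "|A| <=o |N|" if "finite A" for A :: "'d set" using N(1) that by (simp add: ordLess_imp_ordLeq)
have im: "|f ` A| <=o |N|" if "|A| <=o |N|" for f and A :: "'c set" using card_of_image that by (rule ordLeq_transitive)
have J: "|J| <=o |N|" using card_of_mono1[OF JI] N(3) by (rule ordLeq_transitive)
have "cl xs <= carrier H & |cl xs| <=o |N|" if xs: "set xs <= carrier H" for xs
proof -
	consider "xs = []" | x where "xs = [x]" | x y where "xs = [x, y]" | "length xs > 2"
		by (cases xs rule: remdups_adj.cases) (auto simp: neq_Nil_conv, metis (no_types) length_greater_0_conv neq_Nil_conv)
	thus ?thesis
	proof cases
		case 1
		have "|cl []| <=o |N|" unfolding cl_def list.case by (intro Un im N; rule fin) simp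
		moreover have "cl [] <= carrier H" using bi_unit[OF bi] vclosed(2)[OF V] by (auto simp: cl_def)
		ultimately show ?thesis using 1 by simp
	next
		case (2 x)
		hence x: "x IN H" using xs by simp
		have "fst ` set (dec H x) Un snd ` set (dec H x) <= carrier H" using dec(1)[OF pH x] by auto
		moreover have "(%i. S i x) ` J <= carrier H" using Lin_in[OF an x] by blast
		moreover have "(%a. a *.$H x) ` carrier K <= carrier H" using vclosed(3)[OF V _ x] by blast
		ultimately have "cl [x] <= carrier H" by (simp add: cl_def)
		moreover have "|cl [x]| <=o |N|" unfolding cl_def list.case by (intro Un im N J; rule fin) simp_all
		ultimately show ?thesis using 2 by simp
	next
		case (3 x y)
		hence "x IN H" "y IN H" using xs by auto
		hence "cl [x, y] <= carrier H" using bi_closed[OF bi] vclosed(1)[OF V] by (auto simp: cl_def)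
		moreover have "|cl [x, y]| <=o |N|" unfolding cl_def list.case by (intro Un im N; rule fin) simp
		ultimately show ?thesis using 3 by simp
	next
		case 4
		hence "cl xs = {}" by (auto simp: cl_def split: list.split)
		thus ?thesis using fin by simp
	qed
qed
then obtain B where B: "A <= B" "B <= carrier H" "|B| <=o |N|" and cls: "!!xs. set xs <= B ==> cl xs <= B"
	using closure_exists[OF N(1) A, of cl] by metis
have c0: "\<zero>$H:B" "i:I ==> iunit H i:B" for i using cls[of "[]"] by (auto simp: cl_def)
have c1: "a IN K ==> a *.$H x:B" "set (dec H x) <= B \<times> B" "i:J ==> S i x:B" if "x:B" for a x i
proof -
	have k: "(%a. a *.$H x) ` carrier K <= B" "fst ` set (dec H x) <= B" "snd ` set (dec H x) <= B" "(%i. S i x) ` J <= B"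
		using cls[of "[x]"] that by (simp_all add: cl_def)
	show "a IN K ==> a *.$H x:B" "i:J ==> S i x:B" using k(1,4) by blast+
	show "set (dec H x) <= B \<times> B" using k(2,3) by (auto simp: image_subset_iff mem_Times_iff)
qed
have c2: "x +.$H y:B" "i:I ==> imult H i x y:B" if "x:B" "y:B" for x y i using cls[of "[x, y]"] that by (auto simp: cl_def)
have "subspace H B" unfolding subspace_def using B(2) c0 c1 c2 by blast
then obtain rh where rho: "rh:Lin H H" and rho': "ALL x:carrier H. rh x:B" "ALL x:B. rh x = x" using retraction[OF V] by metis
let ?j = "%x::'a. x"
have jB: "?j b IN H" if "b:B" for b using that B(2) by blast
have cm: "EX ps. set ps <= B \<times> B & comult H (?j b) = tsum H (map (%(x, y). (?j x, ?j y)) ps)" if b: "b:B" for b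
	using c1(2)[OF b] dec(2)[OF pH jB[OF b]] by (intro exI[of _ "dec H b"]) (simp add: tsum_def)
have rB: "rh x:B" if "x IN H" for x using rho'(1) that by blast
have rj: "rh (?j b) = b" if "b:B" for b using rho'(2) that by blast
note P = H JI br jB rB rj rho cm
have m: "?j (rh (imult H i (?j a) (?j b))) = imult H i (?j a) (?j b)" if "i:I" "a:B" "b:B" for i a b
	using c2(2)[OF that(2,3,1)] rho'(2) by blast
have u: "?j (rh (iunit H i)) = iunit H i" if "i:I" for i using c0(2)[OF that] rho'(2) by blast
have s: "?j (rh (S i (?j b))) = S i (?j b)" if "i:J" "b:B" for i b using c1(3)[OF that(2,1)] rho'(2) by blast
let ?P = "pullback K H B ?j rh"
have P1: "hstruct I J coc br ?P (%i x. rh (S i (?j x)))" by (rule pull_hstruct[OF P m u s])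
have P2: "carrier ?P = B" by (rule pull_simps(1)[OF P m u s])
have P3: "?j:hmaps I ?P H" by (rule pull_hmaps[OF P m u s])
have P4: "rh:Lin H ?P" by (rule r_Lin[OF P m u s])
note P' = P1 P2 P3 P4
show thesis
proof (rule that[OF P'(1)], unfold P'(2), fact B(1), fact B(2), fact B(3))
	fix sg assume s: "sg:syms I"
	note ib = hstruct_ibialg[OF P'(1)] hstruct_ibialg[OF H]
	show "rel ?P sg = rel H sg Int lists B"
	proof (intro equalityI subsetI)
		fix xs assume xs: "xs:rel ?P sg"
		show "xs:rel H sg Int lists B" using hmaps_rel[OF ib P'(3) s xs] rel_sub[OF ib(1) s xs] P'(2) by auto
	next
		fix xs assume xs: "xs:rel H sg Int lists B"
		show "xs:rel ?P sg" by (rule hmaps_reflect[OF ib P'(3,4) _ s]) (use xs rho'(2) P'(2) in auto)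
	qed
qed
qed
end

context linear_algebra
begin
section \<open>Pushing structures forward\<close>

text \<open>A criterion for a coalgebra \<open>L\<close> that is covered by images of structures:
  each law is verified at one stage and pushed along \<open>q k\<close>. Triples are required to
  have a common stage because associativity and the brace law involve three elements.\<close>

context
fixes P :: "'p set" and H :: "'p => ('k, 'i, 'a) ibialg" and L :: "('k, 'i, 'b) ibialg"
	and q :: "'p => 'a => 'b" and I J :: "'i set" and coc br S SL
assumes H: "!!k. k:P ==> hstruct I J coc br (H k) (S k)" and L: "coalgebra K L" and JI: "J <= I"
	and br: "br <= J \<times> I" and q: "!!k. k:P ==> q k:coalgebra_maps K (H k) L" and mul: "!!k i x y. [|k:P; i:I; x IN H k; y IN H k|]
		==> imult L i (q k x) (q k y) = q k (imult (H k) i x y)" and un: "!!k i. [|k:P; i:I|] ==> iunit L i = q k (iunit (H k) i)"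
	and ant: "!!k i x. [|k:P; i:J; x IN H k|] ==> SL i (q k x) = q k (S k i x)" and cover: "!!x y z. [|x IN L; y IN L; z IN L|] ==>
		EX k:P. x:q k ` carrier (H k) & y:q k ` carrier (H k) & z:q k ` carrier (H k)"
begin
lemma cover3:
assumes "x IN L" "y IN L" "z IN L"
obtains k a b c where "k:P" "a IN H k" "b IN H k" "c IN H k"
	"x = q k a" "y = q k b" "z = q k c" using cover[OF assms] by blast

lemmas pL = coalg_pre[OF L] and LV = pre_Vec[OF coalg_pre[OF L]]

lemma Hk: assumes "k:P" shows "Coalg (H k)" "precoalg (H k)" "Vec (H k)"
	"i:I ==> Bialg (H k) (imult (H k) i) (iunit (H k) i)" "q k:Lin (H k) L" "i:J ==> Antip (H k) (imult (H k) i) (iunit (H k) i) (S k i)"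
	"i:J ==> S k i:Lin (H k) (H k)" using H[OF assms] coalg_pre[of "H k"] pre_Vec[of "H k"] cm_Lin[OF q[OF assms]]
unfolding hstruct_def antipode_def by blast+

lemma qc: "[|k:P; x IN H k|] ==> q k x IN L"
using Lin_in[OF Hk(5)] by blast

lemma sw_push: "[|k:P; Vec Z; be:Bilin L L Z; c IN H k|] ==>
sw L Z be (q k c) = sw (H k) Z (%x y. be (q k x) (q k y)) c" using cm_sw[OF Hk(2) pL q] by blast

lemma push_Bilin: assumes i: "i:I" shows "imult L i:Bilin L L L"
proof (rule BilinI)
fix x y assume "x IN L" "y IN L"
then obtain k a b where k: "k:P" "a IN H k" "b IN H k" "x = q k a" "y = q k b" using cover3[of x y y] by metis
show "imult L i x y IN L" using k i bi_closed[OF Hk(4)] by (simp add: mul qc)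
next
fix x y z assume "x IN L" "y IN L" "z IN L"
then obtain k a b c where k: "k:P" "a IN H k" "b IN H k" "c IN H k" and e: "x = q k a" "y = q k b" "z = q k c" by (rule cover3)
note ql = Lin_add[OF Hk(5)[OF k(1)], symmetric] and B = Bilin_simps[OF bi_Bil[OF Hk(4)[OF k(1) i]]]
note cl = vclosed(1)[OF Hk(3)[OF k(1)]]
show "imult L i (x +.$L y) z = imult L i x z +.$L imult L i y z" "imult L i x (y +.$L z) = imult L i x y +.$L imult L i x z"
	unfolding e using k i by (simp_all add: ql mul cl B)
next
fix a x y assume a: "a IN K" and "x IN L" "y IN L"
then obtain k b c where k: "k:P" "b IN H k" "c IN H k" and e: "x = q k b" "y = q k c" using cover3[of x y y] by metis
note ql = Lin_smult[OF Hk(5)[OF k(1)], symmetric] and B = Bilin_simps[OF bi_Bil[OF Hk(4)[OF k(1) i]]]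
note cl = vclosed(3)[OF Hk(3)[OF k(1)]]
show "imult L i (a *.$L x) y = a *.$L imult L i x y" "imult L i x (a *.$L y) = a *.$L imult L i x y"
	unfolding e using k i a by (simp_all add: ql mul cl B)
qed

lemma push_bialgebra: assumes i: "i:I" shows "Bialg L (imult L i) (iunit L i)"
proof -
note mb = push_Bilin[OF i]
have one: "EX k. k:P" using cover[OF vclosed(2)[OF LV] vclosed(2)[OF LV] vclosed(2)[OF LV]] by blast
then obtain k0 where k0: "k0:P" ..
note B0 = Hk(4)[OF k0 i]
note mc = Bilin_in[OF mb]
have alg: "algebra_structure K L (imult L i) (iunit L i)" unfolding algebra_iff
proof (intro conjI LV mb ballI)
	show "iunit L i IN L" using un[OF k0 i] qc[OF k0 bi_unit[OF B0]] by simp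
	fix x assume x: "x IN L" { obtain k a where k: "k:P" "a IN H k" "x = q k a" using cover3[OF x x x] by metis
		note B = Hk(4)[OF k(1) i]
		show "imult L i (iunit L i) x = x" "imult L i x (iunit L i) = x"
			using k i bi_unit[OF B] bi_one[OF B] by (simp_all add: un[OF k(1) i] mul) }
	fix y z assume y: "y IN L" and z: "z IN L"
	obtain k a b c where k: "k:P" "a IN H k" "b IN H k" "c IN H k" and e: "x = q k a" "y = q k b" "z = q k c" by (rule cover3[OF x y z])
	note B = Hk(4)[OF k(1) i]
	show "imult L i (imult L i x y) z = imult L i x (imult L i y z)" unfolding e using k i by (simp add: mul bi_closed[OF B] bi_assoc[OF B])
qed
let ?T = "ten L L"
note T = ten_Vec[OF LV LV] and p = pur_Bilin[OF LV LV]
have "comult L (imult L i x y) = sw L ?T (%x1 x2. sw L ?T (%y1 y2. pur L L (imult L i x1 y1) (imult L i x2 y2)) y) x &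
		counit L (imult L i x y) = counit L x \<otimes>$K counit L y" if xy: "x IN L" "y IN L" for x y
proof -
	obtain k a b where k: "k:P" "a IN H k" "b IN H k" and e: "x = q k a" "y = q k b" using cover3[OF xy xy(2)] by metis
	note B = Hk(4)[OF k(1) i] and ql = Hk(5)[OF k(1)] and pH = Hk(2)[OF k(1)] and qk = qc[OF k(1)]
	let ?m = "imult (H k) i" and ?q = "q k"
	have b: "(%s t. pur L L (?q s) (?q t)):Bilin (H k) (H k) ?T" by (rule comp_Bilin[OF ql ql LV LV])
	have b1: "(%y1 y2. pur L L (imult L i x1 y1) (imult L i x2 y2)):Bilin L L ?T" if "x1 IN L" "x2 IN L" for x1 x2
		using that by (intro BilinI' LinLR[OF p] LinR[OF mb] Lin_id mc)
	have b2: "(%x1 x2. sw L ?T (%y1 y2. pur L L (imult L i x1 y1) (imult L i x2 y2)) y):Bilin L L ?T"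
		by (intro BilinI' sw_LinP[OF pL T LV xy(2)] LinLR[OF p] LinL[OF mb] Lin_id mc)
	have mab: "?m a b IN H k" using bi_closed[OF B] k by blast
	have "comult L (imult L i x y) = comult L (?q (?m a b))" unfolding e using k i by (simp add: mul)
	also have "... = Tmap L L ?q ?q (comult (H k) (?m a b))" using q[OF k(1)] mab unfolding coalgebra_maps_def by blast
	also have "... = sw (H k) ?T (%s t. pur L L (?q s) (?q t)) (?m a b)" by (rule tmap_sw[OF pH ql ql LV LV mab])
	also have "... = sw (H k) ?T (%x1 x2. sw (H k) ?T (%y1 y2. pur L L (?q (?m x1 y1)) (?q (?m x2 y2))) b) a"
		by (rule sw_mult[OF B T b k(2,3)])
	also have "... = sw (H k) ?T (%x1 x2. sw (H k) ?T (%y1 y2.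
			pur L L (imult L i (?q x1) (?q y1)) (imult L i (?q x2) (?q y2))) b) a" by (intro sw_cong[OF pH] k) (simp add: mul k i)
	also have "... = sw (H k) ?T (%x1 x2. sw L ?T (%y1 y2. pur L L (imult L i (?q x1) y1) (imult L i (?q x2) y2)) y) a"
		unfolding e by (intro sw_cong[OF pH k(2)] sw_push[OF k(1) T _ k(3), symmetric] b1 qk)
	also have "... = sw L ?T (%x1 x2. sw L ?T (%y1 y2. pur L L (imult L i x1 y1) (imult L i x2 y2)) y) x"
		unfolding e(1) by (rule sw_push[OF k(1) T b2 k(2), symmetric])
	finally show ?thesis using cm_counit[OF q[OF k(1)]] bi_counit[OF B k(2,3)] k i mab unfolding e by (simp add: mul)
qed
moreover have "comult L (iunit L i) = pur L L (iunit L i) (iunit L i)"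
proof -
	have "comult L (q k0 (iunit (H k0) i)) = Tmap L L (q k0) (q k0) (comult (H k0) (iunit (H k0) i))"
		using q[OF k0] bi_unit[OF B0] unfolding coalgebra_maps_def by blast
	thus ?thesis using tmap_pure[OF Hk(5)[OF k0] Hk(5)[OF k0] Hk(3)[OF k0] Hk(3)[OF k0] LV LV bi_unit[OF B0] bi_unit[OF B0]]
		by (simp add: un[OF k0 i] bi_comult_unit[OF B0])
qed
moreover have "counit L (iunit L i) = \<one>$K" using cm_counit[OF q[OF k0] bi_unit[OF B0]] by (simp add: un[OF k0 i] bi_counit_unit[OF B0])
ultimately show ?thesis unfolding bialgebra_iff using L alg by blast
qed

lemma push_hstruct: "hstruct I J coc br L SL"
unfolding hstruct_def
proof (intro conjI ballI impI L push_bialgebra)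
have "EX k. k:P" using cover[OF vclosed(2)[OF LV] vclosed(2)[OF LV] vclosed(2)[OF LV]] by blast
then obtain k0 where k0: "k0:P" ..
show "iunit L i = iunit L j" if "i:I" "j:I" for i j using H[OF k0] that un[OF k0] unfolding hstruct_def by metis
show "Cocom L" if coc unfolding cocommutative_iff[OF pL]
proof
	fix c assume c: "c IN L"
	obtain k a where k: "k:P" "a IN H k" "c = q k a" using cover3[OF c c c] by metis
	note T = ten_Vec[OF LV LV] and ql = Hk(5)[OF k(1)]
	have b: "(%s t. pur L L (q k s) (q k t)):Bilin (H k) (H k) (ten L L)" by (rule comp_Bilin[OF ql ql LV LV])
	have b': "(%s t. pur L L t s):Bilin L L (ten L L)" using pur_Bilin[OF LV LV] unfolding bilinear_maps_def by blast
	have "Cocom (H k)" using H[OF k(1)] that unfolding hstruct_def by blast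
	from sw_cocom[OF Hk(2)[OF k(1)] this T b k(2)]
	show "sw L (ten L L) (%x y. pur L L y x) c = sw L (ten L L) (pur L L) c"
		using sw_push[OF k(1) T b' k(2)] sw_push[OF k(1) T pur_Bilin[OF LV LV] k(2)] k(3) by simp
qed
have anti: "SL i:Lin L L" "Antip L (imult L i) (iunit L i) (SL i)" if i: "i:J" for i
proof -
	have iI: "i:I" using i JI by blast
	note mb = push_Bilin[OF iI]
	show l: "SL i:Lin L L"
	proof (rule LinI)
		fix x assume x: "x IN L"
		obtain k a where k: "k:P" "a IN H k" "x = q k a" using cover3[OF x x x] by metis
		note Sl = Hk(7)[OF k(1) i]
		show "SL i x IN L" using k i by (simp add: ant qc Lin_in[OF Sl])
		show "SL i (c *.$L x) = c *.$L SL i x" if "c IN K" for c using k i that vclosed(3)[OF Hk(3)[OF k(1)]]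
			by (simp add: ant Lin_smult[OF Hk(5)[OF k(1)], symmetric] Lin_smult[OF Sl] Lin_in[OF Sl])
	next
		fix x y assume xy: "x IN L" "y IN L"
		obtain k a b where k: "k:P" "a IN H k" "b IN H k" and e: "x = q k a" "y = q k b" using cover3[OF xy xy(2)] by metis
		note Sl = Hk(7)[OF k(1) i]
		show "SL i (x +.$L y) = SL i x +.$L SL i y" unfolding e using k i vclosed(1)[OF Hk(3)[OF k(1)]]
			by (simp add: ant Lin_add[OF Hk(5)[OF k(1)], symmetric] Lin_add[OF Sl] Lin_in[OF Sl])
	qed
	have "sw L L (%x y. imult L i (SL i x) y) c = counit L c *.$L iunit L i &
			sw L L (%x y. imult L i x (SL i y)) c = counit L c *.$L iunit L i" if c: "c IN L" for c
	proof -
		obtain k a where k: "k:P" "a IN H k" "c = q k a" using cover3[OF c c c] by metis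
		note Sl = Hk(7)[OF k(1) i] and B = Hk(4)[OF k(1) iI] and pH = Hk(2)[OF k(1)] and ql = Hk(5)[OF k(1)] and HV = Hk(3)[OF k(1)]
		note sc = Lin_in[OF Sl] and Hmc = bi_closed[OF B]
		have b: "(%x y. imult L i (SL i x) y):Bilin L L L" "(%x y. imult L i x (SL i y)):Bilin L L L"
			by (intro BilinI' LinLR[OF mb] l Lin_id Lin_in[OF l]; assumption)+
		have A: "sw (H k) (H k) (%x y. imult (H k) i (S k i x) y) a = counit (H k) a *.$(H k) iunit (H k) i &
				sw (H k) (H k) (%x y. imult (H k) i x (S k i y)) a = counit (H k) a *.$(H k) iunit (H k) i"
			using Hk(6)[OF k(1) i] anti_iff[OF B] k(2) by blast
		have e: "q k (counit (H k) a *.$(H k) iunit (H k) i) = counit L c *.$L iunit L i"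
			using Lin_smult[OF ql counit_in[OF pH k(2)] bi_unit[OF B]] cm_counit[OF q[OF k(1)] k(2)] k(3) by (simp add: un[OF k(1) iI])
		have "sw L L (%x y. imult L i (SL i x) y) c = sw (H k) L (%x y. q k (imult (H k) i (S k i x) y)) a"
			unfolding k(3) sw_push[OF k(1) LV b(1) k(2)] by (intro sw_cong[OF pH k(2)]) (simp add: ant mul k i iI sc)
		also have "... = q k (sw (H k) (H k) (%x y. imult (H k) i (S k i x) y) a)" by (intro Lin_sw[OF pH ql HV LV k(2), symmetric] sc Hmc)
		moreover have "sw L L (%x y. imult L i x (SL i y)) c = sw (H k) L (%x y. q k (imult (H k) i x (S k i y))) a"
			unfolding k(3) sw_push[OF k(1) LV b(2) k(2)] by (intro sw_cong[OF pH k(2)]) (simp add: ant mul k i iI sc)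
		moreover have "... = q k (sw (H k) (H k) (%x y. imult (H k) i x (S k i y)) a)" by (intro Lin_sw[OF pH ql HV LV k(2), symmetric] sc Hmc)
		ultimately show ?thesis using A e by simp
	qed
	thus "Antip L (imult L i) (iunit L i) (SL i)" using anti_iff[OF push_bialgebra[OF iI]] l by blast
qed
show "Antip L (imult L i) (iunit L i) (SL i)" if "i:J" for i using anti(2)[OF that] .
fix w assume w: "w:br"
obtain i j where ij: "w = (i, j)" by (cases w)
have iJ: "i:J" and iI: "i:I" and jI: "j:I" using w ij br JI by auto
note d = push_Bilin[OF iI] and e = push_Bilin[OF jI]
have "imult L j x (imult L i y z) = sw L L (%x1 w. sw L L (%x2 x3.
		imult L i (imult L i (imult L j x1 y) (SL i x2)) (imult L j x3 z)) w) x" if B: "x IN L" "y IN L" "z IN L" for x y z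
proof -
	obtain k a b c where k: "k:P" "a IN H k" "b IN H k" "c IN H k" and eq: "x = q k a" "y = q k b" "z = q k c" by (rule cover3[OF B])
	note Bi = Hk(4)[OF k(1) iI] and Bj = Hk(4)[OF k(1) jI] and Sl = Hk(7)[OF k(1) iJ] and pH = Hk(2)[OF k(1)]
		and ql = Hk(5)[OF k(1)] and HV = Hk(3)[OF k(1)]
	note cl = bi_closed[OF Bi] bi_closed[OF Bj] Lin_in[OF Sl]
	let ?d = "imult (H k) i" and ?e = "imult (H k) j"
	let ?t = "%x1 x2 x3. ?d (?d (?e x1 b) (S k i x2)) (?e x3 c)"
	let ?tL = "%x1 x2 x3. imult L i (imult L i (imult L j x1 y) (SL i x2)) (imult L j x3 z)"
	note t = brace_trilin[OF bi_Bil[OF Bi] bi_Bil[OF Bj] Sl k(3,4)]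
	note tL = brace_trilin[OF d e anti(1)[OF iJ] B(2,3)]
	have tb: "?tL x1:Bilin L L L" if "x1 IN L" for x1 using tL that unfolding trilin_def by blast
	have law: "brace_law (H k) ?d (S k i) ?e" using H[OF k(1)] w ij unfolding hstruct_def by auto
	have tt: "?tL (q k x1) (q k x2) (q k x3) = q k (?t x1 x2 x3)" if "x1 IN H k" "x2 IN H k" "x3 IN H k" for x1 x2 x3
		unfolding eq using that k iI jI iJ by (simp add: mul ant cl)
	have "sw L L (%x1 w. sw L L (?tL x1) w) x = sw (H k) L (%x1 w. sw L L (?tL (q k x1)) (q k w)) a"
		unfolding eq(1) by (rule sw_push[OF k(1) LV sw_Tri_right[OF pL LV tL LV] k(2)])
	also have "... = sw (H k) L (%x1 w. sw (H k) L (%x2 x3. ?tL (q k x1) (q k x2) (q k x3)) w) a"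
		by (intro sw_cong[OF pH k(2)] sw_push[OF k(1) LV tb] qc[OF k(1)])
	also have "... = sw (H k) L (%x1 w. sw (H k) L (%x2 x3. q k (?t x1 x2 x3)) w) a" by (intro sw_cong[OF pH] k(2) tt)
	also have "... = sw (H k) L (%x1 w. q k (sw (H k) (H k) (?t x1) w)) a"
		by (intro sw_cong[OF pH k(2)] Lin_sw[OF pH ql HV LV, symmetric] Tri_closed[OF t])
	also have "... = q k (sw (H k) (H k) (%x1 w. sw (H k) (H k) (?t x1) w) a)"
		by (intro Lin_sw[OF pH ql HV LV k(2), symmetric] sw_closed[OF pH HV] Tri_closed[OF t])
	also have "... = q k (?e a (?d b c))" using law k unfolding brace_law_def by simp
	also have "... = imult L j x (imult L i y z)" unfolding eq using k iI jI by (simp add: mul cl)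
	finally show ?thesis by simp
qed
thus "case w of (i, j) => brace_law L (imult L i) (SL i) (imult L j)" unfolding ij brace_law_def by auto
qed
end

end

section \<open>Gluing\<close>

text \<open>A presentation of the direct sum of the \<open>V i\<close> modulo the identifications
  \<open>E\<close>. Starting from the free module on the disjoint union puts linearity of the
  inclusions among the relations, so the results on presentations apply directly.\<close>

definition glue_rels ::
"'k ring => 'p set => ('p => ('k, 'a, 'c) module_scheme) => (('p * 'a) * ('p * 'a)) set => ('p * 'a => 'k) set"
where "glue_rels K P V E = (let F = free_module K (SIGMA i:P. carrier (V i)) in
	{delta K (i, x +.$(V i) y) \<ominus>$F (delta K (i, x) +.$F delta K (i, y)) | i x y.
			i:P & x IN V i & y:carrier (V i)} Un
	{delta K (i, a *.$(V i) x) \<ominus>$F (a *.$F delta K (i, x)) | i a x.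
			i:P & a IN K & x:carrier (V i)} Un
	{delta K p \<ominus>$F delta K p' | p p'. (p, p'):E})"

definition glue_sp ::
"'k ring => 'p set => ('p => ('k, 'a, 'c) module_scheme) => (('p * 'a) * ('p * 'a)) set => ('k, ('p * 'a => 'k) set) module" where
"glue_sp K P V E = linear_algebra.pres K (SIGMA i:P. carrier (V i)) (glue_rels K P V E)"

definition glue_map ::
"'k ring => 'p set => ('p => ('k, 'a, 'c) module_scheme) => (('p * 'a) * ('p * 'a)) set => 'p => 'a => ('p * 'a => 'k) set" where
"glue_map K P V E i x = linear_algebra.gen K (SIGMA i:P. carrier (V i)) (glue_rels K P V E) (i, x)"

text \<open>Generators are pairs of an index and an element, so \<open>tensor_lift\<close> with the
  index as first argument defines maps out of the gluing. Multiplications and units do not arise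
  from gluing in general and are therefore parameters, filled in by each application.\<close>

definition glue ::
"'k ring => 'p set => ('p => ('k, 'a, 'c) coalg_scheme) => (('p * 'a) * ('p * 'a)) set
=> ('i => ('p * 'a => 'k) set => ('p * 'a => 'k) set => ('p * 'a => 'k) set) => ('i => ('p * 'a => 'k) set)
=> ('k, 'i, ('p * 'a => 'k) set) ibialg" where "glue K P C E m u = (let Q = glue_sp K P C E; q = glue_map K P C E; T = tensor K Q Q in
	(|carrier = carrier Q, mult = undefined, one = undefined, ring.zero = \<zero>$Q, add = add Q, smult = smult Q,
		comult = tensor_lift K T (%i. linear_algebra.sw K (C i) T (%a b. pure_tensor K Q Q (q i a) (q i b))),
		counit = tensor_lift K (base_module K) (%i. counit (C i)), imult = m, iunit = u|))"

context linear_algebra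
begin
context
fixes P :: "'p set" and V :: "'p => ('k, 'a, 'c) module_scheme" and E
assumes V: "!!i. i:P ==> Vec (V i)" and E: "E <= (SIGMA i:P. carrier (V i)) \<times> (SIGMA i:P. carrier (V i))"
begin
abbreviation "gA == SIGMA i:P. carrier (V i)"
abbreviation "gR == glue_rels K P V E"
abbreviation "Q == glue_sp K P V E"
abbreviation "q == glue_map K P V E"

lemma gF: "[|x IN Free gA; y IN Free gA|]
	==> x +.$(Free gA) y IN Free gA" "[|a IN K; x IN Free gA|] ==> a *.$(Free gA) x IN Free gA"
"[|i:P; x' IN V i|] ==> delta K (i, x') IN Free gA" "(p, p'):E ==> delta K p IN Free gA" "(p, p'):E ==> delta K p' IN Free gA"
using add_closed[OF free_Vec] smult_closed[OF free_Vec] E by (auto intro!: delta_in)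

lemma glue_sub: "gR <= carrier (Free gA)"
unfolding glue_rels_def Let_def
proof (intro Un_least subsetI; elim CollectE exE conjE; hypsubst)
fix i x y assume "i:P" "x IN V i" "y IN V i"
thus "delta K (i, x +.$(V i) y) \<ominus>$(Free gA) (delta K (i, x) +.$(Free gA) delta K (i, y)) IN Free gA"
	by (intro free_diff gF(1-3) vclosed(1)[OF V])
next
fix i a x assume "i:P" "a IN K" "x IN V i"
thus "delta K (i, a *.$(V i) x) \<ominus>$(Free gA) (a *.$(Free gA) delta K (i, x)) IN Free gA"
	by (intro free_diff gF(1-3) vclosed(3)[OF V])
next
fix p p' assume "(p, p'):E"
thus "delta K p \<ominus>$(Free gA) delta K p' IN Free gA" by (intro free_diff gF(4,5))
qed

lemma glue_Vec: "Vec Q"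
unfolding glue_sp_def by (rule pres_Vec[OF glue_sub])

lemma glue_map_in: "[|i:P; x IN V i|] ==> q i x IN Q"
unfolding glue_sp_def glue_map_def by (rule gen_in[OF glue_sub]) simp

lemma glue_map_cls: "q i x = cls (Free gA) (relations gA gR) (delta K (i, x))"
unfolding glue_map_def by (rule gen_cls[OF glue_sub])

lemma glue_map_Lin: assumes i: "i:P" shows "q i:Lin (V i) Q"
proof -
note l = qcls_Lin[OF glue_sub] and d = qcls_diff[OF glue_sub]
note cl = vclosed(1,3)[OF V[OF i]]
show ?thesis
proof (rule LinI)
	fix x assume x: "x IN V i"
	show "q i x IN Q" using glue_map_in i x .
	{ fix a assume a: "a IN K"
		have "cls (Free gA) (relations gA gR) (delta K (i, a *.$(V i) x)) = cls (Free gA) (relations gA gR) (a *.$(Free gA) delta K (i, x))"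
			by (rule d, unfold glue_rels_def Let_def, rule UnI1, rule UnI2, use i a x in blast) (use i a x cl in "auto intro!: gF(1-3)")
		thus "q i (a *.$(V i) x) = a *.$Q q i x" unfolding glue_map_cls glue_sp_def using i a x by (simp add: Lin_smult[OF l] gF) }
	fix y assume y: "y IN V i"
	have "cls (Free gA) (relations gA gR) (delta K (i, x +.$(V i) y)) =
			cls (Free gA) (relations gA gR) (delta K (i, x) +.$(Free gA) delta K (i, y))"
		by (rule d, unfold glue_rels_def Let_def, rule UnI1, rule UnI1, use i y x in blast) (use i y x cl in "auto intro!: gF(1-3)")
	thus "q i (x +.$(V i) y) = q i x +.$Q q i y" unfolding glue_map_cls glue_sp_def using i y x by (simp add: Lin_add[OF l] gF)
qed
qed

lemma glue_eq: assumes "((i, x), (j, y)):E" shows "q i x = q j y"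
unfolding glue_map_cls by (rule qcls_diff[OF glue_sub], unfold glue_rels_def Let_def, rule UnI2, use assms in blast)
	(use gF(4,5)[OF assms] in auto)

context
fixes Z :: "('k, 'z, 'e) module_scheme" and f
assumes Z: "Vec Z" and f: "!!i. i:P ==> f i:Lin (V i) Z"
	and fE: "!!i x j y. ((i, x), (j, y)):E ==> f i x = f j y"
begin
lemma glue_ev: assumes "rh:gR" shows "ev Z (case_prod f) rh = \<zero>$Z"
proof -
have bc: "case_prod f p IN Z" if "p:gA" for p using that Lin_in[OF f] by auto
note e = ev_Lin[of Z gA "case_prod f", OF Z bc]
note S = Lin_add[OF e] Lin_smult[OF e] delta_in ev_delta[of Z gA "case_prod f", OF Z bc]
note D = ev_diff[of Z gA "case_prod f", OF Z bc]
consider (a) i x y where "rh = delta K (i, x +.$(V i) y) \<ominus>$(Free gA) (delta K (i, x) +.$(Free gA) delta K (i, y))"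
		"i:P" "x IN V i" "y IN V i" | (b) i a x where "rh = delta K (i, a *.$(V i) x) \<ominus>$(Free gA) (a *.$(Free gA) delta K (i, x))"
		"i:P" "a IN K" "x IN V i" | (c) p p' where "rh = delta K p \<ominus>$(Free gA) delta K p'" "(p, p'):E"
	using assms unfolding glue_rels_def Let_def by blast
thus ?thesis
proof cases
	case a
	note cl = vclosed(1,3)[OF V[OF a(2)]]
	show ?thesis unfolding a(1) by (rule D) (use a cl in "auto intro!: gF(1-3) simp: S Lin_add[OF f]")
next
	case b
	note cl = vclosed(1,3)[OF V[OF b(2)]]
	show ?thesis unfolding b(1) by (rule D) (use b cl in "auto intro!: gF(1-3) simp: S Lin_smult[OF f]")
next
	case c
	have "p:gA" "p':gA" using c(2) E by auto
	hence "ev Z (case_prod f) (delta K p) = ev Z (case_prod f) (delta K p')" using c(2) fE by (cases p; cases p') (auto simp: S)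
	thus ?thesis unfolding c(1) using gF(4,5)[OF c(2)] by (intro D)
qed
qed

lemma glue_lift_Lin: "Tlift Z f:Lin Q Z"
unfolding glue_sp_def by (rule tensor_lift_Lin[OF glue_sub Z _ glue_ev]) (use Lin_in[OF f] in auto)

lemma glue_lift: "[|i:P; x IN V i|] ==> Tlift Z f (q i x) = f i x"
unfolding glue_map_def by (rule tensor_lift_gen[OF glue_sub Z _ glue_ev]) (use Lin_in[OF f] in auto)
end

lemma glue_induct:
assumes t: "t IN Q" and z: "R \<zero>$Q"
	and s: "!!i x t. [|i:P; x IN V i; t IN Q; R t|] ==> R (q i x +.$Q t)"
shows "R t"
proof (rule pres_induct[OF glue_sub, of t R, folded glue_sp_def, OF t z])
fix a p t assume a: "a IN K" "p:gA" "t IN Q" "R t"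
obtain i x where p: "p = (i, x)" "i:P" "x IN V i" using a(2) by auto
have "a *.$Q gen gA gR p = q i (a *.$(V i) x)" using Lin_smult[OF glue_map_Lin[OF p(2)] a(1) p(3)] by (simp add: glue_map_def p(1))
thus "R (a *.$Q gen gA gR p +.$Q t)" using s[OF p(2) vclosed(3)[OF V[OF p(2)] a(1) p(3)] a(3,4)] by simp
qed

lemma glue_ext:
assumes f: "f:Lin Q Z" and g: "g:Lin Q Z" and Z: "Vec Z"
	and eq: "!!i x. [|i:P; x IN V i|] ==> f (q i x) = g (q i x)" and t: "t IN Q"
shows "f t = g t"
using t
proof (rule glue_induct)
show "f \<zero>$Q = g \<zero>$Q" using Lin_zero[OF f glue_Vec Z] Lin_zero[OF g glue_Vec Z] by simp
fix i x t assume "i:P" "x IN V i" "t IN Q" "f t = g t"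
thus "f (q i x +.$Q t) = g (q i x +.$Q t)" by (simp add: Lin_add[OF f] Lin_add[OF g] glue_map_in eq)
qed
end

text \<open>Identified elements have equal counits, and their comultiplications agree after passing
  to the tensor square of the gluing. This coideal condition covers both diagrams of coalgebras and
  the quotient of a single coalgebra.\<close>

context
fixes P :: "'p set" and C :: "'p => ('k, 'a, 'c) coalg_scheme" and E
	and m :: "'i => ('p * 'a => 'k) set => ('p * 'a => 'k) set => ('p * 'a => 'k) set" and u :: "'i => ('p * 'a => 'k) set"
assumes C: "!!i. i:P ==> coalgebra K (C i)" and E: "E <= (SIGMA i:P. carrier (C i)) \<times> (SIGMA i:P. carrier (C i))"
	and eps: "!!i x j y. ((i, x), (j, y)):E ==> counit (C i) x = counit (C j) y" and cm: "!!i x j y. ((i, x), (j, y)):E ==>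
		sw (C i) (ten (glue_sp K P C E) (glue_sp K P C E))
			(%a b. pur (glue_sp K P C E) (glue_sp K P C E) (glue_map K P C E i a) (glue_map K P C E i b)) x =
		sw (C j) (ten (glue_sp K P C E) (glue_sp K P C E))
			(%a b. pur (glue_sp K P C E) (glue_sp K P C E) (glue_map K P C E j a) (glue_map K P C E j b)) y"
begin
abbreviation "GQ == glue_sp K P C E"
abbreviation "gq == glue_map K P C E"
abbreviation "G == glue K P C E m u"

lemma gC: "i:P ==> precoalg (C i)" "i:P ==> Vec (C i)"
using coalg_pre[OF C] pre_Vec by auto

lemma GQ_Vec: "Vec GQ"
by (rule glue_Vec[of P C E, OF gC(2) E])

lemma gq_Lin: "i:P ==> gq i:Lin (C i) GQ"
by (rule glue_map_Lin[of P C E, OF gC(2) E])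

lemma glue_same: "same_sp GQ G"
by (simp add: same_sp_def glue_def Let_def)

lemma glue_imult: "imult G = m" "iunit G = u" "carrier G = carrier GQ"
by (simp_all add: glue_def Let_def)

lemma G_Vec: "Vec G" using Vec_same[OF glue_same GQ_Vec] .

lemma ten_G: "ten G G = ten GQ GQ" "pur G G = pur GQ GQ"
using ten_same[OF glue_same glue_same] pur_same[OF glue_same glue_same] by simp_all

lemma Lin_G: "Lin G Z = Lin GQ Z" "Lin Z G = Lin Z GQ"
using Lin_same[OF glue_same srefl] Lin_same[OF srefl glue_same] by auto

lemma gq_G: "i:P ==> gq i:Lin (C i) G"
unfolding Lin_G by (rule gq_Lin)

lemma gq_in: "[|i:P; x IN C i|] ==> gq i x IN G"
using Lin_in[OF gq_G] .

lemma glue_comult: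
shows glue_comult_Lin: "comult G:Lin G (ten G G)"
	and glue_comult_map: "[|i:P; x IN C i|] ==> comult G (gq i x) = sw (C i) (ten G G) (%a b. pur G G (gq i a) (gq i b)) x"
	and glue_counit_Lin: "counit G:Lin G Base" and glue_eps: "[|i:P; x IN C i|] ==> counit G (gq i x) = counit (C i) x"
proof -
let ?T = "ten GQ GQ"
have T: "Vec ?T" by (intro ten_Vec GQ_Vec)
have l: "sw (C i) ?T (%a b. pur GQ GQ (gq i a) (gq i b)):Lin (C i) ?T" if "i:P" for i
	by (rule sw_Lin[OF gC(1)[OF that] T comp_Bilin[OF gq_Lin[OF that] gq_Lin[OF that] GQ_Vec GQ_Vec]])
have d: "comult G = Tlift ?T (%i. sw (C i) ?T (%a b. pur GQ GQ (gq i a) (gq i b)))" "counit G = Tlift Base (%i. counit (C i))"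
	by (simp_all add: glue_def Let_def)
show "comult G:Lin G (ten G G)" unfolding d ten_G Lin_G by (rule glue_lift_Lin[of P C E, OF gC(2) E T l cm])
show "[|i:P; x IN C i|] ==> comult G (gq i x) = sw (C i) (ten G G) (%a b. pur G G (gq i a) (gq i b)) x"
	unfolding d ten_G by (rule glue_lift[of P C E, OF gC(2) E T l cm])
show "counit G:Lin G Base" unfolding d Lin_G by (rule glue_lift_Lin[of P C E, OF gC(2) E base_Vec counit_Lin[OF gC(1)] eps])
show "[|i:P; x IN C i|] ==> counit G (gq i x) = counit (C i) x"
	unfolding d by (rule glue_lift[of P C E, OF gC(2) E base_Vec counit_Lin[OF gC(1)] eps])
qed

lemma glue_pre: "precoalg G"
unfolding precoalg_def using G_Vec glue_comult_Lin glue_counit_Lin by blast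

lemma G_ext:
assumes "f:Lin G Z" "g:Lin G Z" "Vec Z"
	and "!!i x. [|i:P; x IN C i|] ==> f (gq i x) = g (gq i x)" and "t IN G"
shows "f t = g t"
using glue_ext[of P C E f Z g t, OF gC(2) E] assms unfolding Lin_G glue_imult by blast

lemma gq_cm: assumes i: "i:P" shows "gq i:Cmaps (C i) G"
by (rule cm_I[OF gC(1)[OF i] glue_pre gq_G[OF i]]) (use i in "auto simp: glue_comult_map glue_eps")

lemma glue_coalgebra: "Coalg G"
proof (rule coalgebraI[OF glue_pre])
note V = G_Vec and pG = glue_pre
let ?Z = "ten G (ten G G)" and ?t = "%x y z. pur G (ten G G) x (pur G G y z)"
have VV: "Vec (ten G G)" and Z: "Vec ?Z" by (intro ten_Vec V)+
note p = pur_Bilin[OF V V] and p' = pur_Bilin[OF V VV]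
have t: "trilin G G G ?Z ?t" by (intro trilinI LinLR[OF p'] LinLR[OF p] Lin_id Bilin_in[OF p])
note bl = sw_Tri_left[OF pG Z t V] and br = sw_Tri_right[OF pG Z t V]
have b1: "(%s s'. ?t s s' s''):Bilin G G ?Z" if "s'' IN G" for s'' using that by (intro BilinI' Tri1[OF t] Tri2[OF t] Lin_id)
have b2: "(%s' s''. ?t s s' s''):Bilin G G ?Z" if "s IN G" for s using that by (intro BilinI' Tri2[OF t] Tri3[OF t] Lin_id)
note s = smult_Bilin[OF V] and e = counit_Lin[OF pG] and ec = counit_in[OF pG]
have e1: "(%x y. counit G x *.$G y):Bilin G G G" "(%x y. counit G y *.$G x):Bilin G G G"
	by (auto intro!: BilinI' LinLR[OF s] Lin_id e simp: ec)
fix c assume c: "c IN G"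
show "sw G ?Z (%x y. sw G ?Z (%x' x''. ?t x' x'' y) x) c = sw G ?Z (%x y. sw G ?Z (%y' y''. ?t x y' y'') y) c"
proof (rule G_ext[OF sw_Lin[OF pG Z bl] sw_Lin[OF pG Z br] Z _ c])
	fix i x assume i: "i:P" and x: "x IN C i"
	note pC = gC(1)[OF i] and push = cm_sw[OF gC(1)[OF i] pG gq_cm[OF i] Z] and qi = gq_in[OF i]
	have tr: "trilin (C i) (C i) (C i) ?Z (%x y z. ?t (gq i x) (gq i y) (gq i z))"
		by (intro trilinI Tri1[OF t] Tri2[OF t] Tri3[OF t] gq_G i qi)
	have "sw G ?Z (%x y. sw G ?Z (%x' x''. ?t x' x'' y) x) (gq i x) = sw (C i) ?Z (%x y. sw G ?Z (%x' x''. ?t x' x'' (gq i y)) (gq i x)) x"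
		by (rule push[OF bl x])
	also have "... = sw (C i) ?Z (%x y. sw (C i) ?Z (%x' x''. ?t (gq i x') (gq i x'') (gq i y)) x) x"
		by (intro sw_cong[OF pC x] push[OF b1] qi)
	also have "... = sw (C i) ?Z (%x y. sw (C i) ?Z (%y' y''. ?t (gq i x) (gq i y') (gq i y'')) y) x" by (rule sw_assoc[OF C[OF i] Z tr x])
	also have "... = sw (C i) ?Z (%x y. sw G ?Z (%y' y''. ?t (gq i x) y' y'') (gq i y)) x"
		by (intro sw_cong[OF pC x] push[OF b2, symmetric] qi)
	also have "... = sw G ?Z (%x y. sw G ?Z (%y' y''. ?t x y' y'') y) (gq i x)" by (rule push[OF br x, symmetric])
	finally show "sw G ?Z (%x y. sw G ?Z (%x' x''. ?t x' x'' y) x) (gq i x) = sw G ?Z (%x y. sw G ?Z (%y' y''. ?t x y' y'') y) (gq i x)" .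
qed
show "sw G G (%x y. counit G x *.$G y) c = c"
proof (rule G_ext[OF sw_Lin[OF pG V e1(1)] Lin_id V _ c])
	fix i x assume i: "i:P" and x: "x IN C i"
	have "sw G G (%x y. counit G x *.$G y) (gq i x) = sw (C i) G (%x y. counit G (gq i x) *.$G gq i y) x"
		by (rule cm_sw[OF gC(1)[OF i] pG gq_cm[OF i] V e1(1) x])
	also have "... = sw (C i) G (%x y. counit (C i) x *.$G gq i y) x" by (intro sw_cong[OF gC(1)[OF i] x]) (simp add: glue_eps i)
	also have "... = gq i x" by (rule sw_counit(1)[OF C[OF i] gq_G[OF i] V x])
	finally show "sw G G (%x y. counit G x *.$G y) (gq i x) = gq i x" .
qed
show "sw G G (%x y. counit G y *.$G x) c = c"
proof (rule G_ext[OF sw_Lin[OF pG V e1(2)] Lin_id V _ c])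
	fix i x assume i: "i:P" and x: "x IN C i"
	have "sw G G (%x y. counit G y *.$G x) (gq i x) = sw (C i) G (%x y. counit G (gq i y) *.$G gq i x) x"
		by (rule cm_sw[OF gC(1)[OF i] pG gq_cm[OF i] V e1(2) x])
	also have "... = sw (C i) G (%x y. counit (C i) y *.$G gq i x) x" by (intro sw_cong[OF gC(1)[OF i] x]) (simp add: glue_eps i)
	also have "... = gq i x" by (rule sw_counit(2)[OF C[OF i] gq_G[OF i] V x])
	finally show "sw G G (%x y. counit G y *.$G x) (gq i x) = gq i x" .
qed
qed

lemma glue_cocommutative:
assumes coc: "!!i. i:P ==> Cocom (C i)" shows "Cocom G"
unfolding cocommutative_iff[OF glue_pre]
proof
note V = G_Vec and pG = glue_pre
have T: "Vec (ten G G)" by (intro ten_Vec V)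
note p = pur_Bilin[OF V V]
have p': "(%x y. pur G G y x):Bilin G G (ten G G)" using p unfolding bilinear_maps_def by blast
fix c assume c: "c IN G"
show "sw G (ten G G) (%x y. pur G G y x) c = sw G (ten G G) (pur G G) c"
proof (rule G_ext[OF sw_Lin[OF pG T p'] sw_Lin[OF pG T p] T _ c])
	fix i x assume i: "i:P" and x: "x IN C i"
	have b: "(%x y. pur G G (gq i x) (gq i y)):Bilin (C i) (C i) (ten G G)" by (rule comp_Bilin[OF gq_G gq_G V V]) (use i in auto)
	note push = cm_sw[OF gC(1)[OF i] pG gq_cm[OF i] T _ x]
	show "sw G (ten G G) (%x y. pur G G y x) (gq i x) = sw G (ten G G) (pur G G) (gq i x)"
		using push[OF p] push[OF p'] sw_cocom[OF gC(1)[OF i] coc[OF i] T b x] by simp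
qed
qed

lemma glue_universal:
fixes D :: "('k, 'd, 'e) coalg_scheme"
assumes D: "Coalg D" and f: "!!i. i:P ==> f i:Cmaps (C i) D"
	and fE: "!!i x j y. ((i, x), (j, y)):E ==> f i x = f j y"
shows "Tlift D f:Cmaps G D"
	"!!i x. [|i:P; x IN C i|] ==> Tlift D f (gq i x) = f i x"
proof -
note pD = coalg_pre[OF D] note DV = pre_Vec[OF pD]
note fl = cm_Lin[OF f]
let ?h = "Tlift D f"
have h: "?h:Lin G D" unfolding Lin_G by (rule glue_lift_Lin[of P C E, OF gC(2) E DV fl fE])
have hq: "?h (gq i x) = f i x" if "i:P" "x IN C i" for i x by (rule glue_lift[of P C E, OF gC(2) E DV fl fE that])
show "!!i x. [|i:P; x IN C i|] ==> Tlift D f (gq i x) = f i x" by (rule hq)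
have T: "Vec (ten D D)" by (intro ten_Vec DV)
have b: "(%x y. pur D D (?h x) (?h y)):Bilin G G (ten D D)" by (rule comp_Bilin[OF h h DV DV])
show "?h:Cmaps G D"
proof (rule cm_I[OF glue_pre pD h])
	fix c assume c: "c IN G"
	show "comult D (?h c) = sw G (ten D D) (%x y. pur D D (?h x) (?h y)) c"
	proof (rule G_ext[OF Lin_comp[OF h comult_Lin[OF pD]] sw_Lin[OF glue_pre T b] T _ c])
		fix i x assume i: "i:P" and x: "x IN C i"
		have "comult D (f i x) = sw (C i) (ten D D) (%a b. pur D D (f i a) (f i b)) x"
			using f[OF i] x tmap_sw[OF gC(1)[OF i] fl[OF i] fl[OF i] DV DV x] unfolding coalgebra_maps_def by auto
		also have "... = sw (C i) (ten D D) (%a b. pur D D (?h (gq i a)) (?h (gq i b))) x" by (intro sw_cong[OF gC(1)[OF i] x]) (simp add: hq i)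
		also have "... = sw G (ten D D) (%x y. pur D D (?h x) (?h y)) (gq i x)"
			by (rule cm_sw[OF gC(1)[OF i] glue_pre gq_cm[OF i] T b x, symmetric])
		finally show "comult D (?h (gq i x)) = sw G (ten D D) (%x y. pur D D (?h x) (?h y)) (gq i x)" using hq i x by simp
	qed
	show "counit D (?h c) = counit G c" by (rule G_ext[OF Lin_comp[OF h counit_Lin[OF pD]] counit_Lin[OF glue_pre] base_Vec _ c])
			(simp add: hq glue_eps cm_counit[OF f])
qed
qed
end

end

definition transitions ::
"'p set => 'p rel => ('p => ('k, 'a, 'c) module_scheme) => ('p => 'p => 'a => 'a) => (('p * 'a) * ('p * 'a)) set"
where "transitions P r V t = {((i, x), (j, t i j x)) | i j x. i:P & j:P & (i, j):r & x IN V i}"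

context linear_algebra
begin
subsection \<open>Directed colimits\<close>

context
fixes P :: "'p set" and r :: "'p rel"
assumes r_refl: "!!i. i:P ==> (i, i):r"
	and r_trans: "!!i j k. [|(i, j):r; (j, k):r|] ==> (i, k):r" and dir: "!!i j. [|i:P; j:P|] ==> EX k:P. (i, k):r & (j, k):r"
	and ne: "P ~= {}"
begin
context
fixes V :: "'p => ('k, 'a, 'c) module_scheme" and t
assumes V: "!!i. i:P ==> Vec (V i)"
	and t: "!!i j. [|i:P; j:P; (i, j):r|] ==> t i j:Lin (V i) (V j)" and tt: "!!i j k x. [|i:P; j:P; k:P; (i, j):r; (j, k):r; x IN V i|] ==>
		t j k (t i j x) = t i k x"
begin
abbreviation "dE == transitions P r V t"
abbreviation "dQ == glue_sp K P V dE"
abbreviation "dq == glue_map K P V dE"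

lemma dE: "dE <= (SIGMA i:P. carrier (V i)) \<times> (SIGMA i:P. carrier (V i))"
unfolding transitions_def using Lin_in[OF t] by auto

lemma dQ_Vec: "Vec dQ"
by (rule glue_Vec[OF V dE])

lemma dq_Lin: "i:P ==> dq i:Lin (V i) dQ"
by (rule glue_map_Lin[OF V dE])

lemma dq_tr: "[|i:P; j:P; (i, j):r; x IN V i|] ==> dq j (t i j x) = dq i x"
by (rule glue_eq[OF V dE, symmetric]) (auto simp: transitions_def)

lemma dir3:
assumes "i:P" "j:P" "k:P"
obtains l where "l:P" "(i, l):r" "(j, l):r" "(k, l):r"
using dir[OF assms(1,2)] dir[OF _ assms(3)] r_trans by metis

lemma dq_surj:
assumes "x IN dQ" obtains k a where "k:P" "a IN V k" "x = dq k a"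
proof -
have "EX k:P. EX a:carrier (V k). x = dq k a"
proof (rule glue_induct[OF V dE assms])
	obtain k where k: "k:P" using ne by blast
	show "EX k:P. EX a:carrier (V k). \<zero>$dQ = dq k a" using k Lin_zero[OF dq_Lin[OF k] V[OF k] dQ_Vec] vclosed(2)[OF V[OF k]] by metis
	fix i x y assume i: "i:P" "x IN V i" and "EX k:P. EX a:carrier (V k). y = dq k a"
	then obtain k a where k: "k:P" "a IN V k" "y = dq k a" by blast
	obtain l where l: "l:P" "(i, l):r" "(k, l):r" using dir[OF i(1) k(1)] by blast
	have c: "t i l x IN V l" "t k l a IN V l" using Lin_in[OF t[OF i(1) l(1,2)] i(2)] Lin_in[OF t[OF k(1) l(1,3)] k(2)] by auto
	have "dq i x +.$dQ y = dq l (t i l x +.$(V l) t k l a)"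
		using dq_tr[OF i(1) l(1,2) i(2)] dq_tr[OF k(1) l(1,3) k(2)] k(3) Lin_add[OF dq_Lin[OF l(1)] c] by simp
	thus "EX k:P. EX a:carrier (V k). dq i x +.$dQ y = dq k a" using l(1) vclosed(1)[OF V[OF l(1)] c] by blast
qed
thus thesis using that by blast
qed

text \<open>The formal sums whose values vanish at all sufficiently late stages form a submodule
  \<open>N\<close> that contains the gluing relations. A generator that is zero in the colimit lies
  in \<open>N\<close> and hence vanishes at a later stage.\<close>

lemma dq_zero:
assumes i: "i:P" and z: "z IN V i" "dq i z = \<zero>$dQ"
shows "EX k:P. (i, k):r & t i k z = \<zero>$(V k)"
proof -
let ?A = "SIGMA i:P. carrier (V i)" let ?F = "Free ?A" let ?R = "glue_rels K P V dE"
interpret F: module K ?F by (rule free_Vec)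
\<comment> \<open>The value at stage \<open>l\<close>. Generators from stages not below
  \<open>l\<close> are sent to zero, which is harmless because membership in \<open>N\<close>
  concerns late stages.\<close>
define ff where "ff l p = (if (fst p, l):r then t (fst p) l (snd p) else \<zero>$(V l))" for l p
have phi: "ff l p IN V l" if "l:P" "p:?A" for l p using that Lin_in[OF t] vclosed(2)[OF V] by (auto simp: ff_def)
have phi1: "ff l (i, x) = t i l x" if "(i, l):r" for l i x using that by (simp add: ff_def)
have e: "ev (V l) (ff l):Lin ?F (V l)" if "l:P" for l by (rule ev_Lin[OF V[OF that] phi[OF that]])
have ed: "ev (V l) (ff l) (delta K p) = ff l p" if "l:P" "p:?A" for l p
	by (rule ev_delta[of _ ?A, OF V[OF that(1)] phi[OF that(1)] that(2)])
define N where "N = {f:carrier ?F. EX k:P. ALL l:P. (k, l):r --> ev (V l) (ff l) f = \<zero>$(V l)}"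
have "submodule N K ?F"
proof (rule F.submoduleI)
	show "N <= carrier ?F" by (auto simp: N_def)
	have "ev (V l) (ff l) \<zero>$?F = \<zero>$(V l)" if "l:P" for l by (rule Lin_zero[OF e[OF that] free_Vec V[OF that]])
	thus "\<zero>$?F:N" using ne by (auto simp: N_def)
	have sm: "a *.$?F f:N" if af: "a IN K" "f:N" for a f
	proof -
		obtain k where k: "k:P" "!!l. [|l:P; (k, l):r|] ==> ev (V l) (ff l) f = \<zero>$(V l)" and f: "f IN ?F"
			using af(2) unfolding N_def by blast
		have "ev (V l) (ff l) (a *.$?F f) = \<zero>$(V l)" if l: "l:P" "(k, l):r" for l
			using Lin_smult[OF e[OF l(1)] af(1) f] k(2)[OF l] smult_zero_right[OF V[OF l(1)] af(1)] by simp
		thus ?thesis using k(1) f af(1) by (auto simp: N_def)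
	qed
	thus "!!a x. [|a IN K; x:N|] ==> a *.$?F x:N" by blast
	show "\<ominus>$?F f:N" if f: "f:N" for f
	proof -
		have "f IN ?F" using f by (simp add: N_def)
		hence "\<ominus>$?F f = (\<ominus>$K \<one>$K) *.$?F f" by (simp add: F.smult_l_minus)
		thus ?thesis using sm[OF K_closed(3) f] by simp
	qed
	show "f +.$?F g:N" if fg: "f:N" "g:N" for f g
	proof -
		obtain k where k: "k:P" "!!l. [|l:P; (k, l):r|] ==> ev (V l) (ff l) f = \<zero>$(V l)" and f: "f IN ?F"
			using fg(1) unfolding N_def by blast
		obtain k' where k': "k':P" "!!l. [|l:P; (k', l):r|] ==> ev (V l) (ff l) g = \<zero>$(V l)" and g: "g IN ?F"
			using fg(2) unfolding N_def by blast
		obtain m where m: "m:P" "(k, m):r" "(k', m):r" using dir[OF k(1) k'(1)] by blast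
		have "ev (V l) (ff l) (f +.$?F g) = \<zero>$(V l)" if l: "l:P" "(m, l):r" for l
			using Lin_add[OF e[OF l(1)] f g] k(2)[OF l(1) r_trans[OF m(2) l(2)]] k'(2)[OF l(1) r_trans[OF m(3) l(2)]]
				zero_left[OF V[OF l(1)] vclosed(2)[OF V[OF l(1)]]] by simp
		thus ?thesis using m(1) f g by (auto simp: N_def)
	qed
qed
moreover have "?R <= N"
proof
	fix rh assume rho: "rh:?R"
	have in_F: "rh IN ?F" using glue_sub[OF V dE] rho by blast
	have ex: "EX k:P. ALL l:P. (k, l):r --> ev (V l) (ff l) rh = \<zero>$(V l)"
	proof -
		note gF = gF[OF V dE] consider (a) i x y where "rh = delta K (i, x +.$(V i) y) \<ominus>$?F (delta K (i, x) +.$?F delta K (i, y))"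
				"i:P" "x IN V i" "y IN V i" | (b) i a x where "rh = delta K (i, a *.$(V i) x) \<ominus>$?F (a *.$?F delta K (i, x))"
				"i:P" "a IN K" "x IN V i" | (c) i j x where "rh = delta K (i, x) \<ominus>$?F delta K (j, t i j x)" "i:P" "j:P" "(i, j):r" "x IN V i"
			using rho unfolding glue_rels_def Let_def transitions_def by blast
		thus ?thesis
		proof cases
			case a
			have "ev (V l) (ff l) rh = \<zero>$(V l)" if l: "l:P" "(i, l):r" for l unfolding a(1) by (rule ev_diff[OF V[OF l(1)] phi[OF l(1)]])
					(use a l vclosed(1)[OF V[OF a(2)]] in
						\<open>auto intro!: gF(1-3) simp: Lin_add[OF e[OF l(1)]] gF ed[OF l(1)] phi1 Lin_add[OF t]\<close>)
			thus ?thesis using a(2) by blast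
		next
			case b
			have "ev (V l) (ff l) rh = \<zero>$(V l)" if l: "l:P" "(i, l):r" for l unfolding b(1) by (rule ev_diff[OF V[OF l(1)] phi[OF l(1)]])
					(use b l vclosed(3)[OF V[OF b(2)]] in
						\<open>auto intro!: gF(1-3) simp: Lin_smult[OF e[OF l(1)]] gF ed[OF l(1)] phi1 Lin_smult[OF t]\<close>)
			thus ?thesis using b(2) by blast
		next
			case c
			have tx: "t i j x IN V j" using Lin_in[OF t[OF c(2-4)] c(5)] .
			have "ev (V l) (ff l) rh = \<zero>$(V l)" if l: "l:P" "(j, l):r" for l unfolding c(1) by (rule ev_diff[OF V[OF l(1)] phi[OF l(1)]])
					(use c l tx r_trans[OF c(4) l(2)] in \<open>auto intro!: gF(1-3) simp: ed[OF l(1)] phi1 tt\<close>)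
			thus ?thesis using c(3) by blast
		qed
	qed
	thus "rh:N" using in_F by (simp add: N_def)
qed
ultimately have sub: "relations ?A ?R <= N" by (intro relations_least(1) glue_sub[OF V dE])
note R = glue_sub[OF V dE]
have d: "delta K (i, z) IN ?F" using gF(3)[OF V dE i z(1)] .
have "cls ?F (relations ?A ?R) (delta K (i, z)) = dq i z" by (rule glue_map_cls[OF V dE, symmetric])
also have "... = cls ?F (relations ?A ?R) \<zero>$?F"
	using z(2) Lin_zero[OF qcls_Lin[OF R] free_Vec pres_Vec[OF R]] unfolding glue_sp_def by simp
finally have "cls ?F (relations ?A ?R) (delta K (i, z)) = cls ?F (relations ?A ?R) \<zero>$?F" .
hence "delta K (i, z) \<ominus>$?F \<zero>$?F:N" using cls_eq_iff[OF free_Vec relations_sub[OF R] d F.zero_closed] sub by blast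
hence "delta K (i, z):N" using d by (simp add: diff_eq[OF free_Vec] smult_zero_right[OF free_Vec] zero_right[OF free_Vec] K_closed)
then obtain k where k: "k:P" "!!l. [|l:P; (k, l):r|] ==> ev (V l) (ff l) (delta K (i, z)) = \<zero>$(V l)" unfolding N_def by blast
obtain l where l: "l:P" "(i, l):r" "(k, l):r" using dir[OF i k(1)] by blast
have "ff l (i, z) = \<zero>$(V l)" using k(2)[OF l(1,3)] ed[OF l(1)] i z by simp
thus ?thesis using l phi1 by auto
qed

lemma dq_inj:
assumes i: "i:P" and x: "x IN V i" "y IN V i" "dq i x = dq i y"
shows "EX k:P. (i, k):r & t i k x = t i k y"
proof -
have c: "x \<ominus>$(V i) y IN V i" using x V[OF i] by (simp add: diff_eq vclosed)
have "dq i (x \<ominus>$(V i) y) = \<zero>$dQ"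
	using Lin_diff[OF dq_Lin[OF i] V[OF i] dQ_Vec x(1,2)] x diff_zero_iff[OF dQ_Vec] Lin_in[OF dq_Lin[OF i]] by simp
from dq_zero[OF i c this] obtain k where k: "k:P" "(i, k):r" "t i k (x \<ominus>$(V i) y) = \<zero>$(V k)" by blast
note tl = t[OF i k(1,2)]
have "t i k x = t i k y" using Lin_diff[OF tl V[OF i] V[OF k(1)] x(1,2)] k(3)
		diff_zero_iff[OF V[OF k(1)] Lin_in[OF tl x(1)] Lin_in[OF tl x(2)]] by argo
thus ?thesis using k by blast
qed

lemma dq_inj2:
assumes i: "i:P" "j:P" and x: "x IN V i" "y IN V j" "dq i x = dq j y"
shows "EX k:P. (i, k):r & (j, k):r & t i k x = t j k y"
proof -
obtain l where l: "l:P" "(i, l):r" "(j, l):r" using dir[OF i] by blast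
note c = Lin_in[OF t[OF i(1) l(1,2)] x(1)] Lin_in[OF t[OF i(2) l(1,3)] x(2)]
have "dq l (t i l x) = dq l (t j l y)" using dq_tr x i l by simp
from dq_inj[OF l(1) c this] obtain k where k: "k:P" "(l, k):r" "t l k (t i l x) = t l k (t j l y)" by blast
thus ?thesis using tt[OF i(1) l(1) k(1) l(2) k(2) x(1)] tt[OF i(2) l(1) k(1) l(3) k(2) x(2)] r_trans l k by metis
qed

text \<open>By \<open>dq_inj2\<close>, two ways of representing a pair of elements agree at a common
  stage, where compatibility of \<open>g\<close> gives a unique value. Unary functions such as
  antipodes are treated as binary ones on the diagonal.\<close>

lemma directed_extension:
assumes g: "!!i j x y. [|i:P; j:P; (i, j):r; x IN V i; y IN V i|]
	==> g j (t i j x) (t i j y) = g i x y"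
shows "EX G. ALL k:P. ALL x:carrier (V k). ALL y:carrier (V k). G (dq k x) (dq k y) = g k x y"
proof -
define R where "R s u z <-> (EX k:P. EX x:carrier (V k). EX y:carrier (V k). s = dq k x & u = dq k y & z = g k x y)" for s u z
have uni: "z = z'" if zz: "R s u z" "R s u z'" for s u z z'
proof -
	obtain i x y where i: "i:P" "x IN V i" "y IN V i" "s = dq i x" "u = dq i y" "z = g i x y" using zz(1) unfolding R_def by blast
	obtain j x' y' where j: "j:P" "x' IN V j" "y' IN V j" "s = dq j x'" "u = dq j y'" "z' = g j x' y'" using zz(2) unfolding R_def by blast
	obtain k where k: "k:P" "(i, k):r" "(j, k):r" "t i k x = t j k x'" using dq_inj2[OF i(1) j(1) i(2) j(2)] i(4) j(4) by metis
	obtain l where l: "l:P" "(i, l):r" "(j, l):r" "t i l y = t j l y'" using dq_inj2[OF i(1) j(1) i(3) j(3)] i(5) j(5) by metis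
	obtain m where m: "m:P" "(k, m):r" "(l, m):r" using dir[OF k(1) l(1)] by blast
	have rm: "(i, m):r" "(j, m):r" using k m r_trans by blast+
	have "t i m x = t j m x'" using tt[OF i(1) k(1) m(1) k(2) m(2) i(2)] tt[OF j(1) k(1) m(1) k(3) m(2) j(2)] k(4) by simp
	moreover have "t i m y = t j m y'" using tt[OF i(1) l(1) m(1) l(2) m(3) i(3)] tt[OF j(1) l(1) m(1) l(3) m(3) j(3)] l(4) by simp
	ultimately show ?thesis using g[OF i(1) m(1) rm(1) i(2,3)] g[OF j(1) m(1) rm(2) j(2,3)] i(6) j(6) by simp
qed
have "(SOME z. R (dq k x) (dq k y) z) = g k x y" if "k:P" "x IN V k" "y IN V k" for k x y
proof -
	have "R (dq k x) (dq k y) (g k x y)" unfolding R_def using that by blast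
	thus ?thesis by (rule some_equality) (use \<open>R (dq k x) (dq k y) (g k x y)\<close> uni in blast)
qed
thus ?thesis by (intro exI[of _ "%s u. SOME z. R s u z"]) blast
qed
end

text \<open>Half of the fact that tensor squares commute with directed colimits. The colimit
  \<open>?Q'\<close> of the tensor squares receives a map from the tensor square of
  \<open>?Q\<close>, so equality there yields equality in \<open>?Q'\<close>, and
  \<open>dq_inj\<close> supplies the stage.\<close>

lemma directed_tensor_inj:
fixes V :: "'p => ('k, 'a, 'c) module_scheme"
assumes V: "!!i. i:P ==> Vec (V i)"
	and t: "!!i j. [|i:P; j:P; (i, j):r|] ==> t i j:Lin (V i) (V j)" and tt: "!!i j k x. [|i:P; j:P; k:P; (i, j):r; (j, k):r; x IN V i|] ==>
		t j k (t i j x) = t i k x" and i: "i:P" and w: "w IN ten (V i) (V i)" "w' IN ten (V i) (V i)"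
	and eq: "Tmap (glue_sp K P V (transitions P r V t)) (glue_sp K P V (transitions P r V t))
			(glue_map K P V (transitions P r V t) i) (glue_map K P V (transitions P r V t) i) w =
		Tmap (glue_sp K P V (transitions P r V t)) (glue_sp K P V (transitions P r V t))
			(glue_map K P V (transitions P r V t) i) (glue_map K P V (transitions P r V t) i) w'"
shows "EX k:P. (i, k):r & Tmap (V k) (V k) (t i k) (t i k) w = Tmap (V k) (V k) (t i k) (t i k) w'"
proof -
let ?E = "transitions P r V t"
let ?Q = "glue_sp K P V ?E" and ?q = "glue_map K P V ?E"
let ?W = "%i. ten (V i) (V i)" and ?s = "%i j. Tmap (V j) (V j) (t i j) (t i j)"
have W: "Vec (?W i)" if "i:P" for i using that V by (intro ten_Vec)
have s: "?s i j:Lin (?W i) (?W j)" if "i:P" "j:P" "(i, j):r" for i j using that V t by (intro tmap_Lin)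
have ss: "?s j k (?s i j x) = ?s i k x" if "i:P" "j:P" "k:P" "(i, j):r" "(j, k):r" "x IN ?W i" for i j k x
proof -
	note ij = t[OF that(1,2,4)] and jk = t[OF that(2,3,5)] and V3 = V[OF that(1)] V[OF that(2)] V[OF that(3)]
	have "?s j k (?s i j x) = Tmap (V k) (V k) (%x. t j k (t i j x)) (%x. t j k (t i j x)) x"
		by (rule tmap_comp[OF ij ij jk jk V3(1,1,2,2,3,3) that(6)])
	also have "... = ?s i k x" by (rule tmap_cong[OF _ _ Lin_comp[OF ij jk] Lin_comp[OF ij jk] V3(1,1,3,3) that(6)]) (use tt that in auto)
	finally show ?thesis .
qed
let ?E' = "transitions P r ?W ?s"
let ?Q' = "glue_sp K P ?W ?E'" and ?q' = "glue_map K P ?W ?E'"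
have Q: "Vec ?Q" by (rule dQ_Vec[OF V t tt])
have Q': "Vec ?Q'" by (rule dQ_Vec[OF W s ss])
have q: "?q i:Lin (V i) ?Q" if "i:P" for i by (rule dq_Lin[OF V t tt that])
have q': "?q' i:Lin (?W i) ?Q'" if "i:P" for i by (rule dq_Lin[OF W s ss that])
have qtr: "?q j (t i j x) = ?q i x" if "i:P" "j:P" "(i, j):r" "x IN V i" for i j x by (rule dq_tr[of V t, OF V t tt that])
have qtr': "?q' j (?s i j x) = ?q' i x" if "i:P" "j:P" "(i, j):r" "x IN ?W i" for i j x by (rule dq_tr[of ?W ?s, OF W s ss that])
have g: "?q' j (pur (V j) (V j) (t i j x) (t i j y)) = ?q' i (pur (V i) (V i) x y)"
	if "i:P" "j:P" "(i, j):r" "x IN V i" "y IN V i" for i j x y using qtr'[OF that(1-3) pur_in[OF V[OF that(1)] V[OF that(1)] that(4,5)]]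
		tmap_pure[OF t[OF that(1-3)] t[OF that(1-3)] V[OF that(1)] V[OF that(1)] V[OF that(2)] V[OF that(2)] that(4,5)] by simp
\<comment> \<open>\<open>B\<close> sends a pair of elements represented at one stage to the class of
  their pure tensor. It is bilinear since any three elements have a common stage, and its lift is
  the required map.\<close>
have "EX B. ALL k:P. ALL x:carrier (V k). ALL y:carrier (V k). B (?q k x) (?q k y) = ?q' k (pur (V k) (V k) x y)"
	by (rule directed_extension[of V t "%k x y. ?q' k (pur (V k) (V k) x y)", OF V t tt g])
then obtain B where B: "!!k x y. [|k:P; x IN V k; y IN V k|] ==> B (?q k x) (?q k y) = ?q' k (pur (V k) (V k) x y)" by blast
have common: "EX k:P. EX a:carrier (V k). EX b:carrier (V k). EX c:carrier (V k). x = ?q k a & y = ?q k b & z = ?q k c"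
	if xyz: "x IN ?Q" "y IN ?Q" "z IN ?Q" for x y z
proof -
	obtain i a where a: "i:P" "a IN V i" "x = ?q i a" by (rule dq_surj[OF V t tt xyz(1)])
	obtain j b where b: "j:P" "b IN V j" "y = ?q j b" by (rule dq_surj[OF V t tt xyz(2)])
	obtain k c where c: "k:P" "c IN V k" "z = ?q k c" by (rule dq_surj[OF V t tt xyz(3)])
	obtain l where l: "l:P" "(i, l):r" "(j, l):r" "(k, l):r" by (rule dir3[OF V t tt a(1) b(1) c(1)])
	show ?thesis using l qtr[OF a(1) l(1,2) a(2)] qtr[OF b(1) l(1,3) b(2)] qtr[OF c(1) l(1,4) c(2)] a b c
			Lin_in[OF t[OF a(1) l(1,2)] a(2)] Lin_in[OF t[OF b(1) l(1,3)] b(2)] Lin_in[OF t[OF c(1) l(1,4)] c(2)] by metis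
qed
have Bb: "B:Bilin ?Q ?Q ?Q'"
proof (rule BilinI)
	fix x y assume "x IN ?Q" "y IN ?Q"
	then obtain k a b where k: "k:P" "a IN V k" "b IN V k" and e: "x = ?q k a" "y = ?q k b" using common[of x y y] by metis
	note p = pur_in[OF V[OF k(1)] V[OF k(1)]]
	show "B x y IN ?Q'" unfolding e using k B Lin_in[OF q'[OF k(1)] p] by simp
	fix a' assume a': "a' IN K"
	note P' = Bilin_simps[OF pur_Bilin[OF V[OF k(1)] V[OF k(1)]]]
	note ql = Lin_smult[OF q[OF k(1)], symmetric] Lin_smult[OF q'[OF k(1)], symmetric] vclosed(3)[OF V[OF k(1)]]
	show "B (a' *.$?Q x) y = a' *.$?Q' B x y" "B x (a' *.$?Q y) = a' *.$?Q' B x y" unfolding e using k a' by (simp_all add: B ql P')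
next
	fix x y z assume "x IN ?Q" "y IN ?Q" "z IN ?Q"
	then obtain k a b c where k: "k:P" "a IN V k" "b IN V k" "c IN V k"
		and e: "x = ?q k a" "y = ?q k b" "z = ?q k c" using common[of x y z] by metis
	note P' = Bilin_simps[OF pur_Bilin[OF V[OF k(1)] V[OF k(1)]]]
	note ql = Lin_add[OF q[OF k(1)], symmetric] Lin_add[OF q'[OF k(1)], symmetric] vclosed(1)[OF V[OF k(1)]]
	show "B (x +.$?Q y) z = B x z +.$?Q' B y z" "B x (y +.$?Q z) = B x y +.$?Q' B x z" unfolding e using k by (simp_all add: B ql P')
qed
note L = lift_Lin[OF Q Q Q' Bb]
have "Tlift ?Q' B (Tmap ?Q ?Q (?q i) (?q i) w) = ?q' i w" if "w IN ?W i" for w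
	by (rule tensor_ext[OF V[OF i] V[OF i] Lin_comp[OF tmap_Lin[OF q[OF i] q[OF i] V[OF i] V[OF i] Q Q] L] q'[OF i] Q' _ that])
		(simp add: tmap_pure[OF q[OF i] q[OF i] V[OF i] V[OF i] Q Q] lift_pure[OF Q Q Q' Bb] Lin_in[OF q[OF i]] B i)
from this[OF w(1)] this[OF w(2)] eq have "?q' i w = ?q' i w'" by simp
thus ?thesis by (rule dq_inj[of ?W ?s, OF W s ss i w, rotated -1])
qed
end

end

section \<open>Directed colimits of structures\<close>

context linear_algebra
begin
context
fixes P :: "'p set" and r :: "'p rel" and H :: "'p => ('k, 'i, 'a) ibialg" and t I J coc br S
assumes r_refl: "!!i. i:P ==> (i, i):r"
	and r_trans: "!!i j k. [|(i, j):r; (j, k):r|] ==> (i, k):r" and dir: "!!i j. [|i:P; j:P|] ==> EX k:P. (i, k):r & (j, k):r"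
	and ne: "P ~= {}" and H: "!!i. i:P ==> hstruct I J coc br (H i) (S i)" and JI: "J <= I" and br: "br <= J \<times> I"
	and t: "!!i j. [|i:P; j:P; (i, j):r|] ==> t i j:hmaps I (H i) (H j)"
	and tt: "!!i j k x. [|i:P; j:P; k:P; (i, j):r; (j, k):r; x IN H i|] ==> t j k (t i j x) = t i k x"
begin
abbreviation "cE == transitions P r H t"
abbreviation "cQ == glue_sp K P H cE"
abbreviation "cq == glue_map K P H cE"

lemma cH: assumes "k:P" shows "Coalg (H k)" "precoalg (H k)" "Vec (H k)"
	"i:I ==> Bialg (H k) (imult (H k) i) (iunit (H k) i)" "i:J ==> Antip (H k) (imult (H k) i) (iunit (H k) i) (S k i)"
	"i:J ==> S k i:Lin (H k) (H k)" "is_ibialg I (H k)"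
using H[OF assms] coalg_pre[of "H k"] pre_Vec[of "H k"] hstruct_ibialg[OF H[OF assms]] unfolding hstruct_def antipode_def by blast+

lemma ct: assumes "i:P" "j:P" "(i, j):r"
shows "t i j:Cmaps (H i) (H j)" "t i j:Lin (H i) (H j)"
	"l:I ==> algebra_map (H i) (imult (H i) l) (iunit (H i) l) (imult (H j) l) (iunit (H j) l) (t i j)"
	"[|l:I; x IN H i; y IN H i|] ==> t i j (imult (H i) l x y) = imult (H j) l (t i j x) (t i j y)"
	"l:I ==> t i j (iunit (H i) l) = iunit (H j) l" "x IN H i ==> t i j x IN H j"
using t[OF assms] Lin_in[of "t i j" "H i" "H j" x] cm_Lin[of "t i j" "H i" "H j"] unfolding hmaps_def algebra_map_def by auto

lemma cE: "cE <= (SIGMA i:P. carrier (H i)) \<times> (SIGMA i:P. carrier (H i))"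
by (rule dE[of P r H t, OF r_refl r_trans dir ne cH(3) ct(2) tt])

lemma cq_Lin: "i:P ==> cq i:Lin (H i) cQ"
by (rule glue_map_Lin[of P H cE, OF cH(3) cE])

lemma cQ_Vec: "Vec cQ"
by (rule glue_Vec[of P H cE, OF cH(3) cE])

lemma cq_tr: "[|i:P; j:P; (i, j):r; x IN H i|] ==> cq j (t i j x) = cq i x"
by (rule dq_tr[of P r H t, OF r_refl r_trans dir ne cH(3) ct(2) tt])

lemma cq_inj: "[|i:P; x IN H i; y IN H i; cq i x = cq i y|] ==> EX k:P. (i, k):r & t i k x = t i k y"
by (rule dq_inj[of P r H t, OF r_refl r_trans dir ne cH(3) ct(2) tt])

lemma cE_eps: "((i, x), (j, y)):cE ==> counit (H i) x = counit (H j) y"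
using ct(1) unfolding transitions_def coalgebra_maps_def by auto

lemma cE_cm: assumes "((i, x), (j, y)):cE"
shows "sw (H i) (ten cQ cQ) (%a b. pur cQ cQ (cq i a) (cq i b)) x =
	sw (H j) (ten cQ cQ) (%a b. pur cQ cQ (cq j a) (cq j b)) y"
proof -
have i: "i:P" "j:P" "(i, j):r" "x IN H i" and y: "y = t i j x" using assms unfolding transitions_def by auto
have T: "Vec (ten cQ cQ)" by (intro ten_Vec cQ_Vec)
show ?thesis unfolding y cm_sw[OF cH(2)[OF i(1)] cH(2)[OF i(2)] ct(1)[OF i(1-3)] T
		comp_Bilin[OF cq_Lin[OF i(2)] cq_Lin[OF i(2)] cQ_Vec cQ_Vec] i(4)] by (intro sw_cong[OF cH(2)[OF i(1)] i(4)]) (simp add: cq_tr i)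
qed

lemma common_stage:
assumes "set xs <= carrier cQ"
shows "EX k:P. EX ys. set ys <= carrier (H k) & xs = map (cq k) ys"
using assms
proof (induction xs)
case Nil
thus ?case using ne by auto
next
case (Cons x xs)
then obtain k ys where k: "k:P" "set ys <= carrier (H k)" "xs = map (cq k) ys" by auto
have x: "x IN cQ" using Cons by simp
obtain j a where j: "j:P" "a IN H j" "x = cq j a" by (rule dq_surj[of P r H t, OF r_refl r_trans dir ne cH(3) ct(2) tt x])
obtain l where l: "l:P" "(k, l):r" "(j, l):r" using dir[OF k(1) j(1)] by blast
have "map (cq l) (map (t k l) ys) = map (cq k) ys"
	unfolding map_map comp_def using k(2) by (intro map_cong refl cq_tr[OF k(1) l(1,2)]) blast
hence "x # xs = map (cq l) (t j l a # map (t k l) ys)"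
	unfolding list.map cq_tr[OF j(1) l(1,3) j(2)] k(3) j(3) by (rule arg_cong2[where f = Cons, OF refl sym])
moreover have "set (t j l a # map (t k l) ys) <= carrier (H l)" unfolding list.set set_map using k(2)
	by (intro insert_subsetI ct(6)[OF j(1) l(1,3) j(2)] image_subsetI ct(6)[OF k(1) l(1,2)]) blast
ultimately show ?case using l(1) by (intro bexI exI conjI)
qed

text \<open>The glued coalgebra acquires its operations by \<open>directed_extension\<close>,
  antipodes being compatible with transitions by naturality, and satisfies the laws by
  \<open>push_hstruct\<close>. The remaining clauses are those of
  \<open>str_colimit\<close>.\<close>

lemma directed_hstruct:
shows "EX (L :: ('k, 'i, ('p * 'a => 'k) set) ibialg) SL. hstruct I J coc br L SL & carrier L = carrier cQ &
	(ALL i:P. cq i:hmaps I (H i) L) & (ALL i:P. ALL j:P. ALL x:carrier (H i). (i, j):r --> cq j (t i j x) = cq i x) &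
	(ALL x:carrier L. EX i:P. EX a:carrier (H i). x = cq i a) &
	(ALL i:P. ALL x:carrier (H i). ALL y:carrier (H i). cq i x = cq i y --> (EX j:P. (i, j):r & t i j x = t i j y)) &
	(ALL rh:syms I. ALL xs:rel L rh. EX i:P. EX ys:rel (H i) rh. xs = map (cq i) ys)"
proof -
obtain k0 where k0: "k0:P" using ne by blast
note E1 = directed_extension[of P r H t, OF r_refl r_trans dir ne cH(3) ct(2) tt]
have "EX G. ALL k:P. ALL x:carrier (H k). ALL y:carrier (H k). G (cq k x) (cq k y) = cq k (imult (H k) i x y)" if "i:I" for i
proof (rule E1)
	fix j k x y assume a: "j:P" "k:P" "(j, k):r" "x IN H j" "y IN H j"
	show "cq k (imult (H k) i (t j k x) (t j k y)) = cq j (imult (H j) i x y)"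
		using cq_tr[OF a(1-3) bi_closed[OF cH(4)[OF a(1) that] a(4,5)]] ct(4)[OF a(1-3) that a(4,5)] by simp
qed
then obtain m where m: "!!i k x y. [|i:I; k:P; x IN H k; y IN H k|] ==> m i (cq k x) (cq k y) = cq k (imult (H k) i x y)" by metis
have "EX G. ALL k:P. ALL x:carrier (H k). ALL y:carrier (H k). G (cq k x) (cq k y) = cq k (S k i x)" if i: "i:J" for i
proof (rule E1)
	have iI: "i:I" using i JI by blast
	fix j k x y assume a: "j:P" "k:P" "(j, k):r" "x IN H j" "y IN H j"
	have "t j k (S j i x) = S k i (t j k x)" by (rule antipode_natural[OF cH(4)[OF a(1) iI] cH(4)[OF a(2) iI] cH(5)[OF a(1) i] cH(5)[OF a(2) i]
			ct(1)[OF a(1-3)] ct(3)[OF a(1-3) iI] a(4)])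
	thus "cq k (S k i (t j k x)) = cq j (S j i x)" using cq_tr[OF a(1-3) Lin_in[OF cH(6)[OF a(1) i] a(4)]] by simp
qed
then obtain s where s: "!!i k x. [|i:J; k:P; x IN H k|] ==> s i (cq k x) (cq k x) = cq k (S k i x)" by metis
define u where "u i = cq k0 (iunit (H k0) i)" for i
have u: "u i = cq k (iunit (H k) i)" if k: "k:P" and i: "i:I" for k i
proof -
	obtain l where l: "l:P" "(k, l):r" "(k0, l):r" using dir[OF k k0] by blast
	show ?thesis unfolding u_def using cq_tr[OF k l(1,2) bi_unit[OF cH(4)[OF k i]]] cq_tr[OF k0 l(1,3) bi_unit[OF cH(4)[OF k0 i]]]
			ct(5)[OF k l(1,2) i] ct(5)[OF k0 l(1,3) i] by simp
qed
let ?L = "glue K P H cE m u"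
have L: "Coalg ?L" by (rule glue_coalgebra[of P H cE, OF cH(1) cE cE_eps cE_cm])
have q: "cq i:Cmaps (H i) ?L" if "i:P" for i by (rule gq_cm[of P H cE, OF cH(1) cE cE_eps cE_cm that])
have Lc: "carrier ?L = carrier cQ" "imult ?L = m" "iunit ?L = u" by (simp_all add: glue_def Let_def)
have cover: "EX k:P. x:cq k ` carrier (H k) & y:cq k ` carrier (H k) & z:cq k ` carrier (H k)" if "x IN ?L" "y IN ?L" "z IN ?L" for x y z
proof -
	have "set [x, y, z] <= carrier cQ" using that by (simp add: Lc)
	from common_stage[OF this] obtain k ws where "k:P" "set ws <= carrier (H k)" "[x, y, z] = map (cq k) ws" by (elim bexE exE conjE)
	thus ?thesis by (intro bexI[of _ k]) (auto simp: Cons_eq_map_conv)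
qed
have hs: "hstruct I J coc br ?L (%i x. s i x x)"
	by (rule push_hstruct[where P = P and q = cq and S = S, OF H L JI br q]) (use m u s cover in "auto simp: Lc")
have qh: "cq i:hmaps I (H i) ?L" if "i:P" for i using q[OF that] that m u unfolding hmaps_def algebra_map_def by (simp add: Lc)
note iL = hstruct_ibialg[OF hs]
note LV = ibi(2)[OF iL]
have sc: "add ?L = add cQ" "smult ?L = smult cQ" by (simp_all add: glue_def Let_def)
have ssp: "same_sp cQ ?L" by (simp add: same_sp_def glue_def Let_def)
have tm: "Tmap ?L ?L f f = Tmap cQ cQ f f" for f :: "'a => ('p * 'a => 'k) set"
	unfolding tensor_map_def using ten_same[OF ssp ssp] pur_same[OF ssp ssp] by simp
have "EX i:P. EX ys:rel (H i) rh. xs = map (cq i) ys" if rh: "rh:syms I" and xs: "xs:rel ?L rh" for rh xs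
proof (cases rh)
	case Add
	then obtain x y where "x IN ?L" "y IN ?L" and xe: "xs = [x, y, x +.$?L y]" using xs by auto
	then obtain k a b where "k:P" "a IN H k" "b IN H k" "x = cq k a" "y = cq k b" using cover[of x y y] by blast
	thus ?thesis using Lin_add[OF cm_Lin[OF q[of k]], of a b] xe unfolding Add by (intro bexI[of _ k] bexI[of _ "[a, b, a +.$(H k) b]"]) auto
next
	case (Smult c)
	then obtain x where "x IN ?L" and xe: "xs = [x, c *.$?L x]" using xs by auto
	then obtain k a where k: "k:P" "a IN H k" "x = cq k a" using cover[of x x x] by blast
	have "c IN K" using rh Smult by (auto simp: syms_def)
	thus ?thesis using Lin_smult[OF cm_Lin[OF q[OF k(1)]], of c a] xe k
		unfolding Smult by (intro bexI[of _ k] bexI[of _ "[a, c *.$(H k) a]"]) auto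
next
	case (Counit c)
	then obtain x where "x IN ?L" and xe: "xs = [x]" "counit ?L x = c" using xs by auto
	then obtain k a where k: "k:P" "a IN H k" "x = cq k a" using cover[of x x x] by blast
	hence "counit (H k) a = c" using q[OF k(1)] xe unfolding coalgebra_maps_def by auto
	thus ?thesis using k xe unfolding Counit by (intro bexI[of _ k] bexI[of _ "[a]"]) auto
next
	case Comult
	then obtain c ys zs where xe: "xs = c # ys @ zs" and c: "c IN ?L" "set ys <= carrier ?L" "set zs <= carrier ?L"
		and len: "length ys = length zs" and cc: "comult ?L c = tsum ?L (zip ys zs)" using xs by auto
	obtain k ws where k: "k:P" and ws: "set ws <= carrier (H k)" "xs = map (cq k) ws"
	proof -
		have "set xs <= carrier cQ" using xe c by (simp add: Lc)
		from common_stage[OF this] that show thesis by (elim bexE exE conjE)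
	qed
	obtain c' ys' zs' where w: "ws = c' # ys' @ zs'" "c = cq k c'" "ys = map (cq k) ys'" "zs = map (cq k) zs'"
		using ws(2) xe by (auto simp: Cons_eq_map_conv append_eq_map_conv)
	have in': "c' IN H k" "set ys' <= carrier (H k)" "set zs' <= carrier (H k)" using ws w by auto
	have len': "length ys' = length zs'" using len w by simp
	note ql = cm_Lin[OF q[OF k]]
	\<comment> \<open>The expansion is known only after mapping into the tensor square of the colimit;
	  \<open>directed_tensor_inj\<close> provides a later stage at which it holds as an instance of
	  \<open>Comult\<close>.\<close>
	have "Tmap ?L ?L (cq k) (cq k) (comult (H k) c') = Tmap ?L ?L (cq k) (cq k) (tsum (H k) (zip ys' zs'))"
		using q[OF k] in' cc w tsum_zip_map[OF ql cH(3)[OF k] LV in'(2,3)] unfolding coalgebra_maps_def by auto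
	hence eq: "Tmap cQ cQ (cq k) (cq k) (comult (H k) c') = Tmap cQ cQ (cq k) (cq k) (tsum (H k) (zip ys' zs'))" unfolding tm .
	have T: "tsum (H k) (zip ys' zs') IN ten (H k) (H k)" unfolding tsum_def by (rule lsum_closed[OF ten_Vec[OF cH(3)[OF k] cH(3)[OF k]]])
			(use in' in "auto intro!: pur_in[OF cH(3)[OF k] cH(3)[OF k]] dest: set_zip_leftD set_zip_rightD")
	have "EX l:P. (k, l):r & Tmap (H l) (H l) (t k l) (t k l) (comult (H k) c') = Tmap (H l) (H l) (t k l) (t k l) (tsum (H k) (zip ys' zs'))"
		by (rule directed_tensor_inj[of P r H t, OF r_refl r_trans dir ne cH(3) ct(2) tt k Lin_in[OF comult_Lin[OF cH(2)[OF k]] in'(1)] T eq])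
	then obtain l where l: "l:P" "(k, l):r" and e: "Tmap (H l) (H l) (t k l) (t k l) (comult (H k) c') =
			Tmap (H l) (H l) (t k l) (t k l) (tsum (H k) (zip ys' zs'))" by blast
	note tl = ct[OF k l]
	have "comult (H l) (t k l c') = tsum (H l) (zip (map (t k l) ys') (map (t k l) zs'))"
		using tl(1) e in' tsum_zip_map[OF tl(2) cH(3)[OF k] cH(3)[OF l(1)] in'(2,3)] unfolding coalgebra_maps_def by auto
	hence "map (t k l) ws:rel (H l) Comult" unfolding rel.simps w(1) list.map map_append mem_Collect_eq using in' len' tl(6)
		by (intro exI[of _ "t k l c'"] exI[of _ "map (t k l) ys'"] exI[of _ "map (t k l) zs'"] conjI) auto
	moreover have "xs = map (cq l) (map (t k l) ws)" using ws cq_tr[OF k l] by auto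
	ultimately show ?thesis using l(1) Comult by blast
next
	case (Mult i)
	then obtain x y where "x IN ?L" "y IN ?L" and xe: "xs = [x, y, imult ?L i x y]" using xs by auto
	then obtain k a b where k: "k:P" "a IN H k" "b IN H k" "x = cq k a" "y = cq k b" using cover[of x y y] by blast
	have "i:I" using rh Mult by (auto simp: syms_def)
	thus ?thesis using k m xe unfolding Mult Lc by (intro bexI[of _ k] bexI[of _ "[a, b, imult (H k) i a b]"]) auto
next
	case (Unit i)
	have "i:I" using rh Unit by (auto simp: syms_def)
	thus ?thesis using u[OF k0] xs k0 unfolding Unit Lc by (intro bexI[of _ k0] bexI[of _ "[iunit (H k0) i]"]) (auto simp: Lc)
qed
moreover have "EX i:P. EX a:carrier (H i). x = cq i a" if "x IN ?L" for x using cover[OF that that that] by blast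
ultimately show ?thesis by (intro exI[of _ ?L] exI[of _ "%i x. s i x x"] conjI ballI impI) (simp_all only: hs Lc(1) qh cq_tr cq_inj)
qed
end

end

section \<open>Categories of structures as relational categories\<close>

context linear_algebra
begin
lemma hmaps_comp:
assumes "is_ibialg I H" "is_ibialg I L" "is_ibialg I M" "f:hmaps I H L" "g:hmaps I L M"
shows "(%x. g (f x)):hmaps I H M"
using assms cm_comp[OF ibi(1)[OF assms(1)] ibi(1)[OF assms(2)] ibi(1)[OF assms(3)], of f g] cm_Lin[of f H L] Lin_in[of f H L]
unfolding hmaps_def algebra_map_def by auto

lemma hmaps_cong:
assumes "is_ibialg I H" "is_ibialg I L" "f:hmaps I H L" "!!x. x IN H ==> g x = f x"
shows "g:hmaps I H L"
proof (rule rel_hmaps[OF assms(1,2)])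
show "g:carrier H \<rightarrow> carrier L" using assms(3,4) cm_Lin[of f H L] Lin_in[of f H L] unfolding hmaps_def by auto
fix rh xs assume r: "rh:syms I" "xs:rel H rh"
have "map g xs = map f xs" using rel_sub[OF assms(1) r] assms(4) by auto
thus "map g xs:rel L rh" using hmaps_rel[OF assms(1-3) r] by metis
qed
end

lemma (in grothendieck) small_quotient:
"small TYPE('u) (carrier M) ==> small TYPE('u) (carrier (quotient_module M N))"
unfolding quotient_module_def by (simp add: A_RCOSETS_def' UNION_singleton_eq_range small_image)

lemma (in grothendieck) small_free:
assumes "small TYPE('u) A" "small TYPE('u) (carrier K)"
shows "small TYPE('u) (carrier (free_module K A))"
by (rule small_funs[OF assms, where c = "\<zero>$K"]) (auto simp: free_module_def)

lemma (in grothendieck) small_tensor: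
assumes "small TYPE('u) (carrier V)" "small TYPE('u) (carrier W)" "small TYPE('u) (carrier K)"
shows "small TYPE('u) (carrier (tensor K V W))"
unfolding tensor_def by (intro small_quotient small_free small_Sigma assms)

text \<open>\<open>V\<close> reads an object as a structure: it is the identity for
  \<open>Halg\<close> and \<open>br_ibialg\<close> for braces. It has to reach every small structure
  but may identify objects, since a brace also records antipodes.\<close>

locale hopf_category = grothendieck ty + linear_algebra K
for ty :: "'u itself" and K :: "'k ring" +
fixes C :: "('o, 'u => 'u) cat" and V :: "'o => ('k, 'i, 'u) ibialg" and I J :: "'i set"
	and coc :: bool and br :: "('i * 'i) set" and Lam :: "'u set"
assumes small_K: "small TYPE('u) (carrier K)"
	and infinite_Lam: "infinite Lam" and small_Lam': "small TYPE('u) Lam" and syms_Lam: "|syms I| <=o |Lam|"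
	and JI: "J <= I" and br: "br <= J \<times> I" and obj: "x:Obj C ==> small TYPE('u) (carrier (V x)) & (EX S. hstruct I J coc br (V x) S)"
	and all_obj: "[|small TYPE('u) (carrier H); hstruct I J coc br H S|] ==> EX x:Obj C. V x = H"
	and Hom_C: "[|x:Obj C; y:Obj C|] ==> Hom C x y = {f:extensional (carrier (V x)). f:hmaps I (V x) (V y)}"
	and Idm_C: "Idm C x = (\<lambda>a\<in>carrier (V x). a)" and Comp_C: "Comp C x y z g f = compose (carrier (V x)) g f"
begin
lemma obj_ibi: "x:Obj C ==> is_ibialg I (V x)"
using obj hstruct_ibialg by blast

text \<open>Structures built on other types, such as glued ones, become objects of \<open>C\<close>
  after renaming their elements into \<open>'u\<close>.\<close>

lemma transport_struct:
fixes H :: "('k, 'i, 'a) ibialg"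
assumes H: "hstruct I J coc br H S" and sm: "small TYPE('u) (carrier H)"
shows "EX x:Obj C. EX b:hmaps I H (V x). EX j:hmaps I (V x) H.
	(ALL y:carrier H. j (b y) = y) & (ALL y:carrier (V x). b (j y) = y) & (ALL rh:syms I. rel (V x) rh = map b ` rel H rh)"
proof -
from small_embed[OF sm] obtain b :: "'a => 'u" where b: "inj_on b (carrier H)" ..
let ?j = "inv_into (carrier H) b"
note p = pull_Lin_back[OF H JI br b]
obtain x where "x:Obj C" "V x = pullback K H (b ` carrier H) ?j b" using all_obj[OF _ p(1)] small_image[OF sm] p(4) by auto
thus ?thesis using p(2-5) b by (intro bexI[of _ x] bexI[of _ b] bexI[of _ ?j] conjI ballI) (auto simp: f_inv_into_f)
qed

sublocale relational ty C "%x. carrier (V x)" "%x. rel (V x)" "syms I" Lam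
proof
show "infinite Lam" "small TYPE('u) Lam" "|syms I| <=o |Lam|" by (fact infinite_Lam small_Lam' syms_Lam)+
show "small TYPE('u) (carrier (V x))" if "x:Obj C" for x using obj[OF that] by blast
show "set xs <= carrier (V x)" if "x:Obj C" "rh:syms I" "xs:rel (V x) rh" for x rh xs by (rule rel_sub[OF obj_ibi[OF that(1)] that(2,3)])
show "Hom C x y = {f:carrier (V x) \<rightarrow>\<^sub>E carrier (V y). ALL rh:syms I. ALL xs:rel (V x) rh. map f xs:rel (V y) rh}"
	if xy: "x:Obj C" "y:Obj C" for x y
proof -
	note i = obj_ibi[OF xy(1)] obj_ibi[OF xy(2)]
	have "f:carrier (V x) \<rightarrow> carrier (V y)" if "f:hmaps I (V x) (V y)" for f
		using that cm_Lin[of f "V x" "V y"] Lin_in[of f "V x" "V y"] unfolding hmaps_def by auto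
	thus ?thesis unfolding Hom_C[OF xy] using hmaps_rel[OF i] rel_hmaps[OF i] by (auto simp: PiE_def)
qed
show "Idm C x = (\<lambda>a\<in>carrier (V x). a)" "Comp C x y z g f = compose (carrier (V x)) g f" for x y z g f by (fact Idm_C Comp_C)+
show "EX y:Obj C. carrier (V y) = b ` carrier (V x) & (ALL rh:syms I. rel (V y) rh = map b ` rel (V x) rh)"
	if x: "x:Obj C" and b: "inj_on b (carrier (V x))" for x and b :: "'u => 'u"
proof -
	obtain S where S: "hstruct I J coc br (V x) S" and sm: "small TYPE('u) (carrier (V x))" using obj[OF x] by blast
	note p = pull_Lin_back[OF S JI br b]
	obtain y where "y:Obj C" "V y = pullback K (V x) (b ` carrier (V x)) (inv_into (carrier (V x)) b) b"
		using all_obj[OF _ p(1)] small_image[OF sm] p(4) by auto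
	thus ?thesis using p(4,5) by (intro bexI[of _ y]) auto
qed
show "EX y:Obj C. A <= carrier (V y) & carrier (V y) <= carrier (V x) & |carrier (V y)| <=o |N| &
		(ALL rh:syms I. rel (V y) rh = rel (V x) rh Int lists (carrier (V y)))"
	if x: "x:Obj C" and A: "A <= carrier (V x)" "|A| <=o |N|" and N: "|Lam| <=o |N|" for x A and N :: "'u set"
proof -
	obtain S where S: "hstruct I J coc br (V x) S" and sm: "small TYPE('u) (carrier (V x))" using obj[OF x] by blast
	have s: "|syms I| <=o |N|" using syms_Lam N by (rule ordLeq_transitive)
	have "|carrier K| <=o |syms I|" "|I| <=o |syms I|" unfolding card_of_ordLeq[symmetric]
		by (rule exI[of _ Smult], auto simp: syms_def inj_on_def)
	hence KI: "|carrier K| <=o |N|" "|I| <=o |N|" using s ordLeq_transitive by blast+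
	have "infinite N" using N infinite_Lam card_of_ordLeq_infinite by blast
	from hull[OF S JI br this KI A] obtain L T where L: "hstruct I J coc br L T" "A <= carrier L" "carrier L <= carrier (V x)"
		"|carrier L| <=o |N|" "!!rh. rh:syms I ==> rel L rh = rel (V x) rh Int lists (carrier L)" by metis
	obtain y where "y:Obj C" "V y = L" using all_obj[OF small_subset[OF sm L(3)] L(1)] by blast
	thus ?thesis using L(2-5) by (intro bexI[of _ y]) auto
qed
qed

lemma small_glue:
assumes "small TYPE('u) P" "!!i. i:P ==> small TYPE('u) (carrier (W i))"
shows "small TYPE('u) (carrier (glue_sp K P W E))"
unfolding glue_sp_def pres_def by (intro small_quotient small_free small_Sigma assms small_K)

sublocale relational_accessible ty C "%x. carrier (V x)" "%x. rel (V x)" "syms I" Lam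
proof
fix P :: "'u set" and r F assume P: "directed_poset kap P r" and F: "is_functor (poset_cat P r) C F"
let ?H = "%i. V (onObj F i)" and ?t = "%i j. onHom F i j ()"
let ?q = "glue_map K P ?H (transitions P r ?H ?t)"
note Fo = F_obj[OF F P]
have "ALL i:P. EX S. hstruct I J coc br (?H i) S" using obj Fo by blast
then obtain S where S: "!!i. i:P ==> hstruct I J coc br (?H i) (S i)" by metis
have t: "?t i j:hmaps I (?H i) (?H j)" if "i:P" "j:P" "(i, j):r" for i j using F_hom[OF F P that] Hom_C Fo that by auto
have ne: "P ~= {}" using bound[OF F P, of "{}"] by auto
have "EX (L :: ('k, 'i, ('u * 'u => 'k) set) ibialg) SL. hstruct I J coc br L SL &
		carrier L = carrier (glue_sp K P ?H (transitions P r ?H ?t)) & (ALL i:P. ?q i:hmaps I (?H i) L) &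
		(ALL i:P. ALL j:P. ALL x:carrier (?H i). (i, j):r --> ?q j (?t i j x) = ?q i x) &
		(ALL x:carrier L. EX i:P. EX a:carrier (?H i). x = ?q i a) &
		(ALL i:P. ALL x:carrier (?H i). ALL y:carrier (?H i). ?q i x = ?q i y --> (EX j:P. (i, j):r & ?t i j x = ?t i j y)) &
		(ALL rh:syms I. ALL xs:rel L rh. EX i:P. EX ys:rel (?H i) rh. xs = map (?q i) ys)" (is "EX L SL. hstruct I J coc br L SL & ?rest L")
	by (rule directed_hstruct[of P r I J coc br ?H S ?t, OF r_refl[OF F P] r_trans[OF F P] bound2[OF F P] ne S JI br t tr_comp[OF F P]])
then obtain L :: "('k, 'i, ('u * 'u => 'k) set) ibialg" and SL where L0: "hstruct I J coc br L SL & ?rest L" by (elim exE)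
note L = conjunct1[OF L0] and L1 = conjunct2[OF L0]
note Lc = conjunct1[OF L1] and L2 = conjunct2[OF L1]
note q = bspec[OF conjunct1[OF L2]] and L3 = conjunct2[OF L2]
note qt = conjunct1[OF L3, rule_format] and L4 = conjunct2[OF L3]
note qs = bspec[OF conjunct1[OF L4]] and L5 = conjunct2[OF L4]
note qi = conjunct1[OF L5, rule_format] and qr = conjunct2[OF L5, rule_format]
have sm: "small TYPE('u) (carrier L)" unfolding Lc by (rule small_glue) (use P Fo obj in "auto simp: directed_poset_def")
from transport_struct[OF L sm] obtain c b j where c: "c:Obj C" and b: "b:hmaps I L (V c)" and j: "j:hmaps I (V c) L"
	and J: "(ALL y:carrier L. j (b y) = y) & (ALL y:carrier (V c). b (j y) = y) & (ALL rh:syms I. rel (V c) rh = map b ` rel L rh)"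
	by (elim bexE) (rule that)
note jb = bspec[OF conjunct1[OF J]] and J2 = conjunct2[OF J]
note bj = bspec[OF conjunct1[OF J2]] and rl = bspec[OF conjunct2[OF J2]]
have mem: "f x IN B" if "f:hmaps I A B" "x IN A" for f x and A :: "('k, 'i, 'x) ibialg" and B :: "('k, 'i, 'y) ibialg"
	using that cm_Lin[of f A B] Lin_in[of f A B] unfolding hmaps_def by auto
have qL: "?q i x IN L" if "i:P" "x IN ?H i" for i x using mem[OF q[OF that(1)] that(2)] .
define ii where "ii i = (\<lambda>a\<in>carrier (?H i). b (?q i a))" for i
have iota: "ii i a = b (?q i a)" if "a IN ?H i" for i a using that by (simp add: ii_def)
have ih: "ii i:Hom C (onObj F i) c" if i: "i:P" for i unfolding Hom_C[OF Fo[OF i] c]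
	using hmaps_cong[OF obj_ibi[OF Fo[OF i]] obj_ibi[OF c] hmaps_comp[OF obj_ibi[OF Fo[OF i]] hstruct_ibialg[OF L] obj_ibi[OF c] q[OF i] b]]
	by (auto simp: ii_def)
have "str_colimit P r F c ii" unfolding str_colimit_def
proof (intro conjI ballI impI)
	show "is_cocone (poset_cat P r) C F c ii" unfolding is_cocone_def
	proof (intro conjI c ballI)
		fix i j f assume ij: "i:Obj (poset_cat P r)" "j:Obj (poset_cat P r)" and f: "f:Hom (poset_cat P r) i j"
		hence i: "i:P" "j:P" "(i, j):r" by (auto simp: poset_cat_def split: if_splits)
		show "Comp C (onObj F i) (onObj F j) c (ii j) (onHom F i j f) = ii i"
		proof
			fix x show "Comp C (onObj F i) (onObj F j) c (ii j) (onHom F i j f) x = ii i x"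
				using iota[OF tr_mem[OF F P i]] qt[OF i(1,2) _ i(3)] by (auto simp: Comp_C compose_def ii_def)
		qed
	qed (use ih in "simp add: poset_cat_def")
	fix x assume "x IN V c"
	thus "EX i:P. EX a:carrier (?H i). x = ii i a" using qs[OF mem[OF j]] bj iota by metis
next
	fix i a b' assume "i:P" "a IN ?H i" "b' IN ?H i" "ii i a = ii i b'"
	thus "EX j:P. (i, j):r & ?t i j a = ?t i j b'" using qi iota jb qL by metis
next
	fix rh xs assume r: "rh:syms I" "xs:rel (V c) rh"
	then obtain ys where "ys:rel L rh" "xs = map b ys" using rl by blast
	then obtain i zs where i: "i:P" "zs:rel (?H i) rh" "xs = map b (map (?q i) zs)" using qr r(1) by blast
	have "map b (map (?q i) zs) = map (ii i) zs" using rel_sub[OF obj_ibi[OF Fo[OF i(1)]] r(1) i(2)] iota by auto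
	thus "EX i:P. EX ys:rel (?H i) rh. xs = map (ii i) ys" using i by metis
qed
thus "EX c ii. str_colimit P r F c ii" by blast
qed
end

section \<open>Auxiliary coalgebras\<close>

definition same_coalg :: "('k, 'a, 'c) coalg_scheme => ('k, 'a, 'd) coalg_scheme => bool" where
"same_coalg C D <-> same_sp C D & comult C = comult D & counit C = counit D"

definition plain :: "('k, 'a, 'c) coalg_scheme => ('k, 'i, 'a) ibialg" where
"plain C = (|carrier = carrier C, mult = undefined, one = undefined, ring.zero = \<zero>$C, add = add C, smult = smult C,
	comult = comult C, counit = counit C, imult = undefined, iunit = undefined|)"

lemma plain_same: "same_coalg C (plain C)"
by (simp add: same_coalg_def same_sp_def plain_def)

text \<open>The co-opposite coalgebra. An antipode is a coalgebra map out of it, so it is the source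
  to which the universal property is applied when a limit receives its antipodes.\<close>

definition cop :: "'k ring => ('k, 'a, 'c) coalg_scheme => ('k, 'a, 'c) coalg_scheme" where
"cop K C = C(|comult := %c. tensor_swap K C C (comult C c)|)"

lemma cop_same: "same_sp C (cop K C)" and cop_simps [simp]: "carrier (cop K C) = carrier C" "counit (cop K C) = counit C"
by (simp_all add: same_sp_def cop_def)

context linear_algebra
begin
abbreviation "Cop == cop K"
lemma same_coalg_sw:
assumes "same_coalg C D" shows "sw C = sw D" "precoalg C <-> precoalg D"
proof -
have s: "same_sp C D" and s': "same_sp D C" and c: "comult C = comult D" "counit C = counit D"
	using assms by (auto simp: same_coalg_def same_sp_def)
have "dec C = dec D" unfolding dec_def ten_same[OF s s] pur_same[OF s s] c using s by (simp add: same_sp_def)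
thus "sw C = sw D" by (simp add: sw_def fun_eq_iff)
show "precoalg C <-> precoalg D"
	unfolding precoalg_def ten_same[OF s s] c Lin_same[OF s srefl] using Vec_same[OF s] Vec_same[OF s'] by blast
qed

lemma same_coalg_cong:
assumes "same_coalg C D"
shows "Coalg C ==> Coalg D" "Cocom C <-> Cocom D"
	"Cmaps C E = Cmaps D E" "Cmaps E C = Cmaps E D"
proof -
have s: "same_sp C D" and c: "comult C = comult D" "counit C = counit D" "carrier C = carrier D" "smult C = smult D"
	using assms by (auto simp: same_coalg_def same_sp_def)
note sw = same_coalg_sw[OF assms]
show "Cmaps C E = Cmaps D E" "Cmaps E C = Cmaps E D" "Cocom C <-> Cocom D"
	unfolding coalgebra_maps_def cocommutative_def tensor_swap_def tensor_map_def Lin_same[OF s srefl] Lin_same[OF srefl s]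
		ten_same[OF s s] pur_same[OF s s] c by rule+
assume C: "Coalg C"
note p = coalg_pre[OF C] note V = pre_Vec[OF p]
have VV: "Vec (ten C C)" "Vec (ten C (ten C C))" by (intro ten_Vec V)+
have swZ: "sw D D = sw D C" using s by (intro sw_lsum_same) (auto simp: same_sp_def)
have t: "trilin C C C (ten C (ten C C)) (%x y z. pur C (ten C C) x (pur C C y z))"
	by (intro trilinI LinLR[OF pur_Bilin] V VV Lin_id pur_in Bilin_left[OF pur_Bilin] Bilin_right[OF pur_Bilin])
show "Coalg D"
proof (rule coalgebraI)
	show "precoalg D" using sw(2) p by blast
	fix c assume cc: "c IN D"
	note c' = cc[folded c(3)]
	note S1 = ten_same[OF s s, symmetric] pur_same[OF s s, symmetric] and S2 = ten_same[OF s srefl, symmetric] pur_same[OF s srefl, symmetric]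
	show "sw D (ten D (ten D D)) (%x y. sw D (ten D (ten D D)) (%x' x''. pur D (ten D D) x' (pur D D x'' y)) x) c =
		sw D (ten D (ten D D)) (%x y. sw D (ten D (ten D D)) (%y' y''. pur D (ten D D) x (pur D D y' y'')) y) c"
		unfolding S1 unfolding S2 sw(1)[symmetric] by (rule sw_assoc[OF C VV(2) t c'])
	show "sw D D (%x y. counit D x *.$D y) c = c" "sw D D (%x y. counit D y *.$D x) c = c"
		using sw_counit[OF C Lin_id V c'] unfolding swZ sw(1) c .
qed
qed

lemma base_sw: "[|a IN K; Vec Z; be:Bilin BaseC BaseC Z|] ==> sw BaseC Z be a = be a \<one>$K"
and base_pre: "precoalg BaseC"
proof -
note s = base_same
have V: "Vec BaseC" using Vec_same[OF s base_Vec] .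
have "(%a. pur Base Base a \<one>$K):Lin Base (ten Base Base)" by (intro LinL[OF pur_Bilin] Lin_id base_Vec) (simp add: K_closed)
moreover have "comult BaseC = (%a. pur Base Base a \<one>$K)" "counit BaseC = (%a. a)" by (simp_all add: fun_eq_iff base_simps)
ultimately show p: "precoalg BaseC" unfolding precoalg_def Lin_same[OF s srefl, symmetric] ten_same[OF s s, symmetric]
	using V Lin_id[of "Base"] by simp
assume a: "a IN K" and Z: "Vec Z" and b': "be:Bilin BaseC BaseC Z"
have b: "be:Bilin Base Base Z" using b' unfolding Bilin_same[OF s s srefl] .
have "sw BaseC Z be a = Tlift Z be (comult BaseC a)" by (rule sw_lift[OF p Z b', symmetric]) (simp add: a base_simps)
thus "sw BaseC Z be a = be a \<one>$K" unfolding base_simps using lift_pure[OF base_Vec base_Vec Z b] a by (simp add: K_closed)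
qed

lemma base_is_coalgebra: "Coalg BaseC" and base_cocommutative: "Cocom BaseC"
proof -
let ?B = "BaseC" and ?M = "Base"
note s = base_same and p = base_pre
note V = pre_Vec[OF p] and M = base_Vec
interpret cring K by (rule cring_K)
have BB: "Vec (ten ?B ?B)" "Vec (ten ?B (ten ?B ?B))" by (intro ten_Vec V)+
note q = pur_Bilin[OF V V] and q' = pur_Bilin[OF V BB(1)]
let ?t = "%x y z. pur ?B (ten ?B ?B) x (pur ?B ?B y z)"
have t: "trilin ?B ?B ?B (ten ?B (ten ?B ?B)) ?t" by (intro trilinI LinLR[OF q'] LinLR[OF q] Lin_id pur_in V)
show "Coalg ?B"
proof (rule coalgebraI[OF p])
	fix c assume "c IN ?B"
	hence c: "c IN K" and one: "\<one>$K IN ?B" "c IN ?B" by (simp_all add: base_simps)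
	have b1: "(%x' x''. ?t x' x'' \<one>$K):Bilin ?B ?B (ten ?B (ten ?B ?B))"
		using one by (intro BilinI' LinLR[OF q'] LinLR[OF q] Lin_id pur_in V)
	have b2: "(%y' y''. ?t c y' y''):Bilin ?B ?B (ten ?B (ten ?B ?B))" using one by (intro BilinI' LinLR[OF q'] LinLR[OF q] Lin_id pur_in V)
	show "sw ?B (ten ?B (ten ?B ?B)) (%x y. sw ?B (ten ?B (ten ?B ?B)) (%x' x''. ?t x' x'' y) x) c =
		sw ?B (ten ?B (ten ?B ?B)) (%x y. sw ?B (ten ?B (ten ?B ?B)) (%y' y''. ?t x y' y'') y) c"
		using base_sw[OF c BB(2) sw_Tri_left[OF p BB(2) t V]] base_sw[OF c BB(2) sw_Tri_right[OF p BB(2) t V]]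
			base_sw[OF c BB(2) b1] base_sw[OF one_closed BB(2) b2] by simp
	have "(%x y. counit ?B x *.$?B y):Bilin ?B ?B ?B" "(%x y. counit ?B y *.$?B x):Bilin ?B ?B ?B"
		using smult_Bilin[OF V] unfolding Bilin_same[OF s srefl srefl] by (auto simp: base_simps bilinear_maps_def)
	from base_sw[OF c V this(1)] base_sw[OF c V this(2)]
	show "sw ?B ?B (%x y. counit ?B x *.$?B y) c = c" "sw ?B ?B (%x y. counit ?B y *.$?B x) c = c"
		using c by (auto simp: base_simps base_coalgebra_def module.extend_def coalg.fields_def base_module_def)
qed
show "Cocom ?B" unfolding cocommutative_iff[OF p]
proof
	fix c assume "c IN ?B"
	hence c: "c IN K" and one: "\<one>$K IN ?B" "c IN ?B" by (simp_all add: base_simps)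
	have sc: "a *.$?B b = a \<otimes>$K b" for a b by (simp add: base_coalgebra_def module.extend_def coalg.fields_def base_module_def)
	have "(%x y. pur ?B ?B y x):Bilin ?B ?B (ten ?B ?B)" using q by (auto simp: bilinear_maps_def)
	from base_sw[OF c BB(1) this] base_sw[OF c BB(1) q]
	have "sw ?B (ten ?B ?B) (%x y. pur ?B ?B y x) c = pur ?B ?B \<one>$K c" "sw ?B (ten ?B ?B) (pur ?B ?B) c = pur ?B ?B c \<one>$K" by simp_all
	moreover have "pur ?B ?B \<one>$K (c *.$?B \<one>$K) = pur ?B ?B (c *.$?B \<one>$K) \<one>$K"
		using Lin_smult[OF Bilin_right[OF q one(1)] c one(1)] Lin_smult[OF Bilin_left[OF q one(1)] c one(1)] by simp
	ultimately show "sw ?B (ten ?B ?B) (%x y. pur ?B ?B y x) c = sw ?B (ten ?B ?B) (pur ?B ?B) c" using c by (simp add: sc)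
qed
qed

lemma cop_pre: assumes p: "precoalg C" shows "precoalg (Cop C)"
proof -
note V = pre_Vec[OF p] and s = cop_same[of C]
have q: "(%x y. pur C C y x):Bilin C C (ten C C)" using pur_Bilin[OF V V] by (auto simp: bilinear_maps_def)
have "(%c. tensor_swap K C C (comult C c)):Lin C (ten C C)"
	unfolding tensor_swap_def by (rule Lin_comp[OF comult_Lin[OF p] lift_Lin[OF V V ten_Vec[OF V V] q]])
thus ?thesis unfolding precoalg_def ten_same[OF s s, symmetric] Lin_same[OF s srefl, symmetric]
	using Vec_same[OF s V] counit_Lin[OF p] by (simp add: cop_def)
qed

lemma sw_cop:
assumes p: "precoalg C" and Z: "Vec Z" and b: "be:Bilin C C Z" and c: "c IN C"
shows "sw (Cop C) Z be c = sw C Z (%x y. be y x) c"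
proof -
note V = pre_Vec[OF p] and s = cop_same[of C] and p' = cop_pre[OF p]
have T: "Vec (ten C C)" by (intro ten_Vec V)
have q: "(%x y. pur C C y x):Bilin C C (ten C C)" using pur_Bilin[OF V V] by (auto simp: bilinear_maps_def)
have "sw (Cop C) Z be c = Tlift Z be (comult (Cop C) c)"
	using Z b c by (intro sw_lift[OF p', symmetric]) (auto simp: Bilin_same[OF s s srefl, symmetric])
also have "... = Tlift Z be (sw C (ten C C) (%x y. pur C C y x) c)" by (simp add: cop_def tensor_swap_def sw_lift[OF p T q c])
also have "... = sw C Z (%x y. Tlift Z be (pur C C y x)) c" by (intro Lin_sw[OF p lift_Lin[OF V V Z b] T Z c] pur_in[OF V V])
also have "... = sw C Z (%x y. be y x) c" by (intro sw_cong[OF p c] lift_pure[OF V V Z b])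
finally show ?thesis .
qed

lemma cop_coalgebra: assumes C: "Coalg C" shows "Coalg (Cop C)"
proof -
let ?D = "Cop C"
note p = coalg_pre[OF C] note V = pre_Vec[OF p]
note s = cop_same[of C]
have p': "precoalg ?D" by (rule cop_pre[OF p])
have VV: "Vec (ten C C)" "Vec (ten C (ten C C))" by (intro ten_Vec V)+
note q = pur_Bilin[OF V V] and q' = pur_Bilin[OF V VV(1)]
let ?t = "%x y z. pur C (ten C C) x (pur C C y z)" let ?Z = "ten C (ten C C)"
have t: "trilin C C C ?Z ?t" by (intro trilinI LinLR[OF q'] LinLR[OF q] Lin_id pur_in V)
have t': "trilin C C C ?Z (%x y z. ?t z y x)" by (intro trilinI LinLR[OF q'] LinLR[OF q] Lin_id pur_in V)
note S1 = ten_same[OF s s, symmetric] pur_same[OF s s, symmetric] and S2 = ten_same[OF s srefl, symmetric] pur_same[OF s srefl, symmetric]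
have b: "(%x' x''. ?t x' x'' y):Bilin C C ?Z" if "y IN C" for y using that by (intro BilinI' LinLR[OF q'] LinLR[OF q] Lin_id pur_in V)
have b': "(%y' y''. ?t y y' y''):Bilin C C ?Z" if "y IN C" for y using that by (intro BilinI' LinLR[OF q'] LinLR[OF q] Lin_id pur_in V)
note cp = sw_cop[OF p]
have D: "carrier ?D = carrier C" by simp
show ?thesis
proof (rule coalgebraI[OF p'])
	fix c assume "c IN ?D" hence c: "c IN C" by simp
	have Tr: "trilin ?D ?D C ?Z ?t = trilin C C C ?Z ?t" "trilin C ?D ?D ?Z ?t = trilin C C C ?Z ?t"
		unfolding trilin_def D Lin_same[OF s srefl, symmetric] Bilin_same[OF s srefl srefl, symmetric]
			Bilin_same[OF srefl s srefl, symmetric] by rule+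
	have "sw ?D ?Z (%x y. sw ?D ?Z (%x' x''. ?t x' x'' y) x) c = sw C ?Z (%y x. sw ?D ?Z (%x' x''. ?t x' x'' y) x) c"
		using sw_Tri_left[OF p' VV(2) t[folded Tr(1)] V] unfolding Bilin_same[OF s srefl srefl, symmetric] by (rule cp[OF VV(2) _ c])
	also have "... = sw C ?Z (%y x. sw C ?Z (%x'' x'. ?t x' x'' y) x) c" by (intro sw_cong[OF p c] cp VV b)
	also have "... = sw C ?Z (%x y. sw C ?Z (%y'' y'. ?t y y' y'') x) c" by (rule sw_assoc[OF C VV(2) t' c, symmetric])
	also have "... = sw C ?Z (%y x. sw ?D ?Z (%y' y''. ?t x y' y'') y) c" by (intro sw_cong[OF p c] cp[symmetric] VV b')
	also have "... = sw ?D ?Z (%x y. sw ?D ?Z (%y' y''. ?t x y' y'') y) c"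
		using sw_Tri_right[OF p' VV(2) t[folded Tr(2)] V] unfolding Bilin_same[OF srefl s srefl, symmetric]
		by (rule cp[OF VV(2) _ c, symmetric])
	finally show "sw ?D (ten ?D (ten ?D ?D)) (%x y. sw ?D (ten ?D (ten ?D ?D)) (%x' x''. pur ?D (ten ?D ?D) x' (pur ?D ?D x'' y)) x) c =
		sw ?D (ten ?D (ten ?D ?D)) (%x y. sw ?D (ten ?D (ten ?D ?D)) (%y' y''. pur ?D (ten ?D ?D) x (pur ?D ?D y' y'')) y) c"
		unfolding S1 unfolding S2 .
	have Dz: "sw ?D ?D = sw ?D C" using s by (intro sw_lsum_same) (auto simp: same_sp_def)
	have sm: "smult ?D = smult C" by (simp add: cop_def)
	have bb: "(%x y. counit C x *.$C y):Bilin C C C" "(%x y. counit C y *.$C x):Bilin C C C"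
		by (auto intro!: BilinI' LinLR[OF smult_Bilin[OF V]] Lin_id counit_Lin[OF p] simp: counit_in[OF p])
	show "sw ?D ?D (%x y. counit ?D x *.$?D y) c = c" "sw ?D ?D (%x y. counit ?D y *.$?D x) c = c"
		unfolding Dz sm cop_simps cp[OF V bb(1) c] cp[OF V bb(2) c] using sw_counit[OF C Lin_id V c] by simp_all
qed
qed

lemma cop_cocommutative: assumes "Coalg C" "Cocom C" shows "Cocom (Cop C)"
proof -
note p = coalg_pre[OF assms(1)]
note V = pre_Vec[OF p] note s = cop_same[of C]
have p': "precoalg (Cop C)" using cop_coalgebra[OF assms(1)] coalg_pre by blast
have T: "Vec (ten C C)" by (intro ten_Vec V)
have q: "(%x y. pur C C y x):Bilin C C (ten C C)" using pur_Bilin[OF V V] by (auto simp: bilinear_maps_def)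
show ?thesis unfolding cocommutative_iff[OF p'] ten_same[OF s s, symmetric] pur_same[OF s s, symmetric]
	using sw_cop[OF p T q] sw_cop[OF p T pur_Bilin[OF V V]] sw_cocom[OF p assms(2) T pur_Bilin[OF V V]] by simp
qed

subsection \<open>Bilinear coalgebra maps\<close>

text \<open>Coalgebra maps out of the tensor coalgebra in terms of elements;
  \<open>cbilin_lift\<close> and \<open>cbilin_of_map\<close> pass between the two forms.\<close>

definition cbilin where
"cbilin C D E be <-> be:Bilin C D E & (ALL x:carrier C. ALL y:carrier D.
	comult E (be x y) = sw C (ten E E) (%x1 x2. sw D (ten E E) (%y1 y2. pur E E (be x1 y1) (be x2 y2)) y) x &
	counit E (be x y) = counit C x \<otimes>$K counit D y)"

lemma cbilin_bialgebra: assumes "Bialg H m u" shows "cbilin H H H m"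
unfolding cbilin_def using bi_Bil[OF assms] bi_comult[OF assms] bi_counit[OF assms] by simp

context
fixes C :: "('k, 'a, 'c) coalg_scheme" and D :: "('k, 'b, 'd) coalg_scheme" and E :: "('k, 'e, 'f) coalg_scheme" and be :: "'a => 'b => 'e"
assumes C: "precoalg C" and D: "precoalg D" and E: "precoalg E"
begin
lemma sw_cbilin:
assumes be: "cbilin C D E be" and Z: "Vec Z" and g: "ga:Bilin E E Z" and x: "x IN C" and y: "y IN D"
shows "sw E Z ga (be x y) = sw C Z (%x1 x2. sw D Z (%y1 y2. ga (be x1 y1) (be x2 y2)) y) x"
proof -
have b: "be:Bilin C D E" using be unfolding cbilin_def by blast
note bc = Bilin_in[OF b]
note V = pre_Vec[OF E] note VV = ten_Vec[OF V V] and pc = pur_in[OF V V]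
note L = lift_Lin[OF V V Z g]
have "sw E Z ga (be x y) = Tlift Z ga (comult E (be x y))" using sw_lift[OF E Z g] bc x y by simp
also have "... = Tlift Z ga (sw C (ten E E) (%x1 x2. sw D (ten E E) (%y1 y2. pur E E (be x1 y1) (be x2 y2)) y) x)"
	using be x y unfolding cbilin_def by simp
also have "... = sw C Z (%x1 x2. Tlift Z ga (sw D (ten E E) (%y1 y2. pur E E (be x1 y1) (be x2 y2)) y)) x"
	by (intro Lin_sw[OF C L VV Z] sw_closed[OF D VV] x y pc bc)
also have "... = sw C Z (%x1 x2. sw D Z (%y1 y2. Tlift Z ga (pur E E (be x1 y1) (be x2 y2))) y) x"
	by (intro sw_cong[OF C] Lin_sw[OF D L VV Z] x y pc bc)
also have "... = sw C Z (%x1 x2. sw D Z (%y1 y2. ga (be x1 y1) (be x2 y2)) y) x"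
	by (intro sw_cong[OF C] sw_cong[OF D] lift_pure[OF V V Z g] x y bc)
finally show ?thesis .
qed

lemma cbilin_lift:
assumes be: "cbilin C D E be" shows "Tlift E be:Cmaps (TC C D) E"
proof -
note CV = pre_Vec[OF C] and DV = pre_Vec[OF D] and EV = pre_Vec[OF E]
have b: "be:Bilin C D E" using be unfolding cbilin_def by blast
let ?h = "Tlift E be"
have h: "?h:Lin (TC C D) E" using lift_Lin[OF CV DV EV b] unfolding Lin_same[OF TC_same srefl] .
have hp: "?h (pur C D x y) = be x y" if "x IN C" "y IN D" for x y by (rule lift_pure[OF CV DV EV b that])
have T: "Vec (ten E E)" by (intro ten_Vec EV)
have p: "(%s t. pur E E (?h s) (?h t)):Bilin (TC C D) (TC C D) (ten E E)" by (rule comp_Bilin[OF h h EV EV])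
note TP = TC_pre[OF C D]
show ?thesis
proof (rule cm_I[OF TP E h])
	fix t assume t: "t IN TC C D"
	show "comult E (?h t) = sw (TC C D) (ten E E) (%s t. pur E E (?h s) (?h t)) t"
	proof (rule TC_ext[OF C D Lin_comp[OF h comult_Lin[OF E]] sw_Lin[OF TP T p] T])
		fix x y assume xy: "x IN C" "y IN D"
		have "sw (TC C D) (ten E E) (%s t. pur E E (?h s) (?h t)) (pur C D x y) =
				sw C (ten E E) (%x1 x2. sw D (ten E E) (%y1 y2. pur E E (be x1 y1) (be x2 y2)) y) x"
			unfolding sw_TC[OF C D T p xy] by (intro sw_cong[OF C] sw_cong[OF D] xy) (simp add: hp)
		thus "comult E (?h (pur C D x y)) = sw (TC C D) (ten E E) (%s t. pur E E (?h s) (?h t)) (pur C D x y)"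
			using be xy hp unfolding cbilin_def by simp
	qed (use t in simp)
	show "counit E (?h t) = counit (TC C D) t" by (rule TC_ext[OF C D Lin_comp[OF h counit_Lin[OF E]] counit_Lin[OF TP] base_Vec])
			(use t be in "auto simp: hp TC_counit_pure[OF C D] cbilin_def")
qed
qed

lemma cbilin_of_map:
assumes h: "h:Cmaps (TC C D) E" shows "cbilin C D E (%x y. h (pur C D x y))"
proof -
note CV = pre_Vec[OF C] and DV = pre_Vec[OF D] and EV = pre_Vec[OF E]
note hl = cm_Lin[OF h]
have T: "Vec (ten E E)" by (intro ten_Vec EV)
have p: "(%s t. pur E E (h s) (h t)):Bilin (TC C D) (TC C D) (ten E E)" by (rule comp_Bilin[OF hl hl EV EV])
note TP = TC_pre[OF C D] and q = pur_Bilin_TC[OF C D] and pc = pur_in[OF CV DV]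
show ?thesis unfolding cbilin_def
proof (intro conjI ballI)
	show "(%x y. h (pur C D x y)):Bilin C D E" by (intro BilinI' Lin_comp[OF Bilin_left[OF q] hl] Lin_comp[OF Bilin_right[OF q] hl])
	fix x y assume xy: "x IN C" "y IN D"
	hence t: "pur C D x y IN TC C D" using pc by simp
	have "comult E (h (pur C D x y)) = sw (TC C D) (ten E E) (%s t. pur E E (h s) (h t)) (pur C D x y)"
		using h t tmap_sw[OF TP hl hl EV EV t] unfolding coalgebra_maps_def by auto
	thus "comult E (h (pur C D x y)) = sw C (ten E E) (%x1 x2. sw D (ten E E) (%y1 y2. pur E E (h (pur C D x1 y1)) (h (pur C D x2 y2))) y) x"
		unfolding sw_TC[OF C D T p xy] .
	show "counit E (h (pur C D x y)) = counit C x \<otimes>$K counit D y" using cm_counit[OF h t] TC_counit_pure[OF C D xy] by simp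
qed
qed
end

lemma cbilin_comp:
assumes pre: "precoalg C" "precoalg D" "precoalg C'" "precoalg D'" "precoalg E"
	and f: "f:Cmaps C C'" and g: "g:Cmaps D D'" and be: "cbilin C' D' E be"
shows "cbilin C D E (%x y. be (f x) (g y))"
unfolding cbilin_def
proof (intro conjI ballI)
note fl = cm_Lin[OF f] and gl = cm_Lin[OF g]
note fc = Lin_in[OF fl] and gc = Lin_in[OF gl]
have b: "be:Bilin C' D' E" using be unfolding cbilin_def by blast
note bc = Bilin_in[OF b]
note V = pre_Vec[OF pre(5)]
have T: "Vec (ten E E)" by (intro ten_Vec V)
note q = pur_Bilin[OF V V]
show "(%x y. be (f x) (g y)):Bilin C D E" by (intro BilinI' LinLR[OF b] fl gl fc gc)
fix x y assume xy: "x IN C" "y IN D"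
have 1: "(%y1 y2. pur E E (be a y1) (be b y2)):Bilin D' D' (ten E E)" if "a IN C'" "b IN C'" for a b
	using that by (intro BilinI' LinLR[OF q] LinR[OF b] Lin_id bc)
have 2: "(%a b. sw D' (ten E E) (%y1 y2. pur E E (be a y1) (be b y2)) (g y)):Bilin C' C' (ten E E)"
	using xy by (intro BilinI' sw_LinP[OF pre(4) T pre_Vec[OF pre(3)]] LinLR[OF q] LinL[OF b] Lin_id bc gc)
have "comult E (be (f x) (g y)) = sw C' (ten E E) (%x1 x2. sw D' (ten E E) (%y1 y2. pur E E (be x1 y1) (be x2 y2)) (g y)) (f x)"
	using be fc gc xy unfolding cbilin_def by blast
also have "... = sw C (ten E E) (%x1 x2. sw D' (ten E E) (%y1 y2. pur E E (be (f x1) y1) (be (f x2) y2)) (g y)) x"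
	by (rule cm_sw[OF pre(1,3) f T 2 xy(1)])
also have "... = sw C (ten E E) (%x1 x2. sw D (ten E E) (%y1 y2. pur E E (be (f x1) (g y1)) (be (f x2) (g y2))) y) x"
	by (intro sw_cong[OF pre(1)] cm_sw[OF pre(2,4) g T 1] xy fc)
finally show "comult E (be (f x) (g y)) =
	sw C (ten E E) (%x1 x2. sw D (ten E E) (%y1 y2. pur E E (be (f x1) (g y1)) (be (f x2) (g y2))) y) x" .
show "counit E (be (f x) (g y)) = counit C x \<otimes>$K counit D y"
	using be xy fc gc cm_counit[OF f] cm_counit[OF g] unfolding cbilin_def by simp
qed

lemma TC_cocommutative:
assumes C: "Coalg C" "Cocom C" and D: "Coalg D" "Cocom D"
shows "Cocom (TC C D)"
proof -
note pC = coalg_pre[OF C(1)] and pD = coalg_pre[OF D(1)]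
note TP = TC_pre[OF pC pD] note V = pre_Vec[OF TP]
let ?T = "TC C D"
have TT: "Vec (ten ?T ?T)" by (intro ten_Vec V)
note q = pur_Bilin[OF V V] and p = pur_Bilin_TC[OF pC pD]
note pc = Bilin_in[OF p]
have q': "(%x y. pur ?T ?T y x):Bilin ?T ?T (ten ?T ?T)" using q by (auto simp: bilinear_maps_def)
have b: "(%y1 y2. pur ?T ?T (pur C D x1 y1) (pur C D x2 y2)):Bilin D D (ten ?T ?T)" if "x1 IN C" "x2 IN C" for x1 x2
	using that by (intro BilinI' LinLR[OF q] LinR[OF p] Lin_id pc)
have b': "(%x1 x2. sw D (ten ?T ?T) (%y1 y2. pur ?T ?T (pur C D x1 y1) (pur C D x2 y2)) y):Bilin C C (ten ?T ?T)" if "y IN D" for y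
	using that by (intro BilinI' sw_LinP[OF pD TT pre_Vec[OF pC]] LinLR[OF q] LinL[OF p] Lin_id pc)
show ?thesis unfolding cocommutative_iff[OF TP]
proof
	fix t assume "t IN ?T"
	hence t: "t IN ten C D" by simp
	show "sw ?T (ten ?T ?T) (%x y. pur ?T ?T y x) t = sw ?T (ten ?T ?T) (pur ?T ?T) t"
	proof (rule TC_ext[OF pC pD sw_Lin[OF TP TT q'] sw_Lin[OF TP TT q] TT])
		fix x y assume xy: "x IN C" "y IN D"
		have "sw ?T (ten ?T ?T) (%x y. pur ?T ?T y x) (pur C D x y) =
				sw C (ten ?T ?T) (%x1 x2. sw D (ten ?T ?T) (%y1 y2. pur ?T ?T (pur C D x2 y2) (pur C D x1 y1)) y) x" by (rule sw_TC[OF pC pD TT q' xy])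
		also have "... = sw C (ten ?T ?T) (%x1 x2. sw D (ten ?T ?T) (%y1 y2. pur ?T ?T (pur C D x2 y1) (pur C D x1 y2)) y) x"
			by (intro sw_cong[OF pC] sw_cocom[OF pD D(2) TT b] xy)
		also have "... = sw C (ten ?T ?T) (%x1 x2. sw D (ten ?T ?T) (%y1 y2. pur ?T ?T (pur C D x1 y1) (pur C D x2 y2)) y) x"
			by (rule sw_cocom[OF pC C(2) TT b'[OF xy(2)] xy(1)])
		also have "... = sw ?T (ten ?T ?T) (pur ?T ?T) (pur C D x y)" by (rule sw_TC[OF pC pD TT q xy, symmetric])
		finally show "sw ?T (ten ?T ?T) (%x y. pur ?T ?T y x) (pur C D x y) = sw ?T (ten ?T ?T) (pur ?T ?T) (pur C D x y)" .
	qed (rule t)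
qed
qed

text \<open>The comultiplication is covered by \<open>antipode_comult\<close>. For the counit,
  \<open>c\<close> is expanded by the counit law, and the counit of \<open>S(c1) c2\<close> is
  evaluated with the antipode law.\<close>

lemma antipode_cop_map:
assumes H: "Bialg H m u" and S: "Antip H m u S"
shows "S:Cmaps (Cop H) H"
proof -
note p = bi_pre[OF H] and V = bi_Vec[OF H] and mc = bi_closed[OF H] and u = bi_unit[OF H]
note p' = coalg_pre[OF cop_coalgebra[OF bi_coalgebra[OF H]]]
interpret cring K by (rule cring_K)
have S': "S:Lin H H" "!!c. c IN H ==> sw H H (%x y. m (S x) y) c = counit H c *.$H u" using S anti_iff[OF H] by auto
note sc = Lin_in[OF S'(1)] and ec = counit_in[OF p] and el = counit_Lin[OF p]
show ?thesis
proof (rule cm_I[OF p' p])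
	show "S:Lin (Cop H) H" using S'(1) Lin_same[OF cop_same[of H K] srefl] by blast
	fix c assume "c IN Cop H" hence c: "c IN H" by simp
	have "(%x y. pur H H (S x) (S y)):Bilin H H (ten H H)" by (rule comp_Bilin[OF S'(1,1) V V])
	thus "comult H (S c) = sw (Cop H) (ten H H) (%x y. pur H H (S x) (S y)) c"
		unfolding antipode_comult[OF H S c] using sw_cop[OF p ten_Vec[OF V V] _ c] by simp
	have "counit H (S c) = sw H Base (%x y. counit H y *.$Base counit H (S x)) c"
		by (rule sw_counit(2)[OF bi_coalgebra[OF H] Lin_comp[OF S'(1) el] base_Vec c, symmetric])
	also have "... = sw H Base (%x y. counit H (m (S x) y)) c" by (intro sw_cong[OF p c]) (simp add: bi_counit[OF H] sc ec m_comm)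
	also have "... = counit H (sw H H (%x y. m (S x) y) c)" by (intro Lin_sw[OF p el V base_Vec c, symmetric] mc sc)
	also have "... = counit H c" unfolding S'(2)[OF c] using Lin_smult[OF el ec[OF c] u] by (simp add: bi_counit_unit[OF H] ec c)
	finally show "counit H (S c) = counit (Cop H) c" by simp
qed
qed
end

text \<open>Coalgebras written as structures without operations, in the same record type, so that
  they form an instance of \<open>hopf_category\<close> and inherit its accessibility
  results.\<close>

definition coalg_cat :: "'k ring => bool => (('k, 'i, 'u) ibialg, 'u => 'u) cat" where
"coalg_cat K coc = (|Obj = {H. small TYPE('u) (carrier H) & coalgebra K H & (coc --> cocommutative K H)},
		Hom = (%H L. {f:extensional (carrier H). f:coalgebra_maps K H L}),
		Idm = (%H. \<lambda>x\<in>carrier H. x), Comp = (%H _ _ g f. compose (carrier H) g f)|)"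

lemma (in linear_algebra) coalgebra_map_cong:
assumes C: "precoalg C" and D: "precoalg D" and f: "f:coalgebra_maps K C D"
	and eq: "!!x. x IN C ==> f' x = f x"
shows "f':coalgebra_maps K C D"
proof -
note fl = cm_Lin[OF f] and V = pre_Vec[OF D]
have l: "f':Lin C D" by (rule Lin_cong[OF fl eq[symmetric] pre_Vec[OF C]])
show ?thesis
proof (rule cm_I[OF C D l])
	fix x assume x: "x IN C"
	have "comult D (f x) = sw C (ten D D) (%x y. pur D D (f x) (f y)) x"
		using f x tmap_sw[OF C fl fl V V x] unfolding coalgebra_maps_def by auto
	also have "... = sw C (ten D D) (%x y. pur D D (f' x) (f' y)) x" by (intro sw_cong[OF C x]) (simp add: eq)
	finally show "comult D (f' x) = sw C (ten D D) (%x y. pur D D (f' x) (f' y)) x" using eq[OF x] by simp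
	show "counit D (f' x) = counit C x" using cm_counit[OF f x] eq[OF x] by simp
qed
qed

section \<open>Colimits and limits of coalgebras\<close>

context hopf_category
begin
lemma hmaps_coalgebra: "hmaps {} H L = Cmaps H L"
and hstruct_coalgebra: "hstruct {} {} coc {} H S <-> Coalg H & (coc --> Cocom H)" by (simp_all add: hmaps_def hstruct_def)

lemma hopf_coalg: "hopf_category K (coalg_cat K coc :: (('k, 'i, 'u) ibialg, 'u => 'u) cat) (%H. H) {} {} coc {} Lam"
proof (rule hopf_category.intro[OF grothendieck_axioms linear_algebra_axioms], rule hopf_category_axioms.intro)
show "|syms {} :: ('k, 'i) sym set| <=o |Lam|" by (rule ordLeq_transitive[OF card_of_mono1 syms_Lam]) (auto simp: syms_def)
show "small TYPE('u) (carrier K)" "infinite Lam" "small TYPE('u) Lam" by (fact small_K infinite_Lam small_Lam')+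
qed (simp_all add: coalg_cat_def hstruct_coalgebra hmaps_coalgebra)

text \<open>Colimits of coalgebras are glued from vector spaces: morphisms of the diagram respect
  comultiplication and counit, so their graphs satisfy the coideal condition. With multiplications
  present, the glued space would not carry a product.\<close>

lemma no_operations_cocomplete:
assumes I: "I = {}" shows "cocomplete_category TYPE('u) C"
unfolding cocomplete_category_def
proof (intro allI impI, elim conjE)
have JB: "J = {}" "br = {}" using JI br I by auto
have hs: "hstruct I J coc br H S <-> Coalg H & (coc --> Cocom H)" for H S unfolding I JB by (rule hstruct_coalgebra)
have hm: "hmaps I H L = Cmaps H L" for H L unfolding I by (rule hmaps_coalgebra)
fix X :: "('u, 'u) cat" and D assume X: "small_category X" and D: "is_functor X C D"
let ?P = "Obj X" and ?H = "%i. V (onObj D i)"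
note Do = functor_obj[OF D] and Dh = functor_hom[OF D]
define E where "E = {((i, x), (j, onHom D i j f x)) | i j f x. i:?P & j:?P & f:Hom X i j & x IN ?H i}"
have co: "Coalg (?H i)" "coc ==> Cocom (?H i)" "small TYPE('u) (carrier (?H i))" if "i:?P" for i
	using obj[OF Do[OF that]] unfolding hs by auto
have t: "onHom D i j f:Cmaps (?H i) (?H j)" if "i:?P" "j:?P" "f:Hom X i j" for i j f
	using Dh[OF that(3,1,2)] Hom_C[OF Do[OF that(1)] Do[OF that(2)]] unfolding hm by auto
note pre = coalg_pre[OF co(1)]
have E: "E <= (SIGMA i:?P. carrier (?H i)) \<times> (SIGMA i:?P. carrier (?H i))" unfolding E_def using Lin_in[OF cm_Lin[OF t]] by auto
let ?Q = "glue_sp K ?P ?H E" and ?q = "glue_map K ?P ?H E"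
have Q: "Vec ?Q" by (rule glue_Vec[of ?P ?H E, OF pre_Vec[OF pre] E])
have ql: "?q i:Lin (?H i) ?Q" if "i:?P" for i by (rule glue_map_Lin[of ?P ?H E, OF pre_Vec[OF pre] E that])
have qe: "?q i x = ?q j y" if "((i, x), (j, y)):E" for i x j y by (rule glue_eq[of ?P ?H E, OF pre_Vec[OF pre] E that])
have eps: "counit (?H i) x = counit (?H j) y" if "((i, x), (j, y)):E" for i x j y using that cm_counit[OF t] unfolding E_def by auto
have cm: "sw (?H i) (ten ?Q ?Q) (%a b. pur ?Q ?Q (?q i a) (?q i b)) x =
		sw (?H j) (ten ?Q ?Q) (%a b. pur ?Q ?Q (?q j a) (?q j b)) y" if e: "((i, x), (j, y)):E" for i x j y
proof -
	obtain f where f: "i:?P" "j:?P" "f:Hom X i j" "x IN ?H i" and y: "y = onHom D i j f x" using e unfolding E_def by auto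
	have qf: "?q j (onHom D i j f a) = ?q i a" if "a IN ?H i" for a using f that by (intro qe[symmetric]) (auto simp: E_def)
	show ?thesis unfolding y cm_sw[OF pre[OF f(1)] pre[OF f(2)] t[OF f(1-3)] ten_Vec[OF Q Q] comp_Bilin[OF ql[OF f(2)] ql[OF f(2)] Q Q] f(4)]
		by (intro sw_cong[OF pre[OF f(1)] f(4)]) (simp add: qf)
qed
let ?L = "glue K ?P ?H E undefined undefined :: ('k, 'i, ('u * 'u => 'k) set) ibialg"
have Lc: "Coalg ?L" by (rule glue_coalgebra[of ?P ?H E, OF co(1) E eps cm])
have Lcoc: "coc --> Cocom ?L" using glue_cocommutative[of ?P ?H E, OF co(1) E eps cm co(2)] by blast
have "carrier ?L = carrier ?Q" by (simp add: glue_def Let_def)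
moreover have "small TYPE('u) ?P" using X unfolding small_category_def by blast
ultimately have sm: "small TYPE('u) (carrier ?L)" using small_glue[of ?P ?H E] co(3) by simp
have qL: "?q i:Cmaps (?H i) ?L" if "i:?P" for i by (rule gq_cm[of ?P ?H E, OF co(1) E eps cm that])
have hL: "hstruct I J coc br ?L S" for S unfolding hs using Lc Lcoc by blast
from transport_struct[OF hL sm] obtain c b j where c: "c:Obj C" and b: "b:Cmaps ?L (V c)" and j: "j:Cmaps (V c) ?L"
	and jb0: "(ALL y:carrier ?L. j (b y) = y) & (ALL y:carrier (V c). b (j y) = y) & (ALL rh:syms I. rel (V c) rh = map b ` rel ?L rh)"
	unfolding hm by (elim bexE) (rule that)
note jb = bspec[OF conjunct1[OF jb0]] and bj = bspec[OF conjunct1[OF conjunct2[OF jb0]]]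
define ii where "ii i = (\<lambda>a\<in>carrier (?H i). b (?q i a))" for i
have iota: "ii i a = b (?q i a)" if "a IN ?H i" for i a using that by (simp add: ii_def)
note pL = coalg_pre[OF Lc]
have pV: "precoalg (V x)" if "x:Obj C" for x using obj[OF that] hs coalg_pre by blast
show "EX c ii. is_colimit X C D c ii"
proof (intro exI[of _ c] exI[of _ ii], unfold is_colimit_def is_cocone_def, intro conjI ballI allI impI c)
	fix i assume i: "i:?P"
	have "(%x. b (?q i x)):Cmaps (?H i) (V c)" by (rule cm_comp[OF pre[OF i] pL pV[OF c] qL[OF i] b])
	from coalgebra_map_cong[OF pre[OF i] pV[OF c] this, of "ii i"] show "ii i:Hom C (onObj D i) c"
		unfolding Hom_C[OF Do[OF i] c] hm by (auto simp: ii_def)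
next
	fix i j f assume f: "i:?P" "j:?P" "f:Hom X i j"
	have "?q j (onHom D i j f x) = ?q i x" if "x IN ?H i" for x using f that by (intro qe[symmetric]) (auto simp: E_def)
	thus "Comp C (onObj D i) (onObj D j) c (ii j) (onHom D i j f) = ii i"
		using Lin_in[OF cm_Lin[OF t[OF f]]] by (auto simp: fun_eq_iff Comp_C compose_def ii_def)
next
	fix d kk
	assume dk: "d:Obj C & (ALL i:?P. kk i:Hom C (onObj D i) d) &
		(ALL i:?P. ALL j:?P. ALL f:Hom X i j. Comp C (onObj D i) (onObj D j) d (kk j) (onHom D i j f) = kk i)"
	hence d: "d:Obj C" by blast
	have k: "kk i:Cmaps (?H i) (V d)" "kk i:extensional (carrier (?H i))" if "i:?P" for i
		using dk Hom_C[OF Do[OF that] d] that unfolding hm by auto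
	have kE: "kk i x = kk j y" if e: "((i, x), (j, y)):E" for i x j y
	proof -
		obtain f where f: "i:?P" "j:?P" "f:Hom X i j" "x IN ?H i" and y: "y = onHom D i j f x" using e unfolding E_def by auto
		have "Comp C (onObj D i) (onObj D j) d (kk j) (onHom D i j f) x = kk i x" using dk f by simp
		thus ?thesis using f(4) y by (simp add: Comp_C compose_def)
	qed
	have dco: "Coalg (V d)" using obj[OF d] unfolding hs by blast
	let ?h = "Tlift (V d) kk"
	have h1: "?h:Cmaps ?L (V d)" by (rule glue_universal(1)[of ?P ?H E, OF co(1) E eps cm dco k(1) kE])
	have h2: "?h (?q i x) = kk i x" if "i:?P" "x IN ?H i" for i x by (rule glue_universal(2)[of ?P ?H E, OF co(1) E eps cm dco k(1) kE that])
	have hj: "(%x. ?h (j x)):Cmaps (V c) (V d)" by (rule cm_comp[OF pV[OF c] pL pV[OF d] j h1])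
	show "EX! h. h:Hom C c d & (ALL i:?P. Comp C (onObj D i) c d h (ii i) = kk i)"
	proof (rule ex1I[of _ "\<lambda>x\<in>carrier (V c). ?h (j x)"])
		have bq: "b (?q i x) IN V c" "j (b (?q i x)) = ?q i x" if "i:?P" "x IN ?H i" for i x
			using Lin_in[OF cm_Lin[OF b]] Lin_in[OF cm_Lin[OF qL[OF that(1)]] that(2)] jb by auto
		show "(\<lambda>x\<in>carrier (V c). ?h (j x)):Hom C c d & (ALL i:?P. Comp C (onObj D i) c d (\<lambda>x\<in>carrier (V c). ?h (j x)) (ii i) = kk i)"
		proof (intro conjI ballI)
			show "(\<lambda>x\<in>carrier (V c). ?h (j x)):Hom C c d"
				unfolding Hom_C[OF c d] hm using coalgebra_map_cong[OF pV[OF c] pV[OF d] hj] by auto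
			fix i assume i: "i:?P"
			show "Comp C (onObj D i) c d (\<lambda>x\<in>carrier (V c). ?h (j x)) (ii i) = kk i"
			proof
				fix x show "Comp C (onObj D i) c d (\<lambda>x\<in>carrier (V c). ?h (j x)) (ii i) x = kk i x"
					using bq[OF i] h2[OF i] k(2)[OF i] by (cases "x IN ?H i") (auto simp: Comp_C compose_def ii_def extensional_def)
			qed
		qed
		fix g assume g: "g:Hom C c d & (ALL i:?P. Comp C (onObj D i) c d g (ii i) = kk i)"
		have gc: "g:Cmaps (V c) (V d)" "g:extensional (carrier (V c))" using g unfolding Hom_C[OF c d] hm by auto
		have gq: "g (b (?q i x)) = ?h (?q i x)" if "i:?P" "x IN ?H i" for i x
		proof -
			have "Comp C (onObj D i) c d g (ii i) x = kk i x" using g that by simp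
			thus ?thesis using that h2[OF that] by (simp add: Comp_C compose_def ii_def)
		qed
		have "g (b y) = ?h y" if "y IN ?L" for y
			by (rule G_ext[of ?P ?H E, OF co(1) E eps cm Lin_comp[OF cm_Lin[OF b] cm_Lin[OF gc(1)]] cm_Lin[OF h1] pre_Vec[OF pV[OF d]] gq that])
		from this[OF Lin_in[OF cm_Lin[OF j]]] show "g = (\<lambda>x\<in>carrier (V c). ?h (j x))"
			using gc(2) bj by (auto simp: fun_eq_iff extensional_def)
	qed
qed
qed

lemma transport_coalg:
assumes A: "Coalg A" "coc --> Cocom A" and sm: "small TYPE('u) (carrier A)"
shows "EX A' :: ('k, 'i, 'u) ibialg. (Coalg A' & (coc --> Cocom A') & small TYPE('u) (carrier A')) &
	(EX b:Cmaps A A'. EX j:Cmaps A' A. (ALL x:carrier A. j (b x) = x) & (ALL y:carrier A'. b (j y) = y))"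
proof -
interpret co: hopf_category ty K "coalg_cat K coc :: (('k, 'i, 'u) ibialg, 'u => 'u) cat" "%H. H" "{}" "{}" coc "{}" Lam
	by (rule hopf_coalg)
let ?A = "plain A :: ('k, 'i, 'a) ibialg"
note cong = same_coalg_cong[of A ?A, OF plain_same]
have "hstruct {} {} coc {} ?A undefined" unfolding hstruct_coalgebra using cong(1)[OF A(1)] cong(2) A(2) by simp
moreover have "small TYPE('u) (carrier ?A)" using sm by (simp add: plain_def)
ultimately obtain x b j where "x:Obj (coalg_cat K coc :: (('k, 'i, 'u) ibialg, 'u => 'u) cat)"
	"b:Cmaps ?A x" "j:Cmaps x ?A" "(ALL y:carrier ?A. j (b y) = y) & (ALL y:carrier x. b (j y) = y)"
	using co.transport_struct[of ?A undefined] unfolding hmaps_coalgebra by blast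
thus ?thesis unfolding cong(3,4)[symmetric] by (intro exI[of _ x] conjI bexI[of _ b] bexI[of _ j]) (auto simp: coalg_cat_def plain_def)
qed

abbreviation cobj :: "('k, 'i, 'u) ibialg => bool" where
"cobj A == Coalg A & (coc --> Cocom A) & small TYPE('u) (carrier A)"

text \<open>The universal property of a limit in coalgebras, phrased by elements so that
  extensionality of morphisms plays no part. \<open>T\<close> lists the arrows of the diagram with
  source and target. Existence and uniqueness of mediating maps are separate clauses, as later
  arguments use them separately.\<close>

definition coalg_limit ::
"'p set => ('p => ('k, 'i, 'u) ibialg) => ('p * 'p * ('u => 'u)) set => ('k, 'i, 'u) ibialg => ('p => 'u => 'u) => bool" where
"coalg_limit P F T L p <-> cobj L & (ALL i:P. p i:Cmaps L (F i)) & (ALL i j f. (i, j, f):T --> (ALL x:carrier L. f (p i x) = p j x)) &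
	(ALL (A :: ('k, 'i, 'u) ibialg) g. cobj A --> (ALL i:P. g i:Cmaps A (F i)) -->
		(ALL i j f. (i, j, f):T --> (ALL x:carrier A. f (g i x) = g j x)) --> (EX h:Cmaps A L. ALL i:P. ALL x:carrier A. p i (h x) = g i x)) &
	(ALL (A :: ('k, 'i, 'u) ibialg) h h'. cobj A --> h:Cmaps A L --> h':Cmaps A L -->
		(ALL i:P. ALL x:carrier A. p i (h x) = p i (h' x)) --> (ALL x:carrier A. h x = h' x))"

text \<open>The operations are forgotten and the limit is taken in coalgebras, which are complete
  because they are accessible and cocomplete. No explicit description of this limit is
  available.\<close>

lemma limit_coalgebra:
fixes X :: "('u, 'u) cat"
assumes X: "small_category X" and D: "is_functor X C D"
shows "EX L p. coalg_limit (Obj X) (%i. V (onObj D i)) {(i, j, onHom D i j f) | i j f. i:Obj X & j:Obj X & f:Hom X i j} L p &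
	(ALL i:Obj X. p i:extensional (carrier L))"
proof -
let ?B = "coalg_cat K coc :: (('k, 'i, 'u) ibialg, 'u => 'u) cat"
interpret co: hopf_category ty K ?B "%H. H" "{}" "{}" coc "{}" Lam by (rule hopf_coalg)
have com: "complete_category TYPE('u) ?B" by (rule co.complete_if_C[OF co.no_operations_cocomplete]) simp
note Do = functor_obj[OF D] and Dh = functor_hom[OF D]
let ?D = "(|onObj = %i. V (onObj D i), onHom = onHom D|) :: ('u, 'u, ('k, 'i, 'u) ibialg, 'u => 'u) func"
have BO: "H:Obj ?B <-> small TYPE('u) (carrier H) & Coalg H & (coc --> Cocom H)"
	and BH: "Hom ?B H H' = {f:extensional (carrier H). f:Cmaps H H'}" and BC: "Comp ?B H H' H'' g f = compose (carrier H) g f" for H H' H'' g f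
	by (simp_all add: coalg_cat_def)
have VO: "V x:Obj ?B" if "x:Obj C" for x using obj[OF that] unfolding BO hstruct_def by blast
have F: "is_functor X ?B ?D" unfolding is_functor_def
proof (intro conjI ballI)
	fix i j f assume f: "i:Obj X" "j:Obj X" "f:Hom X i j"
	show "onHom ?D i j f:Hom ?B (onObj ?D i) (onObj ?D j)"
		using Dh[OF f(3,1,2)] unfolding BH Hom_C[OF Do[OF f(1)] Do[OF f(2)]] hmaps_def by simp
next
	fix i j k f g assume "i:Obj X" "j:Obj X" "k:Obj X" "f:Hom X i j" "g:Hom X j k"
	thus "onHom ?D i k (Comp X i j k g f) = Comp ?B (onObj ?D i) (onObj ?D j) (onObj ?D k) (onHom ?D j k g) (onHom ?D i j f)"
		using functor_comp[OF D] by (simp add: BC Comp_C)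
qed (use VO Do functor_id[OF D] in "simp_all add: Idm_C coalg_cat_def")
obtain L p where Lp: "is_limit X ?B ?D L p" using com X F unfolding complete_category_def by blast
have cone: "is_cone X ?B ?D A g" if "A:Obj ?B" "!!i. i:Obj X ==> g i:Hom ?B A (V (onObj D i))"
	"!!i j f x. [|i:Obj X; j:Obj X; f:Hom X i j; x IN A|] ==> onHom D i j f (g i x) = g j x" for A g unfolding is_cone_def
proof (intro conjI ballI that(1))
	fix i j f assume f: "i:Obj X" "j:Obj X" "f:Hom X i j"
	show "Comp ?B A (onObj ?D i) (onObj ?D j) (onHom ?D i j f) (g i) = g j"
		using that(2)[OF f(2)] that(3)[OF f] unfolding BH by (auto simp: BC compose_def fun_eq_iff extensional_def)
qed (use that(2) in simp)
note Lc = limit_cone[OF Lp]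
have LO: "L:Obj ?B" and p: "p i:Hom ?B L (V (onObj D i))" if "i:Obj X" for i using Lc that unfolding is_cone_def by auto
have LO: "L:Obj ?B" using Lc unfolding is_cone_def by blast
have pT: "onHom D i j f (p i x) = p j x" if "i:Obj X" "j:Obj X" "f:Hom X i j" "x IN L" for i j f x
proof -
	have "Comp ?B L (onObj ?D i) (onObj ?D j) (onHom ?D i j f) (p i) x = p j x" using Lc that(1-3) unfolding is_cone_def by simp
	thus ?thesis using that(4) by (simp add: BC compose_def)
qed
have ex: "EX h:Cmaps A L. ALL i:Obj X. ALL x:carrier A. p i (h x) = g i x"
	if A: "A:Obj ?B" and g: "!!i. i:Obj X ==> g i:Cmaps A (V (onObj D i))"
		and gT: "!!i j f x. [|i:Obj X; j:Obj X; f:Hom X i j; x IN A|] ==> onHom D i j f (g i x) = g j x" for A g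
proof -
	let ?g = "%i. \<lambda>x\<in>carrier A. g i x"
	have "?g i:Hom ?B A (V (onObj D i))" if i: "i:Obj X" for i
		using coalgebra_map_cong[OF _ _ g[OF i], of "?g i"] A VO[OF Do[OF i]] coalg_pre[of A] coalg_pre[of "V (onObj D i)"]
		unfolding BH BO by simp
	hence "is_cone X ?B ?D A ?g" using gT by (intro cone[OF A]) simp_all
	then obtain h where h: "h:Hom ?B A L" "!!i. i:Obj X ==> Comp ?B A L (onObj ?D i) (p i) h = ?g i" using limit_factor[OF Lp] by metis
	have "p i (h x) = g i x" if "i:Obj X" "x IN A" for i x
		using h(2)[OF that(1)] that(2) by (auto simp: BC compose_def fun_eq_iff dest: spec[of _ x])
	thus ?thesis using h(1) unfolding BH by blast
qed
have uniq: "h x = h' x" if A: "A:Obj ?B" and h: "h:Cmaps A L" "h':Cmaps A L"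
		and eq: "!!i x. [|i:Obj X; x IN A|] ==> p i (h x) = p i (h' x)" and x: "x IN A" for A h h' x
proof -
	have pA: "precoalg A" "precoalg L" using A LO coalg_pre unfolding BO by blast+
	have hH: "restrict h (carrier A):Hom ?B A L" "restrict h' (carrier A):Hom ?B A L"
		using coalgebra_map_cong[OF pA h(1)] coalgebra_map_cong[OF pA h(2)] unfolding BH by auto
	have c: "Comp ?B A L (onObj ?D i) (p i) (restrict h' (carrier A)) = Comp ?B A L (onObj ?D i) (p i) (restrict h (carrier A))"
		if "i:Obj X" for i using eq that by (auto simp: BC compose_def fun_eq_iff)
	have "is_cone X ?B ?D A (%i. Comp ?B A L (onObj ?D i) (p i) (restrict h (carrier A)))"
	proof (rule cone[OF A])
		show "Comp ?B A L (onObj ?D i) (p i) (restrict h (carrier A)):Hom ?B A (V (onObj D i))" if i: "i:Obj X" for i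
			using comp_in[OF co.category_C hH(1) p[OF i] A LO VO[OF Do[OF i]]] by simp
	qed (use pT Lin_in[OF cm_Lin[OF h(1)]] in "simp add: BC compose_def")
	from limit_unique[OF Lp this hH refl c] have "restrict h (carrier A) x = restrict h' (carrier A) x" by simp
	thus ?thesis using x by simp
qed
let ?T = "{(i, j, onHom D i j f) | i j f. i:Obj X & j:Obj X & f:Hom X i j}"
have T: "(i, j, onHom D i j f):?T" if "i:Obj X" "j:Obj X" "f:Hom X i j" for i j f using that by blast
show ?thesis unfolding coalg_limit_def
proof (rule exI[of _ L], rule exI[of _ p], intro conjI allI impI)
	show "EX h:Cmaps A L. ALL i:Obj X. ALL x:carrier A. p i (h x) = g i x" if "cobj A" "ALL i:Obj X. g i:Cmaps A (V (onObj D i))"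
			"ALL i j f. (i, j, f):?T --> (ALL x:carrier A. f (g i x) = g j x)" for A :: "('k, 'i, 'u) ibialg" and g
		by (rule ex[OF _ that(2)[rule_format] that(3)[rule_format, OF T]]) (use that(1) BO[of A] in blast)
	show "ALL x:carrier A. h x = h' x" if "cobj A" "h:Cmaps A L" "h':Cmaps A L"
			"ALL i:Obj X. ALL x:carrier A. p i (h x) = p i (h' x)" for A :: "('k, 'i, 'u) ibialg" and h h'
		by (intro ballI, rule uniq[OF _ that(2,3) that(4)[rule_format]]) (use that(1) BO[of A] in blast)
qed (use LO[unfolded BO] p[unfolded BH] pT in auto)
qed
end

section \<open>Sweedler sums over cocommutative coalgebras\<close>

context linear_algebra
begin
lemma sw_sw_Bilin:
assumes C: "precoalg C" and D: "precoalg D" and V: "Vec V" and W: "Vec W" and Z: "Vec Z" and g: "ga:Bilin V W Z"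
	and f: "!!a b. [|a IN C; b IN C|] ==> f a b IN V" and h: "!!a b. [|a IN D; b IN D|] ==> h a b IN W" and x: "x IN C" and y: "y IN D"
shows "sw C Z (%a b. sw D Z (%a' b'. ga (f a b) (h a' b')) y) x = ga (sw C V f x) (sw D W h y)"
proof -
have s: "sw D W h y IN W" by (rule sw_closed[OF D W y h])
have "sw C Z (%a b. sw D Z (%a' b'. ga (f a b) (h a' b')) y) x = sw C Z (%a b. ga (f a b) (sw D W h y)) x"
	by (intro sw_cong[OF C x] Lin_sw[OF D Bilin_right[OF g] W Z y, symmetric] f h)
also have "... = ga (sw C V f x) (sw D W h y)" by (intro Lin_sw[OF C Bilin_left[OF g s] V Z x, symmetric] f)
finally show ?thesis .
qed

context
fixes C :: "('k, 'a, 'c) coalg_scheme" and Z :: "('k, 'z, 'e) module_scheme"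
assumes C: "coalgebra K C" and coc: "cocommutative K C" and Z: "Vec Z"
begin
lemmas kp = coalg_pre[OF C] and kV = pre_Vec[OF coalg_pre[OF C]]

text \<open>The comultiplication of a cocommutative coalgebra is a coalgebra map.\<close>

lemma sw_middle_swap:
assumes l1: "!!a' b b'. [|a' IN C; b IN C; b' IN C|] ==> (%a. tw a a' b b'):Lin C Z"
	and l2: "!!a b b'. [|a IN C; b IN C; b' IN C|] ==> (%a'. tw a a' b b'):Lin C Z"
	and l3: "!!a a' b'. [|a IN C; a' IN C; b' IN C|] ==> (%b. tw a a' b b'):Lin C Z"
	and l4: "!!a a' b. [|a IN C; a' IN C; b IN C|] ==> (%b'. tw a a' b b'):Lin C Z" and x: "x IN C"
shows "sw C Z (%u v. sw C Z (%a a'. sw C Z (%b b'. tw a a' b b') v) u) x =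
	sw C Z (%u v. sw C Z (%a b. sw C Z (%a' b'. tw a a' b b') v) u) x"
proof -
note B = BilinI'[OF l4 l3] and B' = BilinI'[OF l4 l2]
have t1: "trilin C C C Z (%a a' v. sw C Z (%b b'. tw a a' b b') v)" by (intro trilinI sw_Lin[OF kp Z] B sw_LinP[OF kp Z kV] l1 l2)
have t2: "trilin C C C Z (%a b v. sw C Z (%a' b'. tw a a' b b') v)" by (intro trilinI sw_Lin[OF kp Z] B' sw_LinP[OF kp Z kV] l1 l3)
have t3: "trilin C C C Z (%a' b b'. tw a a' b b')" if "a IN C" for a using that by (intro trilinI l2 l3 l4)
have t4: "trilin C C C Z (%b a' b'. tw a a' b b')" if "a IN C" for a using that by (intro trilinI l2 l3 l4)
\<comment> \<open>After reassociation, \<open>a'\<close> and \<open>b\<close> are the two halves of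
  one element \<open>d\<close>, and cocommutativity exchanges them.\<close>
have "sw C Z (%u v. sw C Z (%a a'. sw C Z (%b b'. tw a a' b b') v) u) x = sw C Z (%a w. sw C Z (%a' v. sw C Z (%b b'. tw a a' b b') v) w) x"
	by (rule sw_assoc[OF C Z t1 x])
also have "... = sw C Z (%a w. sw C Z (%d b'. sw C Z (%a' b. tw a a' b b') d) w) x"
	by (intro sw_cong[OF kp x] sw_assoc[OF C Z t3, symmetric])
also have "... = sw C Z (%a w. sw C Z (%d b'. sw C Z (%b a'. tw a a' b b') d) w) x"
	by (intro sw_cong[OF kp] x sw_cocom[OF kp coc Z, symmetric] BilinI' l2 l3)
also have "... = sw C Z (%a w. sw C Z (%b v. sw C Z (%a' b'. tw a a' b b') v) w) x" by (intro sw_cong[OF kp x] sw_assoc[OF C Z t4])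
also have "... = sw C Z (%u v. sw C Z (%a b. sw C Z (%a' b'. tw a a' b b') v) u) x" by (rule sw_assoc[OF C Z t2 x, symmetric])
finally show ?thesis .
qed

text \<open>Two applications of the middle swap. Comultiplying each of \<open>x1, x2, x3\<close>
  gives the same result as splitting \<open>x\<close> into \<open>x'\<close> and \<open>x''\<close>
  and taking three parts of each; thus expressions in \<open>x1, x2, x3\<close> are compatible with
  comultiplication.\<close>

lemma sw3_cocommutative:
assumes V: "Vec V" and g: "ga:Bilin V V Z" and T: "trilin C C C V T" and T': "trilin C C C V T'" and x: "x IN C"
shows "sw C Z (%x1 w. sw C Z (%x2 x3. sw C Z (%a a'. sw C Z (%b b'. sw C Z (%c c'. ga (T a b c) (T' a' b' c')) x3) x2) x1) w) x =
	sw C Z (%x' x''. ga (sw C V (%a w. sw C V (T a) w) x') (sw C V (%a w. sw C V (T' a) w) x'')) x"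
proof -
note Tc = Tri_closed[OF T] and Tc' = Tri_closed[OF T']
note L = LinLR[OF g]
note T1 = L(1)[OF Tri1[OF T Lin_id]] L(1)[OF Tri2[OF T Lin_id]] L(1)[OF Tri3[OF T Lin_id]]
	L(2)[OF Tri1[OF T' Lin_id]] L(2)[OF Tri2[OF T' Lin_id]] L(2)[OF Tri3[OF T' Lin_id]]
have sT: "sw C V (T a) w IN V" "sw C V (T' a) w IN V" if "a IN C" "w IN C" for a w using that by (auto intro!: sw_closed[OF kp V] Tc Tc')
let ?\<Omega> = "%a a' w' w''. ga (sw C V (T a) w') (sw C V (T' a') w'')"
have "sw C Z (%x1 w. sw C Z (%x2 x3. sw C Z (%a a'. sw C Z (%b b'. sw C Z (%c c'. ga (T a b c) (T' a' b' c')) x3) x2) x1) w) x =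
		sw C Z (%x1 w. sw C Z (%a a'. sw C Z (%x2 x3. sw C Z (%b b'. sw C Z (%c c'. ga (T a b c) (T' a' b' c')) x3) x2) w) x1) x"
	by (intro sw_cong[OF kp x] sw_swap[OF kp kp Z] sw_closed[OF kp Z] Bilin_in[OF g] Tc Tc')
also have "... = sw C Z (%x1 w. sw C Z (%a a'. sw C Z (%w' w''. sw C Z (%b c. sw C Z (%b' c'. ga (T a b c) (T' a' b' c')) w'') w') w) x1) x"
	by (intro sw_cong[OF kp] x sw_middle_swap T1 Tc Tc')
also have "... = sw C Z (%x1 w. sw C Z (%a a'. sw C Z (%w' w''. ?\<Omega> a a' w' w'') w) x1) x"
	by (intro sw_cong[OF kp] x sw_sw_Bilin[OF kp kp V V Z g] Tc Tc')
also have "... = sw C Z (%x' x''. sw C Z (%a w'. sw C Z (%a' w''. ?\<Omega> a a' w' w'') x'') x') x"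
	by (intro sw_middle_swap x L sw_LinP[OF kp V kV] sw_Lin[OF kp V] BilinI' sT Tri1[OF T Lin_id] Tri1[OF T' Lin_id]
			Tri2[OF T Lin_id] Tri3[OF T Lin_id] Tri2[OF T' Lin_id] Tri3[OF T' Lin_id])
also have "... = sw C Z (%x' x''. ga (sw C V (%a w. sw C V (T a) w) x') (sw C V (%a w. sw C V (T' a) w) x'')) x"
	by (intro sw_cong[OF kp x] sw_sw_Bilin[OF kp kp V V Z g] sT)
finally show ?thesis .
qed
end

lemma sw_swap2:
assumes C: "precoalg C" and D: "precoalg D" and Z: "Vec Z" and x: "x IN C" and y: "y IN D"
	and f: "!!a b c u v. [|a IN C; b IN C; c IN C; u IN D; v IN D|] ==> ff a b c u v IN Z"
shows "sw D Z (%u v. sw C Z (%a w. sw C Z (%b c. ff a b c u v) w) x) y =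
	sw C Z (%a w. sw C Z (%b c. sw D Z (ff a b c) y) w) x"
proof -
have "sw D Z (%u v. sw C Z (%a w. sw C Z (%b c. ff a b c u v) w) x) y = sw C Z (%a w. sw D Z (%u v. sw C Z (%b c. ff a b c u v) w) y) x"
	by (intro sw_swap[OF D C Z y x] sw_closed[OF C Z] f)
also have "... = sw C Z (%a w. sw C Z (%b c. sw D Z (ff a b c) y) w) x" by (intro sw_cong[OF C x] sw_swap[OF D C Z y] f)
finally show ?thesis .
qed

lemma sw_cbilin':
assumes C: "precoalg C" and D: "precoalg D" and E: "precoalg E"
	and b: "cbilin C D E be" and Z: "Vec Z" and g: "ga:Bilin E E Z" and x: "x IN C" and y: "y IN D"
shows "sw E Z ga (be x y) = sw D Z (%y1 y2. sw C Z (%x1 x2. ga (be x1 y1) (be x2 y2)) x) y"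
proof -
have "be:Bilin C D E" using b unfolding cbilin_def by blast
note bc = Bilin_in[OF this]
show ?thesis unfolding sw_cbilin[OF C D E b Z g x y] by (intro sw_swap[OF C D Z x y] Bilin_in[OF g] bc)
qed
end

text \<open>The type of the tensor square of a quotient of \<open>L\<close>, presented as a gluing
  over a one-element index set. A premise of a lemma cannot be polymorphic, so the coideal condition
  in \<open>lim_coideal\<close> is stated for this one type.\<close>

type_synonym ('k, 'u) test_module =
"('k, ((unit \<times> 'u => 'k) set \<times> (unit \<times> 'u => 'k) set => 'k) set) module"

section \<open>The universal property of the coalgebra limit and the coideal argument\<close>

locale hopf_limit = hopf_category ty K C V I J coc br Lam
for ty :: "'u itself" and K :: "'k ring" and C :: "('o, 'u => 'u) cat" and V :: "'o => ('k, 'i, 'u) ibialg" and I J coc br Lam +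
fixes P :: "'p set" and F :: "'p => ('k, 'i, 'u) ibialg" and S and T :: "('p * 'p * ('u => 'u)) set"
	and L :: "('k, 'i, 'u) ibialg" and p
assumes F: "!!i. i:P ==> hstruct I J coc br (F i) (S i)"
	and T: "!!i j f. (i, j, f):T ==> i:P & j:P & f:hmaps I (F i) (F j)" and lim: "coalg_limit P F T L p"
begin
lemmas lim_parts = lim[unfolded coalg_limit_def, THEN conjunct2]

lemma L: "Coalg L" and Lcoc: "coc --> Cocom L" and Ls: "small TYPE('u) (carrier L)"
using lim[unfolded coalg_limit_def, THEN conjunct1] by simp_all

lemma p: "i:P ==> p i:Cmaps L (F i)" and pT: "[|(i, j, f):T; x IN L|] ==> f (p i x) = p j x"
using lim_parts[THEN conjunct1] lim_parts[THEN conjunct2, THEN conjunct1] by simp_all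

lemma lim_unique0:
fixes A :: "('k, 'i, 'u) ibialg"
assumes "cobj A" "h:Cmaps A L" "h':Cmaps A L" and eq: "!!i x. [|i:P; x IN A|] ==> p i (h x) = p i (h' x)" and "x IN A"
shows "h x = h' x"
proof -
have "ALL i:P. ALL x:carrier A. p i (h x) = p i (h' x)" by (intro ballI eq)
from lim_parts[THEN conjunct2, THEN conjunct2, THEN conjunct2, THEN spec, THEN spec, THEN spec, THEN mp, THEN mp, THEN mp, THEN mp, THEN bspec,
	OF assms(1-3) this assms(5)] show ?thesis .
qed

lemmas Lp = coalg_pre[OF L] and LV = pre_Vec[OF coalg_pre[OF L]]

lemma Ff: assumes "i:P" shows "Coalg (F i)" "coc ==> Cocom (F i)" "precoalg (F i)" "Vec (F i)"
	"l:I ==> Bialg (F i) (imult (F i) l) (iunit (F i) l)" "l:J ==> Antip (F i) (imult (F i) l) (iunit (F i) l) (S i l)"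
	"[|l:I; l':I|] ==> iunit (F i) l = iunit (F i) l'" using F[OF assms] coalg_pre[of "F i"] pre_Vec[of "F i"] unfolding hstruct_def by blast+

lemma Fbr: "[|i:P; (l, l'):br|] ==> brace_law (F i) (imult (F i) l) (S i l) (imult (F i) l')"
using F[of i] unfolding hstruct_def by blast

lemma Tf: assumes "(i, j, f):T" shows "i:P" "j:P" "f:Cmaps (F i) (F j)" "f:Lin (F i) (F j)"
	"[|l:I; x IN F i; y IN F i|] ==> f (imult (F i) l x y) = imult (F j) l (f x) (f y)" "l:I ==> f (iunit (F i) l) = iunit (F j) l"
	"l:I ==> algebra_map (F i) (imult (F i) l) (iunit (F i) l) (imult (F j) l) (iunit (F j) l) f"
using T[OF assms] cm_Lin[of f "F i" "F j"] unfolding hmaps_def algebra_map_def by auto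

lemma pc: "[|i:P; x IN L|] ==> p i x IN F i"
using Lin_in[OF cm_Lin[OF p]] .

text \<open>The universal property speaks of coalgebras on \<open>'u\<close>. Here the test
  coalgebra may have any type as long as it is small, for it has a copy on
  \<open>'u\<close>.\<close>

lemma lim_exists:
fixes A :: "('k, 'a, 'c) coalg_scheme"
assumes A: "Coalg A" "coc --> Cocom A" "small TYPE('u) (carrier A)"
	and g: "!!i. i:P ==> g i:Cmaps A (F i)" and gT: "!!i j f x. [|(i, j, f):T; x IN A|] ==> f (g i x) = g j x"
shows "EX h:Cmaps A L. ALL i:P. ALL x:carrier A. p i (h x) = g i x"
proof -
obtain A' :: "('k, 'i, 'u) ibialg" where A': "Coalg A' & (coc --> Cocom A') & small TYPE('u) (carrier A')"
	and bj: "EX b:Cmaps A A'. EX j:Cmaps A' A. (ALL x:carrier A. j (b x) = x) & (ALL y:carrier A'. b (j y) = y)"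
	using transport_coalg[OF A] by (elim exE conjE) (rule that; blast)
from bj obtain b j where b: "b:Cmaps A A'" and j: "j:Cmaps A' A" and jb: "ALL x:carrier A. j (b x) = x" by (elim bexE conjE)
have pA: "precoalg A" "precoalg A'" using A(1) A' coalg_pre[of A] coalg_pre[of A'] by auto
note bc = Lin_in[OF cm_Lin[OF b]] and jc = Lin_in[OF cm_Lin[OF j]]
have 1: "ALL i:P. (%x. g i (j x)):Cmaps A' (F i)" by (intro ballI cm_comp[OF pA(2,1) Ff(3) j g])
have "ALL i i' f. (i, i', f):T --> (ALL x:carrier A'. f (g i (j x)) = g i' (j x))" by (intro allI impI ballI gT jc)
from lim_parts[THEN conjunct2, THEN conjunct2, THEN conjunct1, THEN spec, THEN spec, THEN mp, THEN mp, THEN mp, OF A' 1 this]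
obtain h where h: "h:Cmaps A' L" "ALL i:P. ALL x:carrier A'. p i (h x) = g i (j x)" by blast
have "(%x. h (b x)):Cmaps A L" by (rule cm_comp[OF pA Lp b h(1)])
moreover have "ALL i:P. ALL x:carrier A. p i (h (b x)) = g i x" using h(2) bc jb by simp
ultimately show ?thesis by (intro bexI[of _ "%x. h (b x)"])
qed

lemma lim_unique: "[|h:Cmaps L L; !!i x. [|i:P; x IN L|] ==> p i (h x) = p i x; x IN L|] ==> h x = x"
proof -
assume h: "h:Cmaps L L" "!!i x. [|i:P; x IN L|] ==> p i (h x) = p i x" "x IN L"
have "(%x. x):Cmaps L L" by (rule cm_I[OF Lp Lp Lin_id]) (simp_all add: comult_sw[OF Lp])
from lim_unique0[OF _ h(1) this] L Lcoc Ls h(2,3) show "h x = x" by simp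
qed

text \<open>
The identity of \<open>L\<close> factors through the quotient of \<open>L\<close> modulo the coideal that \<open>E\<close> generates,
so this coideal is zero.
\<close>

lemma lim_coideal:
assumes E: "!!a b. (a, b):E ==> a IN L & b IN L & counit L a = counit L b"
	and pE: "!!a b i. [|(a, b):E; i:P|] ==> p i a = p i b" and cm: "!!(Z :: ('k, 'u) test_module) ga a b.
		[|Vec Z; ga:Bilin L L Z; !!a a' b. [|(a, a'):E; b IN L|] ==> ga a b = ga a' b & ga b a = ga b a'; (a, b):E|]
		==> sw L Z ga a = sw L Z ga b" and ab: "(a, b):E"
shows "a = b"
proof -
\<comment> \<open>The quotient of \<open>L\<close> by the pairs in \<open>E\<close> is the gluing of
  a single copy of \<open>L\<close>. Premise \<open>cm\<close>, applied to the tensor square of the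
  quotient map, is the coideal condition for this gluing.\<close>
let ?P = "{()}" and ?C = "%_ :: unit. L"
define E' where "E' = {(((), a), ((), b)) | a b. (a, b):E}"
have E': "E' <= (SIGMA i:?P. carrier (?C i)) \<times> (SIGMA i:?P. carrier (?C i))" using E by (auto simp: E'_def)
let ?Q = "glue_sp K ?P ?C E'" and ?q = "glue_map K ?P ?C E'"
have V1: "Vec (?C i)" for i by (rule LV)
have Q: "Vec ?Q" by (rule glue_Vec[of ?P ?C E', OF V1 E'])
have ql: "?q i:Lin L ?Q" for i by (rule glue_map_Lin[of ?P ?C E', OF V1 E']) simp
have qe: "?q i a = ?q i b" if "(a, b):E" for a b i by (rule glue_eq[of ?P ?C E', OF V1 E']) (use that in "auto simp: E'_def")
have C1: "Coalg (?C i)" for i by (rule L)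
have eps: "counit (?C i) x = counit (?C j) y" if "((i, x), (j, y)):E'" for i x j y using that E by (auto simp: E'_def)
have T2: "Vec (ten ?Q ?Q)" by (intro ten_Vec Q)
have cm': "sw (?C i) (ten ?Q ?Q) (%a b. pur ?Q ?Q (?q i a) (?q i b)) x =
		sw (?C j) (ten ?Q ?Q) (%a b. pur ?Q ?Q (?q j a) (?q j b)) y" if "((i, x), (j, y)):E'" for i x j y
	using cm[OF T2 comp_Bilin[OF ql ql Q Q], of "()" "()" x y] qe that by (auto simp: E'_def)
let ?G = "glue K ?P ?C E' undefined undefined :: ('k, 'i, (unit \<times> 'u => 'k) set) ibialg"
have G: "Coalg ?G" by (rule glue_coalgebra[of ?P ?C E', OF C1 E' eps cm'])
have coc': "coc ==> Cocom (?C i)" for i using Lcoc by blast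
have Gc: "coc --> Cocom ?G" by (rule impI, rule glue_cocommutative[of ?P ?C E', OF C1 E' eps cm' coc'])
have Gs: "small TYPE('u) (carrier ?G)" using small_glue[of ?P ?C E'] small_finite[of ?P] Ls by (simp add: glue_def Let_def)
have q: "?q ():Cmaps L ?G" by (rule gq_cm[of ?P ?C E', OF C1 E' eps cm']) ((assumption | rule singletonI)+)
let ?f = "%i. Tlift (F i) (%_ :: unit. p i)"
have pE': "p i x = p i y" if "i:P" "((j, x), (k, y)):E'" for i j k x y using that pE by (auto simp: E'_def)
have f: "?f i:Cmaps ?G (F i)" if i: "i:P" for i by (rule glue_universal(1)[of ?P ?C E', OF C1 E' eps cm' Ff(1)[OF i] p[OF i] pE'[OF i]])
have fq: "?f i (?q k x) = p i x" if i: "i:P" and x: "x IN L" for i k x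
	by (rule glue_universal(2)[of ?P ?C E', OF C1 E' eps cm' Ff(1)[OF i] p[OF i] pE'[OF i] _ x]) (assumption | simp)+
have fT: "g (?f i x) = ?f j x" if g: "(i, j, g):T" and x: "x IN ?G" for i j g x
proof -
	note t = Tf[OF g]
	show ?thesis
	proof (rule G_ext[of ?P ?C E', OF C1 E' eps cm' Lin_comp[OF cm_Lin[OF f[OF t(1)]] t(4)] cm_Lin[OF f[OF t(2)]] Ff(4)[OF t(2)] _ x])
		fix k y assume y: "y IN L"
		show "g (?f i (?q k y)) = ?f j (?q k y)" unfolding fq[OF t(1) y] fq[OF t(2) y] by (rule pT[OF g y])
	qed
qed
\<comment> \<open>The projections descend to the quotient and induce \<open>s\<close> from the
  quotient to \<open>L\<close>. Its composite with the quotient map commutes with all projections,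
  hence is the identity, and the quotient map is injective.\<close>
have "EX h:Cmaps ?G L. ALL i:P. ALL x:carrier ?G. p i (h x) = ?f i x"
	by (rule lim_exists[where g = ?f, OF G Gc Gs f]) (assumption | erule fT)+
then obtain s where s: "s:Cmaps ?G L" "ALL i:P. ALL x:carrier ?G. p i (s x) = ?f i x" by blast
have qc: "?q () x IN ?G" if "x IN L" for x by (rule Lin_in[OF cm_Lin[OF q] that])
have "s (?q () x) = x" if x: "x IN L" for x by (rule lim_unique[OF cm_comp[OF Lp coalg_pre[OF G] Lp q s(1)] _ x]) (use s(2) qc fq in simp)
note sq = this
have c: "a IN L" "b IN L" using E[OF ab] by blast+
show "a = b" by (rule trans[OF sq[OF c(1), symmetric] trans[OF arg_cong[where f = s, OF qe[OF ab]] sq[OF c(2)]]])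
qed
end

section \<open>Operations on the coalgebra limit\<close>

context hopf_limit
begin
text \<open>The maps \<open>(x, y)\<close> to \<open>p i x\<close> times \<open>p i y\<close> are
  coalgebra maps on the tensor coalgebra of \<open>L\<close> with itself and compatible with the
  diagram. The tensor coalgebra is cocommutative if \<open>L\<close> is, so it is an admissible test
  object.\<close>

lemma lim_mult: "EX m. ALL l:I. cbilin L L L (m l) & (ALL i:P. ALL x:carrier L. ALL y:carrier L. p i (m l x y) = imult (F i) l (p i x) (p i y))"
proof -
have "EX m. cbilin L L L m & (ALL i:P. ALL x:carrier L. ALL y:carrier L. p i (m x y) = imult (F i) l (p i x) (p i y))" if l: "l:I" for l
proof -
	let ?g = "%i. Tlift (F i) (%x y. imult (F i) l (p i x) (p i y))"
	have cb: "cbilin L L (F i) (%x y. imult (F i) l (p i x) (p i y))" if i: "i:P" for i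
		by (rule cbilin_comp[OF Lp Lp Ff(3)[OF i] Ff(3)[OF i] Ff(3)[OF i] p[OF i] p[OF i] cbilin_bialgebra[OF Ff(5)[OF i l]]])
	have gp: "?g i (pur L L x y) = imult (F i) l (p i x) (p i y)" if "i:P" "x IN L" "y IN L" for i x y
		using cb[OF that(1)] by (intro lift_pure[OF LV LV Ff(4)] that) (simp add: cbilin_def)
	have g: "?g i:Cmaps (TC L L) (F i)" if i: "i:P" for i by (rule cbilin_lift[OF Lp Lp Ff(3)[OF i] cb[OF i]])
	have "EX h:Cmaps (TC L L) L. ALL i:P. ALL x:carrier (TC L L). p i (h x) = ?g i x"
	proof (rule lim_exists[where g = ?g, OF TC_coalgebra[OF L L] _ _ g])
		show "coc --> Cocom (TC L L)" using Lcoc TC_cocommutative[OF L _ L] by blast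
		show "small TYPE('u) (carrier (TC L L))" using small_tensor[OF Ls Ls small_K] by simp
		show "f (?g i x) = ?g j x" if f: "(i, j, f):T" and x: "x IN TC L L" for i j f x
		proof -
			note t = Tf[OF f]
			show ?thesis
			proof (rule TC_ext[OF Lp Lp Lin_comp[OF cm_Lin[OF g[OF t(1)]] t(4)] cm_Lin[OF g[OF t(2)]] Ff(4)[OF t(2)]])
				fix x y assume xy: "x IN L" "y IN L"
				show "f (?g i (pur L L x y)) = ?g j (pur L L x y)"
					unfolding gp[OF t(1) xy] gp[OF t(2) xy] t(5)[OF l pc[OF t(1) xy(1)] pc[OF t(1) xy(2)]] pT[OF f xy(1)] pT[OF f xy(2)] ..
			qed (use x in simp)
		qed
	qed
	then obtain h where h: "h:Cmaps (TC L L) L" "ALL i:P. ALL x:carrier (TC L L). p i (h x) = ?g i x" by blast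
	have "p i (h (pur L L x y)) = imult (F i) l (p i x) (p i y)" if "i:P" "x IN L" "y IN L" for i x y
		using h(2) that gp[OF that] pur_in[OF LV LV that(2,3)] by simp
	thus ?thesis using cbilin_of_map[OF Lp Lp Lp h(1)] by blast
qed
thus ?thesis by metis
qed

text \<open>The base field is a cocommutative coalgebra, and the units of the \<open>F i\<close> are
  coalgebra maps out of it; the induced map is evaluated at \<open>\<one>$K\<close>. One element
  serves for all indices since each \<open>F i\<close> has a common unit.\<close>

lemma lim_unit: "EX u. I ~= {} --> u IN L & comult L u = pur L L u u & counit L u = \<one>$K & (ALL i:P. ALL l:I. p i u = iunit (F i) l)"
proof (cases "I = {}")
case False
then obtain l0 where l0: "l0:I" by blast
interpret k: cring K by (rule cring_K)
let ?B = "BaseC" let ?g = "%i a. a *.$(F i) iunit (F i) l0"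
have g: "?g i:Cmaps ?B (F i)" if "i:P" for i using Ff(5)[OF that l0] unfolding bialgebra_def by blast
have uF: "iunit (F i) l0 IN F i" if "i:P" for i using bi_unit[OF Ff(5)[OF that l0]] .
have "EX h:Cmaps ?B L. ALL i:P. ALL x:carrier ?B. p i (h x) = ?g i x"
proof (rule lim_exists[where g = ?g, OF base_is_coalgebra _ _ g])
	show "f (?g i a) = ?g j a" if f: "(i, j, f):T" and a: "a IN ?B" for i j f a
		using Tf[OF f] a uF l0 by (simp add: base_simps Lin_smult[of f "F i" "F j"])
qed (use base_cocommutative small_K in "simp_all add: base_simps(1)")
then obtain h where h: "h:Cmaps ?B L" "ALL i:P. ALL x:carrier ?B. p i (h x) = ?g i x" by blast
have one: "\<one>$K IN ?B" by (simp add: base_simps(1))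
note hl = cm_Lin[OF h(1)]
have hl': "h:Lin Base L" using hl unfolding Lin_same[OF base_same srefl] .
have "comult L (h \<one>$K) = Tmap L L h h (pur Base Base \<one>$K \<one>$K)"
	using h(1) one unfolding coalgebra_maps_def by (simp add: base_simps)
hence "comult L (h \<one>$K) = pur L L (h \<one>$K) (h \<one>$K)"
	using tmap_pure[OF hl' hl' base_Vec base_Vec LV LV, of "\<one>$K" "\<one>$K"] by simp
moreover have "p i (h \<one>$K) = iunit (F i) l" if "i:P" "l:I" for i l
	using h(2) that one smult_one[OF Ff(4)[OF that(1)] uF[OF that(1)]] Ff(7)[OF that(1) l0 that(2)] by simp
ultimately show ?thesis using cm_counit[OF h(1) one] Lin_in[OF hl one] by (intro exI[of _ "h \<one>$K"]) (simp add: base_simps)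
qed simp

text \<open>The antipodes of the \<open>F i\<close> reverse the comultiplication, so the test object
  is the co-opposite of \<open>L\<close>.\<close>

lemma lim_antipode: "EX s. ALL l:J. s l:Cmaps (Cop L) L & (ALL i:P. ALL x:carrier L. p i (s l x) = S i l (p i x))"
proof -
have "EX s. s:Cmaps (Cop L) L & (ALL i:P. ALL x:carrier L. p i (s x) = S i l (p i x))" if l: "l:J" for l
proof -
	have lI: "l:I" using l JI by blast
	note cL = cop_coalgebra[OF L]
	have g: "(%x. S i l (p i x)):Cmaps (Cop L) (F i)" if i: "i:P" for i
	proof -
		note Fi = Ff(3)[OF i] and FV = Ff(4)[OF i] and pl = cm_Lin[OF p[OF i]]
		note s = antipode_cop_map[OF Ff(5)[OF i lI] Ff(6)[OF i l]]
		have "p i:Cmaps (Cop L) (Cop (F i))"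
		proof (rule cm_I[OF coalg_pre[OF cL] cop_pre[OF Fi]])
			show "p i:Lin (Cop L) (Cop (F i))" using pl Lin_same[OF cop_same[of L K] cop_same[of "F i" K]] by blast
			fix c assume "c IN Cop L" hence c: "c IN L" by simp
			note same = ten_same[OF cop_same[of "F i" K] cop_same[of "F i" K], symmetric] pur_same[OF cop_same[of "F i" K] cop_same[of "F i" K], symmetric]
			note q = pur_Bilin[OF FV FV] and T2 = ten_Vec[OF FV FV]
			have q': "(%x y. pur (F i) (F i) y x):Bilin (F i) (F i) (ten (F i) (F i))" using q by (auto simp: bilinear_maps_def)
			have pc': "p i c IN F i" by (rule pc[OF i c])
			have "comult (Cop (F i)) (p i c) = sw (F i) (ten (F i) (F i)) (%x y. pur (F i) (F i) y x) (p i c)"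
				using comult_sw[OF cop_pre[OF Fi], of "p i c"] sw_cop[OF Fi T2 q pc'] pc' unfolding same by simp
			also have "... = sw L (ten (F i) (F i)) (%x y. pur (F i) (F i) (p i y) (p i x)) c" by (rule cm_sw[OF Lp Fi p[OF i] T2 q' c])
			also have "... = sw (Cop L) (ten (F i) (F i)) (%x y. pur (F i) (F i) (p i x) (p i y)) c"
				by (rule sw_cop[OF Lp T2 comp_Bilin[OF pl pl FV FV] c, symmetric])
			finally show "comult (Cop (F i)) (p i c) = sw (Cop L) (ten (Cop (F i)) (Cop (F i))) (%x y. pur (Cop (F i)) (Cop (F i)) (p i x) (p i y)) c"
				unfolding same .
			show "counit (Cop (F i)) (p i c) = counit (Cop L) c" using cm_counit[OF p[OF i] c] by simp
		qed
		from cm_comp[OF coalg_pre[OF cL] cop_pre[OF Fi] Fi this s] show ?thesis .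
	qed
	have "EX h:Cmaps (Cop L) L. ALL i:P. ALL x:carrier (Cop L). p i (h x) = S i l (p i x)"
	proof (rule lim_exists[where g = "%i x. S i l (p i x)", OF cL _ _ g])
		show "coc --> Cocom (Cop L)" using Lcoc cop_cocommutative[OF L] by blast
		show "f (S i l (p i x)) = S j l (p j x)" if f: "(i, j, f):T" and x: "x IN Cop L" for i j f x
		proof -
			note t = Tf[OF f] have x: "x IN L" using x by simp
			show ?thesis
				using antipode_natural[OF Ff(5)[OF t(1) lI] Ff(5)[OF t(2) lI] Ff(6)[OF t(1) l] Ff(6)[OF t(2) l] t(3) t(7)[OF lI] pc[OF t(1) x]]
					pT[OF f x] by simp
		qed
	qed (use Ls in simp)
	thus ?thesis by auto
qed
thus ?thesis by metis
qed
end

section \<open>Laws on the coalgebra limit\<close>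

context hopf_limit
begin
context
fixes m u s
assumes m: "!!l. l:I ==> cbilin L L L (m l)"
	and pm: "!!l i x y. [|l:I; i:P; x IN L; y IN L|] ==> p i (m l x y) = imult (F i) l (p i x) (p i y)"
	and u: "!!l :: 'i. l:I ==> u IN L & comult L u = pur L L u u & counit L u = \<one>$K"
	and pu: "!!l i. [|l:I; i:P|] ==> p i u = iunit (F i) l" and s: "!!l. l:J ==> s l:coalgebra_maps K (cop K L) L"
	and ps: "!!l i x. [|l:J; i:P; x IN L|] ==> p i (s l x) = S i l (p i x)"
begin
lemma mB: "l:I ==> m l:Bilin L L L" and m_counit: "[|l:I; x IN L; y IN L|] ==> counit L (m l x y) = counit L x \<otimes>$K counit L y"
and mc: "[|l:I; x IN L; y IN L|] ==> m l x y IN L" using m Bilin_in[of "m l" L L L] unfolding cbilin_def by blast+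

lemmas sw_m = sw_cbilin[OF Lp Lp Lp m]

lemma sw_u: "[|l:I; Vec Z; ga:Bilin L L Z|] ==> sw L Z ga u = ga u u"
using sw_lift[OF Lp, of Z ga u] lift_pure[OF LV LV, of Z ga u u] u by simp

text \<open>The model for the laws that follow: the pairs formed by the two sides are equal under
  all projections, and comultiplying one pair produces tensors of pairs of the same kind, which is
  the coideal condition.\<close>

lemma lim_assoc:
assumes l: "l:I" and xyz: "x IN L" "y IN L" "z IN L"
shows "m l (m l x y) z = m l x (m l y z)"
proof (rule lim_coideal[where E = "{(m l (m l x y) z, m l x (m l y z)) | x y z. x IN L & y IN L & z IN L}"])
let ?E = "{(m l (m l x y) z, m l x (m l y z)) | x y z. x IN L & y IN L & z IN L}"
interpret cring K by (rule cring_K)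
note mc = mc[OF l] and me = m_counit[OF l] and b = mB[OF l]
show "a IN L & b IN L & counit L a = counit L b" if "(a, b):?E" for a b using that by (auto simp: mc me counit_in[OF Lp] m_assoc)
show "p i a = p i b" if "(a, b):?E" "i:P" for a b i using that by (auto simp: mc pm[OF l] pc bi_assoc[OF Ff(5)[OF that(2) l]])
fix Z :: "('k, 'u) test_module" and ga a a'
assume Z: "Vec Z" and g: "ga:Bilin L L Z" and aa: "(a, a'):?E"
	and gE: "!!a a' b. [|(a, a'):?E; b IN L|] ==> ga a b = ga a' b & ga b a = ga b a'"
obtain x y z where x: "x IN L" "y IN L" "z IN L" and a: "a = m l (m l x y) z" "a' = m l x (m l y z)" using aa by blast
have b1: "(%z1 z2. ga (m l a z1) (m l b z2)):Bilin L L Z" if "a IN L" "b IN L" for a b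
	using that by (intro BilinI' LinLR[OF g] LinR[OF b] Lin_id mc)
have b2: "(%a1 a2. sw L Z (%z1 z2. ga (m l a1 z1) (m l a2 z2)) z):Bilin L L Z"
	using x by (intro BilinI' sw_LinP[OF Lp Z LV] LinLR[OF g] LinL[OF b] Lin_id mc)
have "sw L Z ga a = sw L Z (%a1 a2. sw L Z (%z1 z2. ga (m l a1 z1) (m l a2 z2)) z) (m l x y)"
	unfolding a by (rule sw_m[OF l Z g mc[OF x(1,2)] x(3)])
also have "... = sw L Z (%x1 x2. sw L Z (%y1 y2. sw L Z (%z1 z2. ga (m l (m l x1 y1) z1) (m l (m l x2 y2) z2)) z) y) x"
	by (rule sw_m[OF l Z b2 x(1,2)])
also have "... = sw L Z (%x1 x2. sw L Z (%y1 y2. sw L Z (%z1 z2. ga (m l x1 (m l y1 z1)) (m l x2 (m l y2 z2))) z) y) x"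
proof (intro sw_cong[OF Lp] x)
	fix x1 x2 y1 y2 z1 z2 assume c: "x1 IN L" "x2 IN L" "y1 IN L" "y2 IN L" "z1 IN L" "z2 IN L"
	have "(m l (m l x1 y1) z1, m l x1 (m l y1 z1)):?E" "(m l (m l x2 y2) z2, m l x2 (m l y2 z2)):?E" using c by blast+
	\<comment> \<open>The two arguments of \<open>ga\<close> are replaced one after the other.\<close>
	from gE[OF this(1), of "m l (m l x2 y2) z2"] gE[OF this(2), of "m l x1 (m l y1 z1)"]
	show "ga (m l (m l x1 y1) z1) (m l (m l x2 y2) z2) = ga (m l x1 (m l y1 z1)) (m l x2 (m l y2 z2))" using c mc by simp
qed
also have "... = sw L Z (%x1 x2. sw L Z (%b1 b2. ga (m l x1 b1) (m l x2 b2)) (m l y z)) x"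
	by (intro sw_cong[OF Lp x(1)] sw_m[OF l Z b1 x(2,3), symmetric])
also have "... = sw L Z ga a'" unfolding a by (rule sw_m[OF l Z g x(1) mc[OF x(2,3)], symmetric])
finally show "sw L Z ga a = sw L Z ga a'" .
qed (use xyz in blast)

lemma lim_one:
assumes l: "l:I" and x: "x IN L" shows "m l u x = x" "m l x u = x"
proof -
interpret cring K by (rule cring_K)
note mc = mc[OF l] and me = m_counit[OF l] and b = mB[OF l]
have uc: "u IN L" and ue: "counit L u = \<one>$K" using u[OF l] by auto
let ?E = "{(m l u x, x) | x. x:carrier L} Un {(m l x u, x) | x. x IN L}"
have E: "(a, b):?E ==> a = b" for a b
proof (rule lim_coideal[where E = ?E])
	show "a IN L & b IN L & counit L a = counit L b" if "(a, b):?E" for a b using that uc ue by (auto simp: mc me counit_in[OF Lp])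
	show "p i a = p i b" if "(a, b):?E" "i:P" for a b i using that by (auto simp: mc pm[OF l] pc pu[OF l] uc bi_one[OF Ff(5)[OF that(2) l]])
	fix Z :: "('k, 'u) test_module" and ga a a'
	assume Z: "Vec Z" and g: "ga:Bilin L L Z" and aa: "(a, a'):?E"
		and gE: "!!a a' b. [|(a, a'):?E; b IN L|] ==> ga a b = ga a' b & ga b a = ga b a'"
	have gu: "ga (m l u x1) (m l u x2) = ga x1 x2" "ga (m l x1 u) (m l x2 u) = ga x1 x2" if c: "x1 IN L" "x2 IN L" for x1 x2
	proof -
		have "(m l u x1, x1):?E" "(m l u x2, x2):?E" "(m l x1 u, x1):?E" "(m l x2 u, x2):?E" using c by blast+
		from gE[OF this(1), of "m l u x2"] gE[OF this(2), of x1] gE[OF this(3), of "m l x2 u"] gE[OF this(4), of x1]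
		show "ga (m l u x1) (m l u x2) = ga x1 x2" "ga (m l x1 u) (m l x2 u) = ga x1 x2" using c mc uc by simp_all
	qed
	from aa obtain x where "(a = m l u x | a = m l x u) & a' = x & x IN L" by blast
	hence x: "x IN L" and a: "a = m l u x | a = m l x u" "a' = x" by blast+
	have b1: "(%z1 z2. sw L Z (%x1 x2. ga (m l z1 x1) (m l z2 x2)) x):Bilin L L Z"
		using x by (intro BilinI' sw_LinP[OF Lp Z LV] LinLR[OF g] LinL[OF b] Lin_id mc)
	have b2: "(%z1 z2. ga (m l y1 z1) (m l y2 z2)):Bilin L L Z" if "y1 IN L" "y2 IN L" for y1 y2
		using that by (intro BilinI' LinLR[OF g] LinR[OF b] Lin_id mc)
	have 1: "sw L Z ga (m l u x) = sw L Z ga x" unfolding sw_m[OF l Z g uc x] sw_u[OF l Z b1] by (intro sw_cong[OF Lp x] gu)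
	have "sw L Z ga (m l x u) = sw L Z (%x1 x2. ga (m l x1 u) (m l x2 u)) x"
		unfolding sw_m[OF l Z g x uc] by (intro sw_cong[OF Lp x] sw_u[OF l Z b2])
	also have "... = sw L Z ga x" by (intro sw_cong[OF Lp x] gu)
	finally have 2: "sw L Z ga (m l x u) = sw L Z ga x" .
	show "sw L Z ga a = sw L Z ga a'" using a 1 2 by blast
qed
show "m l u x = x" "m l x u = x" using x by (auto intro!: E)
qed

lemma lim_bialgebra: assumes l: "l:I" shows "Bialg L (m l) u"
unfolding bialgebra_iff algebra_iff using L LV mB[OF l] u[OF l] lim_assoc[OF l] lim_one[OF l] m[OF l] unfolding cbilin_def by blast

lemma s_Lin: "l:J ==> s l:Lin L L" and s_counit: "[|l:J; x IN L|] ==> counit L (s l x) = counit L x"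
and sc: "[|l:J; x IN L|] ==> s l x IN L"
proof -
show 1: "s l:Lin L L" if "l:J" for l using cm_Lin[OF s[OF that]] Lin_same[OF cop_same[of L K] srefl] by blast
show "counit L (s l x) = counit L x" if "l:J" "x IN L" for l x using cm_counit[OF s[OF that(1)]] that(2) by simp
show "s l x IN L" if "l:J" "x IN L" for l x using Lin_in[OF 1[OF that(1)] that(2)] .
qed

lemma sw_s:
assumes l: "l:J" and Z: "Vec Z" and b: "be:Bilin L L Z" and x: "x IN L"
shows "sw L Z be (s l x) = sw L Z (%a b. be (s l b) (s l a)) x"
proof -
have "(%a b. be (s l a) (s l b)):Bilin L L Z" by (intro BilinI' LinLR[OF b] s_Lin[OF l] sc[OF l])
from sw_cop[OF Lp Z this x] show ?thesis using cm_sw[OF cop_pre[OF Lp] Lp s[OF l] Z b] x by simp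
qed

text \<open>The pairs consist of the convolution products of \<open>s l\<close> with the identity,
  in both orders, and the convolution unit. Since \<open>s l\<close> reverses comultiplication,
  expanding a pair leaves one convolution product nested inside another, and both are removed in
  turn.\<close>

lemma lim_antipode_law:
assumes l: "l:J" shows "Antip L (m l) u (s l)"
proof -
have lI: "l:I" using l JI by blast
interpret cring K by (rule cring_K)
note mc = mc[OF lI] and me = m_counit[OF lI] and b = mB[OF lI] and sl = s_Lin[OF l] and sc = sc[OF l]
have uc: "u IN L" and ue: "counit L u = \<one>$K" using u[OF lI] by auto
note ec = counit_in[OF Lp] and el = counit_Lin[OF Lp] and smu = smult_closed[OF LV _ uc]
let ?f = "%a b. m l (s l a) b" and ?f' = "%a b. m l a (s l b)"
let ?A = "sw L L ?f" and ?A' = "sw L L ?f'" and ?e = "%x. counit L x *.$L u"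
have fB: "?f:Bilin L L L" by (intro BilinI' LinLR[OF b] sl Lin_id sc)
have fB': "?f':Bilin L L L" by (intro BilinI' LinLR[OF b] sl Lin_id sc)
have Ac: "?A x IN L" "?A' x IN L" if "x IN L" for x using that by (auto intro!: sw_closed[OF Lp LV] mc sc)
have ce: "counit L (sw L L h x) = counit L x"
	if h: "!!a b. [|a IN L; b IN L|] ==> h a b IN L & counit L (h a b) = counit L a \<otimes>$K counit L b" and x: "x IN L" for h x
proof -
	have "counit L (sw L L h x) = sw L Base (%a b. counit L (h a b)) x" by (intro Lin_sw[OF Lp el LV base_Vec x]) (use h in blast)
	also have "... = sw L Base (%a b. counit L a *.$Base counit L b) x" by (intro sw_cong[OF Lp x]) (use h in simp)
	also have "... = counit L x" by (rule sw_counit(1)[OF L el base_Vec x])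
	finally show ?thesis .
qed
let ?E = "{(?A x, ?e x) | x. x:carrier L} Un {(?A' x, ?e x) | x. x IN L}"
have E: "(a, a'):?E ==> a = a'" for a a'
proof (rule lim_coideal[where E = ?E])
	have "counit L (?e x) = counit L x" if "x IN L" for x using Lin_smult[OF el ec[OF that] uc] ue ec[OF that] by simp
	moreover have "counit L (?A x) = counit L x" "counit L (?A' x) = counit L x" if "x IN L" for x
		using that by (auto intro!: ce simp: mc sc me s_counit[OF l])
	ultimately show "a IN L & b IN L & counit L a = counit L b" if "(a, b):?E" for a b using that Ac smu ec by auto
	have "p i (?A x) = p i (?e x) & p i (?A' x) = p i (?e x)" if i: "i:P" and x: "x IN L" for i x
	proof -
		note H = Ff(5)[OF i lI] and V = Ff(4)[OF i] and pl = cm_Lin[OF p[OF i]]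
		let ?m = "imult (F i) l" and ?S = "S i l"
		have Sl: "?S:Lin (F i) (F i)" and S: "!!c. c IN F i ==> sw (F i) (F i) (%x y. ?m (?S x) y) c = counit (F i) c *.$(F i) iunit (F i) l &
				sw (F i) (F i) (%x y. ?m x (?S y)) c = counit (F i) c *.$(F i) iunit (F i) l" using Ff(6)[OF i l] anti_iff[OF H] by auto
		have pe: "p i (?e x) = counit (F i) (p i x) *.$(F i) iunit (F i) l"
			using Lin_smult[OF pl ec[OF x] uc] pu[OF lI i] cm_counit[OF p[OF i] x] by simp
		note bb = bi_Bil[OF H] and Sc = Lin_in[OF Sl]
		have 1: "(%x y. ?m (?S x) y):Bilin (F i) (F i) (F i)" by (intro BilinI' LinLR[OF bb] Sl Lin_id Sc)
		have 2: "(%x y. ?m x (?S y)):Bilin (F i) (F i) (F i)" by (intro BilinI' LinLR[OF bb] Sl Lin_id Sc)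
		have "p i (?A x) = sw L (F i) (%a b. p i (m l (s l a) b)) x" by (intro Lin_sw[OF Lp pl LV V x] mc sc)
		also have "... = sw L (F i) (%a b. ?m (?S (p i a)) (p i b)) x" by (intro sw_cong[OF Lp x]) (simp add: pm[OF lI i] ps[OF l i] sc)
		also have "... = p i (?e x)" using cm_sw[OF Lp Ff(3)[OF i] p[OF i] V 1 x] S[OF pc[OF i x]] pe by simp
		finally have A: "p i (?A x) = p i (?e x)" .
		have "p i (?A' x) = sw L (F i) (%a b. p i (m l a (s l b))) x" by (intro Lin_sw[OF Lp pl LV V x] mc sc)
		also have "... = sw L (F i) (%a b. ?m (p i a) (?S (p i b))) x" by (intro sw_cong[OF Lp x]) (simp add: pm[OF lI i] ps[OF l i] sc)
		also have "... = p i (?e x)" using cm_sw[OF Lp Ff(3)[OF i] p[OF i] V 2 x] S[OF pc[OF i x]] pe by simp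
		finally show ?thesis using A by simp
	qed
	thus "p i a = p i b" if "(a, b):?E" "i:P" for a b i using that by blast
	fix Z :: "('k, 'u) test_module" and ga a a'
	assume Z: "Vec Z" and g: "ga:Bilin L L Z" and aa: "(a, a'):?E"
		and gE: "!!a a' b. [|(a, a'):?E; b IN L|] ==> ga a b = ga a' b & ga b a = ga b a'"
	note gc = Bilin_in[OF g] and gL = LinL[OF g] and gR = LinR[OF g] and bL = LinL[OF b] and bR = LinR[OF b]
	\<comment> \<open>A convolution product in either argument of \<open>ga\<close> counts as a
	  multiple of the unit, by insensitivity of \<open>ga\<close> to the pairs.\<close>
	have gA: "ga (?A d) y = counit L d *.$Z ga u y" "ga y (?A d) = counit L d *.$Z ga y u"
		"ga (?A' d) y = counit L d *.$Z ga u y" "ga y (?A' d) = counit L d *.$Z ga y u" if "d IN L" "y IN L" for d y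
	proof -
		have "(?A d, ?e d):?E" "(?A' d, ?e d):?E" using that by blast+
		from gE[OF this(1) that(2)] gE[OF this(2) that(2)]
		show "ga (?A d) y = counit L d *.$Z ga u y" "ga y (?A d) = counit L d *.$Z ga y u"
			"ga (?A' d) y = counit L d *.$Z ga u y" "ga y (?A' d) = counit L d *.$Z ga y u"
			using Lin_smult[OF Bilin_left[OF g that(2)] ec[OF that(1)] uc] Lin_smult[OF Bilin_right[OF g that(2)] ec[OF that(1)] uc] by simp_all
	qed
	have b1: "(%c1 c2. sw L Z (%b1 b2. ga (m l c1 b1) (m l c2 b2)) y):Bilin L L Z" if "y IN L" for y
		using that by (intro BilinI' sw_LinP[OF Lp Z LV] gL gR bL Lin_id mc)
	have b2: "(%c1 c2. ga (m l a1 c1) (m l a2 c2)):Bilin L L Z" if "a1 IN L" "a2 IN L" for a1 a2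
		using that by (intro BilinI' gL gR bR Lin_id mc)
	have t1: "trilin L L L Z (%a2 b1 b2. ga (m l (s l a2) b1) (m l (s l a1) b2))" if "a1 IN L" for a1
		using that by (intro trilinI gL gR bL bR Lin_id sl mc sc)
	have t2: "trilin L L L Z (%a2 b1 b2. ga (m l a1 (s l b2)) (m l a2 (s l b1)))" if "a1 IN L" for a1
		using that by (intro trilinI gL gR bL bR Lin_id sl mc sc)
	have t3: "trilin L L L Z (%a1 a2 y. sw L Z (%b1 b2. ga (m l (s l a2) b1) (m l (s l a1) b2)) y)"
		by (intro trilinI sw_LinP[OF Lp Z LV] sw_Lin[OF Lp Z] BilinI' gL gR bL bR Lin_id sl mc sc)
	have t4: "trilin L L L Z (%a1 a2 y. sw L Z (%b1 b2. ga (m l a1 (s l b2)) (m l a2 (s l b1))) y)"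
		by (intro trilinI sw_LinP[OF Lp Z LV] sw_Lin[OF Lp Z] BilinI' gL gR bL bR Lin_id sl mc sc)
	note gl = sw_Lin[OF Lp Z g]
	have e: "sw L Z ga (?e x) = counit L x *.$Z ga u u" if "x IN L" for x using Lin_smult[OF gl ec[OF that] uc] sw_u[OF lI Z g] by simp
	\<comment> \<open>Comultiplying \<open>S(a) b\<close> gives \<open>S(a2) b1\<close> and
	  \<open>S(a1) b2\<close>. Coassociativity turns \<open>S(a2) b1\<close> into the convolution
	  product of one element; once it is replaced by a counit, the other factor becomes the convolution
	  product of \<open>x\<close>.\<close>
	have A: "sw L Z ga (?A x) = sw L Z ga (?e x)" if x: "x IN L" for x
	proof -
		have "sw L Z ga (?A x) = sw L Z (%a b. sw L Z ga (m l (s l a) b)) x" by (intro Lin_sw[OF Lp gl LV Z x] mc sc)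
		also have "... = sw L Z (%a b. sw L Z (%c1 c2. sw L Z (%b1 b2. ga (m l c1 b1) (m l c2 b2)) b) (s l a)) x"
			by (intro sw_cong[OF Lp x] sw_m[OF lI Z g] sc)
		also have "... = sw L Z (%a b. sw L Z (%a1 a2. sw L Z (%b1 b2. ga (m l (s l a2) b1) (m l (s l a1) b2)) b) a) x"
			by (intro sw_cong[OF Lp x] sw_s[OF l Z b1])
		also have "... = sw L Z (%a1 w. sw L Z (%a2 y. sw L Z (%b1 b2. ga (m l (s l a2) b1) (m l (s l a1) b2)) y) w) x"
			by (rule sw_assoc[OF L Z t3 x])
		also have "... = sw L Z (%a1 w. sw L Z (%d b2. sw L Z (%a2 b1. ga (m l (s l a2) b1) (m l (s l a1) b2)) d) w) x"
			by (intro sw_cong[OF Lp x] sw_assoc[OF L Z t1, symmetric])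
		also have "... = sw L Z (%a1 w. sw L Z (%d b2. ga (?A d) (m l (s l a1) b2)) w) x"
			by (intro sw_cong[OF Lp] x Lin_sw[OF Lp Bilin_left[OF g] LV Z, symmetric] mc sc)
		also have "... = sw L Z (%a1 w. sw L Z (%d b2. counit L d *.$Z ga u (m l (s l a1) b2)) w) x" by (intro sw_cong[OF Lp] x gA mc sc)
		also have "... = sw L Z (%a1 w. ga u (m l (s l a1) w)) x" by (intro sw_cong[OF Lp x] sw_counit(1)[OF L _ Z] gR bR Lin_id sc uc)
		also have "... = ga u (?A x)" by (intro Lin_sw[OF Lp Bilin_right[OF g uc] LV Z x, symmetric] mc sc)
		finally show ?thesis using gA[OF x uc] e[OF x] by simp
	qed
	have A': "sw L Z ga (?A' x) = sw L Z ga (?e x)" if x: "x IN L" for x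
	proof -
		have "sw L Z ga (?A' x) = sw L Z (%a b. sw L Z ga (m l a (s l b))) x" by (intro Lin_sw[OF Lp gl LV Z x] mc sc)
		also have "... = sw L Z (%a b. sw L Z (%a1 a2. sw L Z (%c1 c2. ga (m l a1 c1) (m l a2 c2)) (s l b)) a) x"
			by (intro sw_cong[OF Lp x] sw_m[OF lI Z g] sc)
		also have "... = sw L Z (%a b. sw L Z (%a1 a2. sw L Z (%b1 b2. ga (m l a1 (s l b2)) (m l a2 (s l b1))) b) a) x"
			by (intro sw_cong[OF Lp] x sw_s[OF l Z b2])
		also have "... = sw L Z (%a1 w. sw L Z (%a2 y. sw L Z (%b1 b2. ga (m l a1 (s l b2)) (m l a2 (s l b1))) y) w) x"
			by (rule sw_assoc[OF L Z t4 x])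
		also have "... = sw L Z (%a1 w. sw L Z (%d b2. sw L Z (%a2 b1. ga (m l a1 (s l b2)) (m l a2 (s l b1))) d) w) x"
			by (intro sw_cong[OF Lp x] sw_assoc[OF L Z t2, symmetric])
		also have "... = sw L Z (%a1 w. sw L Z (%d b2. ga (m l a1 (s l b2)) (?A' d)) w) x"
			by (intro sw_cong[OF Lp] x Lin_sw[OF Lp Bilin_right[OF g] LV Z, symmetric] mc sc)
		also have "... = sw L Z (%a1 w. sw L Z (%d b2. counit L d *.$Z ga (m l a1 (s l b2)) u) w) x" by (intro sw_cong[OF Lp] x gA mc sc)
		also have "... = sw L Z (%a1 w. ga (m l a1 (s l w)) u) x" by (intro sw_cong[OF Lp x] sw_counit(1)[OF L _ Z] gL bR sl uc)
		also have "... = ga (?A' x) u" by (intro Lin_sw[OF Lp Bilin_left[OF g uc] LV Z x, symmetric] mc sc)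
		finally show ?thesis using gA[OF x uc] e[OF x] by simp
	qed
	show "sw L Z ga a = sw L Z ga a'" using aa A A' by blast
qed
have "?A x = ?e x" "?A' x = ?e x" if "x IN L" for x using that by (auto intro!: E)
thus ?thesis unfolding anti_iff[OF lim_bialgebra[OF lI]] using sl by blast
qed

text \<open>Again the two sides of the law form the pairs. Cocommutativity enters twice: in
  \<open>s2\<close>, where the antipode no longer reverses comultiplication, and in
  \<open>sw3_cocommutative\<close>, which makes the right-hand side of the law compatible with the
  comultiplication of \<open>x\<close>.\<close>

lemma lim_brace_law:
assumes ll: "(l, l'):br" and coc: coc shows "brace_law L (m l) (s l) (m l')"
proof -
have lJ: "l:J" "l:I" "l':I" using ll br JI by auto
interpret cring K by (rule cring_K)
have Lco: "Cocom L" using Lcoc coc by blast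
note dB = mB[OF lJ(2)] and eB = mB[OF lJ(3)] and sl = s_Lin[OF lJ(1)]
note cl = mc[OF lJ(2)] mc[OF lJ(3)] sc[OF lJ(1)]
note ec = counit_in[OF Lp] and el = counit_Lin[OF Lp]
let ?d = "m l" and ?e = "m l'" and ?s = "s l"
let ?T = "%y z a b c. ?d (?d (?e a y) (?s b)) (?e c z)"
let ?B = "%y z. sw L L (%a w. sw L L (?T y z a) w)"
have T: "trilin L L L L (?T y z)" if "y IN L" "z IN L" for y z by (rule brace_trilin[OF dB eB sl that])
have Bc: "?B y z x IN L" if "x IN L" "y IN L" "z IN L" for x y z using that by (intro sw_closed[OF Lp LV] cl)
have s2: "sw L Z be (?s x) = sw L Z (%a b. be (?s a) (?s b)) x" if "Vec Z" "be:Bilin L L Z" "x IN L" for Z :: "('k, 'z, 'zz) module_scheme" and be x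
proof -
	have "(%a b. be (?s a) (?s b)):Bilin L L Z" by (intro BilinI' LinLR[OF that(2)] sl cl)
	from sw_cocom[OF Lp Lco that(1) this that(3)] show ?thesis unfolding sw_s[OF lJ(1) that] by simp
qed
let ?E = "{(?e x (?d y z), ?B y z x) | x y z. x IN L & y IN L & z IN L}"
have E: "(a, a'):?E ==> a = a'" for a a'
proof (rule lim_coideal[where E = ?E])
	have "counit L (?B y z x) = counit L x \<otimes>$K (counit L y \<otimes>$K counit L z)" if x: "x IN L" "y IN L" "z IN L" for x y z
	proof -
		let ?M = "Base" and ?f = "%c. counit L c \<otimes>$K (counit L y \<otimes>$K counit L z)"
		have k: "counit L y \<otimes>$K counit L z IN K" using x ec by simp
		have f: "(%c. a \<otimes>$K ?f c):Lin L ?M" if "a IN K" for a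
			using that k Lin_add[OF el] Lin_smult[OF el] by (intro LinI) (auto simp: ec l_distr r_distr m_ac base_module_def)
		have "counit L (?B y z x) = sw L ?M (%a w. sw L ?M (%b c. counit L (?T y z a b c)) w) x"
			using x by (subst Lin_sw[OF Lp el LV base_Vec x(1)]) (auto intro!: sw_closed[OF Lp LV] cl sw_cong[OF Lp] Lin_sw[OF Lp el LV base_Vec])
		also have "... = sw L ?M (%a w. sw L ?M (%b c. counit L b *.$?M (counit L a \<otimes>$K ?f c)) w) x"
		proof (intro sw_cong[OF Lp] x)
			fix a w b c assume abc: "a IN L" "w IN L" "b IN L" "c IN L"
			hence "counit L (?T y z a b c) = ((counit L a \<otimes>$K counit L y) \<otimes>$K counit L b) \<otimes>$K (counit L c \<otimes>$K counit L z)"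
				using x by (simp add: m_counit[OF lJ(2)] m_counit[OF lJ(3)] s_counit[OF lJ(1)] cl)
			thus "counit L (?T y z a b c) = counit L b *.$?M (counit L a \<otimes>$K ?f c)" using x abc by (simp add: ec m_ac)
		qed
		also have "... = sw L ?M (%a w. counit L a *.$?M (\<one>$K \<otimes>$K ?f w)) x"
			using x by (intro sw_cong[OF Lp x(1)] trans[OF sw_counit(1)[OF L f base_Vec]] ec) (simp_all add: ec base_module_def)
		also have "... = ?f x" using sw_counit(1)[OF L f[OF one_closed] base_Vec x(1)] x ec by simp
		finally show ?thesis .
	qed
	thus "a IN L & b IN L & counit L a = counit L b" if "(a, b):?E" for a b
		using that Bc by (auto simp: cl m_counit[OF lJ(2)] m_counit[OF lJ(3)] ec)
	have "p i (?e x (?d y z)) = p i (?B y z x)" if i: "i:P" and x: "x IN L" "y IN L" "z IN L" for i x y z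
	proof -
		note V = Ff(4)[OF i] and pl = cm_Lin[OF p[OF i]] and pF = Ff(3)[OF i] and pc = pc[OF i]
		let ?TF = "%a b c. imult (F i) l (imult (F i) l (imult (F i) l' a (p i y)) (S i l b)) (imult (F i) l' c (p i z))"
		have SF: "S i l:Lin (F i) (F i)" using Ff(6)[OF i lJ(1)] unfolding antipode_def by blast
		have TF: "trilin (F i) (F i) (F i) (F i) ?TF"
			by (rule brace_trilin[OF bi_Bil[OF Ff(5)[OF i lJ(2)]] bi_Bil[OF Ff(5)[OF i lJ(3)]] SF pc[OF x(2)] pc[OF x(3)]])
		have TFb: "?TF a:Bilin (F i) (F i) (F i)" if "a IN F i" for a using that TF unfolding trilin_def by blast
		have "p i (?e x (?d y z)) = sw (F i) (F i) (%a w. sw (F i) (F i) (?TF a) w) (p i x)"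
			using Fbr[OF i ll] pc x cl pm lJ(2,3) i unfolding brace_law_def by simp
		also have "... = sw L (F i) (%a w. sw (F i) (F i) (?TF (p i a)) (p i w)) x"
			by (rule cm_sw[OF Lp pF p[OF i] V sw_Tri_right[OF pF V TF V] x(1)])
		also have "... = sw L (F i) (%a w. sw L (F i) (%b c. ?TF (p i a) (p i b) (p i c)) w) x"
			by (intro sw_cong[OF Lp x(1)] cm_sw[OF Lp pF p[OF i] V TFb] pc)
		also have "... = sw L (F i) (%a w. sw L (F i) (%b c. p i (?T y z a b c)) w) x"
		proof (intro sw_cong[OF Lp] x)
			fix a w b c assume "a IN L" "w IN L" "b IN L" "c IN L"
			thus "?TF (p i a) (p i b) (p i c) = p i (?T y z a b c)" using x by (simp add: pm[OF lJ(2) i] pm[OF lJ(3) i] ps[OF lJ(1) i] cl)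
		qed
		also have "... = sw L (F i) (%a w. p i (sw L L (?T y z a) w)) x" by (intro sw_cong[OF Lp] x Lin_sw[OF Lp pl LV V, symmetric] cl)
		also have "... = p i (?B y z x)" by (intro Lin_sw[OF Lp pl LV V, symmetric] x sw_closed[OF Lp LV] cl)
		finally show ?thesis .
	qed
	thus "p i a = p i b" if "(a, b):?E" "i:P" for a b i using that by blast
	fix Z :: "('k, 'u) test_module" and ga a a'
	assume Z: "Vec Z" and g: "ga:Bilin L L Z" and aa: "(a, a'):?E"
		and gE: "!!a a' b. [|(a, a'):?E; b IN L|] ==> ga a b = ga a' b & ga b a = ga b a'"
	obtain x y z where x: "x IN L" "y IN L" "z IN L" and a: "a = ?e x (?d y z)" "a' = ?B y z x" using aa by blast
	note gc = Bilin_in[OF g] and gL = LinL[OF g] and gR = LinR[OF g] and sd = sw_closed[OF Lp Z]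
	have gB: "ga (?e x' (?d y1 z1)) (?e x'' (?d y2 z2)) = ga (?B y1 z1 x') (?B y2 z2 x'')"
		if c: "x' IN L" "x'' IN L" "y1 IN L" "y2 IN L" "z1 IN L" "z2 IN L" for x' x'' y1 y2 z1 z2
	proof -
		have "(?e x' (?d y1 z1), ?B y1 z1 x'):?E" "(?e x'' (?d y2 z2), ?B y2 z2 x''):?E" using c by blast+
		from gE[OF this(1), of "?e x'' (?d y2 z2)"] gE[OF this(2) Bc[OF c(1,3,5)]] show ?thesis using c cl by simp
	qed
	have bx: "(%b b'. sw L Z (%x' x''. ga (?e x' b) (?e x'' b')) x):Bilin L L Z"
		by (intro BilinI' sw_LinP[OF Lp Z LV] gL gR LinR[OF eB] Lin_id cl x)
	\<comment> \<open>The left side is comultiplied in all three variables and each half is replaced by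
	  a brace expression. The sums over the parts of \<open>x\<close> are then regrouped until the
	  inner sums are the comultiplication of the single term \<open>?T y z x1 x2 x3\<close>.\<close>
	have "sw L Z ga a = sw L Z (%b b'. sw L Z (%x' x''. ga (?e x' b) (?e x'' b')) x) (?d y z)"
		unfolding a by (rule sw_cbilin'[OF Lp Lp Lp m[OF lJ(3)] Z g x(1) cl(1)[OF x(2,3)]])
	also have "... = sw L Z (%z1 z2. sw L Z (%y1 y2. sw L Z (%x' x''. ga (?e x' (?d y1 z1)) (?e x'' (?d y2 z2))) x) y) z"
		by (rule sw_cbilin'[OF Lp Lp Lp m[OF lJ(2)] Z bx x(2,3)])
	also have "... = sw L Z (%z1 z2. sw L Z (%y1 y2. sw L Z (%x' x''. ga (?B y1 z1 x') (?B y2 z2 x'')) x) y) z" by (intro sw_cong[OF Lp] x gB)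
	also have "... = sw L Z (%z1 z2. sw L Z (%y1 y2. sw L Z (%x1 w. sw L Z (%x2 x3. sw L Z (%a a'. sw L Z (%b b'.
			sw L Z (%c c'. ga (?T y1 z1 a b c) (?T y2 z2 a' b' c')) x3) x2) x1) w) x) y) z"
		by (intro sw_cong[OF Lp] x sw3_cocommutative[OF L Lco Z LV g T T, symmetric])
	also have "... = sw L Z (%z1 z2. sw L Z (%x1 w. sw L Z (%x2 x3. sw L Z (%y1 y2. sw L Z (%a a'. sw L Z (%b b'.
			sw L Z (%c c'. ga (?T y1 z1 a b c) (?T y2 z2 a' b' c')) x3) x2) x1) y) w) x) z"
		by (intro sw_cong[OF Lp x(3)] sw_swap2[OF Lp Lp Z x(1,2)] sd gc cl)
	also have "... = sw L Z (%x1 w. sw L Z (%x2 x3. sw L Z (%z1 z2. sw L Z (%y1 y2. sw L Z (%a a'. sw L Z (%b b'.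
			sw L Z (%c c'. ga (?T y1 z1 a b c) (?T y2 z2 a' b' c')) x3) x2) x1) y) z) w) x" by (intro sw_swap2[OF Lp Lp Z x(1,3)] sd gc cl x(2))
	also have "... = sw L Z (%x1 w. sw L Z (%x2 x3. sw L Z ga (?T y z x1 x2 x3)) w) x"
	proof (intro sw_cong[OF Lp] x)
		fix a w b c assume c: "a IN L" "w IN L" "b IN L" "c IN L"
		have bH: "(%h1 h2. ga (?d g1 h1) (?d g2 h2)):Bilin L L Z" if "g1 IN L" "g2 IN L" for g1 g2
			using that by (intro BilinI' gL gR LinR[OF dB] Lin_id cl)
		let ?G = "%z1 z2 g1 g2. sw L Z (%c1 c2. ga (?d g1 (?e c1 z1)) (?d g2 (?e c2 z2))) c"
		have bG: "?G z1 z2:Bilin L L Z" if "z1 IN L" "z2 IN L" for z1 z2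
			using that c by (intro BilinI' sw_LinP[OF Lp Z LV] gL gR LinL[OF dB] Lin_id cl)
		have bK: "(%k1 k2. ?G z1 z2 (?d f1 k1) (?d f2 k2)):Bilin L L Z" if "z1 IN L" "z2 IN L" "f1 IN L" "f2 IN L" for z1 z2 f1 f2
			using that by (intro BilinI' LinLR[OF bG] LinR[OF dB] Lin_id cl)
		have bF: "(%f1 f2. sw L Z (%b1 b2. ?G z1 z2 (?d f1 (?s b1)) (?d f2 (?s b2))) b):Bilin L L Z" if "z1 IN L" "z2 IN L" for z1 z2
			using that c by (intro BilinI' sw_LinP[OF Lp Z LV] LinLR[OF bG] LinL[OF dB] Lin_id cl)
		note k = c x
		have "sw L Z ga (?T y z a b c) = sw L Z (%g1 g2. sw L Z (%h1 h2. ga (?d g1 h1) (?d g2 h2)) (?e c z)) (?d (?e a y) (?s b))"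
			by (intro sw_m[OF lJ(2) Z g] cl k)
		also have "... = sw L Z (%g1 g2. sw L Z (%z1 z2. ?G z1 z2 g1 g2) z) (?d (?e a y) (?s b))"
			by (intro sw_cong[OF Lp] sw_cbilin'[OF Lp Lp Lp m[OF lJ(3)] Z bH] cl k)
		also have "... = sw L Z (%z1 z2. sw L Z (?G z1 z2) (?d (?e a y) (?s b))) z" by (intro sw_swap[OF Lp Lp Z] sd gc cl k)
		also have "... = sw L Z (%z1 z2. sw L Z (%f1 f2. sw L Z (%k1 k2. ?G z1 z2 (?d f1 k1) (?d f2 k2)) (?s b)) (?e a y)) z"
			by (intro sw_cong[OF Lp] sw_m[OF lJ(2) Z bG] cl k)
		also have "... = sw L Z (%z1 z2. sw L Z (%f1 f2. sw L Z (%b1 b2. ?G z1 z2 (?d f1 (?s b1)) (?d f2 (?s b2))) b) (?e a y)) z"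
			by (intro sw_cong[OF Lp] s2[OF Z bK] cl k)
		also have "... = sw L Z (%z1 z2. sw L Z (%y1 y2. sw L Z (%a1 a2. sw L Z (%b1 b2. ?G z1 z2 (?d (?e a1 y1) (?s b1)) (?d (?e a2 y2) (?s b2))) b) a) y) z"
			by (intro sw_cong[OF Lp] sw_cbilin'[OF Lp Lp Lp m[OF lJ(3)] Z bF] cl k)
		finally show "sw L Z (%z1 z2. sw L Z (%y1 y2. sw L Z (%a a'. sw L Z (%b b'.
			sw L Z (%c c'. ga (?T y1 z1 a b c) (?T y2 z2 a' b' c')) c) b) a) y) z = sw L Z ga (?T y z a b c)" by (rule sym)
	qed
	also have "... = sw L Z (%x1 w. sw L Z ga (sw L L (?T y z x1) w)) x"
		by (intro sw_cong[OF Lp] x Lin_sw[OF Lp sw_Lin[OF Lp Z g] LV Z, symmetric] cl)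
	also have "... = sw L Z ga a'" unfolding a by (intro Lin_sw[OF Lp sw_Lin[OF Lp Z g] LV Z, symmetric] x sw_closed[OF Lp LV] cl)
	finally show "sw L Z ga a = sw L Z ga a'" .
qed
thus ?thesis unfolding brace_law_def by blast
qed

text \<open>A mediating coalgebra map is multiplicative by the same argument: the pairs compare
  \<open>h\<close> of a product with the product of the values, and \<open>h\<close> of the unit
  with \<open>u\<close>.\<close>

lemma lim_algebra_map:
assumes A: "!!l. l:I ==> Bialg A (imult A l) (iunit A l)" and h: "h:Cmaps A L"
	and hp: "!!i l. [|i:P; l:I|] ==> algebra_map A (imult A l) (iunit A l) (imult (F i) l) (iunit (F i) l) (%x. p i (h x))" and l: "l:I"
shows "algebra_map A (imult A l) (iunit A l) (m l) u h"
proof -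
note B = A[OF l] note pA = bi_pre[OF B] and VA = bi_Vec[OF B] and mA = bi_closed[OF B] and uA = bi_unit[OF B]
note hl = cm_Lin[OF h] note hc = Lin_in[OF hl] and he = cm_counit[OF h]
let ?d = "imult A l"
have uc: "u IN L" and ue: "counit L u = \<one>$K" using u[OF l] by auto
have hpm: "p i (h (?d x y)) = imult (F i) l (p i (h x)) (p i (h y))" "p i (h (iunit A l)) = iunit (F i) l"
	if "i:P" "x IN A" "y IN A" for i x y using hp[OF that(1) l] that unfolding algebra_map_def by blast+
let ?E = "{(h (?d x y), m l (h x) (h y)) | x y. x:carrier A & y:carrier A} Un {(h (iunit A l), u)}"
have E: "(a, a'):?E ==> a = a'" for a a'
proof (rule lim_coideal[where E = ?E])
	show "a IN L & b IN L & counit L a = counit L b" if "(a, b):?E" for a b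
		using that mA hc uA uc by (auto simp: mc[OF l] he m_counit[OF l] bi_counit[OF B] bi_counit_unit[OF B] ue)
	show "p i a = p i b" if "(a, b):?E" "i:P" for a b i using that hc uA by (auto simp: pm[OF l] pu[OF l] hpm)
	fix Z :: "('k, 'u) test_module" and ga a a'
	assume Z: "Vec Z" and g: "ga:Bilin L L Z" and aa: "(a, a'):?E"
		and gE: "!!a a' b. [|(a, a'):?E; b IN L|] ==> ga a b = ga a' b & ga b a = ga b a'"
	have hg: "(%a b. ga (h a) (h b)):Bilin A A Z" by (intro BilinI' LinLR[OF g] hl hc)
	have 1: "sw L Z ga (h (?d x y)) = sw L Z ga (m l (h x) (h y))" if xy: "x IN A" "y IN A" for x y
	proof -
		have "sw L Z ga (h (?d x y)) = sw A Z (%a b. ga (h a) (h b)) (?d x y)" by (rule cm_sw[OF pA Lp h Z g mA[OF xy]])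
		also have "... = sw A Z (%x1 x2. sw A Z (%y1 y2. ga (h (?d x1 y1)) (h (?d x2 y2))) y) x" by (rule sw_mult[OF B Z hg xy])
		also have "... = sw A Z (%x1 x2. sw A Z (%y1 y2. ga (m l (h x1) (h y1)) (m l (h x2) (h y2))) y) x"
		proof (intro sw_cong[OF pA] xy)
			fix x1 x2 y1 y2 assume c: "x1 IN A" "x2 IN A" "y1 IN A" "y2 IN A"
			have "(h (?d x1 y1), m l (h x1) (h y1)):?E" "(h (?d x2 y2), m l (h x2) (h y2)):?E" using c by blast+
			from gE[OF this(1), of "h (?d x2 y2)"] gE[OF this(2), of "m l (h x1) (h y1)"]
			show "ga (h (?d x1 y1)) (h (?d x2 y2)) = ga (m l (h x1) (h y1)) (m l (h x2) (h y2))" using c hc mA mc[OF l] by simp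
		qed
		also have "... = sw L Z ga (m l (h x) (h y))"
			by (rule sw_cbilin[OF pA pA Lp cbilin_comp[OF pA pA Lp Lp Lp h h m[OF l]] Z g xy, symmetric])
		finally show ?thesis .
	qed
	have "sw L Z ga (h (iunit A l)) = ga (h (iunit A l)) (h (iunit A l))" using cm_sw[OF pA Lp h Z g uA] sw_unit[OF B Z hg] by simp
	also have "... = ga u (h (iunit A l))" using gE[OF _ hc[OF uA], of "h (iunit A l)" u] by blast
	also have "... = ga u u" using gE[OF _ uc, of "h (iunit A l)" u] by blast
	also have "... = sw L Z ga u" by (rule sw_u[OF l Z g, symmetric])
	finally have 2: "sw L Z ga (h (iunit A l)) = sw L Z ga u" .
	show "sw L Z ga a = sw L Z ga a'" using aa 1 2 by blast
qed
have "h (iunit A l) = u" by (rule E) blast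
moreover have "h (?d x y) = m l (h x) (h y)" if "x IN A" "y IN A" for x y by (rule E) (use that in blast)
ultimately show ?thesis unfolding algebra_map_def by blast
qed
end

end

section \<open>Structures on records with the same underlying coalgebra\<close>

context linear_algebra
begin
lemma same_coalg_str:
assumes same: "same_coalg C D" and m: "Bialg C m u"
shows "Bialg D m u" "Antip C m u S ==> Antip D m u S"
proof -
have sp: "same_sp C D" and c: "comult D = comult C" "counit D = counit C" "carrier D = carrier C" "smult D = smult C"
	using same by (auto simp: same_coalg_def same_sp_def)
note sw = same_coalg_sw(1)[OF same, symmetric]
have swZ: "sw C D = sw C C" using sp by (intro sw_lsum_same) (auto simp: same_sp_def)
show B: "Bialg D m u" using m same_coalg_cong(1)[OF same bi_coalgebra[OF m]] Vec_same[OF sp]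
	unfolding bialgebra_iff algebra_iff Bilin_same[OF sp sp sp, symmetric] ten_same[OF sp sp, symmetric] pur_same[OF sp sp, symmetric] sw c
	by simp
show "Antip C m u S ==> Antip D m u S" unfolding anti_iff[OF m] anti_iff[OF B] sw swZ c Lin_same[OF sp sp, symmetric] by simp
qed

lemma same_coalg_brace_law: "[|same_coalg C D; brace_law C d S e|] ==> brace_law D d S e"
proof -
assume same: "same_coalg C D" and b: "brace_law C d S e"
hence sp: "same_sp C D" by (simp add: same_coalg_def)
have "sw C D = sw C C" using sp by (intro sw_lsum_same) (auto simp: same_sp_def)
with b show ?thesis using sp unfolding brace_law_def same_coalg_sw(1)[OF same, symmetric] same_sp_def by simp
qed

lemma hstruct_of_same:
assumes same: "same_coalg L H" and m: "!!l. l:I ==> Bialg L (m l) u" and L: "Coalg L" "coc --> Cocom L"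
	and s: "!!l. l:J ==> Antip L (m l) u (s l)" and b: "!!l l'. (l, l'):br ==> brace_law L (m l) (s l) (m l')" and JI: "J <= I"
	and H: "!!l. l:I ==> imult H l = m l & iunit H l = u" and br: "br <= J \<times> I"
shows "hstruct I J coc br H s"
proof -
have "Bialg H (m l) u" if "l:I" for l by (rule same_coalg_str(1)[OF same m[OF that]])
moreover have "Antip H (m l) u (s l)" if l: "l:J" for l using same_coalg_str(2)[OF same m s[OF l]] l JI by blast
moreover have "brace_law H (imult H l) (s l) (imult H l')" if ll: "(l, l'):br" for l l'
proof -
	have "imult H l = m l" "imult H l' = m l'" using ll H JI br by auto
	thus ?thesis using same_coalg_brace_law[OF same b[OF ll]] by simp
qed
ultimately show ?thesis unfolding hstruct_def using same_coalg_cong(1,2)[OF same] L H JI by auto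
qed
end

section \<open>Completeness of the categories of structures\<close>

context hopf_category
begin
text \<open>The limit of the underlying coalgebras with its induced operations is an object, and
  mediating coalgebra maps are morphisms. The assumption says that any brace law to be verified
  comes with the cocommutativity that \<open>lim_brace_law\<close> uses.\<close>

lemma complete_C:
assumes bc: "br = {} | coc" shows "complete_category TYPE('u) C"
unfolding complete_category_def
proof (intro allI impI, elim conjE)
fix X :: "('u, 'u) cat" and D assume X: "small_category X" and D: "is_functor X C D"
note Do = functor_obj[OF D] and Dh = functor_hom[OF D]
let ?P = "Obj X" and ?F = "%i. V (onObj D i)"
define T where "T = {(i, j, onHom D i j f) | i j f. i:?P & j:?P & f:Hom X i j}"
from limit_coalgebra[OF X D, folded T_def] obtain L p where lim: "coalg_limit ?P ?F T L p"
	and px: "!!i. i:?P ==> p i:extensional (carrier L)" by blast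
have "ALL i:?P. EX S. hstruct I J coc br (?F i) S" using obj Do by blast
then obtain S where S: "!!i. i:?P ==> hstruct I J coc br (?F i) (S i)" by metis
interpret lim: hopf_limit ty K C V I J coc br Lam ?P ?F S T L p
proof (rule hopf_limit.intro[OF hopf_category_axioms], rule hopf_limit_axioms.intro)
	show "hstruct I J coc br (?F i) (S i)" if "i:?P" for i by (rule S[OF that])
	show "i:?P & j:?P & f:hmaps I (?F i) (?F j)" if "(i, j, f):T" for i j f using that Dh Hom_C Do unfolding T_def by auto
qed (rule lim)
note L = lim.L lim.Lcoc lim.Ls and p = lim.p
have pT: "onHom D i j f (p i x) = p j x" if "i:?P" "j:?P" "f:Hom X i j" "x IN L" for i j f x using that lim.pT unfolding T_def by blast
obtain m where m: "ALL l:I. cbilin L L L (m l) & (ALL i:?P. ALL x:carrier L. ALL y:carrier L. p i (m l x y) = imult (?F i) l (p i x) (p i y))"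
	using lim.lim_mult by blast
obtain u where u: "I ~= {} --> u IN L & comult L u = pur L L u u & counit L u = \<one>$K & (ALL i:?P. ALL l:I. p i u = iunit (?F i) l)"
	using lim.lim_unit by blast
obtain s where s: "ALL l:J. s l:Cmaps (Cop L) L & (ALL i:?P. ALL x:carrier L. p i (s l x) = S i l (p i x))" using lim.lim_antipode by blast
have m': "cbilin L L L (m l)" "[|i:?P; x IN L; y IN L|] ==> p i (m l x y) = imult (?F i) l (p i x) (p i y)"
	if "l:I" for l i x y using m that by blast+
have u': "u IN L & comult L u = pur L L u u & counit L u = \<one>$K" if "l:I" for l :: 'i using u that by blast
have pu: "p i u = iunit (?F i) l" if "l:I" "i:?P" for l i using u that by blast
have s': "s l:Cmaps (Cop L) L" "[|i:?P; x IN L|] ==> p i (s l x) = S i l (p i x)" if "l:J" for l i x using s that by blast+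
\<comment> \<open>The limit coalgebra with the induced operations; \<open>all_obj\<close> makes it
  the structure of an object.\<close>
let ?L = "L(|imult := m, iunit := %_. u|)"
have same: "same_coalg L ?L" by (simp add: same_coalg_def same_sp_def)
have hs: "hstruct I J coc br ?L s"
proof (rule hstruct_of_same[OF same])
	show "Bialg L (m l) u" if "l:I" for l by (rule lim.lim_bialgebra[of m u s, OF m' u' pu s' that])
	show "Antip L (m l) u (s l)" if "l:J" for l by (rule lim.lim_antipode_law[of m u s, OF m' u' pu s' that])
	show "brace_law L (m l) (s l) (m l')" if "(l, l'):br" for l l'
		by (rule lim.lim_brace_law[of m u s, OF m' u' pu s' that]) (use bc that in auto)
qed (use L JI br in auto)
obtain c where c: "c:Obj C" and Vc: "V c = ?L" using all_obj[OF _ hs] L(3) by auto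
note cong = same_coalg_cong[OF same]
have hsm: "!!f A. f:hmaps I ?L A <-> f:Cmaps L A & (ALL l:I. algebra_map L (m l) u (imult A l) (iunit A l) f)"
	unfolding hmaps_def cong(3)[symmetric] algebra_map_def by simp
have ph: "p i:Hom C c (onObj D i)" if i: "i:?P" for i
	unfolding Hom_C[OF c Do[OF i]] Vc using p[OF i] px[OF i] m'(2)[OF _ i] pu[OF _ i] by (auto simp: hsm algebra_map_def)
show "EX c qj. is_limit X C D c qj"
proof (intro exI[of _ c] exI[of _ p], unfold is_limit_def is_cone_def, intro conjI ballI allI impI c ph)
	fix i j f assume f: "i:?P" "j:?P" "f:Hom X i j"
	show "Comp C c (onObj D i) (onObj D j) (onHom D i j f) (p i) = p j"
		using pT f px[OF f(2)] by (auto simp: fun_eq_iff Comp_C Vc compose_def extensional_def)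
next
	fix d rh
	assume dr: "d:Obj C & (ALL i:?P. rh i:Hom C d (onObj D i)) &
		(ALL i:?P. ALL j:?P. ALL f:Hom X i j. Comp C d (onObj D i) (onObj D j) (onHom D i j f) (rh i) = rh j)"
	hence d: "d:Obj C" by blast
	obtain Sd where Sd: "hstruct I J coc br (V d) Sd" and sd: "small TYPE('u) (carrier (V d))" using obj[OF d] by blast
	have Ad: "Coalg (V d)" "coc --> Cocom (V d)" and Bd: "!!l. l:I ==> Bialg (V d) (imult (V d) l) (iunit (V d) l)"
		using Sd unfolding hstruct_def by blast+
	have r: "rh i:hmaps I (V d) (?F i)" "rh i:extensional (carrier (V d))" if "i:?P" for i using dr that Hom_C[OF d Do[OF that]] by auto
	have rc: "rh i:Cmaps (V d) (?F i)" if "i:?P" for i using r(1)[OF that] unfolding hmaps_def by blast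
	have rT: "onHom D i j f (rh i x) = rh j x" if f: "i:?P" "j:?P" "f:Hom X i j" and x: "x IN V d" for i j f x
	proof -
		have "Comp C d (onObj D i) (onObj D j) (onHom D i j f) (rh i) x = rh j x" using dr f by simp
		thus ?thesis using x by (simp add: Comp_C compose_def)
	qed
	have "EX h:Cmaps (V d) L. ALL i:?P. ALL x:carrier (V d). p i (h x) = rh i x"
		by (rule lim.lim_exists[OF Ad sd rc]) (use rT in "auto simp: T_def")
	then obtain h where h: "h:Cmaps (V d) L" "!!i x. [|i:?P; x IN V d|] ==> p i (h x) = rh i x" by blast
	have ham: "algebra_map (V d) (imult (V d) l) (iunit (V d) l) (m l) u h" if l: "l:I" for l
	proof (rule lim.lim_algebra_map[of m u s, OF m' u' pu s' Bd h(1) _ l])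
		fix i l assume il: "i:?P" "l:I"
		show "algebra_map (V d) (imult (V d) l) (iunit (V d) l) (imult (?F i) l) (iunit (?F i) l) (%x. p i (h x))"
			using r(1)[OF il(1)] il bi_closed[OF Bd[OF il(2)]] bi_unit[OF Bd[OF il(2)]] unfolding hmaps_def algebra_map_def by (simp add: h(2))
	qed
	have hm: "h:hmaps I (V d) ?L" unfolding hmaps_def cong(4)[symmetric] using h(1) ham by simp
	note iL = hstruct_ibialg[OF hs]
	have hc: "h x IN L" if "x IN V d" for x by (rule Lin_in[OF cm_Lin[OF h(1)] that])
	show "EX! h. h:Hom C d c & (ALL i:?P. Comp C d c (onObj D i) (p i) h = rh i)"
	proof (rule ex1I[of _ "restrict h (carrier (V d))"])
		have "restrict h (carrier (V d)):Hom C d c" unfolding Hom_C[OF d c] Vc using hmaps_cong[OF obj_ibi[OF d] iL hm] by auto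
		moreover have "Comp C d c (onObj D i) (p i) (restrict h (carrier (V d))) = rh i" if "i:?P" for i
			using h(2)[OF that] r(2)[OF that] by (auto simp: fun_eq_iff Comp_C compose_def extensional_def)
		ultimately show "restrict h (carrier (V d)):Hom C d c & (ALL i:?P. Comp C d c (onObj D i) (p i) (restrict h (carrier (V d))) = rh i)"
			by blast
		fix g assume g: "g:Hom C d c & (ALL i:?P. Comp C d c (onObj D i) (p i) g = rh i)"
		have gm: "g:Cmaps (V d) L" "g:extensional (carrier (V d))" using g unfolding Hom_C[OF d c] Vc hmaps_def cong(4)[symmetric] by auto
		have pg: "p i (g x) = p i (h x)" if "i:?P" "x IN V d" for i x
		proof -
			have "Comp C d c (onObj D i) (p i) g x = rh i x" using g that(1) by simp
			thus ?thesis using that h(2)[OF that] by (simp add: Comp_C compose_def)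
		qed
		have "g x = h x" if x: "x IN V d" for x by (rule lim.lim_unique0[OF _ gm(1) h(1) pg x]) (use Ad sd in simp)
		thus "g = restrict h (carrier (V d))" using gm(2) by (auto simp: fun_eq_iff extensional_def)
	qed
qed
qed

text \<open>Completeness comes from the coalgebra limits, cocompleteness follows by accessibility,
  and this is what local presentability lacked.\<close>

lemma lp_C:
assumes "br = {} | coc"
shows "locally_presentable TYPE('u) C & complete_category TYPE('u) C & cocomplete_category TYPE('u) C"
using complete_C[OF assms] cocomplete_if_C locally_presentable_iff by blast
end

text \<open>The antipodes are dropped, being determined by the multiplications on the carrier;
  \<open>False\<close> stands for the dot and \<open>True\<close> for the diamond, in accordance
  with \<open>br\<close>.\<close>

definition br_ibialg :: "('k, 'a) brace => ('k, bool, 'a) ibialg" where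
"br_ibialg H = (|carrier = carrier H, mult = mult H, one = one H, ring.zero = \<zero>$H, add = add H, smult = smult H,
	comult = comult H, counit = counit H, imult = (%b. if b then diamond H else dot H),
	iunit = (%b. if b then diamond_unit H else dot_unit H)|)"

definition ibialg_brace :: "('k, bool, 'a) ibialg => (bool => 'a => 'a) => ('k, 'a) brace" where
"ibialg_brace H S = (|carrier = carrier H, mult = mult H, one = one H, ring.zero = \<zero>$H, add = add H, smult = smult H,
	comult = comult H, counit = counit H, dot = imult H False, dot_unit = iunit H False, dot_antipode = S False,
	diamond = imult H True, diamond_unit = iunit H True, diamond_antipode = S True|)"

lemma br_ibialg_inverse: "br_ibialg (ibialg_brace H S) = H"
by (cases H) (auto simp: br_ibialg_def ibialg_brace_def fun_eq_iff)

lemma brace_same: "same_coalg H (br_ibialg H)" "same_coalg H' (ibialg_brace H' S)"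
by (simp_all add: same_coalg_def same_sp_def br_ibialg_def ibialg_brace_def)

section \<open>Hopf braces as structures\<close>

context linear_algebra
begin
lemma brace_law_sweedler3:
assumes H: "precoalg H" and b: "d:Bilin H H H" "e:Bilin H H H" "S:Lin H H"
shows "brace_law H d S e <-> (ALL x:carrier H. ALL y:carrier H. ALL z:carrier H.
	e x (d y z) = sweedler3 K H H (%x1 x2 x3. d (d (e x1 y) (S x2)) (e x3 z)) x)"
unfolding brace_law_def using sweedler3_sw[OF H pre_Vec[OF H] brace_trilin[OF b]] by simp

text \<open>The brace law at \<open>x = v\<close> and \<open>y = z = u\<close>: since
  \<open>v\<close> is grouplike and the unit of \<open>e\<close>, the law reads
  \<open>u = S v\<close>. The antipode law at \<open>v\<close> then gives \<open>v = u\<close>,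
  which supplies the common unit demanded by \<open>hstruct\<close>.\<close>

lemma brace_units:
assumes d: "Bialg H d u" and S: "Antip H d u S" and e: "Bialg H e v" and b: "brace_law H d S e"
shows "v = u"
proof -
note pH = bi_pre[OF d] and V = bi_Vec[OF d] and dc = bi_closed[OF d] and u = bi_unit[OF d] and v = bi_unit[OF e]
have Sl: "S:Lin H H" and S1: "sw H H (%x y. d (S x) y) v = counit H v *.$H u" using S v anti_iff[OF d] by auto
note Sc = Lin_in[OF Sl v]
let ?t = "%x1 x2 x3. d (d (e x1 u) (S x2)) (e x3 u)"
have t: "trilin H H H H ?t" by (rule brace_trilin[OF bi_Bil[OF d] bi_Bil[OF e] Sl u u])
have tb: "?t v:Bilin H H H" using t v unfolding trilin_def by blast
have "e v (d u u) = sw H H (%x1 w. sw H H (?t x1) w) v" using b u v unfolding brace_law_def by blast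
also have "... = ?t v v v" using sw_unit[OF e V sw_Tri_right[OF pH V t V]] sw_unit[OF e V tb] by simp
finally have "S v = u" using u v Sc by (simp add: bi_one[OF d] bi_one[OF e] dc)
moreover have "(%x y. d (S x) y):Bilin H H H" by (intro BilinI' LinLR[OF bi_Bil[OF d]] Sl Lin_id Lin_in[OF Sl])
ultimately show "v = u" using S1 sw_unit[OF e V] bi_counit_unit[OF e] smult_one[OF V u] bi_one[OF d] v by simp
qed

lemma brace_hstruct:
assumes H: "Hopf_brace K H" and coc: "coc --> Cocom H"
shows "hstruct UNIV UNIV coc {(False, True)} (br_ibialg H) (%b. if b then diamond_antipode H else dot_antipode H)"
proof -
have d: "Bialg H (dot H) (dot_unit H)" "Antip H (dot H) (dot_unit H) (dot_antipode H)"
	and e: "Bialg H (diamond H) (diamond_unit H)" "Antip H (diamond H) (diamond_unit H) (diamond_antipode H)"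
	and br: "ALL x:carrier H. ALL y:carrier H. ALL z:carrier H. diamond H x (dot H y z) = sweedler3 K H H
			(%x1 x2 x3. dot H (dot H (diamond H x1 y) (dot_antipode H x2)) (diamond H x3 z)) x" using H unfolding Hopf_brace_def by blast+
have S: "dot_antipode H:Lin H H" using d(2) unfolding antipode_def by blast
have b: "brace_law H (dot H) (dot_antipode H) (diamond H)"
	using br brace_law_sweedler3[OF bi_pre[OF d(1)] bi_Bil[OF d(1)] bi_Bil[OF e(1)] S] by blast
note eq = brace_units[OF d e(1) b]
show ?thesis by (rule hstruct_of_same[where u = "dot_unit H" and m = "%b. if b then diamond H else dot H", OF brace_same(1)])
		(use d e b coc bi_coalgebra[OF d(1)] in "auto simp: eq br_ibialg_def")
qed

lemma hstruct_brace:
assumes H: "hstruct UNIV UNIV coc {(False, True)} H S"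
shows "Hopf_brace K (ibialg_brace H S)" "coc --> Cocom (ibialg_brace H S)"
proof -
have br: "brace_law H (imult H False) (S False) (imult H True)"
	and bi: "Bialg H (imult H l) (iunit H l)" and an: "Antip H (imult H l) (iunit H l) (S l)" for l using H unfolding hstruct_def by auto
note same = brace_same(2)[of H S]
note st = same_coalg_str(1)[OF same bi] same_coalg_str(2)[OF same bi an]
have "S False:Lin (ibialg_brace H S) (ibialg_brace H S)" using st(2)[of False] unfolding antipode_def by blast
note B = brace_law_sweedler3[OF bi_pre[OF st(1)] bi_Bil[OF st(1)] bi_Bil[OF st(1)] this]
have "brace_law (ibialg_brace H S) (imult H False) (S False) (imult H True)" by (rule same_coalg_brace_law[OF same br])
thus "Hopf_brace K (ibialg_brace H S)" unfolding Hopf_brace_def using st B by (simp add: ibialg_brace_def)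
show "coc --> Cocom (ibialg_brace H S)" using H same_coalg_cong(2)[OF same] unfolding hstruct_def by blast
qed

lemma brace_hmaps:
"f:hmaps UNIV (br_ibialg H) (br_ibialg L) <-> f:Cmaps H L & algebra_map H (dot H) (dot_unit H) (dot L) (dot_unit L) f &
	algebra_map H (diamond H) (diamond_unit H) (diamond L) (diamond_unit L) f"
proof -
have "Cmaps (br_ibialg H) (br_ibialg L) = Cmaps H L"
	using same_coalg_cong(3)[OF brace_same(1)[of H]] same_coalg_cong(4)[OF brace_same(1)[of L]] by metis
thus ?thesis unfolding hmaps_def by (auto simp: UNIV_bool br_ibialg_def algebra_map_def)
qed

lemma hstruct_Hopf:
"(EX S. hstruct I J coc {} H S) <-> IJ_Hopf_algebra K I J H & (coc --> Cocom H)"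
unfolding hstruct_def IJ_Hopf_algebra_def I_bialgebra_def by (auto simp: bchoice_iff)
end

section \<open>The four categories of the theorem\<close>

locale small_field = grothendieck ty + linear_algebra K for ty :: "'u itself" and K :: "'k ring" +
assumes small_carrier: "small TYPE('u) (carrier K)"
begin
text \<open>\<open>Lam\<close> has the size of the symbols plus a countable set, to make it
  infinite. As there is a symbol for each scalar and each index, \<open>Lam\<close> also bounds the
  field and \<open>I\<close>, as hulls require.\<close>

lemma exists_Lam:
fixes I :: "'i set"
assumes I: "small TYPE('u) I"
shows "EX Lam :: 'u set. infinite Lam & small TYPE('u) Lam & |syms I :: ('k, 'i) sym set| <=o |Lam|"
proof -
have "small TYPE('u) (UNIV :: nat set)" using universe card_of_nat ordIso_ordLess_trans unfolding universe_def small_def by blast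
moreover have "small TYPE('u) (syms I)" unfolding syms_def by (intro small_Un small_image small_carrier I small_finite) simp
ultimately have sm: "small TYPE('u) ((UNIV :: nat set) <+> syms I)" unfolding Plus_def by (intro small_Un small_image)
from small_embed[OF sm] obtain e :: "nat + ('k, 'i) sym => 'u" where e: "inj_on e (UNIV <+> syms I)" ..
have "infinite (UNIV <+> syms I :: (nat + ('k, 'i) sym) set)" by (simp add: finite_Plus_iff)
hence "infinite (e ` (UNIV <+> syms I))" using e finite_image_iff by blast
moreover have "|syms I| <=o |e ` (UNIV <+> syms I)|"
	unfolding card_of_ordLeq[symmetric] using e by (intro exI[of _ "%s. e (Inr s)"]) (auto simp: inj_on_def)
ultimately show ?thesis using small_image[OF sm, of e] by blast
qed

lemma hopf_Halg:
assumes "infinite Lam" "small TYPE('u) Lam" "|syms I| <=o |Lam|" "J <= I"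
	and C: "C = (|Obj = {H. small TYPE('u) (carrier H) & IJ_Hopf_algebra K I J H & (coc --> Cocom H)},
		Hom = Hom (Halg K I J), Idm = Idm (Halg K I J), Comp = Comp (Halg K I J)|)"
shows "hopf_category K (C :: (('k, 'i, 'u) ibialg, 'u => 'u) cat) (%H. H) I J coc {} Lam"
proof (rule hopf_category.intro[OF grothendieck_axioms linear_algebra_axioms], rule hopf_category_axioms.intro)
fix H :: "('k, 'i, 'u) ibialg" and S assume "small TYPE('u) (carrier H)" "hstruct I J coc {} H S"
thus "EX x:Obj C. x = H" using hstruct_Hopf[of I J coc H] by (auto simp: C)
qed (use assms small_carrier in "auto simp: hstruct_Hopf Halg_def hmaps_def")

lemma hopf_Hbr:
assumes "infinite Lam" "small TYPE('u) Lam" "|syms (UNIV :: bool set)| <=o |Lam|"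
	and C: "C = (|Obj = {H. small TYPE('u) (carrier H) & Hopf_brace K H & (coc --> Cocom H)},
		Hom = Hom (Hbr K), Idm = Idm (Hbr K), Comp = Comp (Hbr K)|)"
shows "hopf_category K (C :: (('k, 'u) brace, 'u => 'u) cat) br_ibialg UNIV UNIV coc {(False, True)} Lam"
proof (rule hopf_category.intro[OF grothendieck_axioms linear_algebra_axioms], rule hopf_category_axioms.intro)
have c [simp]: "carrier (br_ibialg H) = carrier H" for H :: "('k, 'u) brace" by (simp add: br_ibialg_def)
show "small TYPE('u) (carrier (br_ibialg H)) & (EX S. hstruct UNIV UNIV coc {(False, True)} (br_ibialg H) S)" if "H:Obj C" for H
	using that brace_hstruct[of H coc] by (auto simp: C)
fix H :: "('k, bool, 'u) ibialg" and S assume H: "small TYPE('u) (carrier H)" "hstruct UNIV UNIV coc {(False, True)} H S"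
have "small TYPE('u) (carrier (ibialg_brace H S))" using H(1) by (simp add: ibialg_brace_def)
thus "EX x:Obj C. br_ibialg x = H"
	using hstruct_brace[OF H(2)] by (intro bexI[of _ "ibialg_brace H S"]) (auto simp: C br_ibialg_inverse)
next
fix x y z g f
show "Hom C x y = {f:extensional (carrier (br_ibialg x)). f:hmaps UNIV (br_ibialg x) (br_ibialg y)}"
	"Idm C x = (\<lambda>a\<in>carrier (br_ibialg x). a)" "Comp C x y z g f = compose (carrier (br_ibialg x)) g f"
	unfolding brace_hmaps by (auto simp: C Hbr_def br_ibialg_def)
qed (use assms small_carrier in auto)
end

theorem theoremA:
  fixes K :: "'k ring"
  assumes "universe TYPE('u)"
    and "field K" and "small TYPE('u) (carrier K)"
  shows
    "(\<forall>I J :: 'i set. small TYPE('u) I \<and> J \<subseteq> I \<longrightarrow>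
        (let C = (Halg K I J :: (('k, 'i, 'u) ibialg, 'u \<Rightarrow> 'u) cat) in
         locally_presentable TYPE('u) C \<and>
         complete_category TYPE('u) C \<and> cocomplete_category TYPE('u) C)) \<and>
     (\<forall>I J :: 'i set. small TYPE('u) I \<and> J \<subseteq> I \<longrightarrow>
        (let C = (Halg_coc K I J :: (('k, 'i, 'u) ibialg, 'u \<Rightarrow> 'u) cat) in
         locally_presentable TYPE('u) C \<and>
         complete_category TYPE('u) C \<and> cocomplete_category TYPE('u) C)) \<and>
     (let C = (Hbr_coc K :: (('k, 'u) brace, 'u \<Rightarrow> 'u) cat) in
        locally_presentable TYPE('u) C \<and>
        complete_category TYPE('u) C \<and> cocomplete_category TYPE('u) C) \<and>
     (let C = (Hbr K :: (('k, 'u) brace, 'u \<Rightarrow> 'u) cat) in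
        accessible TYPE('u) C \<and>
        (locally_presentable TYPE('u) C \<longleftrightarrow> complete_category TYPE('u) C) \<and>
        (complete_category TYPE('u) C \<longleftrightarrow> cocomplete_category TYPE('u) C))"
proof -
interpret small_field "TYPE('u)" K by (intro small_field.intro grothendieck.intro linear_algebra.intro small_field_axioms.intro assms)
have Halg: "locally_presentable TYPE('u) C & complete_category TYPE('u) C & cocomplete_category TYPE('u) C"
	if I: "small TYPE('u) I" "J <= I" and C: "C = Halg K I J | C = Halg_coc K I J"
	for I J :: "'i set" and C :: "(('k, 'i, 'u) ibialg, 'u => 'u) cat"
proof -
	obtain Lam :: "'u set" where Lam: "infinite Lam" "small TYPE('u) Lam" "|syms I| <=o |Lam|" using exists_Lam[OF I(1)] by blast
	note lp = hopf_category.lp_C[OF hopf_Halg[OF Lam I(2)]]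
	from C show ?thesis
	proof
		assume "C = Halg K I J" thus ?thesis by (intro lp[where coc = False]) (simp_all add: Halg_def)
	next
		assume "C = Halg_coc K I J" thus ?thesis by (intro lp[where coc = True]) (auto simp: Halg_coc_def full_subcategory_def Halg_def)
	qed
qed
obtain Lam :: "'u set" where Lam: "infinite Lam" "small TYPE('u) Lam" "|syms (UNIV :: bool set)| <=o |Lam|"
	using exists_Lam[OF small_finite[of "UNIV :: bool set"]] by auto
have Hbr_coc: "locally_presentable TYPE('u) C & complete_category TYPE('u) C & cocomplete_category TYPE('u) C"
	if "C = Hbr_coc K" for C :: "(('k, 'u) brace, 'u => 'u) cat"
	by (rule hopf_category.lp_C[OF hopf_Hbr[OF Lam, where coc = True]])
		(auto simp: that Hbr_coc_def full_subcategory_def Hbr_def)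
\<comment> \<open>For braces without cocommutativity the locale still provides accessibility and
  both implications between completeness and cocompleteness.\<close>
interpret br: hopf_category "TYPE('u)" K "Hbr K :: (('k, 'u) brace, 'u => 'u) cat" br_ibialg UNIV UNIV False "{(False, True)}" Lam
	by (rule hopf_Hbr[OF Lam]) (simp add: Hbr_def)
show ?thesis unfolding Let_def
	using Halg[OF _ _ disjI1[OF refl]] Halg[OF _ _ disjI2[OF refl]] Hbr_coc[OF refl] br.accessible br.locally_presentable_iff br.complete_if_C br.cocomplete_if_C by blast
qed
end
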